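(* Assume: (F) $F_0$ has bounded support $\mathcal{S}_0=[0,M_0]$ and is strictly increasing on $\mathcal{S}_0$ with density $f_0$, strictly staying away from zero on $\mathcal{S}_0$; (G) $G$ has support $[0,\infty)$, is strictly increasing on $\mathcal{S}_0$ with density $g$ staying away from zero on $\mathcal{S}_0$, and $g'$ is bounded on $\mathcal{S}_0$. Fix $t>0$ such that $f_0^{(3)}$ and $g^{(3)}$ exist and are continuous at $t$, and such that $q(t)\neq0$, where $$q(t)=f_0''(t)+2\frac{g''(t)f_0(t)+g'(t)f_0'(t)}{g(t)}-2\frac{g'(t)^2f_0(t)}{g(t)^2}.$$ Let $h=cn^{-1/7}$ ($c>0$) be the bandwidth used to define $\hat F_n^{\mathrm{MS}}$, and let $\hat f_n^{\mathrm{MS}}$ be the derivative of $\hat F_n^{\mathrm{MS}}$. Then, as $n\to\infty$, $$n^{2/7}\big(\hat f_n^{\mathrm{MS}}(t)-f_0(t)\big)\rightsquigarrow\mathcal{N}(\mu_{f,\mathrm{MS}},\sigma^2_{f,\mathrm{MS}}),$$ where $$\mu_{f,\mathrm{MS}}=\tfrac12c^2m_2(k)q(t),\qquad \sigma^2_{f,\mathrm{MS}}=\frac{F_0(t)(1-F_0(t))}{c^3g(t)}\int k'(u)^2\,du.$$ This also holds if $\hat f_n^{\mathrm{MS}}$ is replaced by $\hat f_n^{\mathrm{naive}}$. For fixed $t$, the aMSE-optimal bandwidth for $\hat f_n^{\mathrm{MS}}(t)$ is $h_{n,f,\mathrm{MS}}=c_{f,\mathrm{MS}}n^{-1/7}$,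 where $$c_{f,\mathrm{MS}}=\Big\{3\frac{F_0(t)(1-F_0(t))}{g(t)}\int k'(u)^2\,du\Big\}^{1/7}\{m_2^2(k)q^2(t)\}^{-1/7};$$ that is, $c_{f,\mathrm{MS}}$ minimizes the asymptotic mean squared error $\mu_{f,\mathrm{MS}}^2+\sigma_{f,\mathrm{MS}}^2$ over $c>0$.
   Context: Current status model: $X_1,X_2,\dots$ are i.i.d. with distribution function $F_0$ on $[0,\infty)$, and, independently, $T_1,T_2,\dots$ are i.i.d. with distribution function $G$ on $[0,\infty)$ having Lebesgue density $g$. One observes $(T_i,\Delta_i)$, $1\le i\le n$, with $\Delta_i=1_{\{X_i\le T_i\}}$. Kernel: $k$ is a probability density with support $[-1,1]$, symmetric and twice continuously differentiable on $\mathbb{R}$; $m_2(k)=\int u^2k(u)\,du$; $k_h(u)=h^{-1}k(u/h)$. Kernel estimators: for $i=0,1$ let $\mathbb{G}_{n,i}(t)=\frac1n\sum_{j=1}^n1_{[0,t]\times\{i\}}(T_j,\Delta_j)$. Put $\hat g_{n,i}(t)=\int k_h(t-u)\,d\mathbb{G}_{n,i}(u)$ for $t>h$, and for $0\le t\le h$, with $\beta=t/h$, use the boundary-corrected estimator $\hat g_{n,i}(t)=\int h^{-1}k^\beta((t-u)/h)\,d\mathbb{G}_{n,i}(u)$, where $$k^\beta(u)=\frac{\nu_{2,\beta}(k)-\nu_{1,\beta}(k)u}{\nu_{0,\beta}(k)\nu_{2,\beta}(k)-\nu_{1,\beta}(k)^2}\,k(u)1_{(-1,\beta)}(u),\qquad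 \nu_{i,\beta}(k)=\int_{-1}^\beta u^ik(u)\,du.$$ Put $\hat g_n=\hat g_{n,0}+\hat g_{n,1}$, $\hat G_{n,i}(t)=\int_{[0,t]}\hat g_{n,i}(u)\,du$, $\hat G_n(t)=\int_{[0,t]}\hat g_n(u)\,du$; $\hat g_{n,i}'$ is the derivative of $\hat g_{n,i}$ and $\hat g_n'=\hat g_{n,0}'+\hat g_{n,1}'$. The maximum smoothed likelihood estimator $\hat F_n^{\mathrm{MS}}(t)$ is the right-continuous slope of the lower convex hull of the parameterized curve $t\mapsto(\hat G_n(t),\hat G_{n,1}(t))$, $t\in[0,\tau]$, $\tau=\sup\{t\ge0:\hat g_{n,0}(t)+\hat g_{n,1}(t)>0\}$, evaluated at the point with $x$-coordinate $\hat G_n(t)$. Its derivative is $\hat f_n^{\mathrm{MS}}(t)=\frac{d}{du}\hat F_n^{\mathrm{MS}}(u)|_{u=t}$. The naive density estimator is $$\hat f_n^{\mathrm{naive}}(t)=\frac{\hat g_n(t)\hat g_{n,1}'(t)-\hat g_n'(t)\hat g_{n,1}(t)}{\hat g_n(t)^2}.$$ The symbol $\rightsquigarrow$ denotes convergence in distribution. *)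

theory Defs
  imports "HOL-Probability.Probability"
begin

section \<open>Distribution functions and densities\<close>

text \<open>Support of a distribution function: its points of increase.\<close>

definition cdf_support :: "(real \<Rightarrow> real) \<Rightarrow> real set" where
  "cdf_support F = {x. \<forall>e>0. F (x - e) < F (x + e)}"

definition density_of :: "(real \<Rightarrow> real) \<Rightarrow> (real \<Rightarrow> real) \<Rightarrow> bool" where
  "density_of f F \<longleftrightarrow>
     f \<in> borel_measurable borel \<and> (\<forall>x. 0 \<le> f x) \<and>
     (\<forall>x. set_integrable lborel {..x} f \<and> F x = (LINT u:{..x}|lborel. f u))"

definition away_from_zero_on :: "real set \<Rightarrow> (real \<Rightarrow> real) \<Rightarrow> bool" where
  "away_from_zero_on S f \<longleftrightarrow> (\<exists>\<delta>>0. \<forall>x\<in>S. \<delta> \<le> f x)"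

text \<open>Continuity of the third derivative at \<open>t\<close> presupposes that it exists near \<open>t\<close>.\<close>

definition third_deriv_continuous_at :: "(real \<Rightarrow> real) \<Rightarrow> real \<Rightarrow> bool" where
  "third_deriv_continuous_at f t \<longleftrightarrow>
     (\<forall>\<^sub>F x in nhds t. \<forall>j<3. (deriv ^^ j) f differentiable (at x)) \<and>
     isCont ((deriv ^^ 3) f) t"

section \<open>The current status model\<close>

text \<open>Joint independence of the family indexed by the disjoint sum says that the \<open>X j\<close> are
  independent, the \<open>T j\<close> are independent, and the two sequences are independent of each other.
  Observations are numbered from \<open>0\<close>, so a sample of size \<open>n\<close> has the indices \<open>j < n\<close>.\<close>

definition current_status_model ::
  "'a measure \<Rightarrow> (nat \<Rightarrow> 'a \<Rightarrow> real) \<Rightarrow> (nat \<Rightarrow> 'a \<Rightarrow> real) \<Rightarrow>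
   (real \<Rightarrow> real) \<Rightarrow> (real \<Rightarrow> real) \<Rightarrow> (real \<Rightarrow> real) \<Rightarrow> bool" where
  "current_status_model M X T F\<^sub>0 G g \<longleftrightarrow>
     prob_space M \<and>
     prob_space.indep_vars M (\<lambda>_. borel) (case_sum X T) UNIV \<and>
     (\<forall>j. cdf (distr M borel (X j)) = F\<^sub>0) \<and>
     (\<forall>j. cdf (distr M borel (T j)) = G) \<and>
     (\<forall>x<0. F\<^sub>0 x = 0 \<and> G x = 0) \<and>
     density_of g G"

definition status :: "real \<Rightarrow> real \<Rightarrow> nat" where
  "status x t = (if x \<le> t then 1 else 0)"

section \<open>Kernels\<close>

definition smooth_kernel :: "(real \<Rightarrow> real) \<Rightarrow> bool" where
  "smooth_kernel k \<longleftrightarrow>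
     (\<forall>u. 0 \<le> k u) \<and> integrable lborel k \<and> (LINT u|lborel. k u) = 1 \<and>
     closure {u. k u \<noteq> 0} = {-1..1} \<and>
     (\<forall>u. k (- u) = k u) \<and>
     (\<forall>u. k differentiable (at u)) \<and> (\<forall>u. deriv k differentiable (at u)) \<and>
     continuous_on UNIV (deriv (deriv k))"

definition m2 :: "(real \<Rightarrow> real) \<Rightarrow> real" where
  "m2 k = (LINT u|lborel. u\<^sup>2 * k u)"

definition scaled_kernel :: "(real \<Rightarrow> real) \<Rightarrow> real \<Rightarrow> real \<Rightarrow> real" where
  "scaled_kernel k h u = k (u / h) / h"

definition nu :: "(real \<Rightarrow> real) \<Rightarrow> nat \<Rightarrow> real \<Rightarrow> real" where
  "nu k i \<beta> = (LINT u:{-1..\<beta>}|lborel. u ^ i * k u)"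

definition boundary_kernel :: "(real \<Rightarrow> real) \<Rightarrow> real \<Rightarrow> real \<Rightarrow> real" where
  "boundary_kernel k \<beta> u =
     (nu k 2 \<beta> - nu k 1 \<beta> * u) / (nu k 0 \<beta> * nu k 2 \<beta> - (nu k 1 \<beta>)\<^sup>2) *
     k u * indicator {-1<..<\<beta>} u"

section \<open>Estimators based on a sample\<close>

text \<open>Throughout, \<open>ts\<close> and \<open>ds\<close> are the observation times and the status indicators,
  \<open>n\<close> is the sample size and \<open>h\<close> the bandwidth.\<close>

definition emp_subdf ::
  "nat \<Rightarrow> (nat \<Rightarrow> real) \<Rightarrow> (nat \<Rightarrow> nat) \<Rightarrow> nat \<Rightarrow> real \<Rightarrow> real" where
  "emp_subdf n ts ds i t = (\<Sum>j<n. indicator ({0..t} \<times> {i}) (ts j, ds j)) / real n"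

text \<open>Integrals with respect to \<open>d\<G>\<^sub>n\<^sub>,\<^sub>i\<close> are Lebesgue-Stieltjes integrals. Only arguments
  \<open>t \<ge> 0\<close> are meaningful.\<close>

definition ghat_sub ::
  "(real \<Rightarrow> real) \<Rightarrow> real \<Rightarrow> nat \<Rightarrow> (nat \<Rightarrow> real) \<Rightarrow> (nat \<Rightarrow> nat) \<Rightarrow> nat \<Rightarrow> real \<Rightarrow> real" where
  "ghat_sub k h n ts ds i t =
     (if t > h
      then LINT u|interval_measure (emp_subdf n ts ds i). scaled_kernel k h (t - u)
      else LINT u|interval_measure (emp_subdf n ts ds i).
             boundary_kernel k (t / h) ((t - u) / h) / h)"

definition ghat ::
  "(real \<Rightarrow> real) \<Rightarrow> real \<Rightarrow> nat \<Rightarrow> (nat \<Rightarrow> real) \<Rightarrow> (nat \<Rightarrow> nat) \<Rightarrow> real \<Rightarrow> real" where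
  "ghat k h n ts ds t = ghat_sub k h n ts ds 0 t + ghat_sub k h n ts ds 1 t"

definition Ghat_sub ::
  "(real \<Rightarrow> real) \<Rightarrow> real \<Rightarrow> nat \<Rightarrow> (nat \<Rightarrow> real) \<Rightarrow> (nat \<Rightarrow> nat) \<Rightarrow> nat \<Rightarrow> real \<Rightarrow> real" where
  "Ghat_sub k h n ts ds i t = (LINT u:{0..t}|lborel. ghat_sub k h n ts ds i u)"

definition Ghat ::
  "(real \<Rightarrow> real) \<Rightarrow> real \<Rightarrow> nat \<Rightarrow> (nat \<Rightarrow> real) \<Rightarrow> (nat \<Rightarrow> nat) \<Rightarrow> real \<Rightarrow> real" where
  "Ghat k h n ts ds t = (LINT u:{0..t}|lborel. ghat k h n ts ds u)"

definition f_naive ::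
  "(real \<Rightarrow> real) \<Rightarrow> real \<Rightarrow> nat \<Rightarrow> (nat \<Rightarrow> real) \<Rightarrow> (nat \<Rightarrow> nat) \<Rightarrow> real \<Rightarrow> real" where
  "f_naive k h n ts ds t =
     (let g\<^sub>1 = ghat_sub k h n ts ds 1; g\<^sub>1' = deriv (ghat_sub k h n ts ds 1);
          g = ghat k h n ts ds;
          g' = (\<lambda>s. deriv (ghat_sub k h n ts ds 0) s + deriv (ghat_sub k h n ts ds 1) s)
      in (g t * g\<^sub>1' t - g' t * g\<^sub>1 t) / (g t)\<^sup>2)"

text \<open>The lower boundary of the convex hull of a planar set, as a function on the projection of
  that set to the first axis (outside of it the value is meaningless).\<close>

definition lower_convex_hull :: "(real \<times> real) set \<Rightarrow> real \<Rightarrow> real" where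
  "lower_convex_hull S x = Inf {y. (x, y) \<in> convex hull S}"

text \<open>The right-continuous version of the slope of a convex function is its right derivative.
  At the right end point of the domain it is left unspecified.\<close>

definition right_slope :: "(real \<Rightarrow> real) \<Rightarrow> real \<Rightarrow> real" where
  "right_slope C x = Lim (at_right x) (\<lambda>y. (C y - C x) / (y - x))"

definition tau ::
  "(real \<Rightarrow> real) \<Rightarrow> real \<Rightarrow> nat \<Rightarrow> (nat \<Rightarrow> real) \<Rightarrow> (nat \<Rightarrow> nat) \<Rightarrow> real" where
  "tau k h n ts ds = Sup {t. t \<ge> 0 \<and> ghat_sub k h n ts ds 0 t + ghat_sub k h n ts ds 1 t > 0}"

definition F_MS ::
  "(real \<Rightarrow> real) \<Rightarrow> real \<Rightarrow> nat \<Rightarrow> (nat \<Rightarrow> real) \<Rightarrow> (nat \<Rightarrow> nat) \<Rightarrow> real \<Rightarrow> real" where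
  "F_MS k h n ts ds t =
     right_slope
       (lower_convex_hull
          ((\<lambda>s. (Ghat k h n ts ds s, Ghat_sub k h n ts ds 1 s)) ` {0..tau k h n ts ds}))
       (Ghat k h n ts ds t)"

definition f_MS ::
  "(real \<Rightarrow> real) \<Rightarrow> real \<Rightarrow> nat \<Rightarrow> (nat \<Rightarrow> real) \<Rightarrow> (nat \<Rightarrow> nat) \<Rightarrow> real \<Rightarrow> real" where
  "f_MS k h n ts ds t = deriv (F_MS k h n ts ds) t"

section \<open>Asymptotic bias, variance and mean squared error\<close>

definition q_MS :: "(real \<Rightarrow> real) \<Rightarrow> (real \<Rightarrow> real) \<Rightarrow> real \<Rightarrow> real" where
  "q_MS f\<^sub>0 g t =
     (deriv ^^ 2) f\<^sub>0 t
     + 2 * (((deriv ^^ 2) g t * f\<^sub>0 t + deriv g t * deriv f\<^sub>0 t) / g t)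
     - 2 * ((deriv g t)\<^sup>2 * f\<^sub>0 t / (g t)\<^sup>2)"

definition mu_MS ::
  "(real \<Rightarrow> real) \<Rightarrow> (real \<Rightarrow> real) \<Rightarrow> (real \<Rightarrow> real) \<Rightarrow> real \<Rightarrow> real \<Rightarrow> real" where
  "mu_MS k f\<^sub>0 g t c = 1/2 * c\<^sup>2 * m2 k * q_MS f\<^sub>0 g t"

definition sigma2_MS ::
  "(real \<Rightarrow> real) \<Rightarrow> (real \<Rightarrow> real) \<Rightarrow> (real \<Rightarrow> real) \<Rightarrow> real \<Rightarrow> real \<Rightarrow> real" where
  "sigma2_MS k F\<^sub>0 g t c =
     F\<^sub>0 t * (1 - F\<^sub>0 t) / (c ^ 3 * g t) * (LINT u|lborel. (deriv k u)\<^sup>2)"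

definition aMSE_MS ::
  "(real \<Rightarrow> real) \<Rightarrow> (real \<Rightarrow> real) \<Rightarrow> (real \<Rightarrow> real) \<Rightarrow> (real \<Rightarrow> real) \<Rightarrow> real \<Rightarrow> real \<Rightarrow> real" where
  "aMSE_MS k F\<^sub>0 f\<^sub>0 g t c = (mu_MS k f\<^sub>0 g t c)\<^sup>2 + sigma2_MS k F\<^sub>0 g t c"

definition c_opt_MS ::
  "(real \<Rightarrow> real) \<Rightarrow> (real \<Rightarrow> real) \<Rightarrow> (real \<Rightarrow> real) \<Rightarrow> (real \<Rightarrow> real) \<Rightarrow> real \<Rightarrow> real" where
  "c_opt_MS k F\<^sub>0 f\<^sub>0 g t =
     (3 * (F\<^sub>0 t * (1 - F\<^sub>0 t) / g t) * (LINT u|lborel. (deriv k u)\<^sup>2)) powr (1/7) *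
     ((m2 k)\<^sup>2 * (q_MS f\<^sub>0 g t)\<^sup>2) powr (-1/7)"

definition bandwidth :: "real \<Rightarrow> nat \<Rightarrow> real" where
  "bandwidth c n = c * real n powr (-1/7)"

text \<open>The normal distribution with mean \<open>\<mu>\<close> and variance \<open>v\<close>, for \<open>v > 0\<close>
  (\<open>normal_density\<close> takes the standard deviation).\<close>

definition normal_dist :: "real \<Rightarrow> real \<Rightarrow> real measure" where
  "normal_dist \<mu> v = density lborel (\<lambda>x. ennreal (normal_density \<mu> (sqrt v) x))"

end

theory Submission
  imports Defs "HOL-Real_Asymp.Real_Asymp"
begin

text \<open>The observation times with status \<open>1\<close> and \<open>0\<close> have the subdensities \<open>b = F\<^sub>0 g\<close> and
  \<open>(1 - F\<^sub>0) g\<close>, whose sum is \<open>a = g\<close>. Hence \<open>F\<^sub>0 = b / a\<close> and \<open>f\<^sub>0 = (a b' - a' b) / a\<^sup>2\<close>, and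
  the naive estimator is this expression with kernel estimates of the subdensities and of their
  derivatives put in. Two things have to be seen.

  First, the naive estimator is asymptotically normal. Near \<open>t\<close> the kernel estimates of the
  derivatives have a bias of order \<open>h\<^sup>2\<close> and a standard deviation of order \<open>(n h\<^sup>3)\<^sup>-\<^sup>1\<^sup>/\<^sup>2\<close>, and both
  are of order \<open>n\<^sup>-\<^sup>2\<^sup>/\<^sup>7\<close> for \<open>h = c n\<^sup>-\<^sup>1\<^sup>/\<^sup>7\<close>; the estimates of the subdensities themselves are at
  least as good. Multiplied by \<open>n\<^sup>2\<^sup>/\<^sup>7\<close>, squares of such deviations tend to zero, so only the linear
  part of the ratio matters (\<open>ratio_linearisation\<close>, \<open>sd_rate\<close>). That part is an average of \<open>n\<close>
  independent variables whose law depends on \<open>n\<close>, and \<open>triangular_array_CLT\<close> applies to it. Its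
  mean comes from third-order Taylor expansions of the subdensities and the moments of the even
  kernel (\<open>bias_ghat\<close>, \<open>mean_limit\<close>), its variance from the terms with \<open>k'\<close> alone (\<open>var_limit\<close>).

  Secondly, with probability tending to one the maximum smoothed likelihood estimator at \<open>t\<close>
  equals the naive one (\<open>f_MS_eq_f_naive_whp\<close>). The curve has the slope \<open>b / a\<close>, with estimates in place of
  \<open>b\<close> and \<open>a\<close>. The estimates are uniformly consistent near \<open>t\<close>, together with their derivatives,
  and \<open>f\<^sub>0 t > 0\<close>; so this slope is increasing in a fixed neighbourhood of \<open>t\<close>, and there the tangents
  stay below the curve. Away from \<open>t\<close> the curve is uniformly close to its limit. The latter exceeds its
  tangent at \<open>t\<close> by the integral of \<open>(F\<^sub>0 v - F\<^sub>0 t) g v\<close> over \<open>v\<close> from \<open>t\<close> to the parameter \<open>u\<close>, and this is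
  bounded away from zero outside of neighbourhoods of \<open>t\<close>. A tangent that stays below the whole curve forces the convex hull to touch the curve
  (\<open>hull_slope_near\<close>), and the slope of the hull near \<open>t\<close> is then that of the curve.

  The theorem speaks of image measures, so the estimators also have to be measurable functions of
  the sample. For the maximum smoothed likelihood estimator, which is a derivative of a right
  derivative of a convex hull, this is \<open>borel_measurable_f_MS\<close>: the hull is determined by countably
  many lines below the curve, and convexity and monotonicity allow both derivatives to be computed along sequences.

  The asymptotic mean squared error has the form \<open>A c\<^sup>4 + V / c\<^sup>3\<close>, and its minimiser is found by
  factoring the difference to the minimum (\<open>aMSE_unique_minimiser\<close>).\<close>

section \<open>Events of probability tending to one\<close>

context prob_space
begin

text \<open>Only an event inside \<open>{\<omega>. P n \<omega>}\<close> is required: the statements \<open>P n \<omega>\<close> below quantify over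
  uncountably many arguments and may fail to define events.\<close>

definition whp :: "(nat \<Rightarrow> 'a \<Rightarrow> bool) \<Rightarrow> bool" where
  "whp P \<longleftrightarrow> (\<exists>A. (\<forall>n. A n \<in> events) \<and> (\<forall>n. \<forall>\<omega>\<in>A n. P n \<omega>) \<and> (\<lambda>n. prob (A n)) \<longlonglongrightarrow> 1)"

lemma whp_mono:
  assumes "whp P" "\<forall>\<^sub>F n in sequentially. \<forall>\<omega>\<in>space M. P n \<omega> \<longrightarrow> Q n \<omega>"
  shows "whp Q"
proof -
  obtain A where A: "\<And>n. A n \<in> events" "\<And>n \<omega>. \<omega> \<in> A n \<Longrightarrow> P n \<omega>" "(\<lambda>n. prob (A n)) \<longlonglongrightarrow> 1"
    using assms(1) unfolding whp_def by blast
  obtain N where N: "\<And>n \<omega>. n \<ge> N \<Longrightarrow> \<omega> \<in> space M \<Longrightarrow> P n \<omega> \<Longrightarrow> Q n \<omega>"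
    using assms(2) unfolding eventually_sequentially by blast
  define B where "B n = (if n \<ge> N then A n else {})" for n
  have "(\<lambda>n. prob (B n)) \<longlonglongrightarrow> 1"
    by (rule Lim_transform_eventually[OF A(3)])
       (auto simp: eventually_sequentially B_def intro!: exI[of _ N])
  moreover have "B n \<in> events" for n using A(1) by (auto simp: B_def)
  moreover have "Q n \<omega>" if "\<omega> \<in> B n" for n \<omega>
    using that A(1)[of n, THEN sets.sets_into_space] A(2)[of \<omega> n] N[of n \<omega>]
    by (auto simp: B_def split: if_splits)
  ultimately show ?thesis unfolding whp_def by blast
qed

lemma whp_eventually:
  assumes "\<forall>\<^sub>F n in sequentially. \<forall>\<omega>\<in>space M. Q n \<omega>"
  shows "whp Q"
proof -
  have "whp (\<lambda>_ _. True)" unfolding whp_def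
    by (rule exI[of _ "\<lambda>_. space M"]) (auto simp: prob_space)
  then show ?thesis
    by (rule whp_mono) (use assms in \<open>auto elim: eventually_mono\<close>)
qed

lemma whp_conj:
  assumes "whp P" "whp Q"
  shows "whp (\<lambda>n \<omega>. P n \<omega> \<and> Q n \<omega>)"
proof -
  obtain A where A: "\<And>n. A n \<in> events" "\<And>n \<omega>. \<omega> \<in> A n \<Longrightarrow> P n \<omega>" "(\<lambda>n. prob (A n)) \<longlonglongrightarrow> 1"
    using assms(1) unfolding whp_def by blast
  obtain B where B: "\<And>n. B n \<in> events" "\<And>n \<omega>. \<omega> \<in> B n \<Longrightarrow> Q n \<omega>" "(\<lambda>n. prob (B n)) \<longlonglongrightarrow> 1"
    using assms(2) unfolding whp_def by blast
  have le: "prob (A n) + prob (B n) - 1 \<le> prob (A n \<inter> B n)" for n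
  proof -
    have "prob (A n \<union> B n) = prob (A n) + prob (B n) - prob (A n \<inter> B n)"
      by (rule measure_Un3) (simp_all add: fmeasurable_eq_sets A B)
    then show ?thesis using prob_le_1[of "A n \<union> B n"] by linarith
  qed
  have "(\<lambda>n. prob (A n) + prob (B n) - 1) \<longlonglongrightarrow> 1"
    using tendsto_diff[OF tendsto_add[OF A(3) B(3)] tendsto_const[of 1]] by simp
  then have "(\<lambda>n. prob (A n \<inter> B n)) \<longlonglongrightarrow> 1"
    by (rule tendsto_sandwich[rotated 2, OF _ tendsto_const[of 1]]) (use le in auto)
  then show ?thesis unfolding whp_def
    by (intro exI[of _ "\<lambda>n. A n \<inter> B n"]) (use A B in auto)
qed

lemma whp_ball_finite:
  assumes "finite I" "\<And>i. i \<in> I \<Longrightarrow> whp (P i)"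
  shows "whp (\<lambda>n \<omega>. \<forall>i\<in>I. P i n \<omega>)"
  using assms
proof (induction I rule: finite_induct)
  case empty show ?case by (rule whp_eventually) auto
next
  case (insert x F)
  have "whp (\<lambda>n \<omega>. P x n \<omega> \<and> (\<forall>i\<in>F. P i n \<omega>))"
    using insert by (intro whp_conj) auto
  then show ?case by (rule whp_mono) auto
qed

lemma whpI:
  assumes "\<forall>\<^sub>F n in sequentially. B n \<in> events \<and> prob (B n) \<le> b n"
    and "\<forall>\<^sub>F n in sequentially. \<forall>\<omega>\<in>space M - B n. P n \<omega>" and "b \<longlonglongrightarrow> 0"
  shows "whp P"
proof -
  obtain N where N: "\<And>n. n \<ge> N \<Longrightarrow> B n \<in> events" "\<And>n. n \<ge> N \<Longrightarrow> prob (B n) \<le> b n"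
    "\<And>n \<omega>. n \<ge> N \<Longrightarrow> \<omega> \<in> space M - B n \<Longrightarrow> P n \<omega>"
    using eventually_conj[OF assms(1,2)] unfolding eventually_sequentially by blast
  define A where "A n = (if n \<ge> N then space M - B n else {})" for n
  have pA: "prob (A n) = 1 - prob (B n)" if "n \<ge> N" for n
    using that N(1)[OF that] by (simp add: A_def prob_compl)
  have "(\<lambda>n. 1 - b n) \<longlonglongrightarrow> 1" using tendsto_diff[OF tendsto_const[of 1] assms(3)] by simp
  then have "(\<lambda>n. prob (A n)) \<longlonglongrightarrow> 1"
    by (rule tendsto_sandwich[rotated 2, OF _ tendsto_const[of 1]])
       (use pA N(2) in \<open>auto simp: eventually_sequentially intro!: exI[of _ N]\<close>)
  moreover have "\<forall>n. A n \<in> events" using N(1) by (auto simp: A_def)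
  moreover have "\<forall>n. \<forall>\<omega>\<in>A n. P n \<omega>" using N(3) by (auto simp: A_def)
  ultimately show ?thesis unfolding whp_def by (intro exI[of _ A]) auto
qed

lemma whp_Markov:
  fixes R :: "nat \<Rightarrow> 'a \<Rightarrow> real"
  assumes "\<forall>\<^sub>F n in sequentially. integrable M (R n) \<and> (\<forall>\<omega>. 0 \<le> R n \<omega>) \<and> expectation (R n) \<le> b n"
    and "b \<longlonglongrightarrow> 0" and e: "e > 0"
  shows "whp (\<lambda>n \<omega>. R n \<omega> \<le> e)"
proof (rule whpI[where B = "\<lambda>n. {\<omega>\<in>space M. R n \<omega> \<ge> e}" and b = "\<lambda>n. b n / e"])
  show "\<forall>\<^sub>F n in sequentially. {\<omega>\<in>space M. R n \<omega> \<ge> e} \<in> events \<and> prob {\<omega>\<in>space M. R n \<omega> \<ge> e} \<le> b n / e"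
    using assms(1)
  proof eventually_elim
    case (elim n)
    then have [measurable]: "R n \<in> borel_measurable M" by auto
    have "prob {\<omega>\<in>space M. R n \<omega> \<ge> e} \<le> expectation (R n) / e"
      by (rule integral_Markov_inequality_measure[where A = "{}"]) (use elim e in auto)
    also have "\<dots> \<le> b n / e" using elim e by (intro divide_right_mono) auto
    finally show ?case by simp
  qed
  show "(\<lambda>n. b n / e) \<longlonglongrightarrow> 0" using tendsto_divide[OF assms(2) tendsto_const[of e]] e by simp
  show "\<forall>\<^sub>F n in sequentially. \<forall>\<omega>\<in>space M - {\<omega>\<in>space M. R n \<omega> \<ge> e}. R n \<omega> \<le> e"
    by (rule always_eventually) auto
qed

lemma cmod_iexp_diff: "cmod (iexp a - iexp b) \<le> \<bar>a - b\<bar>" "cmod (iexp a - iexp b) \<le> 2"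
proof -
  have eq: "iexp a - iexp b = iexp b * (iexp (a - b) - 1)"
    by (simp add: algebra_simps exp_add[symmetric])
  have *: "cmod (iexp a - iexp b) = 2 * \<bar>sin ((a - b) / 2)\<bar>"
    unfolding eq norm_mult dist_exp_i_1 by simp
  show "cmod (iexp a - iexp b) \<le> \<bar>a - b\<bar>"
    unfolding * using abs_sin_x_le_abs_x[of "(a - b) / 2"] by simp
  show "cmod (iexp a - iexp b) \<le> 2"
    unfolding * using abs_sin_le_one[of "(a - b) / 2"] by simp
qed

lemma weak_conv_m_cong_eventually:
  assumes "\<forall>\<^sub>F n in sequentially. \<mu> n = \<nu> n" "weak_conv_m \<mu> \<rho>"
  shows "weak_conv_m \<nu> \<rho>"
  unfolding weak_conv_m_def weak_conv_def
proof (intro allI impI)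
  fix x assume "isCont (cdf \<rho>) x"
  then have "(\<lambda>n. cdf (\<mu> n) x) \<longlonglongrightarrow> cdf \<rho> x"
    using assms(2) unfolding weak_conv_m_def weak_conv_def by blast
  then show "(\<lambda>n. cdf (\<nu> n) x) \<longlonglongrightarrow> cdf \<rho> x"
    by (rule Lim_transform_eventually) (use assms(1) in \<open>auto elim: eventually_mono\<close>)
qed

text \<open>Slutsky's lemma, stated for characteristic functions because the central limit theorem below is
  proved through them: on the event where the two variables differ by at most \<open>e\<close>, the integrands
  \<open>exp (i \<theta> Z)\<close> and \<open>exp (i \<theta> Y)\<close> differ by at most \<open>\<bar>\<theta>\<bar> e\<close>, and elsewhere by at most \<open>2\<close>. Levy's continuity
  theorem does the rest. \<open>Z n\<close> is assumed to be measurable for large \<open>n\<close>, because the measurability of the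
  maximum smoothed likelihood estimator at \<open>t\<close> is shown for bandwidths less than \<open>t\<close>.\<close>

lemma weak_conv_Slutsky:
  fixes Y Z :: "nat \<Rightarrow> 'a \<Rightarrow> real"
  assumes Y[measurable]: "\<And>n. Y n \<in> borel_measurable M"
    and Z: "\<forall>\<^sub>F n in sequentially. Z n \<in> borel_measurable M"
    and \<mu>: "real_distribution \<mu>"
    and conv: "\<And>\<theta>. (\<lambda>n. char (distr M borel (Y n)) \<theta>) \<longlonglongrightarrow> char \<mu> \<theta>"
    and close: "\<And>e. e > 0 \<Longrightarrow> whp (\<lambda>n \<omega>. \<bar>Z n \<omega> - Y n \<omega>\<bar> \<le> e)"
  shows "weak_conv_m (\<lambda>n. distr M borel (Z n)) \<mu>"
proof -
  \<comment> \<open>Levy's theorem asks for distributions at every index.\<close>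
  define Z' where "Z' n = (if Z n \<in> borel_measurable M then Z n else (\<lambda>_. 0))" for n
  have [measurable]: "Z' n \<in> borel_measurable M" for n by (auto simp: Z'_def)
  have ev: "\<forall>\<^sub>F n in sequentially. Z' n = Z n"
    using Z by eventually_elim (auto simp: Z'_def)
  have close': "whp (\<lambda>n \<omega>. \<bar>Z' n \<omega> - Y n \<omega>\<bar> \<le> e)" if "e > 0" for e
    by (rule whp_mono[OF close[OF that]]) (use ev in \<open>auto elim: eventually_mono\<close>)
  have "weak_conv_m (\<lambda>n. distr M borel (Z' n)) \<mu>"
  proof (rule levy_continuity)
    fix \<theta> :: real
    have int: "integrable M (\<lambda>\<omega>. iexp (\<theta> * f \<omega>))" if [measurable]: "f \<in> borel_measurable M" for f
      by (rule integrable_const_bound[where B = 1]) auto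
    have "(\<lambda>n. char (distr M borel (Z' n)) \<theta> - char (distr M borel (Y n)) \<theta>) \<longlonglongrightarrow> 0"
    proof (rule LIMSEQ_I)
      fix r :: real assume r: "r > 0"
      define e where "e = r / (2 * (\<bar>\<theta>\<bar> + 1))"
      have e: "e > 0" using r by (auto simp: e_def intro!: divide_pos_pos)
      have "\<bar>\<theta>\<bar> * r \<le> r * (\<bar>\<theta>\<bar> + 1)" using r by (simp add: algebra_simps)
      then have te: "\<bar>\<theta>\<bar> * e \<le> r / 2" unfolding e_def by (simp add: field_simps)
      obtain A where A: "\<And>n. A n \<in> events" "\<And>n \<omega>. \<omega> \<in> A n \<Longrightarrow> \<bar>Z' n \<omega> - Y n \<omega>\<bar> \<le> e"
        "(\<lambda>n. prob (A n)) \<longlonglongrightarrow> 1"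
        using close'[OF e] unfolding whp_def by blast
      have "\<forall>\<^sub>F n in sequentially. prob (A n) > 1 - r / 4"
        using A(3) by (rule order_tendstoD) (use r in auto)
      then obtain N where N: "\<And>n. n \<ge> N \<Longrightarrow> prob (A n) > 1 - r / 4"
        unfolding eventually_sequentially by blast
      show "\<exists>no. \<forall>n\<ge>no. norm (char (distr M borel (Z' n)) \<theta> - char (distr M borel (Y n)) \<theta> - 0) < r"
      proof (intro exI[of _ N] allI impI)
        fix n assume n: "n \<ge> N"
        have [measurable]: "A n \<in> events" by (rule A)
        have "char (distr M borel (Z' n)) \<theta> - char (distr M borel (Y n)) \<theta>
          = (CLINT \<omega>|M. iexp (\<theta> * Z' n \<omega>) - iexp (\<theta> * Y n \<omega>))"
        proof -
          have "char (distr M borel f) \<theta> = (CLINT \<omega>|M. iexp (\<theta> * f \<omega>))"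
            if [measurable]: "f \<in> borel_measurable M" for f
            unfolding char_def by (subst integral_distr) auto
          then show ?thesis by (subst Bochner_Integration.integral_diff[OF int int]) simp_all
        qed
        also have "cmod \<dots> \<le> expectation (\<lambda>\<omega>. \<bar>\<theta>\<bar> * e + 2 * indicator (space M - A n) \<omega>)"
        proof (rule order_trans[OF integral_norm_bound], rule integral_mono)
          fix \<omega> assume \<omega>: "\<omega> \<in> space M"
          show "cmod (iexp (\<theta> * Z' n \<omega>) - iexp (\<theta> * Y n \<omega>)) \<le> \<bar>\<theta>\<bar> * e + 2 * indicator (space M - A n) \<omega>"
          proof (cases "\<omega> \<in> A n")
            case True
            have "cmod (iexp (\<theta> * Z' n \<omega>) - iexp (\<theta> * Y n \<omega>)) \<le> \<bar>\<theta> * Z' n \<omega> - \<theta> * Y n \<omega>\<bar>"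
              by (rule cmod_iexp_diff)
            also have "\<dots> = \<bar>\<theta>\<bar> * \<bar>Z' n \<omega> - Y n \<omega>\<bar>" by (simp add: abs_mult[symmetric] algebra_simps)
            also have "\<dots> \<le> \<bar>\<theta>\<bar> * e" using A(2)[OF True] by (intro mult_left_mono) auto
            finally show ?thesis using True by simp
          next
            case False
            then show ?thesis using cmod_iexp_diff(2)[of "\<theta> * Z' n \<omega>" "\<theta> * Y n \<omega>"] e \<omega>
              by (auto intro: order_trans[of _ 2])
          qed
        next
          show "integrable M (\<lambda>\<omega>. cmod (iexp (\<theta> * Z' n \<omega>) - iexp (\<theta> * Y n \<omega>)))"
            by (intro integrable_norm Bochner_Integration.integrable_diff int) measurable
          show "integrable M (\<lambda>\<omega>. \<bar>\<theta>\<bar> * e + 2 * indicator (space M - A n) \<omega>)"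
          proof -
            have "integrable M (indicator (space M - A n) :: 'a \<Rightarrow> real)"
              by (rule integrable_real_indicator) (auto simp: emeasure_eq_measure)
            from Bochner_Integration.integrable_add[OF integrable_const integrable_mult_right[OF this]]
            show ?thesis .
          qed
        qed
        also have "\<dots> = \<bar>\<theta>\<bar> * e + 2 * (1 - prob (A n))"
        proof -
          have i: "integrable M (indicator (space M - A n) :: 'a \<Rightarrow> real)"
            by (rule integrable_real_indicator) (auto simp: emeasure_eq_measure)
          show ?thesis
            by (subst Bochner_Integration.integral_add[OF integrable_const integrable_mult_right[OF i]])
               (simp add: prob_space prob_compl)
        qed
        also have "\<dots> < r"
        proof -
          have "2 * (1 - prob (A n)) < r / 2" using N[OF n] by simp
          from add_le_less_mono[OF te this] show ?thesis by simp
        qed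
        finally show "norm (char (distr M borel (Z' n)) \<theta> - char (distr M borel (Y n)) \<theta> - 0) < r" by simp
      qed
    qed
    from tendsto_add[OF this conv[of \<theta>]]
    show "(\<lambda>n. char (distr M borel (Z' n)) \<theta>) \<longlonglongrightarrow> char \<mu> \<theta>" by simp
  qed (auto intro: \<mu>)
  then show ?thesis
    by (rule weak_conv_m_cong_eventually[rotated]) (use ev in \<open>auto elim: eventually_mono\<close>)
qed

end

section \<open>A central limit theorem for triangular arrays\<close>

lemma real_distribution_normal_dist: "v > 0 \<Longrightarrow> real_distribution (normal_dist m v)"
  unfolding normal_dist_def using prob_space_normal_density[of "sqrt v" m]
  by (auto simp: real_distribution_def real_distribution_axioms_def)

lemma char_normal_dist:
  assumes v: "v > 0"
  shows "char (normal_dist m v) \<theta> = iexp (\<theta> * m) * complex_of_real (exp (- (v * \<theta>\<^sup>2) / 2))"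
proof -
  interpret S: prob_space std_normal_distribution
    using prob_space_normal_density[of 1 0] by simp
  have "distributed std_normal_distribution lborel (\<lambda>x. x) std_normal_density"
    unfolding distributed_def by (auto simp: distr_id2)
  then have "distributed std_normal_distribution lborel (\<lambda>x. m + sqrt v * x) (normal_density (m + sqrt v * 0) (\<bar>sqrt v\<bar> * 1))"
    by (rule S.normal_density_affine) (use v in auto)
  then have eq: "normal_dist m v = distr std_normal_distribution lborel (\<lambda>x. m + sqrt v * x)"
    unfolding distributed_def normal_dist_def using v by auto
  have "char (normal_dist m v) \<theta> = (CLINT x|std_normal_distribution. iexp (\<theta> * (m + sqrt v * x)))"
    unfolding eq char_def by (subst integral_distr) auto
  also have "\<dots> = (CLINT x|std_normal_distribution. iexp (\<theta> * m) * iexp ((\<theta> * sqrt v) * x))"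
    by (intro Bochner_Integration.integral_cong) (auto simp: algebra_simps exp_add[symmetric])
  also have "\<dots> = iexp (\<theta> * m) * char std_normal_distribution (\<theta> * sqrt v)"
    unfolding char_def by simp
  also have "\<dots> = iexp (\<theta> * m) * complex_of_real (exp (- (v * \<theta>\<^sup>2) / 2))"
    unfolding char_std_normal_distribution using v by (simp add: power_mult_distrib mult.commute)
  finally show ?thesis .
qed

locale iid_sample = prob_space M for M :: "'a measure" +
  fixes Z :: "nat \<Rightarrow> 'a \<Rightarrow> 'b" and N :: "'b measure"
  assumes indep: "indep_vars (\<lambda>_. N) Z UNIV"
    and ident: "\<And>j. distr M N (Z j) = distr M N (Z 0)"
begin

definition avg :: "nat \<Rightarrow> ('b \<Rightarrow> real) \<Rightarrow> 'a \<Rightarrow> real" where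
  "avg n \<psi> \<omega> = (\<Sum>j<n. \<psi> (Z j \<omega>)) / real n"

definition ex :: "('b \<Rightarrow> real) \<Rightarrow> real" where
  "ex \<psi> = expectation (\<lambda>\<omega>. \<psi> (Z 0 \<omega>))"

lemma measurable_Z [measurable]: "Z j \<in> M \<rightarrow>\<^sub>M N"
  using indep unfolding indep_vars_def2 by simp

lemma expectation_Z:
  assumes [measurable]: "\<psi> \<in> borel_measurable N"
  shows "expectation (\<lambda>\<omega>. \<psi> (Z j \<omega>)) = ex \<psi>"
proof -
  have "expectation (\<lambda>\<omega>. \<psi> (Z j \<omega>)) = (LINT z|distr M N (Z j). \<psi> z)"
    by (rule integral_distr[symmetric]) measurable
  also have "\<dots> = (LINT z|distr M N (Z 0). \<psi> z)" by (simp only: ident[of j])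
  also have "\<dots> = ex \<psi>" unfolding ex_def by (rule integral_distr) measurable
  finally show ?thesis .
qed

lemma measurable_avg [measurable]:
  assumes [measurable]: "\<psi> \<in> borel_measurable N"
  shows "avg n \<psi> \<in> borel_measurable M"
  unfolding avg_def[abs_def] by measurable

lemma integrable_bounded_Z:
  fixes \<psi> :: "'b \<Rightarrow> real"
  assumes "\<psi> \<in> borel_measurable N" "\<And>z. \<bar>\<psi> z\<bar> \<le> K"
  shows "integrable M (\<lambda>\<omega>. \<psi> (Z j \<omega>))"
  using assms by (intro integrable_const_bound[where B = K]) auto

lemma ex_centred_square:
  assumes [measurable]: "\<psi> \<in> borel_measurable N" and K: "\<And>z. \<bar>\<psi> z\<bar> \<le> K"
  shows "ex (\<lambda>z. (\<psi> z - ex \<psi>)\<^sup>2) = ex (\<lambda>z. (\<psi> z)\<^sup>2) - (ex \<psi>)\<^sup>2"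
proof -
  have K2: "\<bar>(\<psi> z)\<^sup>2\<bar> \<le> K\<^sup>2" for z
    using K[of z] by (metis abs_power2 abs_le_square_iff abs_of_nonneg abs_ge_zero order_trans)
  have i: "integrable M (\<lambda>\<omega>. \<psi> (Z 0 \<omega>))" "integrable M (\<lambda>\<omega>. (\<psi> (Z 0 \<omega>))\<^sup>2)"
    by (rule integrable_bounded_Z[OF _ K], simp) (rule integrable_bounded_Z[OF _ K2], simp)
  show ?thesis using variance_eq[OF i] unfolding ex_def by simp
qed

lemma abs_ex_le:
  assumes [measurable]: "\<psi> \<in> borel_measurable N" and K: "\<And>z. \<bar>\<psi> z\<bar> \<le> K"
  shows "\<bar>ex \<psi>\<bar> \<le> K"
proof -
  have "\<bar>ex \<psi>\<bar> \<le> expectation (\<lambda>\<omega>. \<bar>\<psi> (Z 0 \<omega>)\<bar>)"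
    unfolding ex_def by (rule integral_abs_bound)
  also have "\<dots> \<le> expectation (\<lambda>\<omega>. K)"
    by (rule integral_mono) (use K integrable_bounded_Z[OF assms] in auto)
  finally show ?thesis by (simp add: prob_space)
qed

lemma avg_square_deviation:
  assumes [measurable]: "\<psi> \<in> borel_measurable N" and K: "\<And>z. \<bar>\<psi> z\<bar> \<le> K" and n: "n > 0"
  shows "integrable M (\<lambda>\<omega>. (avg n \<psi> \<omega> - ex \<psi>)\<^sup>2)"
    and "expectation (\<lambda>\<omega>. (avg n \<psi> \<omega> - ex \<psi>)\<^sup>2) = ex (\<lambda>z. (\<psi> z - ex \<psi>)\<^sup>2) / n"
proof -
  define c where "c z = \<psi> z - ex \<psi>" for z
  have [measurable]: "c \<in> borel_measurable N" unfolding c_def[abs_def] by measurable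
  have bc: "\<bar>c z\<bar> \<le> 2 * K" for z
    using K[of z] abs_ex_le[OF assms(1) K] by (simp add: c_def)
  have ic: "integrable M (\<lambda>\<omega>. c (Z j \<omega>))" for j
    by (rule integrable_bounded_Z[OF _ bc]) simp
  have Ec: "expectation (\<lambda>\<omega>. c (Z j \<omega>)) = 0" for j
    using integrable_bounded_Z[OF assms(1) K, of j] expectation_Z[OF assms(1), of j]
    unfolding c_def by (simp add: prob_space)
  have icc: "integrable M (\<lambda>\<omega>. c (Z i \<omega>) * c (Z j \<omega>))" for i j
  proof (rule integrable_const_bound[where B = "2 * K * (2 * K)"])
    show "AE \<omega> in M. norm (c (Z i \<omega>) * c (Z j \<omega>)) \<le> 2 * K * (2 * K)"
    proof (rule AE_I2)
      fix \<omega>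
      have "\<bar>c (Z i \<omega>)\<bar> * \<bar>c (Z j \<omega>)\<bar> \<le> (2 * K) * (2 * K)"
        by (rule mult_mono[OF bc bc order_trans[OF abs_ge_zero bc]]) simp
      then show "norm (c (Z i \<omega>) * c (Z j \<omega>)) \<le> 2 * K * (2 * K)" by (simp add: abs_mult)
    qed
  qed measurable
  have Ecc: "expectation (\<lambda>\<omega>. c (Z i \<omega>) * c (Z j \<omega>)) = (if i = j then ex (\<lambda>z. (c z)\<^sup>2) else 0)" for i j
  proof (cases "i = j")
    case True
    then show ?thesis using expectation_Z[of "\<lambda>z. (c z)\<^sup>2" j] by (simp add: power2_eq_square)
  next
    case False
    have "indep_vars (\<lambda>_. borel) (\<lambda>j \<omega>. c (Z j \<omega>)) {i, j}"
      by (rule indep_vars_compose2[where M' = "\<lambda>_. N"]) (auto intro: indep_vars_subset[OF indep])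
    then have "expectation (\<lambda>\<omega>. \<Prod>k\<in>{i,j}. c (Z k \<omega>)) = (\<Prod>k\<in>{i,j}. expectation (\<lambda>\<omega>. c (Z k \<omega>)))"
      by (intro indep_vars_lebesgue_integral) (auto simp: ic)
    then show ?thesis using False by (simp add: Ec)
  qed
  have eq: "(avg n \<psi> \<omega> - ex \<psi>)\<^sup>2 = (\<Sum>i<n. \<Sum>j<n. c (Z i \<omega>) * c (Z j \<omega>)) / (real n)\<^sup>2" for \<omega>
  proof -
    have "avg n \<psi> \<omega> - ex \<psi> = (\<Sum>j<n. c (Z j \<omega>)) / real n"
      using n unfolding avg_def c_def by (simp add: sum_subtractf field_simps)
    then show ?thesis by (simp add: power_divide power2_eq_square sum_product)
  qed
  show "integrable M (\<lambda>\<omega>. (avg n \<psi> \<omega> - ex \<psi>)\<^sup>2)"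
    unfolding eq by (auto intro!: Bochner_Integration.integrable_sum icc)
  have "expectation (\<lambda>\<omega>. (avg n \<psi> \<omega> - ex \<psi>)\<^sup>2)
      = (\<Sum>i<n. \<Sum>j<n. expectation (\<lambda>\<omega>. c (Z i \<omega>) * c (Z j \<omega>))) / (real n)\<^sup>2"
    unfolding eq by (simp add: Bochner_Integration.integral_sum Bochner_Integration.integrable_sum icc)
  also have "\<dots> = real n * ex (\<lambda>z. (c z)\<^sup>2) / (real n)\<^sup>2"
    unfolding Ecc by simp
  also have "\<dots> = ex (\<lambda>z. (c z)\<^sup>2) / n" using n by (simp add: power2_eq_square)
  finally show "expectation (\<lambda>\<omega>. (avg n \<psi> \<omega> - ex \<psi>)\<^sup>2) = ex (\<lambda>z. (\<psi> z - ex \<psi>)\<^sup>2) / n"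
    unfolding c_def .
qed

lemma avg_square_deviation_le:
  assumes [measurable]: "\<psi> \<in> borel_measurable N" and K: "\<And>z. \<bar>\<psi> z\<bar> \<le> K" and n: "n > 0"
  shows "expectation (\<lambda>\<omega>. (avg n \<psi> \<omega> - ex \<psi>)\<^sup>2) \<le> ex (\<lambda>z. (\<psi> z)\<^sup>2) / n"
  unfolding avg_square_deviation(2)[OF assms] ex_centred_square[OF assms(1) K]
  by (intro divide_right_mono) auto

lemma avg_Chebyshev:
  assumes [measurable]: "\<psi> \<in> borel_measurable N" and K: "\<And>z. \<bar>\<psi> z\<bar> \<le> K" and n: "n > 0" and e: "e > 0"
  shows "prob {\<omega>\<in>space M. \<bar>avg n \<psi> \<omega> - ex \<psi>\<bar> \<ge> e} \<le> ex (\<lambda>z. (\<psi> z)\<^sup>2) / (n * e\<^sup>2)"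
proof -
  have "prob {\<omega>\<in>space M. \<bar>avg n \<psi> \<omega> - ex \<psi>\<bar> \<ge> e} \<le> expectation (\<lambda>\<omega>. (avg n \<psi> \<omega> - ex \<psi>)\<^sup>2) / e\<^sup>2"
    by (rule second_moment_method) (use avg_square_deviation(1)[OF assms(1) K n] e in auto)
  also have "\<dots> \<le> ex (\<lambda>z. (\<psi> z)\<^sup>2) / n / e\<^sup>2"
    by (rule divide_right_mono[OF avg_square_deviation_le[OF assms(1) K n]]) simp
  finally show ?thesis by simp
qed

text \<open>The rows consist of the variables \<open>s n * (\<psi> n (Z j) - ex (\<psi> n)) / n\<close> with \<open>j < n\<close>. They are bounded by a
  sequence that tends to zero, so Lindeberg's condition is trivial and the classical argument works:
  a characteristic function in row \<open>n\<close> is \<open>1 - \<theta>\<^sup>2 v / (2 n)\<close> up to \<open>o(1/n)\<close>, and its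
  \<open>n\<close>-th power tends to \<open>exp (- \<theta>\<^sup>2 v / 2)\<close>.\<close>

theorem triangular_array_CLT:
  fixes \<psi> :: "nat \<Rightarrow> 'b \<Rightarrow> real" and s K m :: "nat \<Rightarrow> real"
  assumes meas[measurable]: "\<And>n. \<psi> n \<in> borel_measurable N" and K: "\<And>n z. \<bar>\<psi> n z\<bar> \<le> K n"
    and negl: "(\<lambda>n. s n * K n / n) \<longlonglongrightarrow> 0"
    and var: "(\<lambda>n. (s n)\<^sup>2 * ex (\<lambda>z. (\<psi> n z - ex (\<psi> n))\<^sup>2) / n) \<longlonglongrightarrow> v"
    and mean: "m \<longlonglongrightarrow> \<mu>" and v: "v > 0"
  shows "(\<lambda>n. char (distr M borel (\<lambda>\<omega>. m n + s n * (avg n (\<psi> n) \<omega> - ex (\<psi> n)))) \<theta>)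
    \<longlonglongrightarrow> char (normal_dist \<mu> v) \<theta>"
proof -
  define V where "V n = (s n)\<^sup>2 * ex (\<lambda>z. (\<psi> n z - ex (\<psi> n))\<^sup>2) / n" for n
  define x where "x n z = s n / n * (\<psi> n z - ex (\<psi> n))" for n z
  have [measurable]: "x n \<in> borel_measurable N" for n unfolding x_def[abs_def] by measurable
  define \<kappa> where "\<kappa> n = 2 * \<bar>s n * K n / n\<bar>" for n
  have \<kappa>0: "\<kappa> \<longlonglongrightarrow> 0" unfolding \<kappa>_def using tendsto_mult[OF tendsto_const[of 2] tendsto_rabs[OF negl]] by simp
  have K0: "0 \<le> K n" for n using K[of n undefined] by linarith
  have bx: "\<bar>x n z\<bar> \<le> \<kappa> n" for n z
  proof -
    have "\<bar>\<psi> n z - ex (\<psi> n)\<bar> \<le> 2 * K n" using K[of n z] abs_ex_le[OF meas[of n] K] by linarith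
    then have "\<bar>s n / n\<bar> * \<bar>\<psi> n z - ex (\<psi> n)\<bar> \<le> \<bar>s n / n\<bar> * (2 * K n)" by (rule mult_left_mono) simp
    moreover have "\<bar>s n / n\<bar> * (2 * K n) = \<kappa> n" using K0[of n] by (simp add: \<kappa>_def abs_mult)
    ultimately show ?thesis unfolding x_def abs_mult by simp
  qed
  have ix: "integrable M (\<lambda>\<omega>. x n (Z j \<omega>))" "integrable M (\<lambda>\<omega>. (x n (Z j \<omega>))\<^sup>2)" for n j
    subgoal by (rule integrable_bounded_Z[OF _ bx]) simp
    subgoal using bx by (intro integrable_bounded_Z[of "\<lambda>z. (x n z)\<^sup>2" "(\<kappa> n)\<^sup>2"])
      (auto simp: abs_le_square_iff[symmetric] intro: order_trans[OF _ abs_ge_self])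
    done
  have Ex: "expectation (\<lambda>\<omega>. x n (Z j \<omega>)) = 0" for n j
    using integrable_bounded_Z[OF meas[of n] K, of j] expectation_Z[OF meas, of n j]
    unfolding x_def by (simp add: prob_space)
  have Ex2: "expectation (\<lambda>\<omega>. (x n (Z j \<omega>))\<^sup>2) = V n / n" for n j
  proof -
    have "(x n (Z j \<omega>))\<^sup>2 = (s n / n)\<^sup>2 * (\<psi> n (Z j \<omega>) - ex (\<psi> n))\<^sup>2" for \<omega>
      unfolding x_def by (rule power_mult_distrib)
    then have "expectation (\<lambda>\<omega>. (x n (Z j \<omega>))\<^sup>2) = (s n / n)\<^sup>2 * ex (\<lambda>z. (\<psi> n z - ex (\<psi> n))\<^sup>2)"
      using expectation_Z[of "\<lambda>z. (\<psi> n z - ex (\<psi> n))\<^sup>2" j] by simp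
    then show ?thesis by (simp add: V_def power2_eq_square)
  qed
  define \<phi> where "\<phi> n = char (distr M borel (\<lambda>\<omega>. x n (Z 0 \<omega>))) \<theta>" for n
  define a where "a = \<theta>\<^sup>2 * v / 2"
  have char_sum: "char (distr M borel (\<lambda>\<omega>. s n * (avg n (\<psi> n) \<omega> - ex (\<psi> n)))) \<theta> = \<phi> n ^ n" if "n > 0" for n
  proof -
    have char_x: "char (distr M borel (\<lambda>\<omega>. x n (Z j \<omega>))) \<theta> = \<phi> n" for j
    proof -
      have "distr M borel (\<lambda>\<omega>. x n (Z j \<omega>)) = distr (distr M N (Z j)) borel (x n)" for j
        by (subst distr_distr) (auto simp: comp_def)
      then show ?thesis unfolding \<phi>_def using ident[of j] by simp
    qed
    have "s n * (avg n (\<psi> n) \<omega> - ex (\<psi> n)) = (\<Sum>j<n. x n (Z j \<omega>))" for \<omega>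
      using that unfolding x_def sum_distrib_left[symmetric] avg_def by (simp add: sum_subtractf field_simps)
    then have "char (distr M borel (\<lambda>\<omega>. s n * (avg n (\<psi> n) \<omega> - ex (\<psi> n)))) \<theta>
        = char (distr M borel (\<lambda>\<omega>. \<Sum>j<n. x n (Z j \<omega>))) \<theta>" by simp
    also have "\<dots> = (\<Prod>j<n. char (distr M borel (\<lambda>\<omega>. x n (Z j \<omega>))) \<theta>)"
      by (rule char_distr_sum, rule indep_vars_compose2[where M' = "\<lambda>_. N"])
         (auto intro: indep_vars_subset[OF indep])
    also have "\<dots> = \<phi> n ^ n" by (simp add: char_x prod_constant)
    finally show ?thesis .
  qed
  \<comment> \<open>The cubic remainder is at most \<open>\<bar>\<theta>\<bar> * \<kappa> n\<close> times the second moment, because \<open>\<bar>x n z\<bar> \<le> \<kappa> n\<close>.\<close>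
  have step: "cmod (\<phi> n - complex_of_real (1 + (- a) / n)) \<le>
      (\<theta>\<^sup>2 / 6 * (\<bar>\<theta>\<bar> * \<kappa> n * V n) + \<theta>\<^sup>2 / 2 * \<bar>V n - v\<bar>) / n" for n
  proof -
    have "cmod (\<phi> n - complex_of_real (1 - \<theta>\<^sup>2 * (V n / n) / 2)) \<le>
        \<theta>\<^sup>2 / 6 * expectation (\<lambda>\<omega>. min (6 * (x n (Z 0 \<omega>))\<^sup>2) (\<bar>\<theta>\<bar> * \<bar>x n (Z 0 \<omega>)\<bar> ^ 3))"
      unfolding \<phi>_def using char_approx3'[of "\<lambda>\<omega>. x n (Z 0 \<omega>)" "V n / n" _ \<theta>]
      by (simp add: ix Ex Ex2)
    also have "expectation (\<lambda>\<omega>. min (6 * (x n (Z 0 \<omega>))\<^sup>2) (\<bar>\<theta>\<bar> * \<bar>x n (Z 0 \<omega>)\<bar> ^ 3))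
       \<le> expectation (\<lambda>\<omega>. \<bar>\<theta>\<bar> * \<kappa> n * (x n (Z 0 \<omega>))\<^sup>2)"
    proof (rule integral_mono)
      show "integrable M (\<lambda>\<omega>. min (6 * (x n (Z 0 \<omega>))\<^sup>2) (\<bar>\<theta>\<bar> * \<bar>x n (Z 0 \<omega>)\<bar> ^ 3))"
        by (rule Bochner_Integration.integrable_bound[where f = "\<lambda>\<omega>. 6 * (x n (Z 0 \<omega>))\<^sup>2"])
           (auto simp: ix)
      fix \<omega>
      have "\<bar>\<theta>\<bar> * \<bar>x n (Z 0 \<omega>)\<bar> ^ 3 = \<bar>\<theta>\<bar> * (\<bar>x n (Z 0 \<omega>)\<bar> * (x n (Z 0 \<omega>))\<^sup>2)"
        by (simp add: power3_eq_cube power2_eq_square abs_mult[symmetric])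
      also have "\<dots> \<le> \<bar>\<theta>\<bar> * (\<kappa> n * (x n (Z 0 \<omega>))\<^sup>2)"
        by (intro mult_left_mono mult_right_mono bx) auto
      finally show "min (6 * (x n (Z 0 \<omega>))\<^sup>2) (\<bar>\<theta>\<bar> * \<bar>x n (Z 0 \<omega>)\<bar> ^ 3) \<le> \<bar>\<theta>\<bar> * \<kappa> n * (x n (Z 0 \<omega>))\<^sup>2"
        by (simp add: mult.assoc)
    qed (auto simp: ix)
    also have "expectation (\<lambda>\<omega>. \<bar>\<theta>\<bar> * \<kappa> n * (x n (Z 0 \<omega>))\<^sup>2) = \<bar>\<theta>\<bar> * \<kappa> n * V n / n"
      by (simp add: Ex2)
    finally have 1: "cmod (\<phi> n - complex_of_real (1 - \<theta>\<^sup>2 * (V n / n) / 2)) \<le> \<theta>\<^sup>2 / 6 * (\<bar>\<theta>\<bar> * \<kappa> n * V n / n)"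
      by (simp add: mult_left_mono)
    have 2: "cmod (complex_of_real (1 - \<theta>\<^sup>2 * (V n / n) / 2) - complex_of_real (1 + (- a) / n)) = \<theta>\<^sup>2 / 2 * \<bar>V n - v\<bar> / n"
    proof -
      have "(1 - \<theta>\<^sup>2 * (V n / n) / 2) - (1 + (- a) / n) = - (\<theta>\<^sup>2 / 2 * (V n - v) / n)"
        by (cases "n = 0") (auto simp: a_def field_simps)
      then show ?thesis unfolding of_real_diff[symmetric] norm_of_real by (simp add: abs_mult)
    qed
    from norm_triangle_le[OF add_mono[OF 1 2[THEN eq_refl]]]
    show ?thesis by (simp only: add_divide_distrib times_divide_eq_right diff_add_cancel add_diff_eq)
  qed
  have V: "V \<longlonglongrightarrow> v" using var unfolding V_def .
  have bnd0: "(\<lambda>n. \<theta>\<^sup>2 / 6 * (\<bar>\<theta>\<bar> * \<kappa> n * V n) + \<theta>\<^sup>2 / 2 * \<bar>V n - v\<bar>) \<longlonglongrightarrow> 0"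
  proof -
    have "(\<lambda>n. \<theta>\<^sup>2 / 6 * (\<bar>\<theta>\<bar> * \<kappa> n * V n) + \<theta>\<^sup>2 / 2 * \<bar>V n - v\<bar>) \<longlonglongrightarrow>
        \<theta>\<^sup>2 / 6 * (\<bar>\<theta>\<bar> * 0 * v) + \<theta>\<^sup>2 / 2 * \<bar>v - v\<bar>"
      by (intro tendsto_intros \<kappa>0 V)
    then show ?thesis by simp
  qed
  have diff: "\<forall>\<^sub>F n in sequentially. cmod (\<phi> n ^ n - complex_of_real (1 + (- a) / n) ^ n) \<le>
      \<theta>\<^sup>2 / 6 * (\<bar>\<theta>\<bar> * \<kappa> n * V n) + \<theta>\<^sup>2 / 2 * \<bar>V n - v\<bar>"
  proof (rule eventually_sequentiallyI)
    \<comment> \<open>From \<open>n \<ge> a\<close> on, \<open>1 - a / n\<close> lies in the unit disc, as comparing powers requires.\<close>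
    fix n :: nat assume "n \<ge> max 1 (nat \<lceil>a\<rceil>)"
    then have n: "n > 0" "a \<le> n" by linarith+
    have a0: "a \<ge> 0" using v by (simp add: a_def)
    interpret D: real_distribution "distr M borel (\<lambda>\<omega>. x n (Z 0 \<omega>))"
      by (rule real_distribution_distr) simp
    have "cmod (complex_of_real (1 + (- a) / n)) \<le> 1"
      unfolding norm_of_real using n a0 by (auto simp: abs_le_iff field_simps)
    then have "cmod (\<phi> n ^ n - complex_of_real (1 + (- a) / n) ^ n) \<le> n * cmod (\<phi> n - complex_of_real (1 + (- a) / n))"
      by (intro norm_power_diff) (auto simp: \<phi>_def D.cmod_char_le_1)
    also have "\<dots> \<le> n * ((\<theta>\<^sup>2 / 6 * (\<bar>\<theta>\<bar> * \<kappa> n * V n) + \<theta>\<^sup>2 / 2 * \<bar>V n - v\<bar>) / n)"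
      by (rule mult_left_mono[OF step]) simp
    finally show "cmod (\<phi> n ^ n - complex_of_real (1 + (- a) / n) ^ n) \<le>
        \<theta>\<^sup>2 / 6 * (\<bar>\<theta>\<bar> * \<kappa> n * V n) + \<theta>\<^sup>2 / 2 * \<bar>V n - v\<bar>" using n by simp
  qed
  have "(\<lambda>n. complex_of_real ((1 + (- a) / n) ^ n)) \<longlonglongrightarrow> complex_of_real (exp (- a))"
    by (rule isCont_tendsto_compose [OF _ tendsto_exp_limit_sequentially]) auto
  then have "(\<lambda>n. complex_of_real (1 + (- a) / n) ^ n) \<longlonglongrightarrow> complex_of_real (exp (- a))" by simp
  then have "(\<lambda>n. \<phi> n ^ n) \<longlonglongrightarrow> complex_of_real (exp (- a))"
    by (rule Lim_transform) (rule Lim_null_comparison[OF diff bnd0])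
  moreover have "(\<lambda>n. iexp (\<theta> * m n)) \<longlonglongrightarrow> iexp (\<theta> * \<mu>)"
    by (intro tendsto_intros mean)
  ultimately have "(\<lambda>n. iexp (\<theta> * m n) * \<phi> n ^ n) \<longlonglongrightarrow> iexp (\<theta> * \<mu>) * complex_of_real (exp (- a))"
    by (intro tendsto_mult)
  also have "iexp (\<theta> * \<mu>) * complex_of_real (exp (- a)) = char (normal_dist \<mu> v) \<theta>"
    unfolding char_normal_dist[OF v] a_def by (simp add: mult.commute)
  finally show ?thesis
  proof (rule Lim_transform_eventually)
    show "\<forall>\<^sub>F n in sequentially. iexp (\<theta> * m n) * \<phi> n ^ n =
        char (distr M borel (\<lambda>\<omega>. m n + s n * (avg n (\<psi> n) \<omega> - ex (\<psi> n)))) \<theta>"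
    proof (rule eventually_sequentiallyI[of 1])
      fix n :: nat assume n: "n \<ge> 1"
      have "char (distr M borel (\<lambda>\<omega>. m n + s n * (avg n (\<psi> n) \<omega> - ex (\<psi> n)))) \<theta>
          = (CLINT \<omega>|M. iexp (\<theta> * m n) * iexp (\<theta> * (s n * (avg n (\<psi> n) \<omega> - ex (\<psi> n)))))"
        unfolding char_def
        by (subst integral_distr) (auto simp: exp_add[symmetric] algebra_simps)
      also have "\<dots> = iexp (\<theta> * m n) * char (distr M borel (\<lambda>\<omega>. s n * (avg n (\<psi> n) \<omega> - ex (\<psi> n)))) \<theta>"
        unfolding char_def by (subst integral_distr) auto
      finally show "iexp (\<theta> * m n) * \<phi> n ^ n =
          char (distr M borel (\<lambda>\<omega>. m n + s n * (avg n (\<psi> n) \<omega> - ex (\<psi> n)))) \<theta>"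
        using char_sum[of n] n by simp
    qed
  qed
qed

end

section \<open>Kernels\<close>

lemma zero_outside_closed:
  fixes f :: "real \<Rightarrow> real"
  assumes c: "continuous_on UNIV f" and z: "\<And>u. \<bar>u\<bar> > 1 \<Longrightarrow> f u = 0" and u: "\<bar>u\<bar> \<ge> 1"
  shows "f u = 0"
proof -
  have cl: "closed {u. f u = 0}" using c by (intro closed_Collect_eq continuous_intros)
  have "closure {1<..} \<subseteq> {u. f u = 0}" by (rule closure_minimal[OF _ cl]) (use z in auto)
  moreover have "closure {..<-1} \<subseteq> {u. f u = 0}" by (rule closure_minimal[OF _ cl]) (use z in auto)
  moreover have "u \<in> closure {1<..} \<or> u \<in> closure {..<-1}"
    using u unfolding closure_greaterThan closure_lessThan by (cases "u \<ge> 0") auto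
  ultimately show ?thesis by blast
qed

lemma integrable_zero_outside:
  fixes f :: "real \<Rightarrow> real"
  assumes c: "continuous_on UNIV f" and z: "\<And>u. \<bar>u\<bar> > 1 \<Longrightarrow> f u = 0"
  shows "integrable lborel f"
proof -
  have "set_integrable lborel {-1..1} f"
    by (rule borel_integrable_atLeastAtMost') (use c in \<open>auto intro: continuous_on_subset\<close>)
  moreover have "indicator {-1..1} u *\<^sub>R f u = f u" for u
    using z[of u] by (cases "\<bar>u\<bar> \<le> 1") (auto simp: indicator_def abs_le_iff)
  then have "(\<lambda>u. indicator {-1..1} u *\<^sub>R f u) = f" by (rule ext)
  ultimately show ?thesis unfolding set_integrable_def by (simp only:)
qed

lemma integrable_indicator_interval [simp]:
  "integrable lborel (indicator {a..b} :: real \<Rightarrow> real)" "integrable lborel (indicator {a<..<b} :: real \<Rightarrow> real)"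
  by (intro integrable_real_indicator; simp add: emeasure_lborel_cbox_eq emeasure_lborel_box_eq
      flip: box_real)+

lemma integral_pos_interval:
  fixes f :: "real \<Rightarrow> real"
  assumes i: "integrable lborel f" and nn: "\<And>u. 0 \<le> f u"
    and ab: "a < b" and c: "c > 0" and ge: "\<And>u. a \<le> u \<Longrightarrow> u \<le> b \<Longrightarrow> c \<le> f u"
  shows "0 < (LINT u|lborel. f u)"
proof -
  have "0 < c * (b - a)" using ab c by simp
  also have "\<dots> = (LINT u|lborel. c * indicator {a..b} u)" using ab by simp
  also have "\<dots> \<le> (LINT u|lborel. f u)"
  proof (rule integral_mono)
    show "integrable lborel (\<lambda>u. c * indicator {a..b} u)" by simp
    show "c * indicator {a..b} u \<le> f u" for u
      using nn ge by (auto simp: indicator_def)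
  qed (rule i)
  finally show ?thesis .
qed

lemma integral_even_odd:
  fixes f :: "real \<Rightarrow> real"
  assumes "\<And>u. f (- u) = - f u"
  shows "(LINT u|lborel. f u) = 0"
  using lborel_integral_real_affine[of "-1" f 0] assms by simp

locale kernel_fun =
  fixes k :: "real \<Rightarrow> real"
  assumes smooth: "smooth_kernel k"
begin

abbreviation "k' \<equiv> deriv k"

lemma k_nonneg [simp]: "0 \<le> k u" and k_sym: "k (- u) = k u" and k_int_1: "(LINT u|lborel. k u) = 1"
  and k_closure: "closure {u. k u \<noteq> 0} = {-1..1}"
  using smooth unfolding smooth_kernel_def by auto

lemma DERIV_k: "DERIV k u :> k' u" and DERIV_k': "DERIV k' u :> deriv k' u"
  using smooth unfolding smooth_kernel_def by (simp_all add: DERIV_deriv_iff_real_differentiable)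

lemma cont_k: "continuous_on S k" and cont_k': "continuous_on S k'" and cont_k'': "continuous_on UNIV (deriv k')"
proof -
  show "continuous_on S k" by (rule DERIV_continuous_on[OF has_field_derivative_at_within[OF DERIV_k]])
  show "continuous_on S k'" by (rule DERIV_continuous_on[OF has_field_derivative_at_within[OF DERIV_k']])
  show "continuous_on UNIV (deriv k')" using smooth unfolding smooth_kernel_def by auto
qed

lemma borel_k [measurable]: "k \<in> borel_measurable borel" and borel_k' [measurable]: "k' \<in> borel_measurable borel"
  using cont_k cont_k' by (auto intro: borel_measurable_continuous_onI)

lemma isCont_k [simp]: "isCont k u" and isCont_k' [simp]: "isCont k' u"
  using DERIV_k DERIV_k' DERIV_isCont by blast+

lemma k_zero: "\<bar>u\<bar> \<ge> 1 \<Longrightarrow> k u = 0"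
proof (rule zero_outside_closed[OF cont_k])
  fix u :: real assume "\<bar>u\<bar> > 1"
  then have "u \<notin> closure {u. k u \<noteq> 0}" unfolding k_closure by auto
  then show "k u = 0" using closure_subset[of "{u. k u \<noteq> 0}"] by auto
qed

lemma deriv_zero_outside:
  fixes f :: "real \<Rightarrow> real"
  assumes "\<And>u. \<bar>u\<bar> > 1 \<Longrightarrow> f u = 0" "\<bar>u\<bar> > 1"
  shows "deriv f u = 0"
proof -
  have "open {u::real. 1 < \<bar>u\<bar>}" by (intro open_Collect_less continuous_intros)
  then have "\<forall>\<^sub>F x in nhds u. f x = 0"
    using assms by (auto simp: eventually_nhds intro!: exI[of _ "{u. 1 < \<bar>u\<bar>}"])
  then have "deriv f u = deriv (\<lambda>_. 0) u" by (intro deriv_cong_ev) auto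
  then show ?thesis by simp
qed

lemma k'_zero: "\<bar>u\<bar> \<ge> 1 \<Longrightarrow> k' u = 0"
  by (rule zero_outside_closed[OF cont_k']) (rule deriv_zero_outside, auto simp: k_zero)

lemma k''_zero: "\<bar>u\<bar> \<ge> 1 \<Longrightarrow> deriv k' u = 0"
  by (rule zero_outside_closed[OF cont_k'']) (rule deriv_zero_outside, auto simp: k'_zero)

lemma bounded_zero_outside:
  fixes f :: "real \<Rightarrow> real"
  assumes c: "continuous_on UNIV f" and z: "\<And>u. \<bar>u\<bar> \<ge> 1 \<Longrightarrow> f u = 0"
  shows "\<exists>B. \<forall>u. \<bar>f u\<bar> \<le> B"
proof -
  have "compact (f ` {-1..1})"
    by (intro compact_continuous_image continuous_on_subset[OF c]) auto
  then have "bounded (f ` {-1..1})" by (rule compact_imp_bounded)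
  then obtain B where B: "\<And>x. x \<in> f ` {-1..1} \<Longrightarrow> norm x \<le> B" "B > 0"
    unfolding bounded_pos by blast
  have "\<bar>f u\<bar> \<le> B" for u
  proof (cases "\<bar>u\<bar> \<le> 1")
    case True
    then have "f u \<in> f ` {-1..1}" by (intro imageI) auto
    from B(1)[OF this] show ?thesis by simp
  qed (use B(2) z[of u] in auto)
  then show ?thesis by blast
qed

text \<open>One bound for \<open>k\<close>, \<open>k'\<close> and \<open>k''\<close>; it is also a Lipschitz constant of \<open>k\<close> and \<open>k'\<close>.\<close>

definition Kb :: real where
  "Kb = (SOME B. B \<ge> 1 \<and> (\<forall>u. \<bar>k u\<bar> \<le> B \<and> \<bar>k' u\<bar> \<le> B \<and> \<bar>deriv k' u\<bar> \<le> B))"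

lemma Kb: "Kb \<ge> 1" "k u \<le> Kb" "\<bar>k u\<bar> \<le> Kb" "\<bar>k' u\<bar> \<le> Kb" "\<bar>deriv k' u\<bar> \<le> Kb"
proof -
  obtain B0 where B0: "\<And>u. \<bar>k u\<bar> \<le> B0" using bounded_zero_outside[OF cont_k k_zero] by blast
  obtain B1 where B1: "\<And>u. \<bar>k' u\<bar> \<le> B1" using bounded_zero_outside[OF cont_k' k'_zero] by blast
  obtain B2 where B2: "\<And>u. \<bar>deriv k' u\<bar> \<le> B2" using bounded_zero_outside[OF cont_k'' k''_zero] by blast
  have "\<exists>B\<ge>1. \<forall>u. \<bar>k u\<bar> \<le> B \<and> \<bar>k' u\<bar> \<le> B \<and> \<bar>deriv k' u\<bar> \<le> B"
    using B0 B1 B2 by (intro exI[of _ "max (max 1 B0) (max B1 B2)"]) (auto simp: le_max_iff_disj)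
  from someI_ex[OF this]
  show "Kb \<ge> 1" "k u \<le> Kb" "\<bar>k u\<bar> \<le> Kb" "\<bar>k' u\<bar> \<le> Kb" "\<bar>deriv k' u\<bar> \<le> Kb"
    unfolding Kb_def by (auto simp: abs_le_iff)
qed

lemma Kb_pos: "Kb > 0" using Kb(1) by linarith

lemma Lip_k: "\<bar>k u - k v\<bar> \<le> Kb * \<bar>u - v\<bar>" and Lip_k': "\<bar>k' u - k' v\<bar> \<le> Kb * \<bar>u - v\<bar>"
proof -
  have "norm (k u - k v) \<le> Kb * norm (u - v)"
    by (rule field_differentiable_bound[of UNIV k k']) (simp_all add: DERIV_k Kb)
  then show "\<bar>k u - k v\<bar> \<le> Kb * \<bar>u - v\<bar>" by simp
  have "norm (k' u - k' v) \<le> Kb * norm (u - v)"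
    by (rule field_differentiable_bound[of UNIV k' "deriv k'"]) (simp_all add: DERIV_k' Kb)
  then show "\<bar>k' u - k' v\<bar> \<le> Kb * \<bar>u - v\<bar>" by simp
qed

lemma integrable_moment:
  assumes "w = k \<or> w = k'"
  shows "integrable lborel (\<lambda>u. u ^ j * w u)"
  using assms
  by (intro integrable_zero_outside continuous_intros) (auto simp: k_zero k'_zero intro: cont_k cont_k')

text \<open>Integration by parts; the boundary terms vanish because \<open>k\<close> is continuous with support \<open>[-1, 1]\<close>.\<close>

lemma moment_k'_eq: "(LINT u|lborel. u ^ Suc j * k' u) = - real (Suc j) * (LINT u|lborel. u ^ j * k u)"
proof -
  have d: "DERIV (\<lambda>u. u ^ Suc j * k u) u :> real (Suc j) * (u ^ j * k u) + u ^ Suc j * k' u" for u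
    using DERIV_mult[OF DERIV_pow[of "Suc j" u] DERIV_k[of u]] by (simp add: algebra_simps)
  have "(LINT u|lborel. (real (Suc j) * (u ^ j * k u) + u ^ Suc j * k' u) * indicator {-1..1} u)
     = 1 ^ Suc j * k 1 - (-1) ^ Suc j * k (-1)"
  proof (rule integral_FTC_Icc_real[of "-1" 1 "\<lambda>u. u ^ Suc j * k u"])
    show "isCont (\<lambda>u. real (Suc j) * (u ^ j * k u) + u ^ Suc j * k' u) x" for x
      by (intro continuous_intros isCont_k isCont_k')
  qed (use d in auto)
  also have "\<dots> = 0" by (simp add: k_zero)
  also have "(\<lambda>u. (real (Suc j) * (u ^ j * k u) + u ^ Suc j * k' u) * indicator {-1..1} u)
     = (\<lambda>u. real (Suc j) * (u ^ j * k u) + u ^ Suc j * k' u)"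
  proof (rule ext)
    fix u show "(real (Suc j) * (u ^ j * k u) + u ^ Suc j * k' u) * indicator {-1..1} u
        = real (Suc j) * (u ^ j * k u) + u ^ Suc j * k' u"
      by (cases "\<bar>u\<bar> \<le> 1") (auto simp: indicator_def k_zero k'_zero abs_le_iff)
  qed
  also have "(LINT u|lborel. real (Suc j) * (u ^ j * k u) + u ^ Suc j * k' u)
     = real (Suc j) * (LINT u|lborel. u ^ j * k u) + (LINT u|lborel. u ^ Suc j * k' u)"
    by (subst Bochner_Integration.integral_add) (auto intro!: integrable_mult_right integrable_moment simp del: power_Suc)
  finally show ?thesis by (simp add: algebra_simps)
qed

lemma moments_k: "(LINT u|lborel. u ^ 0 * k u) = 1" "(LINT u|lborel. u ^ 1 * k u) = 0"
    "(LINT u|lborel. u ^ 2 * k u) = m2 k" "(LINT u|lborel. u ^ 3 * k u) = 0"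
proof -
  show "(LINT u|lborel. u ^ 0 * k u) = 1" using k_int_1 by simp
  show "(LINT u|lborel. u ^ 2 * k u) = m2 k" unfolding m2_def by simp
  show "(LINT u|lborel. u ^ 1 * k u) = 0" "(LINT u|lborel. u ^ 3 * k u) = 0"
    by (rule integral_even_odd, simp add: k_sym)+
qed

lemma moments_k': "(LINT u|lborel. u ^ 0 * k' u) = 0" "(LINT u|lborel. u ^ 1 * k' u) = -1"
    "(LINT u|lborel. u ^ 2 * k' u) = 0" "(LINT u|lborel. u ^ 3 * k' u) = - 3 * m2 k"
proof -
  show "(LINT u|lborel. u ^ 1 * k' u) = -1" using moment_k'_eq[of 0] moments_k(1) by simp
  show "(LINT u|lborel. u ^ 2 * k' u) = 0" using moment_k'_eq[of 1] moments_k(2) by (simp add: numeral_2_eq_2)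
  show "(LINT u|lborel. u ^ 3 * k' u) = - 3 * m2 k"
    using moment_k'_eq[of 2] moments_k(3) by (simp add: numeral_3_eq_3)
  have "(LINT u|lborel. k' u * indicator {-1..1} u) = k 1 - k (-1)"
    by (rule integral_FTC_Icc_real) (auto intro: DERIV_k)
  also have "(\<lambda>u. k' u * indicator {-1..1} u) = k'"
  proof (rule ext)
    fix u show "k' u * indicator {-1..1} u = k' u"
      by (cases "\<bar>u\<bar> \<le> 1") (auto simp: indicator_def k'_zero abs_le_iff)
  qed
  finally show "(LINT u|lborel. u ^ 0 * k' u) = 0" by (simp add: k_zero)
qed

lemma k_positive_interval:
  assumes "-1 \<le> a" "a < b" "b \<le> 1"
  obtains a' b' c where "a < a'" "a' < b'" "b' < b" "c > 0" "\<And>u. a' \<le> u \<Longrightarrow> u \<le> b' \<Longrightarrow> c \<le> k u"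
proof -
  have "(a + b) / 2 \<in> closure {u. k u \<noteq> 0}" unfolding k_closure using assms by auto
  then have "{a<..<b} \<inter> {u. k u \<noteq> 0} \<noteq> {}"
  proof -
    have "(a + b) / 2 \<in> {a<..<b}" using assms by auto
    then have "{a<..<b} \<inter> closure {u. k u \<noteq> 0} \<noteq> {}"
      using \<open>(a + b) / 2 \<in> closure {u. k u \<noteq> 0}\<close> by (metis IntI empty_iff)
    then show ?thesis by (simp only: open_Int_closure_eq_empty[OF open_greaterThanLessThan] not_False_eq_True)
  qed
  then obtain u where u0: "a < u" "u < b" "k u \<noteq> 0" by auto
  with k_nonneg[of u] have u: "a < u" "u < b" "k u > 0" by (simp_all add: less_le)
  have "isCont k u" by simp
  then have "\<forall>\<^sub>F x in at u. k x > k u / 2"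
    using u unfolding isCont_def by (intro order_tendstoD(1)) auto
  then obtain d where d: "d > 0" "\<And>x. x \<noteq> u \<Longrightarrow> \<bar>x - u\<bar> < d \<Longrightarrow> k x > k u / 2"
    unfolding eventually_at by (auto simp: dist_real_def)
  define e where "e = min (d / 2) (min ((u - a) / 2) ((b - u) / 2))"
  have e: "e > 0" "e < d" "e < u - a" "e < b - u" using u d by (auto simp: e_def min_def)
  show ?thesis
  proof (rule that[of "u - e" "u + e" "k u / 2"])
    fix x assume "u - e \<le> x" "x \<le> u + e"
    then have "\<bar>x - u\<bar> < d" using e by auto
    then show "k u / 2 \<le> k x" using d(2)[of x] u by (cases "x = u") auto
  qed (use u e in auto)
qed

lemma m2_pos: "m2 k > 0"
proof -
  obtain a b c where *: "1/2 < a" "a < b" "b < 1" "c > 0" "\<And>u. a \<le> u \<Longrightarrow> u \<le> b \<Longrightarrow> c \<le> k u"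
    by (rule k_positive_interval[of "1/2" 1]) auto
  show ?thesis unfolding m2_def
  proof (rule integral_pos_interval[of _ a b "1/4 * c"])
    fix u assume u: "a \<le> u" "u \<le> b"
    have "(1/2)^2 \<le> u\<^sup>2" using u * by (intro power_mono) auto
    then show "1/4 * c \<le> u\<^sup>2 * k u" using u * by (intro mult_mono) (auto simp: power2_eq_square)
  qed (use * integrable_moment[of k 2] in auto)
qed

text \<open>Since \<open>k\<close> is positive somewhere and zero at \<open>1\<close>, its derivative cannot vanish identically.\<close>

lemma integral_k'_square_pos: "(LINT u|lborel. (k' u)\<^sup>2) > 0"
proof -
  obtain a b c where *: "1/2 < a" "a < b" "b < 1" "c > 0" "\<And>u. a \<le> u \<Longrightarrow> u \<le> b \<Longrightarrow> c \<le> k u"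
    by (rule k_positive_interval[of "1/2" 1]) auto
  have "\<exists>z. a < z \<and> z < 1 \<and> k 1 - k a = (1 - a) * k' z"
    by (rule MVT2) (use * DERIV_k in auto)
  then obtain z where z: "k' z \<noteq> 0" using *(5)[of a] * k_zero[of 1] by force
  have "isCont (\<lambda>u. (k' u)\<^sup>2) z" by (intro continuous_intros isCont_k')
  then have "\<forall>\<^sub>F x in at z. (k' x)\<^sup>2 > (k' z)\<^sup>2 / 2"
    using z unfolding isCont_def by (intro order_tendstoD(1)) auto
  then obtain d where d: "d > 0" "\<And>x. x \<noteq> z \<Longrightarrow> \<bar>x - z\<bar> < d \<Longrightarrow> (k' x)\<^sup>2 > (k' z)\<^sup>2 / 2"
    unfolding eventually_at by (auto simp: dist_real_def)
  show ?thesis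
  proof (rule integral_pos_interval[of _ z "z + d / 2" "(k' z)\<^sup>2 / 2"])
    show "integrable lborel (\<lambda>u. (k' u)\<^sup>2)"
      by (intro integrable_zero_outside continuous_intros cont_k') (auto simp: k'_zero)
    fix u assume "z \<le> u" "u \<le> z + d / 2"
    then show "(k' z)\<^sup>2 / 2 \<le> (k' u)\<^sup>2" using d(1) d(2)[of u] by (cases "u = z") auto
  qed (use d z in auto)
qed

section \<open>Smoothing by a kernel\<close>

lemma kernel_substitution:
  fixes w \<phi> :: "real \<Rightarrow> real" and h s :: real
  assumes h: "h > 0"
  shows "(LINT v|lborel. w ((s - v) / h) * \<phi> v) = h * (LINT u|lborel. w u * \<phi> (s - h * u))"
  using lborel_integral_real_affine[of "-h" "\<lambda>v. w ((s - v) / h) * \<phi> v" s] h by simp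

text \<open>A polynomial approximation of \<open>\<phi>\<close> near \<open>s\<close> is turned into an expansion in powers of \<open>h\<close>, whose
  coefficients are the moments of the weight \<open>w\<close>. With \<open>p = 0\<close> and \<open>p = 1\<close> it
  yields consistency, with \<open>p = 3\<close> the exact bias.\<close>

lemma smoothing_expansion:
  fixes w \<phi> :: "real \<Rightarrow> real" and d :: "nat \<Rightarrow> real"
  assumes w[measurable]: "w \<in> borel_measurable borel" and wz: "\<And>u. \<bar>u\<bar> \<ge> 1 \<Longrightarrow> w u = 0"
    and wK: "\<And>u. \<bar>w u\<bar> \<le> B"
    and \<phi>[measurable]: "\<phi> \<in> borel_measurable borel"
    and approx: "\<And>x. \<bar>x\<bar> < \<delta> \<Longrightarrow> \<bar>\<phi> (s + x) - (\<Sum>j\<le>p. d j * x ^ j)\<bar> \<le> \<epsilon> * \<bar>x\<bar> ^ q"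
    and h: "0 < h" "h < \<delta>" and e: "0 \<le> \<epsilon>"
  shows "integrable lborel (\<lambda>u. w u * \<phi> (s - h * u))"
    and "\<bar>(LINT u|lborel. w u * \<phi> (s - h * u)) - (\<Sum>j\<le>p. d j * (- h) ^ j * (LINT u|lborel. u ^ j * w u))\<bar>
       \<le> 2 * B * \<epsilon> * h ^ q"
proof -
  define R where "R x = \<phi> (s + x) - (\<Sum>j\<le>p. d j * x ^ j)" for x
  have [measurable]: "R \<in> borel_measurable borel" unfolding R_def[abs_def] by measurable
  have B0: "B \<ge> 0" using wK[of 0] by linarith
  have iw: "integrable lborel (\<lambda>u. u ^ j * w u)" for j
  proof (rule Bochner_Integration.integrable_bound[of _ "\<lambda>u. B * indicator {-1..1} u"])
    show "AE u in lborel. norm (u ^ j * w u) \<le> norm (B * indicator {-1..1} u :: real)"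
    proof (rule AE_I2)
      fix u :: real
      show "norm (u ^ j * w u) \<le> norm (B * indicator {-1..1} u :: real)"
      proof (cases "\<bar>u\<bar> < 1")
        case True
        have "\<bar>u\<bar> ^ j * \<bar>w u\<bar> \<le> 1 * B" using True wK by (intro mult_mono power_le_one) auto
        then show ?thesis using True B0 by (simp add: abs_mult power_abs indicator_def abs_less_iff)
      qed (simp add: wz)
    qed
  qed auto
  have bR: "\<bar>w u * R (- (h * u))\<bar> \<le> B * (\<epsilon> * h ^ q) * indicator {-1..1} u" for u
  proof (cases "\<bar>u\<bar> < 1")
    case True
    have hu: "\<bar>h * u\<bar> \<le> h" using h(1) True by (simp add: abs_mult)
    have "\<bar>R (- (h * u))\<bar> \<le> \<epsilon> * \<bar>- (h * u)\<bar> ^ q" unfolding R_def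
      by (rule approx) (use hu h in auto)
    also have "\<dots> \<le> \<epsilon> * h ^ q" using hu e by (intro mult_left_mono power_mono) auto
    finally have "\<bar>w u\<bar> * \<bar>R (- (h * u))\<bar> \<le> B * (\<epsilon> * h ^ q)" using wK by (intro mult_mono) (auto simp: B0)
    then show ?thesis using True by (simp add: abs_mult indicator_def abs_less_iff)
  qed (simp add: wz B0 e h less_imp_le)
  have iR: "integrable lborel (\<lambda>u. w u * R (- (h * u)))"
    by (rule Bochner_Integration.integrable_bound[of _ "\<lambda>u. B * (\<epsilon> * h ^ q) * indicator {-1..1} u"])
       (use bR in \<open>auto intro: order_trans[OF _ abs_ge_self]\<close>)
  have eq: "w u * \<phi> (s - h * u) = (\<Sum>j\<le>p. d j * (- h) ^ j * (u ^ j * w u)) + w u * R (- (h * u))" for u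
  proof -
    have "\<phi> (s - h * u) = (\<Sum>j\<le>p. d j * (- h) ^ j * u ^ j) + R (- (h * u))"
      unfolding R_def by (simp add: power_mult_distrib[symmetric] mult.assoc)
    then show ?thesis by (simp add: algebra_simps sum_distrib_left)
  qed
  show "integrable lborel (\<lambda>u. w u * \<phi> (s - h * u))"
    unfolding eq by (intro Bochner_Integration.integrable_add Bochner_Integration.integrable_sum integrable_mult_right iw iR)
  have "(LINT u|lborel. w u * \<phi> (s - h * u))
      = (\<Sum>j\<le>p. d j * (- h) ^ j * (LINT u|lborel. u ^ j * w u)) + (LINT u|lborel. w u * R (- (h * u)))"
  proof -
    have i: "integrable lborel (\<lambda>u. d j * (- h) ^ j * (u ^ j * w u))" for j
      by (rule integrable_mult_right[OF iw])
    show ?thesis unfolding eq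
      unfolding Bochner_Integration.integral_add[OF Bochner_Integration.integrable_sum[OF i] iR]
        Bochner_Integration.integral_sum[OF i] integral_mult_right_zero ..
  qed
  then have "\<bar>(LINT u|lborel. w u * \<phi> (s - h * u)) - (\<Sum>j\<le>p. d j * (- h) ^ j * (LINT u|lborel. u ^ j * w u))\<bar>
     = \<bar>LINT u|lborel. w u * R (- (h * u))\<bar>" by simp
  also have "\<dots> \<le> (LINT u|lborel. \<bar>w u * R (- (h * u))\<bar>)" by (rule integral_abs_bound)
  also have "\<dots> \<le> (LINT u|lborel. B * (\<epsilon> * h ^ q) * indicator {-1..1::real} u)"
  proof (rule Bochner_Integration.integral_mono)
    show "integrable lborel (\<lambda>u. \<bar>w u * R (- (h * u))\<bar>)" by (rule integrable_abs[OF iR])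
    show "integrable lborel (\<lambda>u. B * (\<epsilon> * h ^ q) * indicator {-1..1::real} u)"
      by (rule integrable_mult_right) simp
  qed (rule bR)
  also have "\<dots> = 2 * B * \<epsilon> * h ^ q" by simp
  finally show "\<bar>(LINT u|lborel. w u * \<phi> (s - h * u)) - (\<Sum>j\<le>p. d j * (- h) ^ j * (LINT u|lborel. u ^ j * w u))\<bar>
       \<le> 2 * B * \<epsilon> * h ^ q" .
qed

section \<open>The boundary kernel\<close>

lemma nu_eq: "nu k i \<beta> = (LINT u|lborel. indicator {..\<beta>} u * (u ^ i * k u))"
  unfolding nu_def set_lebesgue_integral_def
  by (intro Bochner_Integration.integral_cong) (auto simp: indicator_def k_zero)

lemma integrable_nu: "integrable lborel (\<lambda>u. indicator {..\<beta>} u * (u ^ i * k u))"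
  using integrable_real_mult_indicator[of "{..\<beta>}" lborel "\<lambda>u. u ^ i * k u"] integrable_moment[of k i]
  by (simp add: mult.commute)

lemma borel_nu [measurable]: "nu k i \<in> borel_measurable borel"
proof -
  have "(\<lambda>\<beta>. LINT u|lborel. of_bool (u \<le> \<beta>) * (u ^ i * k u)) \<in> borel_measurable borel"
    by (rule lborel.borel_measurable_lebesgue_integral) measurable
  also have "(\<lambda>\<beta>. LINT u|lborel. of_bool (u \<le> \<beta>) * (u ^ i * k u)) = nu k i"
    unfolding nu_eq fun_eq_iff by (auto simp: indicator_def of_bool_def)
  finally show ?thesis .
qed

text \<open>The left-hand side is at least zero and increasing in \<open>\<beta>\<close>, and its minimum over \<open>m\<close> is the
  determinant \<open>nudet \<beta>\<close> divided by \<open>nu k 0 \<beta>\<close>. This is how positivity and monotonicity of the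
  determinant in the denominator of the boundary kernel are obtained.\<close>

lemma nu_quadratic:
  "(LINT u|lborel. indicator {..\<beta>} u * ((u - m)\<^sup>2 * k u)) = nu k 2 \<beta> - 2 * m * nu k 1 \<beta> + m\<^sup>2 * nu k 0 \<beta>"
  "integrable lborel (\<lambda>u. indicator {..\<beta>} u * ((u - m)\<^sup>2 * k u))"
proof -
  have eq: "indicator {..\<beta>} u * ((u - m)\<^sup>2 * k u) = indicator {..\<beta>} u * (u ^ 2 * k u)
     - 2 * m * (indicator {..\<beta>} u * (u ^ 1 * k u)) + m\<^sup>2 * (indicator {..\<beta>} u * (u ^ 0 * k u))" for u
    by (simp add: power2_eq_square algebra_simps)
  note i = integrable_nu[of \<beta> 2] integrable_mult_right[OF integrable_nu[of \<beta> 1], of "2 * m"]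
    integrable_mult_right[OF integrable_nu[of \<beta> 0], of "m\<^sup>2"]
  show "integrable lborel (\<lambda>u. indicator {..\<beta>} u * ((u - m)\<^sup>2 * k u))"
    unfolding eq by (intro Bochner_Integration.integrable_add Bochner_Integration.integrable_diff i)
  show "(LINT u|lborel. indicator {..\<beta>} u * ((u - m)\<^sup>2 * k u)) = nu k 2 \<beta> - 2 * m * nu k 1 \<beta> + m\<^sup>2 * nu k 0 \<beta>"
    unfolding eq Bochner_Integration.integral_add[OF Bochner_Integration.integrable_diff[OF i(1,2)] i(3)]
      Bochner_Integration.integral_diff[OF i(1,2)] integral_mult_right_zero nu_eq ..
qed

definition nudet :: "real \<Rightarrow> real" where
  "nudet \<beta> = nu k 0 \<beta> * nu k 2 \<beta> - (nu k 1 \<beta>)\<^sup>2"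

lemma nu_mono:
  assumes "\<beta>1 \<le> \<beta>2"
  shows "(LINT u|lborel. indicator {..\<beta>1} u * ((u - m)\<^sup>2 * k u)) \<le> (LINT u|lborel. indicator {..\<beta>2} u * ((u - m)\<^sup>2 * k u))"
    and "nu k 0 \<beta>1 \<le> nu k 0 \<beta>2"
  subgoal by (rule integral_mono) (use assms nu_quadratic(2) in \<open>auto simp: indicator_def\<close>)
  subgoal unfolding nu_eq by (rule integral_mono) (use assms integrable_nu[of _ 0] in \<open>auto simp: indicator_def\<close>)
  done

lemma nu0_pos: "nu k 0 0 > 0" and nudet0_pos: "nudet 0 > 0"
proof -
  obtain a b c where *: "-1 < a" "a < b" "b < 0" "c > 0" "\<And>u. a \<le> u \<Longrightarrow> u \<le> b \<Longrightarrow> c \<le> k u"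
    by (rule k_positive_interval[of "-1" 0]) auto
  show nu0: "nu k 0 0 > 0" unfolding nu_eq
    by (rule integral_pos_interval[of _ a b c]) (use * integrable_nu[of 0 0] in \<open>auto simp: indicator_def\<close>)
  define m where "m = nu k 1 0 / nu k 0 0"
  have "(LINT u|lborel. indicator {..0} u * ((u - m)\<^sup>2 * k u)) > 0"
  proof -
    \<comment> \<open>An interval inside \<open>[-1, 0]\<close> that stays away from \<open>m\<close> by at least \<open>1/4\<close>.\<close>
    define p q where "p = (if m \<ge> -1/2 then -1 else -1/4 :: real)" and "q = (if m \<ge> -1/2 then -3/4 else 0 :: real)"
    obtain a b c where *: "p < a" "a < b" "b < q" "c > 0" "\<And>u. a \<le> u \<Longrightarrow> u \<le> b \<Longrightarrow> c \<le> k u"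
      by (rule k_positive_interval[of p q]) (auto simp: p_def q_def)
    show ?thesis
    proof (rule integral_pos_interval[of _ a b "1/16 * c"])
      fix u assume u: "a \<le> u" "u \<le> b"
      have "1/4 \<le> \<bar>u - m\<bar>" using u * by (auto simp: p_def q_def split: if_splits)
      then have "(1/4)^2 \<le> \<bar>u - m\<bar>\<^sup>2" by (intro power_mono) auto
      then have "1/16 * c \<le> (u - m)\<^sup>2 * k u" using u * by (intro mult_mono) (auto simp: power2_eq_square)
      then show "1/16 * c \<le> indicator {..0} u * ((u - m)\<^sup>2 * k u)"
        using u * by (auto simp: indicator_def q_def split: if_splits)
    qed (use * nu_quadratic(2) in auto)
  qed
  then have "0 < nu k 0 0 * (nu k 2 0 - 2 * m * nu k 1 0 + m\<^sup>2 * nu k 0 0)"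
    unfolding nu_quadratic(1) using nu0 by simp
  also have "\<dots> = nudet 0" using nu0 unfolding nudet_def m_def by (simp add: field_simps power2_eq_square)
  finally show "nudet 0 > 0" .
qed

text \<open>Take \<open>m\<close> optimal for \<open>\<beta>\<close>. The quadratic functional at \<open>m\<close> decreases when \<open>\<beta>\<close> is lowered to \<open>0\<close>,
  and it decreases further when \<open>m\<close> is replaced by the minimiser for \<open>\<beta> = 0\<close>.\<close>

lemma nudet_ge:
  assumes "\<beta> \<ge> 0"
  shows "nudet \<beta> \<ge> nudet 0"
proof -
  define m where "m = nu k 1 \<beta> / nu k 0 \<beta>"
  have p: "nu k 0 \<beta> > 0" using nu_mono(2)[OF assms] nu0_pos by linarith
  have "nudet 0 / nu k 0 0 \<le> nu k 2 0 - 2 * m * nu k 1 0 + m\<^sup>2 * nu k 0 0"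
  proof -
    have "nu k 0 0 * (nu k 2 0 - 2 * m * nu k 1 0 + m\<^sup>2 * nu k 0 0) - nudet 0 = (m * nu k 0 0 - nu k 1 0)\<^sup>2"
      unfolding nudet_def by (simp add: power2_eq_square algebra_simps)
    then have "nudet 0 \<le> nu k 0 0 * (nu k 2 0 - 2 * m * nu k 1 0 + m\<^sup>2 * nu k 0 0)"
      by (smt (verit) zero_le_power2)
    then show ?thesis using nu0_pos by (simp add: divide_le_eq mult.commute)
  qed
  also have "\<dots> \<le> nu k 2 \<beta> - 2 * m * nu k 1 \<beta> + m\<^sup>2 * nu k 0 \<beta>"
    using nu_mono(1)[OF assms, of m] unfolding nu_quadratic(1) .
  finally have 1: "nudet 0 / nu k 0 0 \<le> nu k 2 \<beta> - 2 * m * nu k 1 \<beta> + m\<^sup>2 * nu k 0 \<beta>" .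
  have "nudet 0 = nu k 0 0 * (nudet 0 / nu k 0 0)" using nu0_pos by simp
  also have "\<dots> \<le> nu k 0 \<beta> * (nu k 2 \<beta> - 2 * m * nu k 1 \<beta> + m\<^sup>2 * nu k 0 \<beta>)"
    using nu_mono(2)[OF assms] 1 nu0_pos nudet0_pos p by (intro mult_mono) auto
  also have "\<dots> = nudet \<beta>" using p unfolding nudet_def m_def by (simp add: field_simps power2_eq_square)
  finally show ?thesis .
qed

lemma abs_nu_le: "\<bar>nu k i \<beta>\<bar> \<le> 1"
proof -
  have "\<bar>nu k i \<beta>\<bar> \<le> (LINT u|lborel. \<bar>indicator {..\<beta>} u * (u ^ i * k u)\<bar>)"
    unfolding nu_eq by (rule integral_abs_bound)
  also have "\<dots> \<le> (LINT u|lborel. u ^ 0 * k u)"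
  proof (rule integral_mono)
    fix u :: real
    show "\<bar>indicator {..\<beta>} u * (u ^ i * k u)\<bar> \<le> u ^ 0 * k u"
    proof (cases "\<bar>u\<bar> < 1")
      case True
      have "\<bar>u\<bar> ^ i * k u \<le> 1 * k u" using True by (intro mult_right_mono power_le_one) auto
      then show ?thesis by (auto simp: indicator_def abs_mult power_abs)
    qed (simp add: k_zero)
  qed (use integrable_nu integrable_moment[of k 0] in auto)
  finally show ?thesis using moments_k(1) by simp
qed

text \<open>A bound for all boundary kernels: their numerators are at most \<open>2 * Kb\<close> on \<open>[-1, 1]\<close> and their
  denominators at least \<open>nudet 0\<close>.\<close>

definition Cb :: real where "Cb = max Kb (2 * Kb / nudet 0)"

lemma Cb_pos: "Cb > 0" using Kb_pos by (simp add: Cb_def)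

lemma boundary_kernel_bound:
  assumes "\<beta> \<ge> 0"
  shows "\<bar>boundary_kernel k \<beta> u\<bar> \<le> Cb * indicator {-1<..<1} u"
proof (cases "\<bar>u\<bar> < 1")
  case True
  have d: "nudet \<beta> > 0" using nudet_ge[OF assms] nudet0_pos by linarith
  have "\<bar>nu k 2 \<beta> - nu k 1 \<beta> * u\<bar> \<le> \<bar>nu k 2 \<beta>\<bar> + \<bar>nu k 1 \<beta>\<bar> * \<bar>u\<bar>"
    using abs_triangle_ineq4[of "nu k 2 \<beta>" "nu k 1 \<beta> * u"] by (simp add: abs_mult)
  also have "\<dots> \<le> 1 + 1 * 1" using True abs_nu_le by (intro add_mono mult_mono) auto
  finally have n: "\<bar>nu k 2 \<beta> - nu k 1 \<beta> * u\<bar> \<le> 2" by simp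
  have "\<bar>boundary_kernel k \<beta> u\<bar> \<le> \<bar>nu k 2 \<beta> - nu k 1 \<beta> * u\<bar> / nudet \<beta> * k u"
    unfolding boundary_kernel_def nudet_def[symmetric] using d
    by (auto simp: abs_mult indicator_def)
  also have "\<dots> \<le> 2 / nudet 0 * Kb"
    using n d nudet_ge[OF assms] nudet0_pos Kb by (intro mult_mono frac_le) auto
  also have "\<dots> \<le> Cb" by (simp add: Cb_def)
  finally show ?thesis using True by (auto simp: indicator_def)
next
  case False
  then show ?thesis using Cb_pos by (auto simp: boundary_kernel_def k_zero indicator_def)
qed

lemma boundary_kernel_1: "boundary_kernel k 1 u = k u"
proof -
  have "nu k i 1 = (LINT u|lborel. u ^ i * k u)" for i
    unfolding nu_eq by (rule Bochner_Integration.integral_cong) (auto simp: indicator_def k_zero)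
  then have "nu k 0 1 = 1" "nu k 1 1 = 0" "nu k 2 1 = m2 k" using moments_k by simp_all
  then show ?thesis unfolding boundary_kernel_def using m2_pos
    by (cases "\<bar>u\<bar> < 1") (auto simp: indicator_def k_zero abs_less_iff)
qed

text \<open>The two branches of the estimator in one weight, so that \<open>ghat_sub\<close> is an average of weights.\<close>

definition wt :: "real \<Rightarrow> real \<Rightarrow> real \<Rightarrow> real" where
  "wt h s v = (if s > h then k ((s - v) / h) / h else boundary_kernel k (s / h) ((s - v) / h) / h)"

lemma borel_wt [measurable]: "case_prod (wt h) \<in> borel_measurable borel" 
proof -
  have "(\<lambda>x. wt h (fst x) (snd x)) = (\<lambda>x. if fst x > h then k ((fst x - snd x) / h) / h else
     (nu k 2 (fst x / h) - nu k 1 (fst x / h) * ((fst x - snd x) / h)) / nudet (fst x / h) * k ((fst x - snd x) / h)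
      * of_bool (- 1 < (fst x - snd x) / h \<and> (fst x - snd x) / h < fst x / h) / h)"
    unfolding wt_def boundary_kernel_def nudet_def by (auto simp: indicator_def of_bool_def)
  also have "\<dots> \<in> borel_measurable (borel \<Otimes>\<^sub>M borel)" unfolding nudet_def by measurable
  finally show ?thesis by (simp add: case_prod_beta' borel_prod)
qed

lemma borel_wt' [measurable (raw)]:
  assumes [measurable]: "f \<in> borel_measurable N" "g \<in> borel_measurable N"
  shows "(\<lambda>x. wt h (f x) (g x)) \<in> borel_measurable N"
proof -
  have "(\<lambda>x. (f x, g x)) \<in> N \<rightarrow>\<^sub>M borel" by (simp add: borel_prod[symmetric])
  from measurable_compose[OF this borel_wt[of h]] show ?thesis by simp
qed

lemma wt_eq_k: "h > 0 \<Longrightarrow> s \<ge> h \<Longrightarrow> wt h s v = k ((s - v) / h) / h"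
  by (cases "s = h") (auto simp: wt_def boundary_kernel_1)

text \<open>Observations beyond \<open>2 * h\<close> are not affected by the boundary correction, since an argument \<open>s \<le> h\<close> is out of
  the reach of the kernel.\<close>

lemma wt_eq_k_far: 
  assumes "h > 0" "v \<ge> 2 * h" shows "wt h s v = k ((s - v) / h) / h"
proof (cases "s > h")
  case False
  then have "(s - v) / h \<le> -1" using assms by (simp add: field_simps)
  then have "k ((s - v) / h) = 0" by (intro k_zero) linarith
  then show ?thesis by (simp add: wt_def boundary_kernel_def)
qed (use assms in \<open>simp add: wt_eq_k\<close>)

lemma wt_0: assumes "h > 0" "s \<ge> 0" shows "wt h s 0 = 0"
  using assms by (auto simp: wt_def boundary_kernel_def k_zero)

lemma wt_bound:
  assumes h: "h > 0" and s: "s \<ge> 0"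
  shows "\<bar>wt h s v\<bar> \<le> Cb / h * indicator {v - h<..<v + h} s"
proof -
  have i: "indicator {-1<..<1} ((s - v) / h) = (indicator {v - h<..<v + h} s :: real)"
    using h by (auto simp: indicator_def field_simps)
  have "\<bar>k u\<bar> \<le> Cb * indicator {-1<..<1} u" for u
    using Kb(3)[of u] Cb_pos by (cases "\<bar>u\<bar> < 1") (auto simp: Cb_def k_zero abs_less_iff indicator_def)
  from this[of "(s - v) / h"] boundary_kernel_bound[of "s / h" "(s - v) / h"] h s
  show ?thesis unfolding wt_def i by (auto simp: divide_simps)
qed

definition cwt :: "real \<Rightarrow> real \<Rightarrow> real \<Rightarrow> real" where
  "cwt h u v = (LINT s:{0..u}|lborel. wt h s v)"

lemma wt_integrable:
  assumes h: "h > 0" and "A \<subseteq> {0..}" and [measurable]: "A \<in> sets borel"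
  shows "set_integrable lborel A (\<lambda>s. wt h s v)"
  unfolding set_integrable_def
proof (rule Bochner_Integration.integrable_bound[of _ "\<lambda>s. Cb / h * indicator {v - h<..<v + h} s"])
  show "AE s in lborel. norm (indicator A s *\<^sub>R wt h s v) \<le> norm (Cb / h * indicator {v - h<..<v + h} s :: real)"
  proof (rule AE_I2)
    fix s :: real
    show "norm (indicator A s *\<^sub>R wt h s v) \<le> norm (Cb / h * indicator {v - h<..<v + h} s :: real)"
    proof (cases "s \<in> A")
      case True
      then have "s \<ge> 0" using assms(2) by auto
      from order_trans[OF wt_bound[OF h this, of v] abs_ge_self] True show ?thesis by simp
    qed simp
  qed
qed auto

lemma borel_cwt [measurable]: "cwt h u \<in> borel_measurable borel"
proof -
  have "(\<lambda>v. LINT s|lborel. of_bool (0 \<le> s \<and> s \<le> u) * wt h s v) \<in> borel_measurable borel"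
    by (rule lborel.borel_measurable_lebesgue_integral) measurable
  also have "(\<lambda>v. LINT s|lborel. of_bool (0 \<le> s \<and> s \<le> u) * wt h s v) = cwt h u"
    unfolding cwt_def fun_eq_iff set_lebesgue_integral_def 
    by (auto intro!: Bochner_Integration.integral_cong simp: indicator_def)
  finally show ?thesis .
qed

lemma abs_cwt_le:
  assumes h: "h > 0"
  shows "\<bar>cwt h u v\<bar> \<le> 2 * Cb"
proof -
  have "\<bar>cwt h u v\<bar> \<le> (LINT s|lborel. \<bar>indicator {0..u} s *\<^sub>R wt h s v\<bar>)"
    unfolding cwt_def set_lebesgue_integral_def by (rule integral_abs_bound)
  also have "\<dots> \<le> (LINT s|lborel. Cb / h * indicator {v - h<..<v + h} s)"
  proof (rule integral_mono)
    show "integrable lborel (\<lambda>s. \<bar>indicator {0..u} s *\<^sub>R wt h s v\<bar>)"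
      using wt_integrable[OF h, of "{0..u}" v] unfolding set_integrable_def by (intro integrable_abs) auto
    fix s :: real
    have nn: "0 \<le> Cb / h * indicator {v - h<..<v + h} s" using Cb_pos h by simp
    show "\<bar>indicator {0..u} s *\<^sub>R wt h s v\<bar> \<le> Cb / h * indicator {v - h<..<v + h} s"
    proof (cases "s \<in> {0..u}")
      case True
      then have "s \<ge> 0" by auto
      from wt_bound[OF h this, of v] nn True show ?thesis by simp
    qed (use nn in simp)
  qed auto
  also have "\<dots> = 2 * Cb" using h by simp
  finally show ?thesis .
qed

lemma cwt_far:
  assumes h: "h > 0" and v: "v \<ge> 2 * h"
  shows "0 \<le> cwt h u v" "cwt h u v \<le> 1" "u \<le> v - h \<Longrightarrow> cwt h u v = 0" "u \<ge> v + h \<Longrightarrow> cwt h u v = 1"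
proof -
  have eq: "cwt h u v = (LINT x|lborel. indicator {- v / h..(u - v) / h} x * k x)"
  proof -
    have "cwt h u v = (LINT s|lborel. indicator {0..u} s * (k ((s - v) / h) / h))"
      unfolding cwt_def set_lebesgue_integral_def by (simp add: wt_eq_k_far[OF assms])
    also have "\<dots> = (LINT x|lborel. h * (indicator {0..u} (v + h * x) * (k x / h)))"
      using lborel_integral_real_affine[of h "\<lambda>s. indicator {0..u} s * (k ((s - v) / h) / h)" v] h by simp
    also have "\<dots> = (LINT x|lborel. indicator {- v / h..(u - v) / h} x * k x)"
      using h by (intro Bochner_Integration.integral_cong) (auto simp: indicator_def field_simps)
    finally show ?thesis .
  qed
  have i: "integrable lborel (\<lambda>x. indicator {- v / h..(u - v) / h} x * k x)"
    using integrable_real_mult_indicator[of "{- v / h..(u - v) / h}" lborel k] integrable_moment[of k 0]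
    by (simp add: mult.commute)
  show "0 \<le> cwt h u v" unfolding eq by (intro Bochner_Integration.integral_nonneg) auto
  have "cwt h u v \<le> (LINT x|lborel. k x)" unfolding eq
    by (rule integral_mono) (use i integrable_moment[of k 0] in \<open>auto simp: indicator_def\<close>)
  then show "cwt h u v \<le> 1" by (simp add: k_int_1)
  show "cwt h u v = 0" if "u \<le> v - h"
  proof -
    have "(u - v) / h \<le> -1" using h that by (simp add: field_simps)
    then have "indicator {- v / h..(u - v) / h} x * k x = 0" for x
      by (auto simp: indicator_def k_zero)
    then have "(\<lambda>x. indicator {- v / h..(u - v) / h} x * k x) = (\<lambda>_. 0)" by (rule ext)
    then show ?thesis unfolding eq by (simp only: Bochner_Integration.integral_zero)
  qed
  show "cwt h u v = 1" if "u \<ge> v + h"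
  proof -
    have "(u - v) / h \<ge> 1" "- v / h \<le> -1" using h v that by (simp_all add: field_simps)
    then have "indicator {- v / h..(u - v) / h} x * k x = k x" for x
      by (cases "\<bar>x\<bar> < 1") (auto simp: indicator_def k_zero)
    then have "(\<lambda>x. indicator {- v / h..(u - v) / h} x * k x) = k" by (rule ext)
    then show ?thesis unfolding eq by (simp only: k_int_1)
  qed
qed

text \<open>As a function of \<open>v\<close>, the integrated weight is a smoothed version of the indicator of \<open>v \<le> u\<close>. The
  boundary kernel may be negative and need not integrate to one, so near the boundary only the
  crude bound \<open>2 * Cb\<close> remains; few observations fall there.\<close>

lemma cwt_bounds:
  assumes h: "h > 0"
  shows "cwt h u v \<le> of_bool (v \<le> u + h) + (2 * Cb + 1) * of_bool (v \<le> 2 * h)"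
    and "of_bool (v \<le> u - h) - (2 * Cb + 1) * of_bool (v \<le> 2 * h) \<le> cwt h u v"
proof -
  have "cwt h u v \<le> of_bool (v \<le> u + h) + (2 * Cb + 1) * of_bool (v \<le> 2 * h)
     \<and> of_bool (v \<le> u - h) - (2 * Cb + 1) * of_bool (v \<le> 2 * h) \<le> cwt h u v"
  proof (cases "v \<le> 2 * h")
    case True
    then show ?thesis using abs_cwt_le[OF h, of u v] Cb_pos by (auto simp: abs_le_iff)
  next
    case False
    then show ?thesis using cwt_far[OF h, of v u] by auto
  qed
  then show "cwt h u v \<le> of_bool (v \<le> u + h) + (2 * Cb + 1) * of_bool (v \<le> 2 * h)"
    "of_bool (v \<le> u - h) - (2 * Cb + 1) * of_bool (v \<le> 2 * h) \<le> cwt h u v" by auto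
qed

end

section \<open>Explicit form of the estimators\<close>

context
  fixes n :: nat and ts :: "nat \<Rightarrow> real" and ds :: "nat \<Rightarrow> nat" and i :: nat
begin

lemma emp_subdf_eq: "emp_subdf n ts ds i x = (\<Sum>j\<in>{j. j < n \<and> 0 \<le> ts j \<and> ds j = i}. of_bool (ts j \<le> x)) / real n"
proof -
  have "(\<Sum>j<n. indicator ({0..x} \<times> {i}) (ts j, ds j)) = (\<Sum>j<n. if 0 \<le> ts j \<and> ds j = i then of_bool (ts j \<le> x) else 0 :: real)"
    by (intro sum.cong) (auto simp: indicator_def)
  also have "\<dots> = (\<Sum>j\<in>{j. j < n \<and> 0 \<le> ts j \<and> ds j = i}. of_bool (ts j \<le> x))"
    by (subst sum.inter_filter[symmetric]) (auto intro!: sum.cong)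
  finally show ?thesis unfolding emp_subdf_def by simp
qed

text \<open>The empirical subdistribution function is a right-continuous step function, and its
  Lebesgue-Stieltjes measure puts mass \<open>1 / n\<close> on each observation of the class \<open>i\<close>. Both measures agree on
  half-open intervals.\<close>

lemma interval_measure_emp_subdf:
  "interval_measure (emp_subdf n ts ds i)
    = distr (point_measure {j. j < n \<and> 0 \<le> ts j \<and> ds j = i} (\<lambda>_. ennreal (1 / real n))) borel ts"
    (is "?M = distr ?P borel ts")
proof -
  let ?J = "{j. j < n \<and> 0 \<le> ts j \<and> ds j = i}"
  have [measurable]: "ts \<in> ?P \<rightarrow>\<^sub>M borel" by (simp add: measurable_point_measure_eq1)
  have mono: "emp_subdf n ts ds i x \<le> emp_subdf n ts ds i y" if "x \<le> y" for x y
    unfolding emp_subdf_eq using that by (intro divide_right_mono sum_mono) auto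
  have rc1: "continuous (at_right a) (\<lambda>x. of_bool (c \<le> x) :: real)" for a c :: real
  proof (cases "c \<le> a")
    case True
    have "\<forall>\<^sub>F x in at_right a. of_bool (c \<le> x) = (1::real)"
      using True by (auto simp: eventually_at_right_field intro!: exI[of _ "a + 1"])
    then show ?thesis unfolding continuous_within using True by (auto intro: tendsto_eventually)
  next
    case False
    have "\<forall>\<^sub>F x in at_right a. of_bool (c \<le> x) = (0::real)"
      using False by (auto simp: eventually_at_right_field intro!: exI[of _ c])
    then show ?thesis unfolding continuous_within using False by (auto intro: tendsto_eventually)
  qed
  have rc: "continuous (at_right a) (emp_subdf n ts ds i)" for a
  proof (cases "n = 0")
    case True
    then show ?thesis unfolding emp_subdf_def[abs_def] by simp
  next
    case False
    then show ?thesis unfolding emp_subdf_eq[abs_def] by (intro continuous_intros rc1) auto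
  qed
  have Ioc: "emeasure (distr ?P borel ts) {a<..b} = emeasure ?M {a<..b}" for a b :: real
  proof (cases "a \<le> b")
    case True
    have "emeasure (distr ?P borel ts) {a<..b} = emeasure ?P {j\<in>?J. a < ts j \<and> ts j \<le> b}"
      by (subst emeasure_distr) (auto intro!: arg_cong[where f = "emeasure ?P"] simp: space_point_measure)
    also have "\<dots> = (\<Sum>j\<in>{j\<in>?J. a < ts j \<and> ts j \<le> b}. ennreal (1 / real n))"
      by (rule emeasure_point_measure_finite) auto
    also have "\<dots> = ennreal (\<Sum>j\<in>{j\<in>?J. a < ts j \<and> ts j \<le> b}. 1 / real n)"
      by (rule sum_ennreal) auto
    also have "(\<Sum>j\<in>{j\<in>?J. a < ts j \<and> ts j \<le> b}. 1 / real n) = (\<Sum>j\<in>?J. if a < ts j \<and> ts j \<le> b then 1 / real n else 0)"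
      by (rule sum.inter_filter) auto
    also have "\<dots> = emp_subdf n ts ds i b - emp_subdf n ts ds i a"
      unfolding emp_subdf_eq diff_divide_distrib[symmetric] sum_subtractf[symmetric] sum_divide_distrib
      using True by (intro sum.cong) auto
    also have "ennreal \<dots> = emeasure ?M {a<..b}"
      using True by (subst emeasure_interval_measure_Ioc[OF _ mono rc]) auto
    finally show ?thesis .
  qed auto
  have fin: "emeasure ?M {a<..b} \<noteq> \<infinity>" for a b :: real
    by (subst emeasure_interval_measure_Ioc_eq[OF mono rc]) auto
  show ?thesis
  proof (rule measure_eqI_generator_eq[where \<Omega> = UNIV and E = "range (\<lambda>(a, b). {a<..b::real})" and A = "\<lambda>i. {- real i<..real i}"])
    fix X assume "X \<in> range (\<lambda>(a, b). {a<..b::real})"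
    then show "emeasure ?M X = emeasure (distr ?P borel ts) X" using Ioc by auto
  next
    show "(\<Union>i. {- real (i::nat)<..real i}) = UNIV"
      by (rule UN_Ioc_eq_UNIV)
  qed (use fin in \<open>auto simp: borel_sigma_sets_Ioc Int_stable_def\<close>)
qed

lemma integral_interval_measure_emp_subdf:
  fixes \<phi> :: "real \<Rightarrow> real"
  assumes [measurable]: "\<phi> \<in> borel_measurable borel"
  shows "(LINT u|interval_measure (emp_subdf n ts ds i). \<phi> u)
    = (\<Sum>j<n. of_bool (0 \<le> ts j \<and> ds j = i) * \<phi> (ts j)) / n"
proof -
  let ?J = "{j. j < n \<and> 0 \<le> ts j \<and> ds j = i}"
  have [measurable]: "ts \<in> point_measure ?J (\<lambda>_. ennreal (1 / real n)) \<rightarrow>\<^sub>M borel"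
    by (simp add: measurable_point_measure_eq1)
  have "(LINT u|interval_measure (emp_subdf n ts ds i). \<phi> u) = (\<Sum>j\<in>?J. (1 / real n) *\<^sub>R \<phi> (ts j))"
    unfolding interval_measure_emp_subdf by (subst integral_distr)
      (auto simp del: real_scaleR_def intro!: lebesgue_integral_point_measure_finite)
  also have "\<dots> = (\<Sum>j\<in>?J. \<phi> (ts j)) / n"
    by (simp add: sum_divide_distrib)
  also have "(\<Sum>j\<in>?J. \<phi> (ts j)) = (\<Sum>j<n. of_bool (0 \<le> ts j \<and> ds j = i) * \<phi> (ts j))"
    by (rule sum.mono_neutral_cong_left) auto
  finally show ?thesis .
qed

end

context kernel_fun
begin

lemma ghat_sub_eq:
  "ghat_sub k h n ts ds i s = (\<Sum>j<n. of_bool (0 \<le> ts j \<and> ds j = i) * wt h s (ts j)) / n"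
proof -
  have "ghat_sub k h n ts ds i s = (LINT u|interval_measure (emp_subdf n ts ds i). wt h s u)"
    unfolding ghat_sub_def wt_def scaled_kernel_def by simp
  also have "\<dots> = (\<Sum>j<n. of_bool (0 \<le> ts j \<and> ds j = i) * wt h s (ts j)) / n"
    by (rule integral_interval_measure_emp_subdf) measurable
  finally show ?thesis .
qed

lemma ghat_sub_integrable:
  assumes "h > 0" "A \<subseteq> {0..}" "A \<in> sets borel"
  shows "set_integrable lborel A (ghat_sub k h n ts ds i)"
proof -
  have int: "integrable lborel (\<lambda>s. indicator A s * wt h s v)" for v
    using wt_integrable[OF assms, of v] unfolding set_integrable_def by simp
  have "indicator A s *\<^sub>R ghat_sub k h n ts ds i s
      = (\<Sum>j<n. of_bool (0 \<le> ts j \<and> ds j = i) * (indicator A s * wt h s (ts j))) / n" for s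
    unfolding ghat_sub_eq
    by (simp only: real_scaleR_def times_divide_eq_right sum_distrib_left mult.left_commute)
  then show ?thesis unfolding set_integrable_def
    by (simp only:) (intro integrable_divide Bochner_Integration.integrable_sum integrable_mult_right int)
qed

lemma Ghat_sub_eq:
  assumes h: "h > 0"
  shows "Ghat_sub k h n ts ds i u = (\<Sum>j<n. of_bool (0 \<le> ts j \<and> ds j = i) * cwt h u (ts j)) / n"
proof -
  have int: "integrable lborel (\<lambda>s. indicator {0..u} s * wt h s v)" for v
    using wt_integrable[OF h, of "{0..u}" v] unfolding set_integrable_def by auto
  have "Ghat_sub k h n ts ds i u = (LINT s|lborel. (\<Sum>j<n. of_bool (0 \<le> ts j \<and> ds j = i) * (indicator {0..u} s * wt h s (ts j))) / n)"
    unfolding Ghat_sub_def set_lebesgue_integral_def ghat_sub_eq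
    by (simp only: real_scaleR_def times_divide_eq_right sum_distrib_left mult.left_commute)
  also have "\<dots> = (\<Sum>j<n. of_bool (0 \<le> ts j \<and> ds j = i) * (LINT s|lborel. indicator {0..u} s * wt h s (ts j))) / n"
  proof -
    have i: "integrable lborel (\<lambda>s. of_bool (0 \<le> ts j \<and> ds j = i) * (indicator {0..u} s * wt h s (ts j)))" for j
      by (rule integrable_mult_right[OF int])
    show ?thesis
      unfolding integral_divide_zero Bochner_Integration.integral_sum[OF i] integral_mult_right_zero ..
  qed
  finally show ?thesis unfolding cwt_def set_lebesgue_integral_def by simp
qed

lemma Ghat_eq:
  assumes h: "h > 0"
  shows "Ghat k h n ts ds u = Ghat_sub k h n ts ds 0 u + Ghat_sub k h n ts ds 1 u"
  unfolding Ghat_def Ghat_sub_def ghat_def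
  by (rule set_integral_add) (rule ghat_sub_integrable; use h in auto)+

text \<open>The end point \<open>s = h\<close> is included because the boundary kernel for \<open>\<beta> = 1\<close> is \<open>k\<close> itself.\<close>

lemma ghat_sub_interior:
  assumes "h > 0" "s \<ge> h"
  shows "ghat_sub k h n ts ds i s = (\<Sum>j<n. of_bool (0 \<le> ts j \<and> ds j = i) * (k ((s - ts j) / h) / h)) / n"
  unfolding ghat_sub_eq using assms by (simp add: wt_eq_k)

lemma ghat_sub_nonneg: "h > 0 \<Longrightarrow> s \<ge> h \<Longrightarrow> 0 \<le> ghat_sub k h n ts ds i s"
  unfolding ghat_sub_interior by (intro divide_nonneg_nonneg sum_nonneg mult_nonneg_nonneg) auto

definition dghat :: "real \<Rightarrow> nat \<Rightarrow> (nat \<Rightarrow> real) \<Rightarrow> (nat \<Rightarrow> nat) \<Rightarrow> nat \<Rightarrow> real \<Rightarrow> real" where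
  "dghat h n ts ds i s = (\<Sum>j<n. of_bool (0 \<le> ts j \<and> ds j = i) * (k' ((s - ts j) / h) / h\<^sup>2)) / n"

lemma DERIV_ghat_sub:
  assumes h: "h > 0" and s: "s > h"
  shows "DERIV (ghat_sub k h n ts ds i) s :> dghat h n ts ds i s"
proof -
  have 1: "DERIV (\<lambda>s. k ((s - v) / h) / h) s :> k' ((s - v) / h) / h\<^sup>2" for v
  proof -
    have "DERIV (\<lambda>s. (s - v) / h) s :> 1 / h" using h by (auto intro!: derivative_eq_intros)
    from DERIV_cdivide[OF DERIV_chain2[OF DERIV_k this], of h]
    show ?thesis by (simp add: power2_eq_square)
  qed
  have "DERIV (\<lambda>s. (\<Sum>j<n. of_bool (0 \<le> ts j \<and> ds j = i) * (k ((s - ts j) / h) / h)) / n) s :> dghat h n ts ds i s"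
    unfolding dghat_def by (intro DERIV_cdivide DERIV_sum DERIV_cmult 1)
  then show ?thesis
  proof (rule has_field_derivative_transform_within_open)
    show "open {h<..}" "s \<in> {h<..}" using s by auto
  qed (use h in \<open>auto simp: ghat_sub_interior\<close>)
qed

lemma isCont_ghat_sub: "h > 0 \<Longrightarrow> s > h \<Longrightarrow> isCont (ghat_sub k h n ts ds i) s"
  using DERIV_ghat_sub DERIV_isCont by blast

lemma continuous_on_Ghat_sub:
  assumes h: "h > 0"
  shows "continuous_on {0..R} (Ghat_sub k h n ts ds i)"
proof -
  have io: "ghat_sub k h n ts ds i integrable_on {0..R}"
    by (rule set_borel_integral_eq_integral(1)[OF ghat_sub_integrable[OF h]]) auto
  have "continuous_on {0..R} (\<lambda>x. integral {0..x} (ghat_sub k h n ts ds i))"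
    by (rule indefinite_integral_continuous_1[OF io])
  moreover have "Ghat_sub k h n ts ds i x = integral {0..x} (ghat_sub k h n ts ds i)" for x
    unfolding Ghat_sub_def
    by (rule set_borel_integral_eq_integral(2)[OF ghat_sub_integrable[OF h]]) auto
  ultimately show ?thesis by simp
qed

lemma DERIV_Ghat_sub:
  assumes h: "h > 0" and s: "s > h"
  shows "DERIV (Ghat_sub k h n ts ds i) s :> ghat_sub k h n ts ds i s"
proof -
  let ?g = "ghat_sub k h n ts ds i"
  have eq: "Ghat_sub k h n ts ds i x = integral {0..x} ?g" for x
    unfolding Ghat_sub_def
    by (rule set_borel_integral_eq_integral(2)[OF ghat_sub_integrable[OF h]]) auto
  have io: "?g integrable_on {0..x}" for x
    by (rule set_borel_integral_eq_integral(1)[OF ghat_sub_integrable[OF h]]) auto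
  have "((\<lambda>u. integral {0..u} ?g) has_vector_derivative ?g s) (at s within {0..s + 1})"
    using integral_has_vector_derivative_continuous_at[OF io, of s "s + 1" "{}"]
      continuous_at_imp_continuous_within[OF isCont_ghat_sub[OF h s]] s h by simp
  moreover have "at s within {0..s + 1} = at s" by (rule at_within_Icc_at) (use s h in auto)
  ultimately have "((\<lambda>u. integral {0..u} ?g) has_vector_derivative ?g s) (at s)" by simp
  then show ?thesis unfolding eq[abs_def] has_real_derivative_iff_has_vector_derivative by simp
qed

end

section \<open>The lower convex hull of a curve with a supporting tangent\<close>

text \<open>The half-plane above a line that lies below the curve is convex, so it contains the
  convex hull.\<close>

lemma lower_convex_hull_contact:
  fixes x y :: "real \<Rightarrow> real"
  assumes s: "s \<in> I" and tangent: "\<And>u. u \<in> I \<Longrightarrow> r * (x u - x s) \<le> y u - y s"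
  shows "lower_convex_hull ((\<lambda>s. (x s, y s)) ` I) (x s) = y s"
proof -
  define H :: "(real \<times> real) set" where "H = {p. (- r, 1) \<bullet> p \<ge> y s - r * x s}"
  have "convex H" unfolding H_def by (rule convex_halfspace_ge)
  moreover have "(\<lambda>s. (x s, y s)) ` I \<subseteq> H"
    using tangent by (auto simp: H_def algebra_simps)
  ultimately have "convex hull ((\<lambda>s. (x s, y s)) ` I) \<subseteq> H" by (rule hull_minimal[rotated])
  then have "y s \<le> b" if "(x s, b) \<in> convex hull ((\<lambda>s. (x s, y s)) ` I)" for b
  proof -
    have "(x s, b) \<in> H" using that \<open>convex hull _ \<subseteq> H\<close> by blast
    then show ?thesis unfolding H_def by (simp add: algebra_simps)
  qed
  moreover have "(x s, y s) \<in> convex hull ((\<lambda>s. (x s, y s)) ` I)"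
    by (rule hull_inc) (use s in auto)
  ultimately show ?thesis unfolding lower_convex_hull_def by (intro cInf_eq_minimum) auto
qed

lemma right_slope_DERIV:
  assumes "DERIV C x :> D" shows "right_slope C x = D"
proof -
  have "((\<lambda>y. (C y - C x) / (y - x)) \<longlongrightarrow> D) (at x)" using assms unfolding has_field_derivative_iff .
  then have "((\<lambda>y. (C y - C x) / (y - x)) \<longlongrightarrow> D) (at_right x)" by (rule tendsto_within_subset) auto
  then show ?thesis unfolding right_slope_def by (intro tendsto_Lim) auto
qed

text \<open>If a curve \<open>(x, y)\<close> with \<open>x' > 0\<close> runs in the graph of \<open>L\<close>, then the slope of \<open>L\<close> is \<open>y' / x'\<close>.\<close>

lemma DERIV_of_parametrisation:
  fixes x y L :: "real \<Rightarrow> real"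
  assumes ab: "a < s" "s < b"
    and dx: "\<And>u. a \<le> u \<Longrightarrow> u \<le> b \<Longrightarrow> DERIV x u :> p u" and p: "\<And>u. a \<le> u \<Longrightarrow> u \<le> b \<Longrightarrow> p u > 0"
    and dy: "DERIV y s :> q"
    and L: "\<And>u. a \<le> u \<Longrightarrow> u \<le> b \<Longrightarrow> L (x u) = y u"
  shows "DERIV L (x s) :> q / p s"
proof -
  define g where "g = inv_into {a..b} x"
  have mono: "x u < x v" if "a \<le> u" "u < v" "v \<le> b" for u v
    by (rule DERIV_pos_imp_increasing[OF that(2)]) (use that dx p in \<open>meson order_trans\<close>)
  have inj: "inj_on x {a..b}"
  proof (rule inj_onI)
    fix u v assume "u \<in> {a..b}" "v \<in> {a..b}" "x u = x v"
    then show "u = v" using mono[of u v] mono[of v u] by (cases u v rule: linorder_cases) auto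
  qed
  have gx: "g (x u) = u" if "a \<le> u" "u \<le> b" for u
    unfolding g_def by (rule inv_into_f_f[OF inj]) (use that in auto)
  have cx: "isCont x u" if "a \<le> u" "u \<le> b" for u using dx[OF that] DERIV_isCont by blast
  have xg: "x (g z) = z \<and> a \<le> g z \<and> g z \<le> b" if "x a < z" "z < x b" for z
  proof -
    have "\<exists>u\<ge>a. u \<le> b \<and> x u = z"
      by (rule IVT) (use that ab cx in auto)
    then show ?thesis using gx by auto
  qed
  have cg: "isCont g (x s)"
    by (rule isCont_inverse_function2[of a s b]) (use ab gx cx in auto)
  have gs: "g (x s) = s" using gx ab by auto
  have dg: "DERIV g (x s) :> inverse (p s)"
  proof (rule DERIV_inverse_function[where f = x and a = "x a" and b = "x b"])
    show "DERIV x (g (x s)) :> p s" unfolding gs using dx ab by auto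
    show "p s \<noteq> 0" using p[of s] ab by auto
    show "x a < x s" "x s < x b" using mono ab by auto
    show "x (g z) = z" if "x a < z" "z < x b" for z using xg[OF that] by auto
  qed (rule cg)
  have "DERIV (\<lambda>z. y (g z)) (x s) :> q * inverse (p s)"
    by (rule DERIV_chain2[OF _ dg]) (simp add: gs dy)
  then have "DERIV L (x s) :> q * inverse (p s)"
  proof (rule has_field_derivative_transform_within_open)
    show "open {x a<..<x b}" "x s \<in> {x a<..<x b}" using mono ab by auto
    show "y (g z) = L z" if "z \<in> {x a<..<x b}" for z
      using L[of "g z"] xg[of z] that by auto
  qed
  then show ?thesis by (simp add: divide_inverse)
qed

text \<open>Inside the \<open>\<epsilon>\<close>-neighbourhood the tangents stay below the curve because the slope is increasing. Outside, the
  tangent at \<open>t\<close> is below the curve by the margin \<open>\<gamma>\<close>, and the tangents at points \<open>s\<close> close to \<open>t\<close> inherit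
  this because they differ little from the tangent at \<open>t\<close> on the bounded range of \<open>x\<close>. So the hull passes through
  the points of the curve close to \<open>t\<close>.\<close>

lemma hull_slope_near:
  fixes x y p q :: "real \<Rightarrow> real" and \<tau> t \<epsilon> B \<gamma> :: real
  defines "r \<equiv> \<lambda>s. q s / p s"
  assumes e: "\<epsilon> > 0" "\<epsilon> \<le> t" "t + \<epsilon> \<le> \<tau>"
    and dx: "\<And>u. \<bar>u - t\<bar> < \<epsilon> \<Longrightarrow> DERIV x u :> p u" and p: "\<And>u. \<bar>u - t\<bar> < \<epsilon> \<Longrightarrow> p u > 0"
    and dy: "\<And>u. \<bar>u - t\<bar> < \<epsilon> \<Longrightarrow> DERIV y u :> q u"
    and mono: "\<And>u v. \<bar>u - t\<bar> < \<epsilon> \<Longrightarrow> \<bar>v - t\<bar> < \<epsilon> \<Longrightarrow> u \<le> v \<Longrightarrow> r u \<le> r v"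
    and cr: "isCont r t"
    and B: "\<And>u. u \<in> {0..\<tau>} \<Longrightarrow> \<bar>x u\<bar> \<le> B"
    and gap: "\<gamma> > 0" "\<And>u. u \<in> {0..\<tau>} \<Longrightarrow> \<bar>u - t\<bar> \<ge> \<epsilon> \<Longrightarrow> \<gamma> \<le> y u - y t - r t * (x u - x t)"
  shows "\<forall>\<^sub>F s in nhds t. right_slope (lower_convex_hull ((\<lambda>s. (x s, y s)) ` {0..\<tau>})) (x s) = r s"
proof -
  let ?L = "lower_convex_hull ((\<lambda>s. (x s, y s)) ` {0..\<tau>})"
  have near: "r s * (x u - x s) \<le> y u - y s" if s: "\<bar>s - t\<bar> < \<epsilon>" and u: "\<bar>u - t\<bar> < \<epsilon>" for s u
  proof -
    have d: "DERIV (\<lambda>v. y v - r s * x v) v :> p v * (r v - r s)" if "\<bar>v - t\<bar> < \<epsilon>" for v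
    proof -
      have "DERIV (\<lambda>v. y v - r s * x v) v :> q v - r s * p v"
        by (intro DERIV_diff DERIV_cmult dx dy that)
      also have "q v - r s * p v = p v * (r v - r s)"
        using p[OF that] by (simp add: r_def field_simps)
      finally show ?thesis .
    qed
    have "y s - r s * x s \<le> y u - r s * x u"
    proof (cases "s \<le> u")
      case True
      show ?thesis
      proof (rule DERIV_nonneg_imp_nondecreasing[OF True])
        fix v assume v: "s \<le> v" "v \<le> u"
        then have "\<bar>v - t\<bar> < \<epsilon>" using s u by auto
        moreover from this have "0 \<le> p v * (r v - r s)"
          using p[of v] mono[OF s _ v(1)] by (intro mult_nonneg_nonneg) auto
        ultimately show "\<exists>z. DERIV (\<lambda>v. y v - r s * x v) v :> z \<and> 0 \<le> z" using d by blast
      qed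
    next
      case False
      then have us: "u \<le> s" by simp
      show ?thesis
      proof (rule DERIV_nonpos_imp_nonincreasing[OF us])
        fix v assume v: "u \<le> v" "v \<le> s"
        then have v': "\<bar>v - t\<bar> < \<epsilon>" using s u by auto
        moreover have "p v * (r v - r s) \<le> 0"
          using p[OF v'] mono[OF v' s v(2)] by (intro mult_nonneg_nonpos) auto
        ultimately show "\<exists>z. DERIV (\<lambda>v. y v - r s * x v) v :> z \<and> z \<le> 0" using d by blast
      qed
    qed
    then show ?thesis by (simp add: algebra_simps)
  qed
  have cx: "isCont x t" and cy: "isCont y t" using dx[of t] dy[of t] e DERIV_isCont by force+
  \<comment> \<open>How much the margin can shrink when the tangent at \<open>t\<close> is replaced by the one at \<open>s\<close>.\<close>
  define \<Delta> where "\<Delta> s = \<bar>y s - y t\<bar> + \<bar>r s - r t\<bar> * B + \<bar>r s * x s - r t * x t\<bar>" for s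
  have "(\<Delta> \<longlongrightarrow> \<bar>y t - y t\<bar> + \<bar>r t - r t\<bar> * B + \<bar>r t * x t - r t * x t\<bar>) (at t)"
    unfolding \<Delta>_def using cx cy cr unfolding isCont_def by (intro tendsto_intros)
  then have "\<forall>\<^sub>F s in at t. \<Delta> s < \<gamma>" using gap(1) by (intro order_tendstoD(2)) auto
  then have "\<forall>\<^sub>F s in nhds t. \<Delta> s < \<gamma>"
    unfolding eventually_at_filter by eventually_elim (use gap(1) in \<open>auto simp: \<Delta>_def\<close>)
  then obtain d where d: "d > 0" "\<And>s. dist s t < d \<Longrightarrow> \<Delta> s < \<gamma>"
    unfolding eventually_nhds_metric by blast
  define \<eta> where "\<eta> = min d \<epsilon>"
  have contact: "?L (x s) = y s" if s: "\<bar>s - t\<bar> < \<eta>" for s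
  proof (rule lower_convex_hull_contact)
    show "s \<in> {0..\<tau>}" using s e by (auto simp: \<eta>_def)
    fix u assume u: "u \<in> {0..\<tau>}"
    show "r s * (x u - x s) \<le> y u - y s"
    proof (cases "\<bar>u - t\<bar> < \<epsilon>")
      case True
      show ?thesis by (rule near[OF _ True]) (use s in \<open>auto simp: \<eta>_def\<close>)
    next
      case False
      have 1: "(r s - r t) * x u \<le> \<bar>r s - r t\<bar> * B"
      proof -
        have "(r s - r t) * x u \<le> \<bar>(r s - r t) * x u\<bar>" by (rule abs_ge_self)
        also have "\<dots> \<le> \<bar>r s - r t\<bar> * B" unfolding abs_mult using B[OF u] by (rule mult_left_mono) simp
        finally show ?thesis .
      qed
      have "y u - y s - r s * (x u - x s) = (y u - y t - r t * (x u - x t)) - (y s - y t) - (r s - r t) * x u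
          + (r s * x s - r t * x t)" by (simp add: algebra_simps)
      moreover have "\<gamma> \<le> y u - y t - r t * (x u - x t)" using gap(2)[OF u] False by auto
      moreover have "\<Delta> s < \<gamma>" using d(2)[of s] s by (auto simp: \<eta>_def dist_real_def)
      ultimately show ?thesis using 1 unfolding \<Delta>_def by linarith
    qed
  qed
  have "right_slope ?L (x s) = r s" if s: "\<bar>s - t\<bar> < \<eta>" for s
  proof -
    define m where "m = (\<eta> - \<bar>s - t\<bar>) / 2"
    have m: "m > 0" "\<And>u. s - m \<le> u \<Longrightarrow> u \<le> s + m \<Longrightarrow> \<bar>u - t\<bar> < \<eta>"
      using s unfolding m_def by (auto simp: abs_if field_simps split: if_splits)
    have ee: "\<eta> \<le> \<epsilon>" by (simp add: \<eta>_def)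
    have "DERIV ?L (x s) :> q s / p s"
    proof (rule DERIV_of_parametrisation[of "s - m" s "s + m"])
      show "DERIV y s :> q s" using s ee by (intro dy) auto
      fix u assume u: "s - m \<le> u" "u \<le> s + m"
      from m(2)[OF this] ee have "\<bar>u - t\<bar> < \<epsilon>" "\<bar>u - t\<bar> < \<eta>" by auto
      then show "DERIV x u :> p u" "p u > 0" "?L (x u) = y u" using dx p contact by auto
    qed (use m in auto)
    then show ?thesis unfolding r_def by (rule right_slope_DERIV)
  qed
  then show ?thesis
    unfolding eventually_nhds_metric using d(1) e(1)
    by (intro exI[of _ \<eta>]) (auto simp: \<eta>_def dist_real_def)
qed

section \<open>The lower convex hull of a compact planar set\<close>

lemma tendsto_one_over_Suc: "(\<lambda>m. 1 / (real m + 1)) \<longlonglongrightarrow> 0"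
  by real_asymp

context
  fixes S :: "(real \<times> real) set" and a b :: real
  assumes comp: "compact S" and proj: "fst ` S = {a..b}" and ab: "a \<le> b"
begin

lemma hull_fst: "(z, \<beta>) \<in> convex hull S \<Longrightarrow> a \<le> z \<and> z \<le> b"
proof -
  have "convex ({a..b} \<times> (UNIV :: real set))" by (intro convex_Times) auto
  moreover have "S \<subseteq> {a..b} \<times> UNIV" using proj by force
  ultimately have "convex hull S \<subseteq> {a..b} \<times> UNIV" by (rule hull_minimal[rotated])
  then show "(z, \<beta>) \<in> convex hull S \<Longrightarrow> a \<le> z \<and> z \<le> b" by auto
qed

lemma lower_convex_hull_outside: "z \<notin> {a..b} \<Longrightarrow> lower_convex_hull S z = Inf {}"
  unfolding lower_convex_hull_def using hull_fst by (intro arg_cong[where f = Inf]) auto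

lemma lower_convex_hull_attained:
  assumes z: "z \<in> {a..b}"
  shows "(z, lower_convex_hull S z) \<in> convex hull S"
    and "(z, \<beta>) \<in> convex hull S \<Longrightarrow> lower_convex_hull S z \<le> \<beta>"
proof -
  let ?Y = "{\<beta>. (z, \<beta>) \<in> convex hull S}"
  have K: "compact (convex hull S)" by (rule compact_convex_hull[OF comp])
  have "?Y = snd ` (convex hull S \<inter> ({z} \<times> UNIV))" by force
  moreover have "compact (convex hull S \<inter> ({z} \<times> UNIV))"
    by (rule compact_Int_closed[OF K]) (auto intro: closed_Times)
  ultimately have Y: "compact ?Y" by (auto intro!: compact_continuous_image continuous_intros)
  obtain p where "p \<in> S" "fst p = z" using z proj by (metis imageE)
  then have ne: "?Y \<noteq> {}" using hull_inc[of p S] by (cases p) auto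
  have bd: "bdd_below ?Y" by (rule bounded_imp_bdd_below[OF compact_imp_bounded[OF Y]])
  have "Inf ?Y \<in> ?Y" by (rule closed_contains_Inf[OF ne bd compact_imp_closed[OF Y]])
  then show "(z, lower_convex_hull S z) \<in> convex hull S" unfolding lower_convex_hull_def by simp
  show "lower_convex_hull S z \<le> \<beta>" if "(z, \<beta>) \<in> convex hull S"
    unfolding lower_convex_hull_def by (rule cInf_lower[OF _ bd]) (use that in simp)
qed

lemma lower_convex_hull_convex: "convex_on {a..b} (lower_convex_hull S)"
proof (rule convex_onI)
  fix t x y :: real assume t: "0 < t" "t < 1" and x: "x \<in> {a..b}" and y: "y \<in> {a..b}"
  have "(1 - t) *\<^sub>R (x, lower_convex_hull S x) + t *\<^sub>R (y, lower_convex_hull S y) \<in> convex hull S"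
    by (rule convexD_alt[OF convex_convex_hull]) (use t x y lower_convex_hull_attained(1) in auto)
  moreover have "(1 - t) *\<^sub>R x + t *\<^sub>R y \<in> {a..b}"
    by (rule convexD_alt) (use t x y in auto)
  ultimately show "lower_convex_hull S ((1 - t) *\<^sub>R x + t *\<^sub>R y)
      \<le> (1 - t) * lower_convex_hull S x + t * lower_convex_hull S y"
    using lower_convex_hull_attained(2) by auto
qed auto

text \<open>The hull at \<open>z\<close> lies above \<open>c\<close> if and only if some line passes strictly above \<open>(z, c)\<close> and below
  the set: separate the compact hull from the vertical ray below \<open>(z, c)\<close>. Since the set is bounded, the slope
  \<open>\<alpha>\<close> and the margin \<open>\<eta>\<close> can be taken rational, which makes the hull of a random curve measurable.\<close>

lemma less_lower_convex_hull_iff: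
  assumes z: "z \<in> {a..b}"
  shows "c < lower_convex_hull S z \<longleftrightarrow>
    (\<exists>\<alpha>\<in>\<rat>. \<exists>\<eta>\<in>\<rat>. \<eta> > 0 \<and> (\<forall>p\<in>S. c + \<eta> \<le> \<alpha> * z + snd p - \<alpha> * fst p))"
proof
  assume "\<exists>\<alpha>\<in>\<rat>. \<exists>\<eta>\<in>\<rat>. \<eta> > 0 \<and> (\<forall>p\<in>S. c + \<eta> \<le> \<alpha> * z + snd p - \<alpha> * fst p)"
  then obtain \<alpha> \<eta> where \<eta>: "\<eta> > 0" and *: "\<And>p. p \<in> S \<Longrightarrow> c + \<eta> \<le> \<alpha> * z + snd p - \<alpha> * fst p" by blast
  define H :: "(real \<times> real) set" where "H = {p. (- \<alpha>, 1) \<bullet> p \<ge> c + \<eta> - \<alpha> * z}"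
  have "convex H" unfolding H_def by (rule convex_halfspace_ge)
  moreover have "S \<subseteq> H"
  proof
    fix p assume "p \<in> S" from *[OF this] show "p \<in> H" unfolding H_def by (cases p) (simp add: algebra_simps)
  qed
  ultimately have "convex hull S \<subseteq> H" by (rule hull_minimal[rotated])
  with lower_convex_hull_attained(1)[OF z] have "(z, lower_convex_hull S z) \<in> H" by blast
  then show "c < lower_convex_hull S z" using \<eta> unfolding H_def by simp
next
  assume c: "c < lower_convex_hull S z"
  let ?K = "convex hull S" and ?R = "{z} \<times> {..c}"
  have "?K \<inter> ?R = {}"
    using lower_convex_hull_attained(2)[OF z] c by fastforce
  then have "\<exists>v d. (\<forall>p\<in>?K. v \<bullet> p < d) \<and> (\<forall>p\<in>?R. v \<bullet> p > d)"
    by (intro separating_hyperplane_compact_closed)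
       (use lower_convex_hull_attained(1)[OF z] in \<open>auto intro!: convex_Times closed_Times compact_convex_hull[OF comp]\<close>)
  then obtain v d where v: "\<And>p. p \<in> ?K \<Longrightarrow> v \<bullet> p < d" "\<And>p. p \<in> ?R \<Longrightarrow> v \<bullet> p > d" by blast
  obtain v1 v2 where vv: "v = (v1, v2)" by (cases v)
  have "v1 * z + v2 * lower_convex_hull S z < v1 * z + v2 * c"
    using v(1)[OF lower_convex_hull_attained(1)[OF z]] v(2)[of "(z, c)"] unfolding vv by simp
  then have "v2 * (lower_convex_hull S z - c) < 0" by (simp add: algebra_simps)
  then have v2: "v2 < 0" using c by (simp add: mult_less_0_iff)
  define \<alpha> d' where "\<alpha> = v1 / (- v2)" and "d' = d / (- v2)"
  have S1: "\<alpha> * fst p - snd p < d'" if "p \<in> S" for p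
  proof -
    have "v1 * fst p + v2 * snd p < d" using v(1)[OF hull_inc[OF that]] unfolding vv by (cases p) simp
    then have "(v1 * fst p + v2 * snd p) / (- v2) < d / (- v2)" using v2 by (intro divide_strict_right_mono) auto
    moreover have "(v1 * fst p + v2 * snd p) / (- v2) = \<alpha> * fst p - snd p" using v2 by (simp add: \<alpha>_def field_simps)
    ultimately show ?thesis by (simp add: d'_def)
  qed
  have z1: "d' < \<alpha> * z - c"
  proof -
    have "d < v1 * z + v2 * c" using v(2)[of "(z, c)"] unfolding vv by simp
    then have "d / (- v2) < (v1 * z + v2 * c) / (- v2)" using v2 by (intro divide_strict_right_mono) auto
    moreover have "(v1 * z + v2 * c) / (- v2) = \<alpha> * z - c" using v2 by (simp add: \<alpha>_def field_simps)
    ultimately show ?thesis by (simp add: d'_def)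
  qed
  obtain \<eta> where \<eta>: "\<eta> \<in> \<rat>" "0 < \<eta>" "\<eta> < (\<alpha> * z - c - d') / 2"
    using Rats_dense_in_real[of 0 "(\<alpha> * z - c - d') / 2"] z1 by auto
  obtain \<alpha>' where \<alpha>': "\<alpha>' \<in> \<rat>" "\<alpha> < \<alpha>'" "\<alpha>' < \<alpha> + \<eta> / (b - a + 1)"
    using Rats_dense_in_real[of \<alpha> "\<alpha> + \<eta> / (b - a + 1)"] \<eta> ab by auto
  have "c + \<eta> \<le> \<alpha>' * z + snd p - \<alpha>' * fst p" if p: "p \<in> S" for p
  proof -
    have f: "fst p \<in> {a..b}" using p proj by blast
    have "\<bar>(\<alpha>' - \<alpha>) * (z - fst p)\<bar> \<le> (\<eta> / (b - a + 1)) * (b - a + 1)"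
      unfolding abs_mult using \<alpha>' f z ab \<eta> by (intro mult_mono) auto
    also have "\<dots> = \<eta>" using ab by simp
    finally have "- \<eta> \<le> (\<alpha>' - \<alpha>) * (z - fst p)" by linarith
    moreover have "c + 2 * \<eta> \<le> \<alpha> * z + snd p - \<alpha> * fst p" using S1[OF p] \<eta>(3) by (simp add: field_simps)
    ultimately have "c + \<eta> \<le> (\<alpha> * z + snd p - \<alpha> * fst p) + (\<alpha>' - \<alpha>) * (z - fst p)" by linarith
    also have "\<dots> = \<alpha>' * z + snd p - \<alpha>' * fst p" by (simp add: algebra_simps)
    finally show ?thesis .
  qed
  then show "\<exists>\<alpha>\<in>\<rat>. \<exists>\<eta>\<in>\<rat>. \<eta> > 0 \<and> (\<forall>p\<in>S. c + \<eta> \<le> \<alpha> * z + snd p - \<alpha> * fst p)"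
    using \<alpha>'(1) \<eta>(1,2) by blast
qed

text \<open>Steps to the right of \<open>z\<close> that stay in \<open>[a, b]\<close>. At \<open>z = b\<close> there are none; steps \<open>1 / (m + 1)\<close> are used
  there, so that \<open>right_slope_lower_convex_hull\<close> holds at this point as well, with the meaningless
  values that the hull has outside of \<open>[a, b]\<close>.\<close>

definition hstep :: "real \<Rightarrow> nat \<Rightarrow> real" where
  "hstep z m = (if z < b then b - z else 1) / (real m + 1)"

lemma hull_slope_mono:
  assumes "a \<le> z" "z < u" "u \<le> v" "v \<le> b"
  shows "(lower_convex_hull S u - lower_convex_hull S z) / (u - z) \<le> (lower_convex_hull S v - lower_convex_hull S z) / (v - z)"
proof (cases "u = v")
  case False
  then show ?thesis
    using convex_on_slope_le(1)[OF lower_convex_hull_convex, of z v u] assms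
    by (smt (verit) atLeastAtMost_iff minus_diff_eq minus_divide_divide)
qed simp

text \<open>The difference quotients of a convex function are monotone, so they converge as soon as they
  converge along one sequence. Both sides are then the same (possibly unspecified) limit.\<close>

lemma right_slope_lower_convex_hull:
  assumes z: "z \<in> {a..b}"
  shows "right_slope (lower_convex_hull S) z
    = lim (\<lambda>m. (lower_convex_hull S (z + hstep z m) - lower_convex_hull S z) / hstep z m)"
proof -
  let ?L = "lower_convex_hull S"
  let ?Q = "\<lambda>y. (?L y - ?L z) / (y - z)"
  have st: "hstep z m > 0" for m using z by (auto simp: hstep_def)
  have st0: "hstep z \<longlonglongrightarrow> 0"
  proof -
    have "(\<lambda>m. (if z < b then b - z else 1) * (1 / (real m + 1))) \<longlonglongrightarrow> (if z < b then b - z else 1) * 0"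
      by (intro tendsto_mult tendsto_const tendsto_one_over_Suc)
    then show ?thesis by (simp add: hstep_def[abs_def])
  qed
  have seq: "filterlim (\<lambda>m. z + hstep z m) (at_right z) sequentially"
    unfolding filterlim_at
  proof (intro conjI always_eventually allI)
    show "(\<lambda>m. z + hstep z m) \<longlonglongrightarrow> z" using tendsto_add[OF tendsto_const[of z] st0] by simp
    show "z + hstep z m \<in> {z<..}" "z + hstep z m \<noteq> z" for m using st[of m] by auto
  qed
  have "(?Q \<longlongrightarrow> l) (at_right z) \<longleftrightarrow> (\<lambda>m. (?L (z + hstep z m) - ?L z) / hstep z m) \<longlonglongrightarrow> l" for l
  proof
    assume "(?Q \<longlongrightarrow> l) (at_right z)"
    from filterlim_compose[OF this seq]
    show "(\<lambda>m. (?L (z + hstep z m) - ?L z) / hstep z m) \<longlonglongrightarrow> l" by simp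
  next
    assume lim: "(\<lambda>m. (?L (z + hstep z m) - ?L z) / hstep z m) \<longlonglongrightarrow> l"
    show "(?Q \<longlongrightarrow> l) (at_right z)"
    proof (cases "z < b")
      case True
      have le: "z + hstep z m \<le> b" for m
      proof -
        have "hstep z m \<le> b - z" using True by (simp add: hstep_def divide_le_eq mult_le_cancel_left1)
        then show ?thesis by simp
      qed
      have Ql: "l \<le> ?Q y" if "z < y" "y \<le> b" for y
      proof (rule tendsto_upperbound[OF lim])
        have "\<forall>\<^sub>F m in sequentially. hstep z m < y - z"
          using st0 that by (intro order_tendstoD(2)) auto
        then show "\<forall>\<^sub>F m in sequentially. (?L (z + hstep z m) - ?L z) / hstep z m \<le> ?Q y"
        proof eventually_elim
          case (elim m)
          then show ?case using hull_slope_mono[of z "z + hstep z m" y] st[of m] that z by auto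
        qed
      qed simp
      show ?thesis
      proof (rule tendstoI)
        fix e :: real assume e: "e > 0"
        have "\<forall>\<^sub>F m in sequentially. (?L (z + hstep z m) - ?L z) / hstep z m < l + e"
          using lim e by (intro order_tendstoD(2)) auto
        then obtain m where m: "(?L (z + hstep z m) - ?L z) / hstep z m < l + e"
          unfolding eventually_sequentially by blast
        have "dist (?Q y) l < e" if "z < y" "y < z + hstep z m" for y
          using hull_slope_mono[of z y "z + hstep z m"] Ql[of y] that z le[of m] m
          by (auto simp: dist_real_def abs_less_iff)
        then show "\<forall>\<^sub>F y in at_right z. dist (?Q y) l < e"
          using st[of m] unfolding eventually_at_right_field by (intro exI[of _ "z + hstep z m"]) auto
      qed
    next
      case False
      then have zb: "z = b" using z by auto
      \<comment> \<open>Beyond \<open>b\<close> the hull has the constant value \<open>Inf {}\<close>; the quotients converge only if this is its value at \<open>b\<close>.\<close>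
      define d where "d = Inf {} - ?L z"
      have Q: "?L y - ?L z = d" if "y > z" for y
        using lower_convex_hull_outside[of y] that zb by (simp add: d_def)
      have "(\<lambda>m. d * (real m + 1)) \<longlonglongrightarrow> l"
        using lim Q[OF less_add_same_cancel1[THEN iffD2, OF st]] zb by (simp add: hstep_def)
      then have "(\<lambda>m. d * (real m + 1) * (1 / (real m + 1))) \<longlonglongrightarrow> l * 0"
        by (rule tendsto_mult) (rule tendsto_one_over_Suc)
      then have "(\<lambda>m::nat. d) \<longlonglongrightarrow> 0" by simp
      then have d: "d = 0" by (simp add: LIMSEQ_const_iff)
      with \<open>(\<lambda>m. d * (real m + 1)) \<longlonglongrightarrow> l\<close> have l: "l = 0" by (simp add: LIMSEQ_const_iff)
      have "\<forall>\<^sub>F y in at_right z. 0 = ?Q y"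
        unfolding eventually_at_right_field using Q d by (intro exI[of _ "z + 1"]) auto
      then show ?thesis unfolding l by (rule Lim_transform_eventually[OF tendsto_const])
    qed
  qed
  then show ?thesis unfolding right_slope_def t2_space_class.Lim_def by simp
qed

lemma right_slope_lower_convex_hull_bounds:
  assumes z: "a < z" "z < b"
  shows "z < v \<Longrightarrow> v \<le> b \<Longrightarrow> right_slope (lower_convex_hull S) z \<le> (lower_convex_hull S v - lower_convex_hull S z) / (v - z)"
    and "a \<le> w \<Longrightarrow> w < z \<Longrightarrow> (lower_convex_hull S z - lower_convex_hull S w) / (z - w) \<le> right_slope (lower_convex_hull S) z"
proof -
  let ?L = "lower_convex_hull S"
  let ?q = "\<lambda>m. (?L (z + hstep z m) - ?L z) / hstep z m"
  have zz: "z \<in> {a..b}" using z by auto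
  have st: "hstep z m > 0" "z + hstep z m \<le> b" "hstep z (Suc m) \<le> hstep z m" for m
  proof -
    have "hstep z m \<le> b - z" using z by (simp add: hstep_def divide_le_eq mult_le_cancel_left1)
    then show "z + hstep z m \<le> b" by simp
    show "hstep z m > 0" using z by (simp add: hstep_def)
    show "hstep z (Suc m) \<le> hstep z m" using z unfolding hstep_def by (auto intro!: divide_left_mono)
  qed
  have lower: "(?L z - ?L w) / (z - w) \<le> ?q m" if "a \<le> w" "w < z" for w m
  proof -
    have "(?L w - ?L z) / (w - z) \<le> (?L w - ?L (z + hstep z m)) / (w - (z + hstep z m))"
         "(?L w - ?L (z + hstep z m)) / (w - (z + hstep z m)) \<le> (?L z - ?L (z + hstep z m)) / (z - (z + hstep z m))"
      using convex_on_slope_le[OF lower_convex_hull_convex, of w "z + hstep z m" z] that z st[of m] by auto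
    then have "(?L w - ?L z) / (w - z) \<le> (?L z - ?L (z + hstep z m)) / (z - (z + hstep z m))" by linarith
    moreover have "(?L w - ?L z) / (w - z) = (?L z - ?L w) / (z - w)"
      by (metis minus_diff_eq minus_divide_divide)
    moreover have "(?L z - ?L (z + hstep z m)) / (z - (z + hstep z m)) = ?q m"
      by (metis add_diff_cancel_left' minus_diff_eq minus_divide_divide)
    ultimately show ?thesis by simp
  qed
  have "decseq ?q"
  proof (rule decseq_SucI)
    fix m show "?q (Suc m) \<le> ?q m"
      using hull_slope_mono[of z "z + hstep z (Suc m)" "z + hstep z m"] st[of m] st[of "Suc m"] zz by auto
  qed
  moreover have "bdd_below (range ?q)"
    using lower[of a] z by (intro bdd_belowI[of _ "(?L z - ?L a) / (z - a)"]) auto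
  ultimately have conv: "?q \<longlonglongrightarrow> (INF m. ?q m)" by (intro LIMSEQ_decseq_INF)
  then have q: "?q \<longlonglongrightarrow> right_slope ?L z"
    unfolding right_slope_lower_convex_hull[OF zz] using convergentI convergent_LIMSEQ_iff by blast
  show "(?L z - ?L w) / (z - w) \<le> right_slope ?L z" if "a \<le> w" "w < z"
    by (rule tendsto_lowerbound[OF q]) (use lower[OF that] in auto)
  have st0: "hstep z \<longlonglongrightarrow> 0"
  proof -
    have "(\<lambda>m. (b - z) * (1 / (real m + 1))) \<longlonglongrightarrow> (b - z) * 0"
      by (intro tendsto_mult tendsto_const) (rule tendsto_one_over_Suc)
    then show ?thesis using z by (simp add: hstep_def[abs_def])
  qed
  show "right_slope ?L z \<le> (?L v - ?L z) / (v - z)" if v: "z < v" "v \<le> b"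
  proof (rule tendsto_upperbound[OF q])
    have "\<forall>\<^sub>F m in sequentially. hstep z m < v - z"
      using st0 v by (intro order_tendstoD(2)) auto
    then show "\<forall>\<^sub>F m in sequentially. ?q m \<le> (?L v - ?L z) / (v - z)"
    proof eventually_elim
      case (elim m)
      then show ?case using hull_slope_mono[of z "z + hstep z m" v] st(1)[of m] v z by auto
    qed
  qed simp
qed

lemma right_slope_lower_convex_hull_mono:
  assumes "a < z" "z \<le> u" "u < b"
  shows "right_slope (lower_convex_hull S) z \<le> right_slope (lower_convex_hull S) u"
proof (cases "z = u")
  case False
  then show ?thesis
    using right_slope_lower_convex_hull_bounds(1)[of z u] right_slope_lower_convex_hull_bounds(2)[of u z] assms by auto
qed simp

end

section \<open>Derivatives along a sequence\<close>

text \<open>For \<open>1 / (N + 1) < y - t \<le> 1 / N\<close> monotonicity encloses \<open>F y\<close> between the values at \<open>t + 1 / (N + 1)\<close> and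
  \<open>t + 1 / N\<close>, and replacing \<open>y - t\<close> by \<open>1 / N\<close> or \<open>1 / (N + 1)\<close> changes the quotient by a factor that tends to one. The
  value \<open>F t\<close> itself may be smaller or larger than its neighbours, which is why the enclosing sequences are a
  maximum and a minimum.\<close>

lemma right_derivative_sequence:
  fixes F :: "real \<Rightarrow> real"
  assumes \<delta>: "\<delta> > 0" and mono: "\<And>u v. t < u \<Longrightarrow> u \<le> v \<Longrightarrow> v < t + \<delta> \<Longrightarrow> F u \<le> F v"
    and lim: "(\<lambda>m. (F (t + 1 / real (Suc m)) - F t) * real (Suc m)) \<longlonglongrightarrow> D"
  shows "((\<lambda>y. (F y - F t) / (y - t)) \<longlongrightarrow> D) (at_right t)"
proof -
  define A where "A N = (F (t + 1 / real N) - F t) * real N" for N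
  have A: "A \<longlonglongrightarrow> D" using lim unfolding A_def by (rule LIMSEQ_imp_Suc)
  define up where "up N = max (A N) (A N * (real (Suc N) / real N))" for N
  define lo where "lo N = min (A (Suc N)) (A (Suc N) * (real N / real (Suc N)))" for N
  have r1: "(\<lambda>N. real (Suc N) / real N) \<longlonglongrightarrow> 1" and r2: "(\<lambda>N. real N / real (Suc N)) \<longlonglongrightarrow> 1"
    by real_asymp+
  have up: "up \<longlonglongrightarrow> D" unfolding up_def using tendsto_max[OF A tendsto_mult[OF A r1]] by simp
  have lo: "lo \<longlonglongrightarrow> D" unfolding lo_def
    using tendsto_min[OF LIMSEQ_Suc[OF A] tendsto_mult[OF LIMSEQ_Suc[OF A] r2]] by simp
  define N where "N y = nat \<lfloor>inverse (y - t)\<rfloor>" for y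
  have Nlim: "filterlim N sequentially (at_right t)"
  proof -
    have 1: "filterlim (\<lambda>y. y - t) (at_right 0) (at_right t)"
      unfolding filterlim_at by (auto intro!: tendsto_eq_intros simp: eventually_at_right_field intro: exI[of _ "t + 1"])
    show ?thesis unfolding N_def
      by (rule filterlim_compose[OF filterlim_nat_sequentially filterlim_compose[OF filterlim_floor_sequentially
          filterlim_compose[OF filterlim_inverse_at_top_right 1]]])
  qed
  define \<eta> where "\<eta> = min 1 \<delta>"
  have key: "lo (N y) \<le> (F y - F t) / (y - t) \<and> (F y - F t) / (y - t) \<le> up (N y)"
    if y: "t < y" "y < t + \<eta>" and Nd: "1 / real (N y) < \<delta>" for y
  proof -
    let ?x = "y - t" and ?N = "N y"
    have x: "0 < ?x" "?x < 1" using y by (auto simp: \<eta>_def)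
    have i1: "1 < inverse ?x" using x by (simp add: one_less_inverse)
    have N1: "real ?N \<le> inverse ?x" "inverse ?x < real (Suc ?N)"
    proof -
      have "0 \<le> \<lfloor>inverse ?x\<rfloor>" using i1 by linarith
      then have rN: "real ?N = of_int \<lfloor>inverse ?x\<rfloor>" unfolding N_def by simp
      show "real ?N \<le> inverse ?x" "inverse ?x < real (Suc ?N)" using rN by linarith+
    qed
    have N0: "?N \<ge> 1" using i1 unfolding N_def by linarith
    have x1: "?x \<le> 1 / real ?N" using N1(1) N0 x by (simp add: field_simps)
    have x2: "1 / real (Suc ?N) < ?x" using N1(2) x by (simp add: field_simps)
    have Fu: "F y \<le> F (t + 1 / real ?N)" by (rule mono) (use x1 x Nd in auto)
    have Fl: "F (t + 1 / real (Suc ?N)) \<le> F y" by (rule mono) (use x2 y in \<open>auto simp: \<eta>_def\<close>)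
    have e1: "F (t + 1 / real ?N) - F t = A ?N / real ?N" using N0 by (simp add: A_def)
    have e2: "F (t + 1 / real (Suc ?N)) - F t = A (Suc ?N) / real (Suc ?N)" by (simp add: A_def)
    have "(F y - F t) / ?x \<le> A ?N / real ?N * inverse ?x"
      using Fu e1 x by (simp add: divide_inverse mult_right_mono)
    also have "\<dots> \<le> up ?N"
    proof (cases "A ?N \<ge> 0")
      case True
      have "A ?N / real ?N * inverse ?x \<le> A ?N / real ?N * real (Suc ?N)"
        using True N1 by (intro mult_left_mono) auto
      then show ?thesis unfolding up_def by simp
    next
      case False
      have "A ?N / real ?N * inverse ?x \<le> A ?N / real ?N * real ?N"
        using False N1 N0 by (intro mult_left_mono_neg) (auto simp: divide_nonpos_nonneg)
      then show ?thesis using N0 unfolding up_def by simp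
    qed
    finally have 1: "(F y - F t) / ?x \<le> up ?N" .
    have "lo ?N \<le> A (Suc ?N) / real (Suc ?N) * inverse ?x"
    proof (cases "A (Suc ?N) \<ge> 0")
      case True
      have "A (Suc ?N) / real (Suc ?N) * real ?N \<le> A (Suc ?N) / real (Suc ?N) * inverse ?x"
        using True N1 by (intro mult_left_mono) auto
      then show ?thesis unfolding lo_def by simp
    next
      case False
      have "A (Suc ?N) / real (Suc ?N) * real (Suc ?N) \<le> A (Suc ?N) / real (Suc ?N) * inverse ?x"
        using False N1 by (intro mult_left_mono_neg) (auto simp: divide_nonpos_nonneg)
      then show ?thesis unfolding lo_def by simp
    qed
    also have "\<dots> \<le> (F y - F t) / ?x"
      using Fl e2 x by (simp add: divide_inverse mult_right_mono)
    finally show ?thesis using 1 by blast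
  qed
  have "\<forall>\<^sub>F n in sequentially. 1 / real n < \<delta>"
    using lim_1_over_n \<delta> by (rule order_tendstoD(2))
  then have "\<forall>\<^sub>F y in at_right t. 1 / real (N y) < \<delta>"
    using Nlim unfolding filterlim_iff by blast
  moreover have "\<forall>\<^sub>F y in at_right t. t < y \<and> y < t + \<eta>"
    using \<delta> unfolding eventually_at_right_field by (intro exI[of _ "t + \<eta>"]) (auto simp: \<eta>_def)
  ultimately have ev: "\<forall>\<^sub>F y in at_right t. lo (N y) \<le> (F y - F t) / (y - t) \<and> (F y - F t) / (y - t) \<le> up (N y)"
    by eventually_elim (use key in blast)
  show ?thesis
    by (rule tendsto_sandwich[OF _ _ filterlim_compose[OF lo Nlim] filterlim_compose[OF up Nlim]])
       (use ev in \<open>auto elim: eventually_mono\<close>)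
qed

lemma DERIV_sequence_iff:
  fixes F :: "real \<Rightarrow> real"
  assumes \<delta>: "\<delta> > 0" and mono_r: "\<And>u v. t < u \<Longrightarrow> u \<le> v \<Longrightarrow> v < t + \<delta> \<Longrightarrow> F u \<le> F v"
    and mono_l: "\<And>u v. t - \<delta> < u \<Longrightarrow> u \<le> v \<Longrightarrow> v < t \<Longrightarrow> F u \<le> F v"
  shows "DERIV F t :> D \<longleftrightarrow>
    (\<lambda>m. (F (t + 1 / real (Suc m)) - F t) * real (Suc m)) \<longlonglongrightarrow> D \<and>
    (\<lambda>m. (F t - F (t - 1 / real (Suc m))) * real (Suc m)) \<longlonglongrightarrow> D"
proof
  have s0: "(\<lambda>m. 1 / real (Suc m)) \<longlonglongrightarrow> 0" by real_asymp
  assume "DERIV F t :> D"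
  then have l: "((\<lambda>y. (F y - F t) / (y - t)) \<longlongrightarrow> D) (at t)" unfolding has_field_derivative_iff .
  have "filterlim (\<lambda>m. t + 1 / real (Suc m)) (at t) sequentially"
    unfolding filterlim_at using tendsto_add[OF tendsto_const[of t] s0] by (auto intro!: always_eventually)
  from filterlim_compose[OF l this]
  have 1: "(\<lambda>m. (F (t + 1 / real (Suc m)) - F t) * real (Suc m)) \<longlonglongrightarrow> D" by (simp add: field_simps)
  have "filterlim (\<lambda>m. t - 1 / real (Suc m)) (at t) sequentially"
    unfolding filterlim_at using tendsto_diff[OF tendsto_const[of t] s0] by (auto intro!: always_eventually)
  from filterlim_compose[OF l this]
  have "(\<lambda>m. (F (t - 1 / real (Suc m)) - F t) / (t - 1 / real (Suc m) - t)) \<longlonglongrightarrow> D" .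
  also have "(\<lambda>m. (F (t - 1 / real (Suc m)) - F t) / (t - 1 / real (Suc m) - t))
     = (\<lambda>m. (F t - F (t - 1 / real (Suc m))) * real (Suc m))"
    by (simp add: fun_eq_iff divide_simps algebra_simps)
  finally show "(\<lambda>m. (F (t + 1 / real (Suc m)) - F t) * real (Suc m)) \<longlonglongrightarrow> D \<and>
    (\<lambda>m. (F t - F (t - 1 / real (Suc m))) * real (Suc m)) \<longlonglongrightarrow> D" using 1 by blast
next
  assume *: "(\<lambda>m. (F (t + 1 / real (Suc m)) - F t) * real (Suc m)) \<longlonglongrightarrow> D \<and>
    (\<lambda>m. (F t - F (t - 1 / real (Suc m))) * real (Suc m)) \<longlonglongrightarrow> D"
  have r: "((\<lambda>y. (F y - F t) / (y - t)) \<longlongrightarrow> D) (at_right t)"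
    by (rule right_derivative_sequence[OF \<delta> mono_r]) (use * in auto)
  have "((\<lambda>y. (- F (- y) - - F (- (- t))) / (y - - t)) \<longlongrightarrow> D) (at_right (- t))"
  proof (rule right_derivative_sequence[OF \<delta>])
    show "- F (- u) \<le> - F (- v)" if "- t < u" "u \<le> v" "v < - t + \<delta>" for u v
      using mono_l[of "- v" "- u"] that by auto
    show "(\<lambda>m. (- F (- (- t + 1 / real (Suc m))) - - F (- (- t))) * real (Suc m)) \<longlonglongrightarrow> D"
      using * by (simp add: algebra_simps)
  qed
  moreover have "(- F (- y) - - F (- (- t))) / (y - - t) = (F (- y) - F t) / (- y - t)" for y
    using minus_divide_divide[of "F (- y) - F t" "- y - t"] by (simp add: add.commute)
  ultimately have l: "((\<lambda>y. (F y - F t) / (y - t)) \<longlongrightarrow> D) (at_left t)"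
    unfolding filterlim_at_left_to_right by simp
  show "DERIV F t :> D" unfolding has_field_derivative_iff using l r by (rule filterlim_split_at)
qed

section \<open>Measurability of the density estimator\<close>

context kernel_fun
begin

text \<open>The estimates vanish from this point on. To take the curve up to this point instead of up to \<open>tau\<close> avoids
  a supremum that is unspecified for some samples.\<close>

definition obs_bound :: "real \<Rightarrow> nat \<Rightarrow> (nat \<Rightarrow> real) \<Rightarrow> real" where
  "obs_bound h n ts = h + (\<Sum>j<n. \<bar>ts j\<bar>)"

lemma ghat_sub_beyond:
  assumes h: "h > 0" and s: "s \<ge> obs_bound h n ts"
  shows "ghat_sub k h n ts ds i s = 0"
proof -
  have "h \<le> obs_bound h n ts" unfolding obs_bound_def by (simp add: sum_nonneg)
  then have sh: "s \<ge> h" using s by simp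
  have "k ((s - ts j) / h) = 0" if "j < n" for j
  proof (rule k_zero)
    have "\<bar>ts j\<bar> \<le> (\<Sum>j<n. \<bar>ts j\<bar>)" by (rule member_le_sum) (use that in auto)
    then have "h \<le> s - ts j" using s unfolding obs_bound_def by linarith
    then have "1 \<le> (s - ts j) / h" using h by (simp add: le_divide_eq)
    then show "1 \<le> \<bar>(s - ts j) / h\<bar>" by linarith
  qed
  then show ?thesis unfolding ghat_sub_interior[OF h sh] by simp
qed

lemma Ghat_sub_const:
  assumes "\<And>s. s > r \<Longrightarrow> ghat_sub k h n ts ds i s = 0" "r \<le> u"
  shows "Ghat_sub k h n ts ds i u = Ghat_sub k h n ts ds i r"
  unfolding Ghat_sub_def set_lebesgue_integral_def
proof (rule Bochner_Integration.integral_cong[OF refl])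
  fix s show "indicator {0..u} s *\<^sub>R ghat_sub k h n ts ds i s = indicator {0..r} s *\<^sub>R ghat_sub k h n ts ds i s"
    using assms(1)[of s] assms(2) by (cases "s > r") (auto simp: indicator_def)
qed

lemma Ghat_sub_mono:
  assumes h: "h > 0" and u: "h < u" "u \<le> v"
  shows "Ghat_sub k h n ts ds i u \<le> Ghat_sub k h n ts ds i v"
proof (rule DERIV_nonneg_imp_nondecreasing[OF u(2)])
  fix s assume s: "u \<le> s" "s \<le> v"
  show "\<exists>z. DERIV (Ghat_sub k h n ts ds i) s :> z \<and> 0 \<le> z"
    using DERIV_Ghat_sub[OF h, of s n ts ds i] ghat_sub_nonneg[OF h, of s n ts ds i] s u by auto
qed

definition curve :: "real \<Rightarrow> nat \<Rightarrow> (nat \<Rightarrow> real) \<Rightarrow> (nat \<Rightarrow> nat) \<Rightarrow> (real \<times> real) set" where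
  "curve h n ts ds = (\<lambda>s. (Ghat k h n ts ds s, Ghat_sub k h n ts ds 1 s)) ` {0..obs_bound h n ts}"

lemma obs_bound_ge: "h \<le> obs_bound h n ts"
  unfolding obs_bound_def by (simp add: sum_nonneg)

text \<open>The rightmost part of the kernel is positive near its end, so an observation at \<open>ts j > 0\<close> makes the estimates
  positive at some point beyond \<open>h\<close>; and there they are nonnegative, so they vanish beyond \<open>tau\<close>.\<close>

lemma tau_props:
  assumes h: "h > 0" and j: "j < n" "ts j > 0" "ds j = 0 \<or> ds j = 1"
  shows "h < tau k h n ts ds" "tau k h n ts ds \<le> obs_bound h n ts"
    and "s > tau k h n ts ds \<Longrightarrow> ghat_sub k h n ts ds 0 s = 0 \<and> ghat_sub k h n ts ds 1 s = 0"
proof -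
  let ?A = "{t. t \<ge> 0 \<and> ghat_sub k h n ts ds 0 t + ghat_sub k h n ts ds 1 t > 0}"
  define e where "e = min 1 (ts j / h)"
  have e: "0 < e" "e \<le> 1" "e * h \<le> ts j" using h j by (auto simp: e_def min_def field_simps)
  obtain a' b' c where u: "1 - e < a'" "a' < b'" "b' < 1" "c > 0" "\<And>u. a' \<le> u \<Longrightarrow> u \<le> b' \<Longrightarrow> c \<le> k u"
    by (rule k_positive_interval[of "1 - e" 1]) (use e in auto)
  have ka: "k a' > 0" using u(5)[OF order_refl less_imp_le[OF u(2)]] u(4) by linarith
  define s0 where "s0 = ts j + h * a'"
  have "h * (1 - e) < h * a'" using u h by simp
  then have s0: "s0 > h" using e unfolding s0_def by (simp add: algebra_simps)
  have pos: "0 < ghat_sub k h n ts ds (ds j) s0"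
  proof -
    have "0 < (\<Sum>l<n. of_bool (0 \<le> ts l \<and> ds l = ds j) * (k ((s0 - ts l) / h) / h))"
      by (rule sum_pos2[of _ j]) (use j h ka in \<open>auto simp: s0_def\<close>)
    then show ?thesis using j s0 h by (subst ghat_sub_interior) auto
  qed
  have s0A: "s0 \<in> ?A"
    using j(3) pos s0 h ghat_sub_nonneg[OF h, of s0 n ts ds 0] ghat_sub_nonneg[OF h, of s0 n ts ds 1] by auto
  have up: "t \<le> obs_bound h n ts" if "t \<in> ?A" for t
    using that ghat_sub_beyond[OF h, of n ts t ds 0] ghat_sub_beyond[OF h, of n ts t ds 1] by (cases "t \<le> obs_bound h n ts") auto
  have bd: "bdd_above ?A" using up by (rule bdd_aboveI)
  show "h < tau k h n ts ds" using cSup_upper[OF s0A bd] s0 unfolding tau_def by linarith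
  show "tau k h n ts ds \<le> obs_bound h n ts" unfolding tau_def by (rule cSup_least) (use s0A up in auto)
  assume s: "s > tau k h n ts ds"
  have sh: "s \<ge> h" using s \<open>h < tau k h n ts ds\<close> by linarith
  have "s \<notin> ?A" using cSup_upper[of s ?A, OF _ bd] s unfolding tau_def by auto
  then have "ghat_sub k h n ts ds 0 s + ghat_sub k h n ts ds 1 s \<le> 0" using sh h by auto
  then show "ghat_sub k h n ts ds 0 s = 0 \<and> ghat_sub k h n ts ds 1 s = 0"
    using ghat_sub_nonneg[OF h sh, of n ts ds 0] ghat_sub_nonneg[OF h sh, of n ts ds 1] by auto
qed

text \<open>After \<open>tau\<close> the estimates vanish and the coordinates are constant, so extending the parameter
  interval adds no points to the curve. If no observation is positive, all estimates vanish, \<open>tau\<close> is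
  unspecified, and both sides are derivatives of constants.\<close>

lemma f_MS_eq_curve:
  assumes h: "h > 0" and t: "h < t" and ds: "\<And>j. ds j = 0 \<or> ds j = 1"
  shows "f_MS k h n ts ds t = deriv (\<lambda>u. right_slope (lower_convex_hull (curve h n ts ds)) (Ghat k h n ts ds u)) t"
proof (cases "\<exists>j<n. ts j > 0")
  case True
  then obtain j where j: "j < n" "ts j > 0" by blast
  note \<tau> = tau_props[where h = h and n = n and j = j and ts = ts and ds = ds, OF h j ds]
  let ?\<tau> = "tau k h n ts ds"
  have c: "Ghat_sub k h n ts ds i u = Ghat_sub k h n ts ds i ?\<tau>" if "i = 0 \<or> i = 1" "?\<tau> \<le> u" for i u
    by (rule Ghat_sub_const) (use \<tau>(3) that in auto)
  have "(\<lambda>s. (Ghat k h n ts ds s, Ghat_sub k h n ts ds 1 s)) ` {0..?\<tau>} = curve h n ts ds" (is "?f ` _ = _")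
  proof
    show "?f ` {0..?\<tau>} \<subseteq> curve h n ts ds" unfolding curve_def using \<tau>(2) by (intro image_mono) auto
    show "curve h n ts ds \<subseteq> ?f ` {0..?\<tau>}"
    proof
      fix p assume "p \<in> curve h n ts ds"
      then obtain s where s: "0 \<le> s" "p = ?f s" unfolding curve_def by auto
      show "p \<in> ?f ` {0..?\<tau>}"
      proof (cases "s \<le> ?\<tau>")
        case False
        then have "?f s = ?f ?\<tau>" using c[of 0 s] c[of 1 s] by (simp add: Ghat_eq[OF h])
        then show ?thesis using s \<tau>(1) h by auto
      qed (use s in auto)
    qed
  qed
  then have "F_MS k h n ts ds = (\<lambda>u. right_slope (lower_convex_hull (curve h n ts ds)) (Ghat k h n ts ds u))"
    unfolding F_MS_def fun_eq_iff by simp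
  then show ?thesis unfolding f_MS_def by simp
next
  case False
  have g0: "ghat_sub k h n ts ds i s = 0" if "s \<ge> 0" for i s
  proof -
    have "of_bool (0 \<le> ts j \<and> ds j = i) * wt h s (ts j) = 0" if "j < n" for j
    proof (cases "ts j = 0")
      case True
      then show ?thesis using wt_0[OF h \<open>s \<ge> 0\<close>] by simp
    next
      case neq: False
      have "\<not> 0 < ts j" using False that by blast
      then show ?thesis using neq by simp
    qed
    then show ?thesis unfolding ghat_sub_eq by simp
  qed
  have G0: "Ghat k h n ts ds u = Ghat k h n ts ds 0" if "u \<ge> 0" for u
  proof -
    have "Ghat_sub k h n ts ds i u = Ghat_sub k h n ts ds i 0" for i
      by (rule Ghat_sub_const[OF g0 that]) simp
    then show ?thesis unfolding Ghat_eq[OF h] by (simp only:)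
  qed
  have ev: "\<forall>\<^sub>F u in nhds t. Ghat k h n ts ds u = Ghat k h n ts ds 0"
  proof (rule eventually_mono)
    show "\<forall>\<^sub>F u in nhds t. u \<in> {0<..}" by (rule eventually_nhds_in_open) (use t h in auto)
  qed (rule G0, simp)
  have "\<forall>\<^sub>F u in nhds t. F_MS k h n ts ds u = F_MS k h n ts ds 0"
    by (rule eventually_mono[OF ev]) (simp only: F_MS_def)
  then have "f_MS k h n ts ds t = deriv (\<lambda>u. F_MS k h n ts ds 0) t"
    unfolding f_MS_def by (rule deriv_cong_ev) simp
  moreover have "deriv (\<lambda>u. right_slope (lower_convex_hull (curve h n ts ds)) (Ghat k h n ts ds u)) t
    = deriv (\<lambda>u. right_slope (lower_convex_hull (curve h n ts ds)) (Ghat k h n ts ds 0)) t"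
    by (rule deriv_cong_ev[OF eventually_mono[OF ev] refl]) (simp only:)
  ultimately show ?thesis by simp
qed

context
  fixes h :: real and n :: nat and ts :: "nat \<Rightarrow> real" and ds :: "nat \<Rightarrow> nat"
  assumes h: "h > 0"
begin

definition xmin where "xmin = Inf (Ghat k h n ts ds ` {0..obs_bound h n ts})"
definition xmax where "xmax = Sup (Ghat k h n ts ds ` {0..obs_bound h n ts})"

lemma cont_coords:
  "continuous_on {0..R} (Ghat k h n ts ds)" "continuous_on {0..R} (Ghat_sub k h n ts ds 1)"
  unfolding Ghat_eq[OF h, abs_def] by (intro continuous_intros continuous_on_Ghat_sub[OF h])+

lemma curve_props:
  "compact (curve h n ts ds)" "fst ` curve h n ts ds = {xmin..xmax}" "xmin \<le> xmax"
proof -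
  let ?I = "{0..obs_bound h n ts}"
  show "compact (curve h n ts ds)" unfolding curve_def
    by (intro compact_continuous_image continuous_intros cont_coords compact_Icc)
  have f: "fst ` curve h n ts ds = Ghat k h n ts ds ` ?I" unfolding curve_def by force
  have "connected (Ghat k h n ts ds ` ?I)" "compact (Ghat k h n ts ds ` ?I)"
    by (intro connected_continuous_image compact_continuous_image cont_coords connected_Icc compact_Icc)+
  then obtain a b where ab: "Ghat k h n ts ds ` ?I = {a..b}"
    using connected_compact_interval_1 by blast
  have "?I \<noteq> {}" using obs_bound_ge[of h n ts] h by auto
  then have le: "a \<le> b" using ab by (metis atLeastatMost_empty_iff image_is_empty)
  then have "xmin = a" "xmax = b" unfolding xmin_def xmax_def ab by auto
  then show "fst ` curve h n ts ds = {xmin..xmax}" "xmin \<le> xmax" using f ab le by auto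
qed

lemma coords_const:
  assumes "u \<ge> obs_bound h n ts"
  shows "Ghat k h n ts ds u = Ghat k h n ts ds (obs_bound h n ts)"
    "Ghat_sub k h n ts ds 1 u = Ghat_sub k h n ts ds 1 (obs_bound h n ts)"
proof -
  have "Ghat_sub k h n ts ds i u = Ghat_sub k h n ts ds i (obs_bound h n ts)" for i
    by (rule Ghat_sub_const[OF ghat_sub_beyond[OF h] assms]) simp
  then show "Ghat k h n ts ds u = Ghat k h n ts ds (obs_bound h n ts)"
    "Ghat_sub k h n ts ds 1 u = Ghat_sub k h n ts ds 1 (obs_bound h n ts)" by (simp_all add: Ghat_eq[OF h])
qed

lemma Ghat_range: "u \<ge> 0 \<Longrightarrow> Ghat k h n ts ds u \<in> {xmin..xmax}"
proof -
  assume u: "u \<ge> 0"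
  have o: "obs_bound h n ts \<ge> 0" using obs_bound_ge[of h n ts] h by linarith
  have "Ghat k h n ts ds u \<in> Ghat k h n ts ds ` {0..obs_bound h n ts}"
    using u o coords_const(1)[of u] by (cases "u \<le> obs_bound h n ts") auto
  also have "\<dots> = fst ` curve h n ts ds" unfolding curve_def by force
  finally show ?thesis unfolding curve_props(2) .
qed

text \<open>Suprema of continuous functions over the parameter interval are suprema over countably many
  parameters that do not depend on the sample.\<close>

lemma ex_curve_iff_Rats:
  "(\<exists>s\<in>{0..obs_bound h n ts}. c < \<alpha> * Ghat k h n ts ds s + \<beta> * Ghat_sub k h n ts ds 1 s) \<longleftrightarrow>
   (\<exists>s\<in>\<rat> \<inter> {0..}. c < \<alpha> * Ghat k h n ts ds s + \<beta> * Ghat_sub k h n ts ds 1 s)"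
    (is "(\<exists>s\<in>_. c < ?\<phi> s) \<longleftrightarrow> _")
proof
  let ?R = "obs_bound h n ts"
  have R: "?R \<ge> 0" using obs_bound_ge[of h n ts] h by linarith
  assume "\<exists>s\<in>{0..?R}. c < ?\<phi> s"
  then obtain s where s: "s \<in> {0..?R}" "c < ?\<phi> s" by blast
  have "continuous_on {0..?R + 1} ?\<phi>" by (intro continuous_intros cont_coords)
  then have "(?\<phi> \<longlongrightarrow> ?\<phi> s) (at s within {0..?R + 1})" using s unfolding continuous_on_def by auto
  then have "\<forall>\<^sub>F u in at s within {0..?R + 1}. c < ?\<phi> u" by (rule order_tendstoD(1)) (rule s(2))
  then obtain d where d: "d > 0" "\<And>u. u \<in> {0..?R + 1} \<Longrightarrow> u \<noteq> s \<Longrightarrow> dist u s < d \<Longrightarrow> c < ?\<phi> u"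
    unfolding eventually_at by blast
  obtain u where u: "u \<in> \<rat>" "s < u" "u < min (s + d) (s + 1)"
    using Rats_dense_in_real[of s "min (s + d) (s + 1)"] d(1) by auto
  have "c < ?\<phi> u" by (rule d(2)) (use u s in \<open>auto simp: dist_real_def\<close>)
  then show "\<exists>s\<in>\<rat> \<inter> {0..}. c < ?\<phi> s" using u s by (intro bexI[of _ u]) auto
next
  let ?R = "obs_bound h n ts"
  have R: "?R \<ge> 0" using obs_bound_ge[of h n ts] h by linarith
  assume "\<exists>s\<in>\<rat> \<inter> {0..}. c < ?\<phi> s"
  then obtain s where s: "s \<ge> 0" "c < ?\<phi> s" by auto
  show "\<exists>s\<in>{0..?R}. c < ?\<phi> s"
  proof (cases "s \<le> ?R")
    case False
    then show ?thesis using s R coords_const[of s] by (intro bexI[of _ ?R]) auto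
  qed (use s in auto)
qed

lemma less_xmax_iff: "c < xmax \<longleftrightarrow> (\<exists>s\<in>\<rat> \<inter> {0..}. c < Ghat k h n ts ds s)"
proof -
  have e: "Ghat k h n ts ds ` {0..obs_bound h n ts} = {xmin..xmax}"
    unfolding curve_props(2)[symmetric] curve_def by force
  have "c < xmax \<longleftrightarrow> (\<exists>x\<in>{xmin..xmax}. c < x)" using curve_props(3) by force
  also have "\<dots> \<longleftrightarrow> (\<exists>s\<in>{0..obs_bound h n ts}. c < Ghat k h n ts ds s)" unfolding e[symmetric] by auto
  also have "\<dots> \<longleftrightarrow> (\<exists>s\<in>\<rat> \<inter> {0..}. c < Ghat k h n ts ds s)" using ex_curve_iff_Rats[of c 1 0] by simp
  finally show ?thesis .
qed

lemma less_hull_iff: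
  assumes z: "xmin \<le> z"
  shows "c < lower_convex_hull (curve h n ts ds) z \<longleftrightarrow>
    (if z \<le> xmax then (\<exists>\<alpha>\<in>\<rat>. \<exists>\<eta>\<in>\<rat>. \<eta> > 0 \<and>
        (\<forall>s\<in>\<rat> \<inter> {0..}. \<alpha> * Ghat k h n ts ds s - Ghat_sub k h n ts ds 1 s \<le> \<alpha> * z - c - \<eta>))
     else c < Inf {})"
proof (cases "z \<le> xmax")
  case True
  have "(\<forall>p\<in>curve h n ts ds. c + \<eta> \<le> \<alpha> * z + snd p - \<alpha> * fst p) \<longleftrightarrow>
      (\<forall>s\<in>\<rat> \<inter> {0..}. \<alpha> * Ghat k h n ts ds s - Ghat_sub k h n ts ds 1 s \<le> \<alpha> * z - c - \<eta>)" for \<alpha> \<eta>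
  proof -
    have "(\<forall>p\<in>curve h n ts ds. c + \<eta> \<le> \<alpha> * z + snd p - \<alpha> * fst p) \<longleftrightarrow>
      \<not> (\<exists>s\<in>{0..obs_bound h n ts}. \<alpha> * z - c - \<eta> < \<alpha> * Ghat k h n ts ds s + (-1) * Ghat_sub k h n ts ds 1 s)"
      unfolding curve_def by (force simp: algebra_simps not_less)
    also have "\<dots> \<longleftrightarrow> (\<forall>s\<in>\<rat> \<inter> {0..}. \<alpha> * Ghat k h n ts ds s - Ghat_sub k h n ts ds 1 s \<le> \<alpha> * z - c - \<eta>)"
      unfolding ex_curve_iff_Rats by (auto simp: not_less)
    finally show ?thesis .
  qed
  then show ?thesis using True z less_lower_convex_hull_iff[OF curve_props, of z c] by simp
next
  case False
  then show ?thesis using lower_convex_hull_outside[OF curve_props, of z] by auto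
qed

text \<open>The slope of the hull is increasing along the interior of its domain. If the \<open>x\<close>-coordinate is constant on one
  side of \<open>t\<close>, the slope is constant there, whatever value it has; otherwise points on that side
  close to \<open>t\<close> have \<open>x\<close>-coordinates in the interior. At \<open>t\<close> itself, which may correspond to the right
  end of the domain, nothing is claimed.\<close>

lemma slope_one_sided_mono:
  assumes t: "h < t"
  defines "F \<equiv> \<lambda>u. right_slope (lower_convex_hull (curve h n ts ds)) (Ghat k h n ts ds u)"
  shows "\<exists>\<delta>>0. (\<forall>u v. t < u \<and> u \<le> v \<and> v < t + \<delta> \<longrightarrow> F u \<le> F v) \<and>
    (\<forall>u v. t - \<delta> < u \<and> u \<le> v \<and> v < t \<longrightarrow> F u \<le> F v)"
proof -
  let ?x = "Ghat k h n ts ds"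
  have xm: "?x u \<le> ?x v" if "h < u" "u \<le> v" for u v
    unfolding Ghat_eq[OF h] using that by (intro add_mono Ghat_sub_mono[OF h])
  have rng: "xmin \<le> ?x u" "?x u \<le> xmax" if "h < u" for u using Ghat_range[of u] that h by auto
  have Fm: "F u \<le> F v" if "h < u" "u \<le> v" "xmin < ?x u" "?x v < xmax" for u v
    unfolding F_def by (rule right_slope_lower_convex_hull_mono[OF curve_props]) (use that xm in auto)
  have cx: "isCont ?x t" 
    unfolding Ghat_eq[OF h, abs_def] using DERIV_isCont[OF DERIV_Ghat_sub[OF h t]]
    by (intro continuous_intros) auto
  have right: "\<exists>\<delta>>0. \<forall>u v. t < u \<and> u \<le> v \<and> v < t + \<delta> \<longrightarrow> F u \<le> F v"
  proof (cases "\<exists>u>t. ?x u = ?x t")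
    case True
    then obtain u0 where u0: "u0 > t" "?x u0 = ?x t" by blast
    have "?x u = ?x t" if "t < u" "u \<le> u0" for u
      using xm[of t u] xm[of u u0] that t u0 by auto
    then show ?thesis using u0(1) by (intro exI[of _ "u0 - t"]) (auto simp: F_def)
  next
    case False
    then have gt: "?x t < ?x u" if "t < u" for u using xm[of t u] t that by (metis less_le order_less_imp_le)
    have "?x t < xmax" using gt[of "t + 1"] rng(2)[of "t + 1"] t by auto
    then have "\<forall>\<^sub>F u in at t. ?x u < xmax" using cx unfolding isCont_def by (rule order_tendstoD(2)[rotated])
    then obtain d where d: "d > 0" "\<And>u. u \<noteq> t \<Longrightarrow> dist u t < d \<Longrightarrow> ?x u < xmax"
      unfolding eventually_at by auto
    have "F u \<le> F v" if "t < u" "u \<le> v" "v < t + d" for u v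
      by (rule Fm) (use that t gt[of u] rng(1)[of t] d(2)[of v] in \<open>auto simp: dist_real_def\<close>)
    then show ?thesis using d(1) by blast
  qed
  have left: "\<exists>\<delta>>0. \<forall>u v. t - \<delta> < u \<and> u \<le> v \<and> v < t \<longrightarrow> F u \<le> F v"
  proof (cases "\<exists>u. h < u \<and> u < t \<and> ?x u = ?x t")
    case True
    then obtain u0 where u0: "h < u0" "u0 < t" "?x u0 = ?x t" by blast
    have "?x u = ?x t" if "u0 \<le> u" "u < t" for u
      using xm[of u0 u] xm[of u t] that u0 by auto
    then show ?thesis using u0 by (intro exI[of _ "t - u0"]) (auto simp: F_def)
  next
    case False
    then have lt: "?x u < ?x t" if "h < u" "u < t" for u using xm[of u t] that by (metis less_le order_less_imp_le)
    define w where "w = (h + t) / 2"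
    have w: "h < w" "w < t" using t by (auto simp: w_def)
    have "xmin < ?x t" using lt[OF w] rng(1)[OF w(1)] by auto
    then have "\<forall>\<^sub>F u in at t. xmin < ?x u" using cx unfolding isCont_def by (rule order_tendstoD(1)[rotated])
    then obtain d where d: "d > 0" "\<And>u. u \<noteq> t \<Longrightarrow> dist u t < d \<Longrightarrow> xmin < ?x u"
      unfolding eventually_at by auto
    have "F u \<le> F v" if "t - min d (t - h) < u" "u \<le> v" "v < t" for u v
    proof (rule Fm)
      show hu: "h < u" and "u \<le> v" using that by auto
      show "xmin < ?x u" using d(2)[of u] that by (auto simp: dist_real_def)
      show "?x v < xmax" using lt[of v] hu that rng(2)[of t] t by simp
    qed
    then show ?thesis using d(1) t by (intro exI[of _ "min d (t - h)"]) auto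
  qed
  obtain d1 d2 where d: "d1 > 0" "\<forall>u v. t < u \<and> u \<le> v \<and> v < t + d1 \<longrightarrow> F u \<le> F v"
    "d2 > 0" "\<forall>u v. t - d2 < u \<and> u \<le> v \<and> v < t \<longrightarrow> F u \<le> F v" using left right by blast
  show ?thesis
    by (intro exI[of _ "min d1 d2"] conjI) (use d in auto)
qed

end

text \<open>Where the derivative does not exist, \<open>deriv\<close> has the fixed value \<open>SOME l. False\<close>; so it suffices
  that existence and value of the derivative are expressed by limits of sequences of measurable functions.\<close>

lemma borel_measurable_f_MS:
  fixes M :: "'a measure" and T :: "nat \<Rightarrow> 'a \<Rightarrow> real" and D :: "nat \<Rightarrow> 'a \<Rightarrow> nat"
  assumes T[measurable]: "\<And>j. T j \<in> borel_measurable M" and D[measurable]: "\<And>j. D j \<in> M \<rightarrow>\<^sub>M count_space UNIV"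
    and D01: "\<And>j \<omega>. D j \<omega> = 0 \<or> D j \<omega> = 1" and h: "h > 0" and t: "h < t"
  shows "(\<lambda>\<omega>. f_MS k h n (\<lambda>j. T j \<omega>) (\<lambda>j. D j \<omega>) t) \<in> borel_measurable M"
proof -
  let ?x = "\<lambda>\<omega> u. Ghat k h n (\<lambda>j. T j \<omega>) (\<lambda>j. D j \<omega>) u"
  let ?y = "\<lambda>\<omega> u. Ghat_sub k h n (\<lambda>j. T j \<omega>) (\<lambda>j. D j \<omega>) 1 u"
  let ?b = "\<lambda>\<omega>. xmax h n (\<lambda>j. T j \<omega>) (\<lambda>j. D j \<omega>)" and ?a = "\<lambda>\<omega>. xmin h n (\<lambda>j. T j \<omega>) (\<lambda>j. D j \<omega>)"
  let ?L = "\<lambda>\<omega>. lower_convex_hull (curve h n (\<lambda>j. T j \<omega>) (\<lambda>j. D j \<omega>))"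
  have cQ: "countable (\<rat> :: real set)" "countable (\<rat> \<inter> {0..} :: real set)"
    using countable_rat by auto
  have y[measurable]: "(\<lambda>\<omega>. Ghat_sub k h n (\<lambda>j. T j \<omega>) (\<lambda>j. D j \<omega>) i u) \<in> borel_measurable M" for i u
    unfolding Ghat_sub_eq[OF h] by measurable
  have x[measurable]: "(\<lambda>\<omega>. ?x \<omega> u) \<in> borel_measurable M" for u
    unfolding Ghat_eq[OF h] by measurable
  have b[measurable]: "?b \<in> borel_measurable M"
    unfolding borel_measurable_iff_greater less_xmax_iff[OF h]
    by (intro allI sets.sets_Collect_countable_Ex'[OF _ cQ(2)]) measurable
  have L: "(\<lambda>\<omega>. ?L \<omega> (z \<omega>)) \<in> borel_measurable M"
    if [measurable]: "z \<in> borel_measurable M" and z: "\<And>\<omega>. ?a \<omega> \<le> z \<omega>" for z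
    unfolding borel_measurable_iff_greater less_hull_iff[OF h z]
  proof
    fix c
    have 1: "{\<omega>\<in>space M. \<exists>\<alpha>\<in>\<rat>. \<exists>\<eta>\<in>\<rat>. \<eta> > 0 \<and> (\<forall>s\<in>\<rat> \<inter> {0..}. \<alpha> * ?x \<omega> s - ?y \<omega> s \<le> \<alpha> * z \<omega> - c - \<eta>)} \<in> sets M"
      by (intro sets.sets_Collect_countable_Ex'[OF _ cQ(1)] sets.sets_Collect_conj
            sets.sets_Collect_countable_All'[OF _ cQ(2)]) measurable
    have 2: "{\<omega>\<in>space M. z \<omega> \<le> ?b \<omega>} \<in> sets M" by measurable
    have "{\<omega>\<in>space M. if z \<omega> \<le> ?b \<omega> then (\<exists>\<alpha>\<in>\<rat>. \<exists>\<eta>\<in>\<rat>. \<eta> > 0 \<and> (\<forall>s\<in>\<rat> \<inter> {0..}. \<alpha> * ?x \<omega> s - ?y \<omega> s \<le> \<alpha> * z \<omega> - c - \<eta>)) else c < Inf {}}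
      = ({\<omega>\<in>space M. z \<omega> \<le> ?b \<omega>} \<inter> {\<omega>\<in>space M. \<exists>\<alpha>\<in>\<rat>. \<exists>\<eta>\<in>\<rat>. \<eta> > 0 \<and> (\<forall>s\<in>\<rat> \<inter> {0..}. \<alpha> * ?x \<omega> s - ?y \<omega> s \<le> \<alpha> * z \<omega> - c - \<eta>)})
        \<union> ((space M - {\<omega>\<in>space M. z \<omega> \<le> ?b \<omega>}) \<inter> (if c < Inf {} then space M else {}))"
      by auto
    also have "\<dots> \<in> sets M" using 1 2 by auto
    finally show "{\<omega>\<in>space M. if z \<omega> \<le> ?b \<omega> then (\<exists>\<alpha>\<in>\<rat>. \<exists>\<eta>\<in>\<rat>. \<eta> > 0 \<and> (\<forall>s\<in>\<rat> \<inter> {0..}. \<alpha> * ?x \<omega> s - ?y \<omega> s \<le> \<alpha> * z \<omega> - c - \<eta>)) else c < Inf {}} \<in> sets M" .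
  qed
  define F where "F \<omega> u = right_slope (?L \<omega>) (?x \<omega> u)" for \<omega> u
  have F: "(\<lambda>\<omega>. F \<omega> u) \<in> borel_measurable M" if u: "u \<ge> 0" for u
  proof -
    have r: "?x \<omega> u \<in> {?a \<omega>..?b \<omega>}" for \<omega> by (rule Ghat_range[OF h u])
    have "F \<omega> u = lim (\<lambda>m. (?L \<omega> (?x \<omega> u + hstep (?b \<omega>) (?x \<omega> u) m) - ?L \<omega> (?x \<omega> u)) / hstep (?b \<omega>) (?x \<omega> u) m)" for \<omega>
      unfolding F_def by (rule right_slope_lower_convex_hull[OF curve_props[OF h] r])
    moreover have hs: "(\<lambda>\<omega>. hstep (?b \<omega>) (?x \<omega> u) m) \<in> borel_measurable M" for m
      unfolding hstep_def[OF curve_props[OF h]] by measurable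
    moreover have L1: "(\<lambda>\<omega>. ?L \<omega> (?x \<omega> u)) \<in> borel_measurable M"
      by (rule L[OF x]) (use r in simp)
    moreover have L2: "(\<lambda>\<omega>. ?L \<omega> (?x \<omega> u + hstep (?b \<omega>) (?x \<omega> u) m)) \<in> borel_measurable M" for m
    proof (rule L[OF borel_measurable_add[OF x hs]])
      fix \<omega>
      have "0 \<le> hstep (?b \<omega>) (?x \<omega> u) m"
        unfolding hstep_def[OF curve_props[OF h]] using r[of \<omega>] by simp
      then show "?a \<omega> \<le> ?x \<omega> u + hstep (?b \<omega>) (?x \<omega> u) m" using r[of \<omega>] by simp
    qed
    ultimately show ?thesis
      by (simp only:) (intro borel_measurable_lim_metric borel_measurable_divide borel_measurable_diff L1 L2 hs)
  qed
  \<comment> \<open>The left difference quotients are taken from an index on at which \<open>t - 1 / (m + 1)\<close> is nonnegative.\<close>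
  define N where "N = nat \<lceil>1 / t\<rceil>"
  define A B where "A m \<omega> = (F \<omega> (t + 1 / real (Suc m)) - F \<omega> t) * real (Suc m)"
    and "B m \<omega> = (F \<omega> t - F \<omega> (t - 1 / real (Suc m))) * real (Suc m)" for m \<omega>
  have Am[measurable]: "A m \<in> borel_measurable M" for m
    unfolding A_def using t h by (intro borel_measurable_times borel_measurable_diff F) auto
  have Bm[measurable]: "B (m + N) \<in> borel_measurable M" for m
  proof -
    have "1 / t \<le> real (Suc (m + N))" unfolding N_def by linarith
    then have "1 / real (Suc (m + N)) \<le> t" using t h by (simp add: field_simps)
    then show ?thesis unfolding B_def using t h by (intro borel_measurable_times borel_measurable_diff F) auto
  qed
  have d: "DERIV (F \<omega>) t :> l \<longleftrightarrow> (\<lambda>m. A m \<omega>) \<longlonglongrightarrow> l \<and> (\<lambda>m. B (m + N) \<omega>) \<longlonglongrightarrow> l" for \<omega> l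
  proof -
    obtain \<delta> where \<delta>: "\<delta> > 0" "\<And>u v. t < u \<Longrightarrow> u \<le> v \<Longrightarrow> v < t + \<delta> \<Longrightarrow> F \<omega> u \<le> F \<omega> v"
      "\<And>u v. t - \<delta> < u \<Longrightarrow> u \<le> v \<Longrightarrow> v < t \<Longrightarrow> F \<omega> u \<le> F \<omega> v"
      using slope_one_sided_mono[OF h t, of n "\<lambda>j. T j \<omega>" "\<lambda>j. D j \<omega>"] unfolding F_def by blast
    have "DERIV (F \<omega>) t :> l \<longleftrightarrow>
      (\<lambda>m. (F \<omega> (t + 1 / real (Suc m)) - F \<omega> t) * real (Suc m)) \<longlonglongrightarrow> l \<and>
      (\<lambda>m. (F \<omega> t - F \<omega> (t - 1 / real (Suc m))) * real (Suc m)) \<longlonglongrightarrow> l"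
      by (rule DERIV_sequence_iff[OF \<delta>(1)]) (erule (2) \<delta>(2) \<delta>(3))+
    then show ?thesis unfolding A_def B_def
      using LIMSEQ_ignore_initial_segment[of "\<lambda>m. (F \<omega> t - F \<omega> (t - 1 / real (Suc m))) * real (Suc m)" l N]
        LIMSEQ_offset[of "\<lambda>m. (F \<omega> t - F \<omega> (t - 1 / real (Suc m))) * real (Suc m)" N l] by blast
  qed
  have eq: "f_MS k h n (\<lambda>j. T j \<omega>) (\<lambda>j. D j \<omega>) t =
     (if Cauchy (\<lambda>m. A m \<omega>) \<and> Cauchy (\<lambda>m. B (m + N) \<omega>) \<and> lim (\<lambda>m. A m \<omega>) = lim (\<lambda>m. B (m + N) \<omega>)
      then lim (\<lambda>m. A m \<omega>) else (SOME l. False))" for \<omega>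
  proof -
    have "f_MS k h n (\<lambda>j. T j \<omega>) (\<lambda>j. D j \<omega>) t = deriv (F \<omega>) t"
      unfolding F_def[abs_def] by (rule f_MS_eq_curve[OF h t D01])
    also have "\<dots> = (SOME l. (\<lambda>m. A m \<omega>) \<longlonglongrightarrow> l \<and> (\<lambda>m. B (m + N) \<omega>) \<longlonglongrightarrow> l)"
      unfolding deriv_def d ..
    also have "\<dots> = (if Cauchy (\<lambda>m. A m \<omega>) \<and> Cauchy (\<lambda>m. B (m + N) \<omega>) \<and> lim (\<lambda>m. A m \<omega>) = lim (\<lambda>m. B (m + N) \<omega>)
      then lim (\<lambda>m. A m \<omega>) else (SOME l. False))"
    proof (cases "Cauchy (\<lambda>m. A m \<omega>) \<and> Cauchy (\<lambda>m. B (m + N) \<omega>) \<and> lim (\<lambda>m. A m \<omega>) = lim (\<lambda>m. B (m + N) \<omega>)")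
      case True
      then have "(\<lambda>m. A m \<omega>) \<longlonglongrightarrow> lim (\<lambda>m. A m \<omega>)" "(\<lambda>m. B (m + N) \<omega>) \<longlonglongrightarrow> lim (\<lambda>m. A m \<omega>)"
        by (metis Cauchy_convergent convergent_LIMSEQ_iff)+
      then have "((\<lambda>m. A m \<omega>) \<longlonglongrightarrow> l \<and> (\<lambda>m. B (m + N) \<omega>) \<longlonglongrightarrow> l) \<longleftrightarrow> l = lim (\<lambda>m. A m \<omega>)" for l
        using LIMSEQ_unique by blast
      then show ?thesis using True by simp
    next
      case False
      have "\<not> ((\<lambda>m. A m \<omega>) \<longlonglongrightarrow> l \<and> (\<lambda>m. B (m + N) \<omega>) \<longlonglongrightarrow> l)" for l
        using False by (metis LIMSEQ_imp_Cauchy limI)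
      then have "(\<lambda>l. (\<lambda>m. A m \<omega>) \<longlonglongrightarrow> l \<and> (\<lambda>m. B (m + N) \<omega>) \<longlonglongrightarrow> l) = (\<lambda>l. False)"
        by (simp add: fun_eq_iff)
      then show ?thesis unfolding if_not_P[OF False] by (simp only:)
    qed
    finally show ?thesis .
  qed
  have "Measurable.pred M (\<lambda>\<omega>. Cauchy (\<lambda>m. A m \<omega>))" "Measurable.pred M (\<lambda>\<omega>. Cauchy (\<lambda>m. B (m + N) \<omega>))"
    unfolding pred_def by (intro sets_Collect_Cauchy Am Bm)+
  then show ?thesis unfolding eq by measurable
qed

end

section \<open>Laws of large numbers\<close>

context iid_sample
begin

lemma avg_mono: "(\<And>z. \<phi> z \<le> \<psi> z) \<Longrightarrow> avg n \<phi> \<omega> \<le> avg n \<psi> \<omega>"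
  unfolding avg_def by (intro divide_right_mono sum_mono) auto

lemma ex_mono:
  fixes \<phi> \<psi> :: "'b \<Rightarrow> real"
  assumes "\<phi> \<in> borel_measurable N" "\<And>z. \<bar>\<phi> z\<bar> \<le> K" "\<psi> \<in> borel_measurable N" "\<And>z. \<bar>\<psi> z\<bar> \<le> L"
    and "\<And>z. \<phi> z \<le> \<psi> z"
  shows "ex \<phi> \<le> ex \<psi>"
  unfolding ex_def by (rule integral_mono) (use assms integrable_bounded_Z in blast)+

lemma weak_law:
  fixes \<psi> :: "'b \<Rightarrow> real"
  assumes \<psi>: "\<psi> \<in> borel_measurable N" "\<And>z. \<bar>\<psi> z\<bar> \<le> K" and e: "e > 0"
  shows "whp (\<lambda>n \<omega>. \<bar>avg n \<psi> \<omega> - ex \<psi>\<bar> \<le> e)"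
proof (rule whpI[where B = "\<lambda>n. {\<omega>\<in>space M. \<bar>avg n \<psi> \<omega> - ex \<psi>\<bar> \<ge> e}" and b = "\<lambda>n. (ex (\<lambda>z. (\<psi> z)\<^sup>2) / e\<^sup>2) * (1 / real n)"])
  have [measurable]: "\<psi> \<in> borel_measurable N" by (rule \<psi>)
  show "\<forall>\<^sub>F n in sequentially. {\<omega>\<in>space M. \<bar>avg n \<psi> \<omega> - ex \<psi>\<bar> \<ge> e} \<in> events \<and>
      prob {\<omega>\<in>space M. \<bar>avg n \<psi> \<omega> - ex \<psi>\<bar> \<ge> e} \<le> (ex (\<lambda>z. (\<psi> z)\<^sup>2) / e\<^sup>2) * (1 / real n)"
  proof (rule eventually_sequentiallyI[of 1])
    fix n :: nat assume "n \<ge> 1"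
    then show "{\<omega>\<in>space M. \<bar>avg n \<psi> \<omega> - ex \<psi>\<bar> \<ge> e} \<in> events \<and>
      prob {\<omega>\<in>space M. \<bar>avg n \<psi> \<omega> - ex \<psi>\<bar> \<ge> e} \<le> (ex (\<lambda>z. (\<psi> z)\<^sup>2) / e\<^sup>2) * (1 / real n)"
      using avg_Chebyshev[OF \<psi>, of n e] e by (simp add: mult.commute)
  qed
  show "\<forall>\<^sub>F n in sequentially. \<forall>\<omega>\<in>space M - {\<omega>\<in>space M. \<bar>avg n \<psi> \<omega> - ex \<psi>\<bar> \<ge> e}. \<bar>avg n \<psi> \<omega> - ex \<psi>\<bar> \<le> e"
    by (rule always_eventually) auto
  show "(\<lambda>n. (ex (\<lambda>z. (\<psi> z)\<^sup>2) / e\<^sup>2) * (1 / real n)) \<longlonglongrightarrow> 0"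
    using tendsto_mult[OF tendsto_const[of "ex (\<lambda>z. (\<psi> z)\<^sup>2) / e\<^sup>2"] lim_1_over_n] by simp
qed

text \<open>The argument of Glivenko and Cantelli: the weak law at finitely many grid points and, for the tail, for the
  function \<open>top\<close> that dominates all \<open>\<psi> u\<close>; between grid points monotonicity, and the means increase by at
  most \<open>e / 2\<close> from one grid point to the next.\<close>

lemma uniform_law_monotone:
  fixes \<psi> :: "real \<Rightarrow> 'b \<Rightarrow> real" and top :: "'b \<Rightarrow> real"
  assumes meas[measurable]: "\<And>u. \<psi> u \<in> borel_measurable N" "top \<in> borel_measurable N"
    and rng: "\<And>u z. 0 \<le> \<psi> u z" "\<And>u z. \<psi> u z \<le> top z" "\<And>z. top z \<le> 1"
    and mono: "\<And>u v z. u \<le> v \<Longrightarrow> \<psi> u z \<le> \<psi> v z"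
    and unif: "\<And>e. e > 0 \<Longrightarrow> \<exists>\<delta>>0. \<forall>u\<ge>0. ex (\<psi> (u + \<delta>)) \<le> ex (\<psi> u) + e"
    and tail: "\<And>e. e > 0 \<Longrightarrow> \<exists>R. ex top \<le> ex (\<psi> R) + e"
    and e: "e > 0"
  shows "whp (\<lambda>n \<omega>. \<forall>u\<ge>0. \<bar>avg n (\<psi> u) \<omega> - ex (\<psi> u)\<bar> \<le> e)"
proof -
  define H where "H u = ex (\<psi> u)" for u
  have e2: "e / 2 > 0" using e by simp
  obtain \<delta> where \<delta>: "\<delta> > 0" "\<And>u. u \<ge> 0 \<Longrightarrow> H (u + \<delta>) \<le> H u + e / 2"
    using unif[OF e2] unfolding H_def by blast
  obtain R where R: "ex top \<le> H R + e / 2" using tail[OF e2] unfolding H_def by blast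
  have b1: "\<bar>\<psi> u z\<bar> \<le> 1" "\<bar>top z\<bar> \<le> 1" for u z
    using rng(1)[of u z] rng(2)[of u z] rng(3)[of z] by auto
  have Hm: "H u \<le> H v" if "u \<le> v" for u v
    unfolding H_def by (rule ex_mono[OF meas(1) b1(1) meas(1) b1(1) mono[OF that]])
  have Ht: "H u \<le> ex top" for u
    unfolding H_def by (rule ex_mono[OF meas(1) b1(1) meas(2) b1(2) rng(2)])
  define m where "m = nat \<lceil>\<bar>R\<bar> / \<delta>\<rceil>"
  have mR: "R \<le> real m * \<delta>"
  proof -
    have "\<bar>R\<bar> / \<delta> \<le> real m" unfolding m_def by linarith
    then show ?thesis using \<delta>(1) by (simp add: divide_le_eq)
  qed
  have "whp (\<lambda>n \<omega>. (\<forall>l\<in>{..m}. \<bar>avg n (\<psi> (real l * \<delta>)) \<omega> - H (real l * \<delta>)\<bar> \<le> e / 2) \<and> \<bar>avg n top \<omega> - ex top\<bar> \<le> e / 2)"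
    unfolding H_def by (intro whp_conj whp_ball_finite weak_law[OF meas(1) b1(1) e2] weak_law[OF meas(2) b1(2) e2]) auto
  then show ?thesis
  proof (rule whp_mono, intro always_eventually allI ballI impI)
    fix n \<omega> u
    assume A: "(\<forall>l\<in>{..m}. \<bar>avg n (\<psi> (real l * \<delta>)) \<omega> - H (real l * \<delta>)\<bar> \<le> e / 2) \<and> \<bar>avg n top \<omega> - ex top\<bar> \<le> e / 2"
      and u: "0 \<le> (u :: real)"
    have Al: "\<bar>avg n (\<psi> (real l * \<delta>)) \<omega> - H (real l * \<delta>)\<bar> \<le> e / 2" if "l \<le> m" for l using A that by auto
    have At: "\<bar>avg n top \<omega> - ex top\<bar> \<le> e / 2" using A by blast
    have am: "avg n (\<psi> v) \<omega> \<le> avg n (\<psi> w) \<omega>" if "v \<le> w" for v w by (rule avg_mono[OF mono[OF that]])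
    have at: "avg n (\<psi> v) \<omega> \<le> avg n top \<omega>" for v by (rule avg_mono[OF rng(2)])
    show "\<bar>avg n (\<psi> u) \<omega> - ex (\<psi> u)\<bar> \<le> e"
    proof (cases "u \<ge> real m * \<delta>")
      case True
      have "H R \<le> H (real m * \<delta>)" "H (real m * \<delta>) \<le> H u" "H u \<le> ex top"
        using Hm mR True Ht by auto
      then show ?thesis
        using am[OF True] at[of u] Al[of m] At R unfolding H_def[symmetric] abs_le_iff by auto
    next
      case False
      define l where "l = nat \<lfloor>u / \<delta>\<rfloor>"
      have "0 \<le> \<lfloor>u / \<delta>\<rfloor>" using u \<delta>(1) by simp
      then have l: "real l \<le> u / \<delta>" "u / \<delta> \<le> real (Suc l)" unfolding l_def by linarith+
      have l1: "real l * \<delta> \<le> u" "u \<le> real (Suc l) * \<delta>" using l \<delta>(1) by (simp_all add: field_simps)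
      have "real l * \<delta> < real m * \<delta>" using l1(1) False by linarith
      then have lm: "Suc l \<le> m" using \<delta>(1) by simp
      have "H (real (Suc l) * \<delta>) \<le> H (real l * \<delta>) + e / 2"
        using \<delta>(2)[of "real l * \<delta>"] \<delta>(1) by (simp add: algebra_simps)
      then show ?thesis
        using am[OF l1(1)] am[OF l1(2)] Al[of l] Al[OF lm] Hm[OF l1(1)] Hm[OF l1(2)] lm
        unfolding H_def[symmetric] abs_le_iff by auto
    qed
  qed
qed

end

section \<open>The current status model\<close>

locale current_status = prob_space M for M :: "'a measure" +
  fixes X T :: "nat \<Rightarrow> 'a \<Rightarrow> real" and F0 G g :: "real \<Rightarrow> real"
  assumes model: "current_status_model M X T F0 G g"
begin

definition Z :: "nat \<Rightarrow> 'a \<Rightarrow> real \<times> real" where "Z j \<omega> = (T j \<omega>, X j \<omega>)"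

lemma indep_XT: "indep_vars (\<lambda>_. borel) (case_sum X T) UNIV"
  using model unfolding current_status_model_def by blast

lemma rv_X [measurable]: "X j \<in> borel_measurable M" and rv_T [measurable]: "T j \<in> borel_measurable M"
proof -
  have "case_sum X T i \<in> borel_measurable M" for i
    using indep_XT unfolding indep_vars_def2 by simp
  from this[of "Inl j"] this[of "Inr j"]
  show "X j \<in> borel_measurable M" "T j \<in> borel_measurable M" by simp_all
qed

lemma indep_TX: "indep_var borel (T j) borel (X j)"
proof -
  have "indep_var (PiM {Inr j} (\<lambda>_. borel)) (\<lambda>\<omega>. restrict (\<lambda>i. case_sum X T i \<omega>) {Inr j})
      (PiM {Inl j} (\<lambda>_. borel)) (\<lambda>\<omega>. restrict (\<lambda>i. case_sum X T i \<omega>) {Inl j})"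
    by (rule indep_var_restrict[OF indep_XT]) auto
  then have "indep_var borel ((\<lambda>f. f (Inr j)) \<circ> (\<lambda>\<omega>. restrict (\<lambda>i. case_sum X T i \<omega>) {Inr j}))
      borel ((\<lambda>f. f (Inl j)) \<circ> (\<lambda>\<omega>. restrict (\<lambda>i. case_sum X T i \<omega>) {Inl j}))"
    by (rule indep_var_compose) measurable
  then show ?thesis by (simp add: comp_def)
qed

lemma indep_Z: "indep_vars (\<lambda>_. borel \<Otimes>\<^sub>M borel) Z UNIV"
proof -
  define K :: "nat \<Rightarrow> (nat + nat) set" where "K j = {Inl j, Inr j}" for j
  have "indep_vars (\<lambda>j. PiM (K j) (\<lambda>_. borel)) (\<lambda>j \<omega>. restrict (\<lambda>i. case_sum X T i \<omega>) (K j)) UNIV"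
    by (rule indep_vars_restrict[OF indep_XT]) (auto simp: K_def disjoint_family_on_def)
  then have "indep_vars (\<lambda>_. borel \<Otimes>\<^sub>M borel)
      (\<lambda>j \<omega>. (\<lambda>f. (f (Inr j), f (Inl j))) (restrict (\<lambda>i. case_sum X T i \<omega>) (K j))) UNIV"
    by (rule indep_vars_compose2) (auto simp: K_def intro!: measurable_Pair measurable_component_singleton)
  then show ?thesis by (simp add: Z_def[abs_def] K_def)
qed

lemma distr_X: "distr M borel (X j) = distr M borel (X 0)" and distr_T: "distr M borel (T j) = distr M borel (T 0)"
proof -
  have "cdf (distr M borel (X j)) = cdf (distr M borel (X 0))" "cdf (distr M borel (T j)) = cdf (distr M borel (T 0))"
    using model unfolding current_status_model_def by simp_all
  then show "distr M borel (X j) = distr M borel (X 0)" "distr M borel (T j) = distr M borel (T 0)"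
    by (auto intro!: cdf_unique real_distribution_distr)
qed

lemma distr_Z: "distr M (borel \<Otimes>\<^sub>M borel) (Z j) = distr M borel (T 0) \<Otimes>\<^sub>M distr M borel (X 0)"
  using indep_TX[of j] unfolding indep_var_distribution_eq Z_def[abs_def] by (simp add: distr_X[of j] distr_T[of j])

sublocale iid_sample M Z "borel \<Otimes>\<^sub>M borel"
  by unfold_locales (rule indep_Z, simp only: distr_Z)

lemma borel_g [measurable]: "g \<in> borel_measurable borel" and g_nonneg [simp]: "0 \<le> g x"
  and g_int: "set_integrable lborel {..x} g" and G_eq: "G x = (LINT u:{..x}|lborel. g u)"
  using model unfolding current_status_model_def density_of_def by auto

lemma cdf_T: "cdf (distr M borel (T j)) = G" and cdf_X: "cdf (distr M borel (X j)) = F0"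
  using model unfolding current_status_model_def by auto

sublocale DT: real_distribution "distr M borel (T 0)" by (rule real_distribution_distr) simp
sublocale DX: real_distribution "distr M borel (X 0)" by (rule real_distribution_distr) simp

lemma G_mono: "u \<le> v \<Longrightarrow> G u \<le> G v" and F0_mono: "u \<le> v \<Longrightarrow> F0 u \<le> F0 v"
  using DT.cdf_nondecreasing DX.cdf_nondecreasing unfolding cdf_T cdf_X by auto

lemma F0_bounds: "0 \<le> F0 u" "F0 u \<le> 1" and G_bounds: "0 \<le> G u" "G u \<le> 1"
  using DX.cdf_nonneg DX.cdf_bounded_prob DT.cdf_nonneg DT.cdf_bounded_prob unfolding cdf_T cdf_X by auto

lemma borel_F0 [measurable]: "F0 \<in> borel_measurable borel"
  using F0_mono by (intro borel_measurable_mono) (auto simp: mono_def)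

lemma density_T: "distr M borel (T 0) = density lborel (\<lambda>x. ennreal (g x))"
proof (rule measure_eqI_generator_eq[where \<Omega> = UNIV and E = "range (\<lambda>(a, b). {a<..b::real})" and A = "\<lambda>i. {- real i<..real i}"])
  fix Y assume "Y \<in> range (\<lambda>(a, b). {a<..b::real})"
  then obtain a b where Y: "Y = {a<..b}" by auto
  show "emeasure (distr M borel (T 0)) Y = emeasure (density lborel (\<lambda>x. ennreal (g x))) Y"
  proof (cases "a \<le> b")
    case True
    have i: "set_integrable lborel {a<..b} g"
      by (rule set_integrable_subset[OF g_int[of b]]) auto
    have "{..b} = {..a} \<union> {a<..b}" using True by auto
    then have "G b = (LINT u:{..a} \<union> {a<..b}|lborel. g u)" unfolding G_eq by simp
    also have "\<dots> = G a + (LINT u:{a<..b}|lborel. g u)"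
      unfolding G_eq by (rule set_integral_Un) (use i g_int in auto)
    finally have "G b - G a = (LINT u|lborel. indicator {a<..b} u * g u)"
      unfolding set_lebesgue_integral_def by simp
    then have "ennreal (G b - G a) = (\<integral>\<^sup>+u. ennreal (indicator {a<..b} u * g u) \<partial>lborel)"
      using i unfolding set_integrable_def by (subst nn_integral_eq_integral) auto
    also have "\<dots> = emeasure (density lborel (\<lambda>x. ennreal (g x))) {a<..b}"
      by (subst emeasure_density) (auto intro!: nn_integral_cong simp: indicator_def)
    finally show ?thesis unfolding Y using DT.emeasure_Ioc[OF True] unfolding cdf_T by simp
  qed (simp add: Y)
next
  show "(\<Union>i. {- real (i::nat)<..real i}) = UNIV"
    by (rule UN_Ioc_eq_UNIV)
  show "emeasure (distr M borel (T 0)) {- real i<..real i} \<noteq> \<infinity>" for i :: nat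
    using DT.emeasure_finite by simp
qed (auto simp: borel_sigma_sets_Ioc Int_stable_def)

lemma measure_T_singleton: "measure (distr M borel (T 0)) {x} = 0"
proof -
  have "emeasure (distr M borel (T 0)) {x} = 0" unfolding density_T
    by (subst emeasure_density) (auto simp: nn_integral_0_iff_AE intro!: AE_I'[of "{x}"])
  then show ?thesis unfolding measure_def by simp
qed

lemma isCont_G: "isCont G x"
  using DT.isCont_cdf[of x] measure_T_singleton unfolding cdf_T by simp

lemma G_nonpos: "x \<le> 0 \<Longrightarrow> G x = 0"
proof -
  have neg: "G x = 0" if "x < 0" for x using model that unfolding current_status_model_def by auto
  have "(G \<longlongrightarrow> G 0) (at_left 0)" using isCont_G[of 0] unfolding isCont_def by (rule tendsto_within_subset) auto
  moreover have "\<forall>\<^sub>F x in at_left 0. G x = 0"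
    using neg unfolding eventually_at_left_field by (intro exI[of _ "-1"]) auto
  then have "(G \<longlongrightarrow> 0) (at_left 0)" by (rule tendsto_eventually)
  ultimately have "G 0 = 0" using tendsto_unique trivial_limit_at_left_real by blast
  then show "x \<le> 0 \<Longrightarrow> G x = 0" using neg by (cases "x = 0") auto
qed

lemma AE_g_nonpos: "AE v in lborel. v \<le> 0 \<longrightarrow> g v = 0"
proof -
  have "(LINT u|lborel. indicator {..0} u * g u) = 0"
    using G_nonpos[of 0] unfolding G_eq set_lebesgue_integral_def by simp
  moreover have "integrable lborel (\<lambda>u. indicator {..0} u * g u)"
    using g_int[of 0] unfolding set_integrable_def by simp
  ultimately have "AE u in lborel. indicator {..0} u * g u = 0"
    by (subst (asm) integral_nonneg_eq_0_iff_AE) auto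
  then show ?thesis by eventually_elim (auto simp: indicator_def split: if_splits)
qed

text \<open>A continuous distribution function is uniformly continuous.\<close>

lemma G_uniform:
  assumes e: "e > 0" shows "\<exists>\<delta>>0. \<forall>u. G (u + \<delta>) \<le> G u + e"
proof -
  have "(G \<longlongrightarrow> 1) at_top" using DT.cdf_lim_at_top_prob unfolding cdf_T .
  then have "\<forall>\<^sub>F u in at_top. G u > 1 - e" by (rule order_tendstoD(1)) (use e in simp)
  then obtain R where R: "\<And>u. u \<ge> R \<Longrightarrow> G u > 1 - e" unfolding eventually_at_top_linorder by blast
  have "uniformly_continuous_on {-1..\<bar>R\<bar> + 1} G"
    by (intro compact_uniformly_continuous) (auto intro: continuous_at_imp_continuous_on isCont_G)
  then obtain d where d: "d > 0" "\<And>u v. u \<in> {-1..\<bar>R\<bar> + 1} \<Longrightarrow> v \<in> {-1..\<bar>R\<bar> + 1} \<Longrightarrow> dist v u < d \<Longrightarrow> dist (G v) (G u) < e"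
    unfolding uniformly_continuous_on_def using e by blast
  define \<delta> where "\<delta> = min 1 (d / 2)"
  have \<delta>: "\<delta> > 0" "\<delta> \<le> 1" "\<delta> < d" using d(1) by (auto simp: \<delta>_def)
  have "G (u + \<delta>) \<le> G u + e" for u
  proof (cases "u \<ge> R")
    case True
    then show ?thesis using R[OF True] G_bounds(2)[of "u + \<delta>"] by simp
  next
    case False
    show ?thesis
    proof (cases "u < -1")
      case True
      then have "G (u + \<delta>) = 0" using \<delta> by (intro G_nonpos) auto
      then show ?thesis using G_bounds(1)[of u] e by simp
    next
      case nu: False
      have "dist (G (u + \<delta>)) (G u) < e" by (rule d(2)) (use False nu \<delta> in \<open>auto simp: dist_real_def\<close>)
      then show ?thesis by (auto simp: dist_real_def)
    qed
  qed
  then show ?thesis using \<delta>(1) by blast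
qed

text \<open>Given an observation time \<open>v\<close>, the status is \<open>1\<close> with probability \<open>F0 v\<close>. So \<open>sg i\<close> is the
  density of the observation times with status \<open>i\<close>, and \<open>cls i\<close> indicates membership in this class;
  the condition \<open>0 \<le> fst z\<close> is inherited from the empirical subdistribution function.\<close>

definition sg :: "nat \<Rightarrow> real \<Rightarrow> real" where
  "sg i v = (if i = 1 then F0 v * g v else (1 - F0 v) * g v)"

definition cls :: "nat \<Rightarrow> real \<times> real \<Rightarrow> real" where
  "cls i z = of_bool (0 \<le> fst z \<and> status (snd z) (fst z) = i)"

lemma cls_range: "0 \<le> cls i z" "cls i z \<le> 1" "\<bar>cls i z\<bar> \<le> 1"
  by (auto simp: cls_def)

lemma borel_cls [measurable]: "cls i \<in> borel_measurable (borel \<Otimes>\<^sub>M borel)"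
  unfolding cls_def[abs_def] status_def by measurable

lemma borel_cls_le [measurable]: "(\<lambda>z. cls i z * of_bool (fst z \<le> u)) \<in> borel_measurable (borel \<Otimes>\<^sub>M borel)"
  by measurable

lemma cls_le_range: "0 \<le> cls i z * of_bool (fst z \<le> u)" "cls i z * of_bool (fst z \<le> u) \<le> cls i z"
    "\<bar>cls i z * of_bool (fst z \<le> u)\<bar> \<le> 1"
    "u \<le> v \<Longrightarrow> cls i z * of_bool (fst z \<le> u) \<le> cls i z * of_bool (fst z \<le> v)"
  by (auto simp: cls_def)

lemma borel_sg [measurable]: "sg i \<in> borel_measurable borel"
  unfolding sg_def[abs_def] by measurable

lemma integrable_g: "integrable lborel g"
proof -
  have "(\<integral>\<^sup>+v. ennreal (g v) \<partial>lborel) = 1"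
    using DT.emeasure_space_1 unfolding density_T by (simp add: emeasure_density)
  then show ?thesis by (intro integrableI_nonneg) auto
qed

lemma integrable_sg_mult:
  assumes [measurable]: "\<phi> \<in> borel_measurable borel" and K: "\<And>v. \<bar>\<phi> v\<bar> \<le> K"
  shows "integrable lborel (\<lambda>v. sg i v * \<phi> v)"
proof (rule Bochner_Integration.integrable_bound[OF integrable_mult_right[OF integrable_g, of K]])
  have "norm (sg i v * \<phi> v) \<le> norm (K * g v)" for v
  proof -
    have "\<bar>sg i v\<bar> \<le> g v" unfolding sg_def using F0_bounds[of v] by (auto simp: abs_mult mult_left_le_one_le)
    then have "\<bar>sg i v\<bar> * \<bar>\<phi> v\<bar> \<le> g v * K" using K[of v] by (intro mult_mono) auto
    then show ?thesis using order_trans[OF abs_ge_zero K[of v]] by (simp add: abs_mult mult.commute)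
  qed
  then show "AE v in lborel. norm (sg i v * \<phi> v) \<le> norm (K * g v)" by simp
qed measurable

text \<open>Integrate over the event time first; negative observation times have probability zero.\<close>

lemma ex_cls:
  assumes i: "i = 0 \<or> i = 1" and [measurable]: "\<phi> \<in> borel_measurable borel" and K: "\<And>v. \<bar>\<phi> v\<bar> \<le> K"
  shows "ex (\<lambda>z. cls i z * \<phi> (fst z)) = (LINT v|lborel. sg i v * \<phi> v)"
proof -
  let ?T = "distr M borel (T 0)" and ?X = "distr M borel (X 0)"
  interpret P: pair_prob_space ?T ?X ..
  define \<psi> where "\<psi> z = cls i z * \<phi> (fst z)" for z
  have [measurable]: "\<psi> \<in> borel_measurable (borel \<Otimes>\<^sub>M borel)" unfolding \<psi>_def[abs_def] by measurable
  have b: "\<bar>\<psi> z\<bar> \<le> K" for z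
    using mult_mono[OF cls_range(3)[of i z] K[of "fst z"]] by (simp add: \<psi>_def abs_mult)
  have int: "integrable (?T \<Otimes>\<^sub>M ?X) \<psi>"
    by (rule P.P.integrable_const_bound[where B = K]) (use b in \<open>auto simp: measurable_cong_sets[OF sets_pair_measure_cong[OF sets_distr sets_distr] refl]\<close>)
  have "ex \<psi> = (LINT z|distr M (borel \<Otimes>\<^sub>M borel) (Z 0). \<psi> z)"
    unfolding ex_def by (rule integral_distr[symmetric]) measurable
  also have "\<dots> = (LINT v|?T. (LINT x|?X. \<psi> (v, x)))"
    unfolding distr_Z by (rule P.integral_fst'[symmetric]) (use int in simp)
  also have "\<dots> = (LINT v|?T. of_bool (0 \<le> v) * (if i = 1 then F0 v else 1 - F0 v) * \<phi> v)"
  proof (rule Bochner_Integration.integral_cong[OF refl])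
    fix v
    have F: "measure ?X {..v} = F0 v" using cdf_X[of 0] unfolding cdf_def by (auto simp: fun_eq_iff)
    have F': "measure ?X {v<..} = 1 - F0 v"
    proof -
      have "{v<..} = space ?X - {..v}" by auto
      then show ?thesis using DX.prob_compl[of "{..v}"] F by simp
    qed
    show "(LINT x|?X. \<psi> (v, x)) = of_bool (0 \<le> v) * (if i = 1 then F0 v else 1 - F0 v) * \<phi> v"
    proof (cases "i = 1")
      case True
      have "\<psi> (v, x) = (of_bool (0 \<le> v) * \<phi> v) * indicator {..v} x" for x
        using True by (auto simp: \<psi>_def cls_def status_def indicator_def)
      then show ?thesis using F True by simp
    next
      case False
      have "\<psi> (v, x) = (of_bool (0 \<le> v) * \<phi> v) * indicator {v<..} x" for x
        using False i by (auto simp: \<psi>_def cls_def status_def indicator_def)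
      then show ?thesis using F' False by simp
    qed
  qed
  also have "\<dots> = (LINT v|lborel. g v *\<^sub>R (of_bool (0 \<le> v) * (if i = 1 then F0 v else 1 - F0 v) * \<phi> v))"
    unfolding density_T by (rule integral_density) auto
  also have "\<dots> = (LINT v|lborel. sg i v * \<phi> v)"
  proof (rule integral_cong_AE)
    show "AE v in lborel. g v *\<^sub>R (of_bool (0 \<le> v) * (if i = 1 then F0 v else 1 - F0 v) * \<phi> v) = sg i v * \<phi> v"
      using AE_g_nonpos by eventually_elim (auto simp: sg_def)
  qed measurable
  finally show ?thesis unfolding \<psi>_def[abs_def] .
qed

definition emp :: "nat \<Rightarrow> nat \<Rightarrow> real \<Rightarrow> 'a \<Rightarrow> real" where
  "emp n i u = avg n (\<lambda>z. cls i z * of_bool (fst z \<le> u))"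

definition SG :: "nat \<Rightarrow> real \<Rightarrow> real" where
  "SG i u = ex (\<lambda>z. cls i z * of_bool (fst z \<le> u))"

lemma SG_eq: "i = 0 \<or> i = 1 \<Longrightarrow> SG i u = (LINT v|lborel. sg i v * of_bool (v \<le> u))"
  unfolding SG_def by (rule ex_cls[where K = 1]) auto

lemma SG_increment:
  assumes "u \<le> v" shows "SG i u \<le> SG i v" "SG i v \<le> SG i u + (G v - G u)"
proof -
  show "SG i u \<le> SG i v" unfolding SG_def
    by (rule ex_mono[OF borel_cls_le cls_le_range(3) borel_cls_le cls_le_range(3) cls_le_range(4)[OF assms]])
  have i: "integrable M (\<lambda>\<omega>. cls i (Z 0 \<omega>) * of_bool (fst (Z 0 \<omega>) \<le> w))" for w
    by (rule integrable_bounded_Z[OF borel_cls_le cls_le_range(3)])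
  have Gi: "G w = expectation (\<lambda>\<omega>. of_bool (T 0 \<omega> \<le> w))" for w
  proof -
    have "G w = measure M {\<omega>\<in>space M. T 0 \<omega> \<le> w}"
      unfolding cdf_T[of 0, symmetric] cdf_def
      by (subst measure_distr) (auto intro!: arg_cong[where f = "measure M"])
    also have "\<dots> = expectation (indicator {\<omega>\<in>space M. T 0 \<omega> \<le> w})" by simp
    also have "\<dots> = expectation (\<lambda>\<omega>. of_bool (T 0 \<omega> \<le> w))"
      by (intro Bochner_Integration.integral_cong) (auto simp: indicator_def)
    finally show ?thesis .
  qed
  have iT: "integrable M (\<lambda>\<omega>. of_bool (T 0 \<omega> \<le> w) :: real)" for w
    by (rule integrable_const_bound[where B = 1]) auto
  have "SG i v - SG i u = expectation (\<lambda>\<omega>. cls i (Z 0 \<omega>) * of_bool (fst (Z 0 \<omega>) \<le> v) - cls i (Z 0 \<omega>) * of_bool (fst (Z 0 \<omega>) \<le> u))"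
    unfolding SG_def ex_def by (rule Bochner_Integration.integral_diff[symmetric]) (rule i)+
  also have "\<dots> \<le> expectation (\<lambda>\<omega>. of_bool (T 0 \<omega> \<le> v) - of_bool (T 0 \<omega> \<le> u))"
  proof (rule integral_mono[OF Bochner_Integration.integrable_diff[OF i i] Bochner_Integration.integrable_diff[OF iT iT]])
    fix \<omega> show "cls i (Z 0 \<omega>) * of_bool (fst (Z 0 \<omega>) \<le> v) - cls i (Z 0 \<omega>) * of_bool (fst (Z 0 \<omega>) \<le> u)
        \<le> of_bool (T 0 \<omega> \<le> v) - of_bool (T 0 \<omega> \<le> u)"
      using assms by (auto simp: Z_def cls_def)
  qed
  also have "\<dots> = G v - G u" unfolding Gi by (rule Bochner_Integration.integral_diff[OF iT iT])
  finally show "SG i v \<le> SG i u + (G v - G u)" by simp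
qed

lemma Glivenko_Cantelli:
  assumes e: "e > 0"
  shows "whp (\<lambda>n \<omega>. \<forall>u\<ge>0. \<bar>emp n i u \<omega> - SG i u\<bar> \<le> e)"
  unfolding emp_def SG_def
proof (rule uniform_law_monotone[where top = "cls i", OF _ _ _ _ _ _ _ _ e])
  fix e :: real assume e: "e > 0"
  obtain \<delta> where d: "\<delta> > 0" "\<And>u. G (u + \<delta>) \<le> G u + e" using G_uniform[OF e] by blast
  have "SG i (u + \<delta>) \<le> SG i u + e" for u
    using SG_increment(2)[of u "u + \<delta>" i] d(1) d(2)[of u] by simp
  then show "\<exists>\<delta>>0. \<forall>u\<ge>0. ex (\<lambda>z. cls i z * of_bool (fst z \<le> u + \<delta>)) \<le> ex (\<lambda>z. cls i z * of_bool (fst z \<le> u)) + e"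
    using d(1) unfolding SG_def by blast
  have "(G \<longlongrightarrow> 1) at_top" using DT.cdf_lim_at_top_prob unfolding cdf_T .
  then have "\<forall>\<^sub>F u in at_top. G u > 1 - e" by (rule order_tendstoD(1)) (use e in simp)
  then obtain R where R: "G R > 1 - e" unfolding eventually_at_top_linorder by blast
  have i: "integrable M (\<lambda>\<omega>. cls i (Z 0 \<omega>) * of_bool (fst (Z 0 \<omega>) \<le> R))" 
    by (rule integrable_bounded_Z[OF borel_cls_le cls_le_range(3)])
  have it: "integrable M (\<lambda>\<omega>. cls i (Z 0 \<omega>))" 
    by (rule integrable_bounded_Z[OF borel_cls cls_range(3)])
  have "ex (cls i) - SG i R = expectation (\<lambda>\<omega>. cls i (Z 0 \<omega>) - cls i (Z 0 \<omega>) * of_bool (fst (Z 0 \<omega>) \<le> R))"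
    unfolding SG_def ex_def by (rule Bochner_Integration.integral_diff[OF it i, symmetric])
  also have "\<dots> \<le> expectation (\<lambda>\<omega>. indicator {\<omega>\<in>space M. R < T 0 \<omega>} \<omega>)"
    by (rule integral_mono[OF Bochner_Integration.integrable_diff[OF it i]])
       (auto simp: Z_def cls_def indicator_def intro!: integrable_const_bound[where B = 1])
  also have "\<dots> = prob {\<omega>\<in>space M. R < T 0 \<omega>}" by simp
  also have "\<dots> = 1 - prob {\<omega>\<in>space M. T 0 \<omega> \<le> R}"
  proof -
    have "{\<omega>\<in>space M. R < T 0 \<omega>} = space M - {\<omega>\<in>space M. T 0 \<omega> \<le> R}" by auto
    then show ?thesis by (simp add: prob_compl)
  qed
  also have "prob {\<omega>\<in>space M. T 0 \<omega> \<le> R} = G R"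
    unfolding cdf_T[of 0, symmetric] cdf_def
    by (subst measure_distr) (auto intro!: arg_cong[where f = "measure M"])
  finally have "ex (cls i) \<le> SG i R + e" using R by simp
  then show "\<exists>R. ex (cls i) \<le> ex (\<lambda>z. cls i z * of_bool (fst z \<le> R)) + e" unfolding SG_def by blast
qed (simp_all only: borel_cls_le borel_cls cls_le_range cls_range)

end

section \<open>Uniform consistency near the point and coincidence with the naive estimator\<close>

text \<open>The number \<open>d i j\<close> is the coefficient of \<open>x ^ j\<close> in the Taylor expansion of \<open>sg i\<close> at \<open>t\<close>, so that \<open>d 1 0 / (d 0 0 + d 1 0)\<close>
  stands for \<open>F0 t\<close>. The assumptions are what the probabilistic part needs to know about the two
  subdensities: strict differentiability and a third-order expansion at \<open>t\<close>, a positive density of the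
  observation times at \<open>t\<close>, a positive derivative of the ratio, and a limiting curve that stays
  away from its tangent at \<open>t\<close> outside of neighbourhoods of \<open>t\<close>.\<close>

locale cs_point = current_status M X T F0 G g + kernel_fun k
  for M :: "'a measure" and X T :: "nat \<Rightarrow> 'a \<Rightarrow> real" and F0 G g k :: "real \<Rightarrow> real" +
  fixes t c :: real and d :: "nat \<Rightarrow> nat \<Rightarrow> real"
  assumes t_pos: "t > 0" and c_pos: "c > 0"
    and strict_diff: "\<And>i e. i = 0 \<or> i = 1 \<Longrightarrow> e > 0 \<Longrightarrow>
      \<exists>\<delta>>0. \<forall>s x. \<bar>s - t\<bar> < \<delta> \<longrightarrow> \<bar>x\<bar> < \<delta> \<longrightarrow> \<bar>sg i (s + x) - sg i s - d i 1 * x\<bar> \<le> e * \<bar>x\<bar>"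
    and Peano: "\<And>i e. i = 0 \<or> i = 1 \<Longrightarrow> e > 0 \<Longrightarrow>
      \<exists>\<delta>>0. \<forall>x. \<bar>x\<bar> < \<delta> \<longrightarrow> \<bar>sg i (t + x) - (\<Sum>j\<le>3. d i j * x ^ j)\<bar> \<le> e * \<bar>x\<bar> ^ 3"
    and a_pos: "d 0 0 + d 1 0 > 0"
    and slope_pos: "(d 0 0 + d 1 0) * d 1 1 - (d 0 1 + d 1 1) * d 1 0 > 0"
    and separation: "\<And>e. e > 0 \<Longrightarrow> \<exists>\<gamma>>0. \<forall>u\<ge>0. \<bar>u - t\<bar> \<ge> e \<longrightarrow>
      \<gamma> \<le> SG 1 u - SG 1 t - d 1 0 / (d 0 0 + d 1 0) * (SG 0 u + SG 1 u - (SG 0 t + SG 1 t))"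
begin

abbreviation "hn \<equiv> bandwidth c"

abbreviation ts :: "'a \<Rightarrow> nat \<Rightarrow> real" where "ts \<omega> \<equiv> (\<lambda>j. T j \<omega>)"
abbreviation ds :: "'a \<Rightarrow> nat \<Rightarrow> nat" where "ds \<omega> \<equiv> (\<lambda>j. status (X j \<omega>) (T j \<omega>))"

lemma hn_pos: "n > 0 \<Longrightarrow> hn n > 0" using c_pos by (simp add: bandwidth_def)

lemma hn_tendsto: "hn \<longlonglongrightarrow> 0" unfolding bandwidth_def by real_asymp

lemma hn_small: "e > 0 \<Longrightarrow> \<forall>\<^sub>F n in sequentially. 0 < hn n \<and> hn n < e"
  using eventually_conj[OF eventually_gt_at_top[of 0] order_tendstoD(2)[OF hn_tendsto, of e]]
  by (rule eventually_mono) (auto intro: hn_pos)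

lemma sg_cont:
  assumes i: "i = 0 \<or> i = 1" and e: "e > 0"
  shows "\<exists>\<delta>>0. \<forall>x. \<bar>x\<bar> < \<delta> \<longrightarrow> \<bar>sg i (t + x) - d i 0\<bar> \<le> e"
proof -
  obtain \<delta> where \<delta>: "\<delta> > 0" "\<And>x. \<bar>x\<bar> < \<delta> \<Longrightarrow> \<bar>sg i (t + x) - (\<Sum>j\<le>3. d i j * x ^ j)\<bar> \<le> (e / 2) * \<bar>x\<bar> ^ 3"
    using Peano[OF i, of "e / 2"] e by auto
  have "((\<lambda>x. \<Sum>j\<le>3. d i j * x ^ j) \<longlongrightarrow> (\<Sum>j\<le>3. d i j * 0 ^ j)) (at 0)" by (intro tendsto_intros)
  also have "(\<Sum>j\<le>3. d i j * 0 ^ j) = d i 0" by (simp add: numeral_3_eq_3)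
  finally have "\<forall>\<^sub>F x in at 0. dist (\<Sum>j\<le>3. d i j * x ^ j) (d i 0) < e / 2"
    by (rule tendstoD) (use e in simp)
  then obtain \<eta> where \<eta>: "\<eta> > 0" "\<And>x. x \<noteq> 0 \<Longrightarrow> \<bar>x\<bar> < \<eta> \<Longrightarrow> \<bar>(\<Sum>j\<le>3. d i j * x ^ j) - d i 0\<bar> < e / 2"
    unfolding eventually_at by (auto simp: dist_real_def)
  have "\<bar>sg i (t + x) - d i 0\<bar> \<le> e" if x: "\<bar>x\<bar> < min 1 (min \<delta> \<eta>)" for x
  proof -
    have "\<bar>x\<bar> ^ 3 \<le> 1" using x by (intro power_le_one) auto
    then have "(e / 2) * \<bar>x\<bar> ^ 3 \<le> e / 2" using e by (simp add: mult_left_le)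
    moreover have "\<bar>(\<Sum>j\<le>3. d i j * x ^ j) - d i 0\<bar> \<le> e / 2"
    proof (cases "x = 0")
      case True
      then show ?thesis using e by (simp add: numeral_3_eq_3)
    next
      case False
      from \<eta>(2)[OF this] x show ?thesis by simp
    qed
    moreover have "\<bar>x\<bar> < \<delta>" using x by simp
    note \<delta>(2)[OF this]
    ultimately show ?thesis by linarith
  qed
  then show ?thesis using \<delta>(1) \<eta>(1) by (intro exI[of _ "min 1 (min \<delta> \<eta>)"]) auto
qed

lemma sg_bounded:
  assumes i: "i = 0 \<or> i = 1"
  shows "\<exists>B \<delta>. \<delta> > 0 \<and> B > 0 \<and> (\<forall>v. \<bar>v - t\<bar> < \<delta> \<longrightarrow> \<bar>sg i v\<bar> \<le> B)"
proof -
  obtain \<delta> where \<delta>: "\<delta> > 0" "\<And>x. \<bar>x\<bar> < \<delta> \<Longrightarrow> \<bar>sg i (t + x) - d i 0\<bar> \<le> 1"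
    using sg_cont[OF i, of 1] by auto
  have "\<bar>sg i v\<bar> \<le> \<bar>d i 0\<bar> + 1" if "\<bar>v - t\<bar> < \<delta>" for v using \<delta>(2)[of "v - t"] that by simp
  then show ?thesis using \<delta>(1) by (intro exI[of _ "\<bar>d i 0\<bar> + 1"] exI[of _ \<delta>]) auto
qed

text \<open>The contribution of one observation to the estimate (\<open>w = k\<close>, \<open>r = 1\<close>) and to its derivative
  (\<open>w = k'\<close>, \<open>r = 2\<close>); products of \<open>k\<close> and \<open>k'\<close> as \<open>w\<close> occur in the second moments.\<close>

definition \<psi> :: "nat \<Rightarrow> (real \<Rightarrow> real) \<Rightarrow> nat \<Rightarrow> real \<Rightarrow> real \<Rightarrow> real \<times> real \<Rightarrow> real" where
  "\<psi> i w r h s z = cls i z * (w ((s - fst z) / h) / h ^ r)"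

lemma borel_psi [measurable]:
  assumes [measurable]: "w \<in> borel_measurable borel"
  shows "\<psi> i w r h s \<in> borel_measurable (borel \<Otimes>\<^sub>M borel)"
  unfolding \<psi>_def[abs_def] by measurable

lemma psi_bound:
  assumes "\<And>u. \<bar>w u\<bar> \<le> K" "h \<ge> 0"
  shows "\<bar>\<psi> i w r h s z\<bar> \<le> K / h ^ r"
proof -
  have "\<bar>cls i z\<bar> * \<bar>w ((s - fst z) / h) / h ^ r\<bar> \<le> 1 * (K / h ^ r)"
    using assms cls_range(3) by (intro mult_mono) (auto simp: divide_right_mono)
  then show ?thesis by (simp add: \<psi>_def abs_mult)
qed

lemma ghat_avg: "h > 0 \<Longrightarrow> s \<ge> h \<Longrightarrow> ghat_sub k h n (ts \<omega>) (ds \<omega>) i s = avg n (\<psi> i k 1 h s) \<omega>"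
  unfolding ghat_sub_interior avg_def \<psi>_def cls_def Z_def by simp

lemma dghat_avg: "dghat h n (ts \<omega>) (ds \<omega>) i s = avg n (\<psi> i k' 2 h s) \<omega>"
  unfolding dghat_def avg_def \<psi>_def cls_def Z_def by simp

lemma ex_psi:
  assumes i: "i = 0 \<or> i = 1" and w[measurable]: "w \<in> borel_measurable borel" and K: "\<And>u. \<bar>w u\<bar> \<le> K" and h: "h > 0"
  shows "ex (\<psi> i w r h s) = h / h ^ r * (LINT u|lborel. w u * sg i (s - h * u))"
proof -
  have "ex (\<psi> i w r h s) = (LINT v|lborel. sg i v * (w ((s - v) / h) / h ^ r))"
    unfolding \<psi>_def[abs_def]
    by (rule ex_cls[OF i, where \<phi> = "\<lambda>v. w ((s - v) / h) / h ^ r" and K = "K / h ^ r"])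
       (use K h in \<open>auto simp: abs_mult divide_right_mono\<close>)
  also have "\<dots> = (LINT v|lborel. (1 / h ^ r) * (w ((s - v) / h) * sg i v))"
    by (intro Bochner_Integration.integral_cong) auto
  also have "\<dots> = (1 / h ^ r) * (LINT v|lborel. w ((s - v) / h) * sg i v)" by simp
  also have "(LINT v|lborel. w ((s - v) / h) * sg i v) = h * (LINT u|lborel. w u * sg i (s - h * u))"
    by (rule kernel_substitution[OF h])
  finally show ?thesis by simp
qed

lemma ex_psi_square_le:
  assumes i: "i = 0 \<or> i = 1" and w[measurable]: "w \<in> borel_measurable borel" and K: "\<And>u. \<bar>w u\<bar> \<le> K"
    and wz: "\<And>u. \<bar>u\<bar> \<ge> 1 \<Longrightarrow> w u = 0"
    and B: "\<And>v. \<bar>v - t\<bar> < \<delta> \<Longrightarrow> \<bar>sg i v\<bar> \<le> B" and h: "h > 0" "h < \<delta> / 2" and s: "\<bar>s - t\<bar> \<le> \<delta> / 2"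
  shows "ex (\<lambda>z. (\<psi> i w r h s z)\<^sup>2) \<le> 2 * B * K\<^sup>2 * (h / (h ^ r)\<^sup>2)"
proof -
  have K2: "(w u)\<^sup>2 \<le> K\<^sup>2" for u using power_mono[OF K[of u], of 2] by simp
  have K2': "(w u / h ^ r)\<^sup>2 \<le> K\<^sup>2 / (h ^ r)\<^sup>2" for u unfolding power_divide using K2 by (rule divide_right_mono) simp
  have B0: "0 \<le> B" using B[of t] h by (auto intro: order_trans[OF abs_ge_zero])
  have "(\<lambda>z. (\<psi> i w r h s z)\<^sup>2) = (\<lambda>z. cls i z * (w ((s - fst z) / h) / h ^ r)\<^sup>2)"
    unfolding \<psi>_def power_mult_distrib by (auto simp: fun_eq_iff cls_def)
  then have "ex (\<lambda>z. (\<psi> i w r h s z)\<^sup>2) = (LINT v|lborel. sg i v * (w ((s - v) / h) / h ^ r)\<^sup>2)"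
    by (simp only:) (rule ex_cls[OF i, where \<phi> = "\<lambda>v. (w ((s - v) / h) / h ^ r)\<^sup>2" and K = "K\<^sup>2 / (h ^ r)\<^sup>2"],
        measurable, use K2' in simp)
  also have "\<dots> \<le> (LINT v|lborel. B * (K\<^sup>2 / (h ^ r)\<^sup>2) * indicator {s - h..s + h} v)"
  proof (rule Bochner_Integration.integral_mono)
    show "integrable lborel (\<lambda>v. sg i v * (w ((s - v) / h) / h ^ r)\<^sup>2)"
      by (rule integrable_sg_mult[where K = "K\<^sup>2 / (h ^ r)\<^sup>2"]) (use K2' in auto)
    show "integrable lborel (\<lambda>v. B * (K\<^sup>2 / (h ^ r)\<^sup>2) * indicator {s - h..s + h} v)"
      by (rule integrable_mult_right) simp
    fix v
    show "sg i v * (w ((s - v) / h) / h ^ r)\<^sup>2 \<le> B * (K\<^sup>2 / (h ^ r)\<^sup>2) * indicator {s - h..s + h} v"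
    proof (cases "v \<in> {s - h..s + h}")
      case True
      then have "s - h \<le> v" "v \<le> s + h" by auto
      then have "\<bar>v - t\<bar> < \<delta>" using h s by linarith
      from B[OF this] have "sg i v * (w ((s - v) / h) / h ^ r)\<^sup>2 \<le> B * (K\<^sup>2 / (h ^ r)\<^sup>2)"
        using K2'[of "(s - v) / h"] by (intro mult_mono) (auto simp: B0)
      then show ?thesis using True by simp
    next
      case False
      have "\<bar>s - v\<bar> > h" using False by auto
      then have "1 \<le> \<bar>(s - v) / h\<bar>" using h by (simp add: abs_divide le_divide_eq)
      then show ?thesis using False by (simp add: wz)
    qed
  qed
  also have "\<dots> = 2 * B * K\<^sup>2 * (h / (h ^ r)\<^sup>2)" using h by simp
  finally show ?thesis .
qed

text \<open>Chebyshev's inequality gives a probability of order \<open>1 / (n h\<^sup>3)\<close> for a deviation at one argument, and by the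
  Lipschitz condition the averages move by at most \<open>h\<^sup>-\<^sup>3\<close> times the mesh of a grid of arguments. A grid of about
  \<open>sqrt n\<close> points makes both harmless: \<open>sqrt n / (n h\<^sup>3)\<close> and \<open>h\<^sup>-\<^sup>3 / sqrt n\<close> are of order
  \<open>n\<^sup>-\<^sup>1\<^sup>/\<^sup>1\<^sup>4\<close>.\<close>

lemma uniform_local:
  assumes i: "i = 0 \<or> i = 1" and w[measurable]: "w \<in> borel_measurable borel" and K: "\<And>u. \<bar>w u\<bar> \<le> K"
    and wz: "\<And>u. \<bar>u\<bar> \<ge> 1 \<Longrightarrow> w u = 0" and Lip: "\<And>u v. \<bar>w u - w v\<bar> \<le> K * \<bar>u - v\<bar>"
    and r: "r = 1 \<or> r = 2" and e: "e > 0"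
    and \<delta>2: "\<delta>2 > 0" and mean: "\<forall>\<^sub>F n in sequentially. \<forall>s. \<bar>s - t\<bar> \<le> \<delta>2 \<longrightarrow> \<bar>ex (\<psi> i w r (hn n) s) - m\<bar> \<le> e"
  shows "\<exists>\<delta>>0. whp (\<lambda>n \<omega>. \<forall>s. \<bar>s - t\<bar> \<le> \<delta> \<longrightarrow> \<bar>avg n (\<psi> i w r (hn n) s) \<omega> - m\<bar> \<le> 3 * e)"
proof -
  have K0: "0 \<le> K" using order_trans[OF abs_ge_zero K[of 0]] .
  obtain B \<delta>1 where B: "\<delta>1 > 0" "B > 0" "\<And>v. \<bar>v - t\<bar> < \<delta>1 \<Longrightarrow> \<bar>sg i v\<bar> \<le> B"
    using sg_bounded[OF i] by blast
  define \<delta> where "\<delta> = min (\<delta>1 / 2) \<delta>2"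
  have \<delta>: "\<delta> > 0" "\<delta> \<le> \<delta>1 / 2" "\<delta> \<le> \<delta>2" using B(1) \<delta>2 by (auto simp: \<delta>_def)
  define N where "N n = Suc (nat \<lceil>sqrt (real n)\<rceil>)" for n
  have Nb: "sqrt (real n) \<le> real (N n)" "real (N n) \<le> sqrt (real n) + 2" "N n > 0" for n
  proof -
    have "0 \<le> \<lceil>sqrt (real n)\<rceil>" by (simp add: order_less_le_trans[of "-1" 0])
    then have "real (N n) = of_int \<lceil>sqrt (real n)\<rceil> + 1" unfolding N_def by simp
    then show "sqrt (real n) \<le> real (N n)" "real (N n) \<le> sqrt (real n) + 2" by linarith+
  qed (simp add: N_def)
  define s where "s n l = t - \<delta> + 2 * \<delta> * real l / real (N n)" for n l :: nat
  have s_rng: "\<bar>s n l - t\<bar> \<le> \<delta>" if "l \<le> N n" for n l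
  proof -
    have "0 \<le> real l / real (N n)" "real l / real (N n) \<le> 1" using that Nb(3)[of n] by auto
    then have "0 \<le> 2 * \<delta> * (real l / real (N n))" "2 * \<delta> * (real l / real (N n)) \<le> 2 * \<delta> * 1"
      using \<delta>(1) by (intro mult_nonneg_nonneg mult_left_mono; simp)+
    moreover have "s n l - t = - \<delta> + 2 * \<delta> * (real l / real (N n))" unfolding s_def by simp
    ultimately show ?thesis unfolding abs_le_iff by linarith
  qed
  define Bad where "Bad n = (\<Union>l\<in>{..N n}. {\<omega>\<in>space M. \<bar>avg n (\<psi> i w r (hn n) (s n l)) \<omega> - ex (\<psi> i w r (hn n) (s n l))\<bar> \<ge> e})" for n
  define b where "b n = (2 * B * K\<^sup>2 / e\<^sup>2) * ((sqrt (real n) + 3) / ((hn n) ^ 3 * real n))" for n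
  have b0: "b \<longlonglongrightarrow> 0"
  proof -
    have "(\<lambda>n. (sqrt (real n) + 3) / ((c * real n powr (-1/7)) ^ 3 * real n)) \<longlonglongrightarrow> 0"
      using c_pos by real_asymp
    from tendsto_mult[OF tendsto_const[of "2 * B * K\<^sup>2 / e\<^sup>2"] this]
    show ?thesis unfolding b_def bandwidth_def by simp
  qed
  define L where "L n = K * (2 * \<delta>) * (1 / ((hn n) ^ 3 * sqrt (real n)))" for n
  have L0: "L \<longlonglongrightarrow> 0"
  proof -
    have "(\<lambda>n. 1 / ((c * real n powr (-1/7)) ^ 3 * sqrt (real n))) \<longlonglongrightarrow> 0"
      using c_pos by real_asymp
    from tendsto_mult[OF tendsto_const[of "K * (2 * \<delta>)"] this]
    show ?thesis unfolding L_def bandwidth_def by simp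
  qed
  have "whp (\<lambda>n \<omega>. \<forall>s. \<bar>s - t\<bar> \<le> \<delta> \<longrightarrow> \<bar>avg n (\<psi> i w r (hn n) s) \<omega> - m\<bar> \<le> 3 * e)"
  proof (rule whpI[of Bad b])
    have "\<forall>\<^sub>F n in sequentially. 0 < hn n \<and> hn n < min 1 (\<delta>1 / 2)" using B(1) by (intro hn_small) auto
    then show "\<forall>\<^sub>F n in sequentially. Bad n \<in> events \<and> prob (Bad n) \<le> b n"
      using eventually_gt_at_top[of 0]
    proof eventually_elim
      case (elim n)
      have h: "0 < hn n" "hn n < \<delta>1 / 2" "hn n \<le> 1" and n: "n > 0" using elim by auto
      have hr: "hn n / (hn n ^ r)\<^sup>2 \<le> 1 / hn n ^ 3"
        using r h by (auto simp: power2_eq_square power3_eq_cube field_simps mult_le_one)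
      have P: "prob {\<omega>\<in>space M. \<bar>avg n (\<psi> i w r (hn n) (s n l)) \<omega> - ex (\<psi> i w r (hn n) (s n l))\<bar> \<ge> e}
          \<le> 2 * B * K\<^sup>2 / (hn n ^ 3 * (n * e\<^sup>2))" if "l \<le> N n" for l
      proof -
        have "prob {\<omega>\<in>space M. \<bar>avg n (\<psi> i w r (hn n) (s n l)) \<omega> - ex (\<psi> i w r (hn n) (s n l))\<bar> \<ge> e}
          \<le> ex (\<lambda>z. (\<psi> i w r (hn n) (s n l) z)\<^sup>2) / (n * e\<^sup>2)"
          by (rule avg_Chebyshev[where K = "K / hn n ^ r"]) (use h n e K in \<open>auto intro: psi_bound\<close>)
        also have "\<dots> \<le> 2 * B * K\<^sup>2 * (hn n / (hn n ^ r)\<^sup>2) / (n * e\<^sup>2)"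
        proof (intro divide_right_mono ex_psi_square_le[OF i w K wz B(3) h(1,2)])
          show "\<bar>s n l - t\<bar> \<le> \<delta>1 / 2" using s_rng[OF that] \<delta> by linarith
        qed auto
        also have "\<dots> \<le> 2 * B * K\<^sup>2 * (1 / hn n ^ 3) / (n * e\<^sup>2)"
          using hr B(2) by (intro divide_right_mono mult_left_mono) auto
        finally show ?thesis by simp
      qed
      have "prob (Bad n) \<le> (\<Sum>l\<in>{..N n}. prob {\<omega>\<in>space M. \<bar>avg n (\<psi> i w r (hn n) (s n l)) \<omega> - ex (\<psi> i w r (hn n) (s n l))\<bar> \<ge> e})"
        unfolding Bad_def by (rule finite_measure_subadditive_finite) auto
      also have "\<dots> \<le> (\<Sum>l\<in>{..N n}. 2 * B * K\<^sup>2 / (hn n ^ 3 * (n * e\<^sup>2)))"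
        by (rule sum_mono) (use P in auto)
      also have "\<dots> = (real (N n) + 1) * (2 * B * K\<^sup>2 / (hn n ^ 3 * (n * e\<^sup>2)))" by (simp add: add.commute)
      also have "\<dots> \<le> (sqrt (real n) + 3) * (2 * B * K\<^sup>2 / (hn n ^ 3 * (n * e\<^sup>2)))"
        using Nb(2)[of n] B(2) h by (intro mult_right_mono divide_nonneg_nonneg) auto
      also have "\<dots> = b n" unfolding b_def by (simp add: ac_simps)
      finally have "prob (Bad n) \<le> b n" .
      moreover have "Bad n \<in> events" unfolding Bad_def by (intro sets.finite_UN) auto
      ultimately show ?case by blast
    qed
    have "\<forall>\<^sub>F n in sequentially. L n < e" by (rule order_tendstoD(2)[OF L0 e])
    moreover have "\<forall>\<^sub>F n in sequentially. 0 < hn n \<and> hn n < 1" by (rule hn_small) simp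
    ultimately show "\<forall>\<^sub>F n in sequentially. \<forall>\<omega>\<in>space M - Bad n. \<forall>s. \<bar>s - t\<bar> \<le> \<delta> \<longrightarrow> \<bar>avg n (\<psi> i w r (hn n) s) \<omega> - m\<bar> \<le> 3 * e"
      using mean eventually_gt_at_top[of 0]
    proof eventually_elim
      case (elim n)
      have h: "0 < hn n" "hn n < 1" and n: "n > 0" using elim by auto
      show ?case
      proof (intro ballI allI impI)
        fix \<omega> x assume \<omega>: "\<omega> \<in> space M - Bad n" and x: "\<bar>x - t\<bar> \<le> \<delta>"
        \<comment> \<open>The position of \<open>x\<close> on the grid; \<open>s n l\<close> will be the grid point to its left.\<close>
        define q where "q = (x - t + \<delta>) * real (N n) / (2 * \<delta>)"
        define l where "l = nat \<lfloor>q\<rfloor>"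
        have "0 \<le> x - t + \<delta>" using x by auto
        then have q0: "0 \<le> q" using \<delta>(1) by (simp add: q_def)
        then have l: "real l \<le> q" "q \<le> real l + 1" unfolding l_def by linarith+
        have "q \<le> real (N n)"
        proof -
          have "(x - t + \<delta>) * real (N n) \<le> (2 * \<delta>) * real (N n)" using x by (intro mult_right_mono) auto
          then show ?thesis using \<delta>(1) by (simp add: q_def divide_le_eq mult.commute)
        qed
        then have lN: "l \<le> N n" using l(1) by linarith
        have xq: "x = t - \<delta> + 2 * \<delta> * q / real (N n)" using Nb(3)[of n] \<delta>(1) by (simp add: q_def field_simps)
        have "x - s n l = 2 * \<delta> * ((q - real l) / real (N n))" unfolding xq s_def by (simp add: algebra_simps diff_divide_distrib)
        then have "\<bar>x - s n l\<bar> = 2 * \<delta> * (\<bar>q - real l\<bar> / real (N n))" using \<delta>(1) by (simp add: abs_mult)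
        also have "\<dots> \<le> 2 * \<delta> * (1 / sqrt (real n))"
        proof (rule mult_left_mono)
          have "\<bar>q - real l\<bar> \<le> 1" using l by auto
          then show "\<bar>q - real l\<bar> / real (N n) \<le> 1 / sqrt (real n)" using Nb(1)[of n] n by (intro frac_le) auto
        qed (use \<delta> in simp)
        finally have xs: "\<bar>x - s n l\<bar> \<le> 2 * \<delta> * (1 / sqrt (real n))" .
        have pw: "\<bar>\<psi> i w r (hn n) x z - \<psi> i w r (hn n) (s n l) z\<bar> \<le> L n" for z
        proof -
          have "\<bar>\<psi> i w r (hn n) x z - \<psi> i w r (hn n) (s n l) z\<bar>
              = \<bar>cls i z\<bar> * (\<bar>w ((x - fst z) / hn n) - w ((s n l - fst z) / hn n)\<bar> / hn n ^ r)"
            unfolding \<psi>_def right_diff_distrib[symmetric] diff_divide_distrib[symmetric] abs_mult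
            using h by simp
          also have "\<dots> \<le> 1 * ((K * (2 * \<delta> * (1 / sqrt (real n)) / hn n)) / hn n ^ r)"
          proof (intro mult_mono divide_right_mono)
            have "\<bar>w ((x - fst z) / hn n) - w ((s n l - fst z) / hn n)\<bar> \<le> K * \<bar>(x - fst z) / hn n - (s n l - fst z) / hn n\<bar>"
              by (rule Lip)
            also have "\<bar>(x - fst z) / hn n - (s n l - fst z) / hn n\<bar> = \<bar>x - s n l\<bar> / hn n"
              using h by (simp add: diff_divide_distrib[symmetric])
            also have "K * (\<bar>x - s n l\<bar> / hn n) \<le> K * (2 * \<delta> * (1 / sqrt (real n)) / hn n)"
              using xs h K0 by (intro mult_left_mono divide_right_mono) auto
            finally show "\<bar>w ((x - fst z) / hn n) - w ((s n l - fst z) / hn n)\<bar> \<le> K * (2 * \<delta> * (1 / sqrt (real n)) / hn n)" .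
          qed (use cls_range h in auto)
          also have "\<dots> = K * (2 * \<delta>) * (1 / sqrt (real n)) * (1 / (hn n * hn n ^ r))" by simp
          also have "\<dots> \<le> K * (2 * \<delta>) * (1 / sqrt (real n)) * (1 / hn n ^ 3)"
          proof (rule mult_left_mono)
            have "hn n ^ 3 \<le> hn n ^ Suc r" using r h by (intro power_decreasing) auto
            then show "1 / (hn n * hn n ^ r) \<le> 1 / hn n ^ 3" using h by (intro frac_le) auto
          qed (use K0 \<delta> in simp)
          also have "\<dots> = L n" unfolding L_def by simp
          finally show ?thesis .
        qed
        have "\<bar>avg n (\<psi> i w r (hn n) x) \<omega> - avg n (\<psi> i w r (hn n) (s n l)) \<omega>\<bar>
            = \<bar>\<Sum>j<n. \<psi> i w r (hn n) x (Z j \<omega>) - \<psi> i w r (hn n) (s n l) (Z j \<omega>)\<bar> / real n"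
          unfolding avg_def diff_divide_distrib[symmetric] sum_subtractf[symmetric] by simp
        also have "\<dots> \<le> (\<Sum>j<n. L n) / real n"
          using pw by (intro divide_right_mono order_trans[OF sum_abs sum_mono]) auto
        also have "\<dots> = L n" using n by simp
        finally have 1: "\<bar>avg n (\<psi> i w r (hn n) x) \<omega> - avg n (\<psi> i w r (hn n) (s n l)) \<omega>\<bar> \<le> e" using elim by linarith
        have 2: "\<bar>avg n (\<psi> i w r (hn n) (s n l)) \<omega> - ex (\<psi> i w r (hn n) (s n l))\<bar> < e"
        proof (rule ccontr)
          assume "\<not> ?thesis"
          then have bad: "e \<le> \<bar>avg n (\<psi> i w r (hn n) (s n l)) \<omega> - ex (\<psi> i w r (hn n) (s n l))\<bar>" by simp
          have "\<omega> \<in> Bad n" unfolding Bad_def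
          proof (rule UN_I[of l])
            show "\<omega> \<in> {\<omega>\<in>space M. \<bar>avg n (\<psi> i w r (hn n) (s n l)) \<omega> - ex (\<psi> i w r (hn n) (s n l))\<bar> \<ge> e}"
              using bad DiffD1[OF \<omega>] by simp
          qed (use lN in simp)
          then show False using \<omega> by simp
        qed
        have 3: "\<bar>ex (\<psi> i w r (hn n) (s n l)) - m\<bar> \<le> e"
          using elim s_rng[OF lN] \<delta>(3) by auto
        show "\<bar>avg n (\<psi> i w r (hn n) x) \<omega> - m\<bar> \<le> 3 * e" using 1 2 3 by linarith
      qed
    qed
  qed (rule b0)
  then show ?thesis using \<delta>(1) by blast
qed

lemma mean_ghat:
  assumes i: "i = 0 \<or> i = 1" and e: "e > 0"
  shows "\<exists>\<delta>>0. \<forall>\<^sub>F n in sequentially. \<forall>s. \<bar>s - t\<bar> \<le> \<delta> \<longrightarrow> \<bar>ex (\<psi> i k 1 (hn n) s) - d i 0\<bar> \<le> e"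
proof -
  have e': "e / (2 * Kb) > 0" using e Kb_pos by simp
  obtain \<delta> where \<delta>: "\<delta> > 0" "\<And>x. \<bar>x\<bar> < \<delta> \<Longrightarrow> \<bar>sg i (t + x) - d i 0\<bar> \<le> e / (2 * Kb)"
    using sg_cont[OF i e'] by blast
  have "\<forall>\<^sub>F n in sequentially. 0 < hn n \<and> hn n < \<delta> / 2" by (rule hn_small) (use \<delta> in simp)
  then have "\<forall>\<^sub>F n in sequentially. \<forall>s. \<bar>s - t\<bar> \<le> \<delta> / 2 \<longrightarrow> \<bar>ex (\<psi> i k 1 (hn n) s) - d i 0\<bar> \<le> e"
  proof (eventually_elim, intro allI impI)
    fix n s assume h: "0 < hn n \<and> hn n < \<delta> / 2" and s: "\<bar>s - t\<bar> \<le> \<delta> / 2"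
    have "\<bar>(LINT u|lborel. k u * sg i (s - hn n * u)) - (\<Sum>j\<le>0. d i 0 * (- hn n) ^ j * (LINT u|lborel. u ^ j * k u))\<bar>
        \<le> 2 * Kb * (e / (2 * Kb)) * hn n ^ 0"
    proof (rule smoothing_expansion(2)[where \<delta> = "\<delta> / 2"])
      fix x :: real assume "\<bar>x\<bar> < \<delta> / 2"
      then have "\<bar>s - t + x\<bar> < \<delta>" using s by linarith
      from \<delta>(2)[OF this] show "\<bar>sg i (s + x) - (\<Sum>j\<le>0. d i 0 * x ^ j)\<bar> \<le> e / (2 * Kb) * \<bar>x\<bar> ^ 0" by (simp add: algebra_simps)
    qed (use h e' in \<open>auto simp: k_zero Kb\<close>)
    then show "\<bar>ex (\<psi> i k 1 (hn n) s) - d i 0\<bar> \<le> e"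
      using ex_psi[OF i borel_k Kb(3), of "hn n" 1 s] h Kb_pos k_int_1 by simp
  qed
  then show ?thesis using \<delta>(1) by (intro exI[of _ "\<delta> / 2"]) auto
qed

text \<open>This is where strict differentiability is used: since \<open>k'\<close> has vanishing integral, the mean at \<open>s\<close> is a difference
  quotient of \<open>sg i\<close> near \<open>s\<close>, and it has to be close to the derivative at \<open>t\<close> for all \<open>s\<close> near \<open>t\<close>.\<close>

lemma mean_dghat:
  assumes i: "i = 0 \<or> i = 1" and e: "e > 0"
  shows "\<exists>\<delta>>0. \<forall>\<^sub>F n in sequentially. \<forall>s. \<bar>s - t\<bar> \<le> \<delta> \<longrightarrow> \<bar>ex (\<psi> i k' 2 (hn n) s) - d i 1\<bar> \<le> e"
proof -
  have e': "e / (2 * Kb) > 0" using e Kb_pos by simp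
  obtain \<delta> where \<delta>: "\<delta> > 0" "\<And>s x. \<bar>s - t\<bar> < \<delta> \<Longrightarrow> \<bar>x\<bar> < \<delta> \<Longrightarrow> \<bar>sg i (s + x) - sg i s - d i 1 * x\<bar> \<le> e / (2 * Kb) * \<bar>x\<bar>"
    using strict_diff[OF i e'] by blast
  have "\<forall>\<^sub>F n in sequentially. 0 < hn n \<and> hn n < \<delta>" by (rule hn_small) (use \<delta> in simp)
  then have "\<forall>\<^sub>F n in sequentially. \<forall>s. \<bar>s - t\<bar> \<le> \<delta> / 2 \<longrightarrow> \<bar>ex (\<psi> i k' 2 (hn n) s) - d i 1\<bar> \<le> e"
  proof (eventually_elim, intro allI impI)
    fix n s assume h: "0 < hn n \<and> hn n < \<delta>" and s: "\<bar>s - t\<bar> \<le> \<delta> / 2"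
    define D where "D j = (if j = 0 then sg i s else d i 1)" for j :: nat
    have "\<bar>(LINT u|lborel. k' u * sg i (s - hn n * u)) - (\<Sum>j\<le>1. D j * (- hn n) ^ j * (LINT u|lborel. u ^ j * k' u))\<bar>
        \<le> 2 * Kb * (e / (2 * Kb)) * hn n ^ 1"
    proof (rule smoothing_expansion(2)[where \<delta> = \<delta>])
      fix x :: real assume x: "\<bar>x\<bar> < \<delta>"
      have "\<bar>s - t\<bar> < \<delta>" using s \<delta>(1) by auto
      from \<delta>(2)[OF this x] show "\<bar>sg i (s + x) - (\<Sum>j\<le>1. D j * x ^ j)\<bar> \<le> e / (2 * Kb) * \<bar>x\<bar> ^ 1"
        by (simp add: D_def algebra_simps)
    qed (use h e' in \<open>auto simp: k'_zero Kb\<close>)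
    then have "\<bar>(LINT u|lborel. k' u * sg i (s - hn n * u)) - d i 1 * hn n\<bar> \<le> e * hn n"
      using moments_k'(1,2) Kb_pos by (simp add: D_def)
    then have "\<bar>(LINT u|lborel. k' u * sg i (s - hn n * u)) - d i 1 * hn n\<bar> / hn n \<le> e * hn n / hn n"
      using h by (intro divide_right_mono) auto
    moreover have "ex (\<psi> i k' 2 (hn n) s) - d i 1 = ((LINT u|lborel. k' u * sg i (s - hn n * u)) - d i 1 * hn n) / hn n"
      using ex_psi[OF i borel_k' Kb(4), of "hn n" 2 s] h by (simp add: power2_eq_square diff_divide_distrib)
    ultimately show "\<bar>ex (\<psi> i k' 2 (hn n) s) - d i 1\<bar> \<le> e" using h by simp
  qed
  then show ?thesis using \<delta>(1) by (intro exI[of _ "\<delta> / 2"]) auto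
qed

lemma uniform_consistency:
  assumes e: "e > 0"
  shows "\<exists>\<delta>>0. whp (\<lambda>n \<omega>. \<forall>i\<in>{0, 1}. \<forall>s. \<bar>s - t\<bar> \<le> \<delta> \<longrightarrow>
    \<bar>avg n (\<psi> i k 1 (hn n) s) \<omega> - d i 0\<bar> \<le> e \<and> \<bar>avg n (\<psi> i k' 2 (hn n) s) \<omega> - d i 1\<bar> \<le> e)"
proof -
  have e3: "e / 3 > 0" using e by simp
  have "\<exists>\<delta>>0. whp (\<lambda>n \<omega>. \<forall>s. \<bar>s - t\<bar> \<le> \<delta> \<longrightarrow>
    \<bar>avg n (\<psi> i k 1 (hn n) s) \<omega> - d i 0\<bar> \<le> e \<and> \<bar>avg n (\<psi> i k' 2 (hn n) s) \<omega> - d i 1\<bar> \<le> e)" if i: "i = 0 \<or> i = 1" for i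
  proof -
    obtain \<delta>1 where "\<delta>1 > 0" "\<forall>\<^sub>F n in sequentially. \<forall>s. \<bar>s - t\<bar> \<le> \<delta>1 \<longrightarrow> \<bar>ex (\<psi> i k 1 (hn n) s) - d i 0\<bar> \<le> e / 3"
      using mean_ghat[OF i e3] by blast
    from uniform_local[OF i borel_k Kb(3) k_zero Lip_k _ e3 this]
    obtain \<eta>1 where \<eta>1: "\<eta>1 > 0" "whp (\<lambda>n \<omega>. \<forall>s. \<bar>s - t\<bar> \<le> \<eta>1 \<longrightarrow> \<bar>avg n (\<psi> i k 1 (hn n) s) \<omega> - d i 0\<bar> \<le> 3 * (e / 3))"
      by auto
    obtain \<delta>2 where "\<delta>2 > 0" "\<forall>\<^sub>F n in sequentially. \<forall>s. \<bar>s - t\<bar> \<le> \<delta>2 \<longrightarrow> \<bar>ex (\<psi> i k' 2 (hn n) s) - d i 1\<bar> \<le> e / 3"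
      using mean_dghat[OF i e3] by blast
    from uniform_local[OF i borel_k' Kb(4) k'_zero Lip_k' _ e3 this]
    obtain \<eta>2 where \<eta>2: "\<eta>2 > 0" "whp (\<lambda>n \<omega>. \<forall>s. \<bar>s - t\<bar> \<le> \<eta>2 \<longrightarrow> \<bar>avg n (\<psi> i k' 2 (hn n) s) \<omega> - d i 1\<bar> \<le> 3 * (e / 3))"
      by auto
    have "whp (\<lambda>n \<omega>. \<forall>s. \<bar>s - t\<bar> \<le> min \<eta>1 \<eta>2 \<longrightarrow>
      \<bar>avg n (\<psi> i k 1 (hn n) s) \<omega> - d i 0\<bar> \<le> e \<and> \<bar>avg n (\<psi> i k' 2 (hn n) s) \<omega> - d i 1\<bar> \<le> e)"
      by (rule whp_mono[OF whp_conj[OF \<eta>1(2) \<eta>2(2)]]) (rule always_eventually, simp)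
    then show ?thesis using \<eta>1(1) \<eta>2(1) by (intro exI[of _ "min \<eta>1 \<eta>2"]) auto
  qed
  from this[of 0] this[of 1]
  obtain \<delta>0 \<delta>1 where \<delta>: "\<delta>0 > 0" "\<delta>1 > 0"
    "whp (\<lambda>n \<omega>. \<forall>s. \<bar>s - t\<bar> \<le> \<delta>0 \<longrightarrow> \<bar>avg n (\<psi> 0 k 1 (hn n) s) \<omega> - d 0 0\<bar> \<le> e \<and> \<bar>avg n (\<psi> 0 k' 2 (hn n) s) \<omega> - d 0 1\<bar> \<le> e)"
    "whp (\<lambda>n \<omega>. \<forall>s. \<bar>s - t\<bar> \<le> \<delta>1 \<longrightarrow> \<bar>avg n (\<psi> 1 k 1 (hn n) s) \<omega> - d 1 0\<bar> \<le> e \<and> \<bar>avg n (\<psi> 1 k' 2 (hn n) s) \<omega> - d 1 1\<bar> \<le> e)"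
    by auto
  have "whp (\<lambda>n \<omega>. \<forall>i\<in>{0, 1}. \<forall>s. \<bar>s - t\<bar> \<le> min \<delta>0 \<delta>1 \<longrightarrow>
    \<bar>avg n (\<psi> i k 1 (hn n) s) \<omega> - d i 0\<bar> \<le> e \<and> \<bar>avg n (\<psi> i k' 2 (hn n) s) \<omega> - d i 1\<bar> \<le> e)"
    by (rule whp_mono[OF whp_conj[OF \<delta>(3,4)]]) (rule always_eventually, simp)
  then show ?thesis using \<delta>(1,2) by (intro exI[of _ "min \<delta>0 \<delta>1"]) auto
qed

lemma emp_SG_neg: "u < 0 \<Longrightarrow> emp n i u \<omega> = 0" "u < 0 \<Longrightarrow> SG i u = 0"
proof -
  assume u: "u < 0"
  have "(\<lambda>z. cls i z * of_bool (fst z \<le> u)) = (\<lambda>_. 0)" using u by (auto simp: cls_def fun_eq_iff)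
  then show "emp n i u \<omega> = 0" "SG i u = 0" unfolding emp_def SG_def by (simp_all add: avg_def ex_def)
qed

text \<open>By \<open>cwt_bounds\<close> the smoothed distribution function lies between shifts of the empirical one by \<open>h\<close>, up to a multiple of
  the proportion of observations in \<open>[0, 2 h]\<close>. The latter and the effect of the shifts are small because \<open>G\<close> is
  uniformly continuous.\<close>

lemma Ghat_uniform:
  assumes e: "e > 0"
  shows "whp (\<lambda>n \<omega>. \<forall>u\<ge>0. \<bar>Ghat_sub k (hn n) n (ts \<omega>) (ds \<omega>) i u - SG i u\<bar> \<le> e)"
proof -
  define \<rho> where "\<rho> = e / (4 * Cb + 4)"
  have \<rho>: "\<rho> > 0" "(4 * Cb + 4) * \<rho> = e" using e Cb_pos by (auto simp: \<rho>_def)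
  obtain \<delta> where \<delta>: "\<delta> > 0" "\<And>u. G (u + \<delta>) \<le> G u + \<rho>" using G_uniform[OF \<rho>(1)] by blast
  have "\<forall>\<^sub>F n in sequentially. 0 < hn n \<and> hn n < \<delta> / 2" by (rule hn_small) (use \<delta> in simp)
  with Glivenko_Cantelli[OF \<rho>(1), of i] show ?thesis
  proof (rule whp_mono[OF _ eventually_mono])
    fix n assume "0 < hn n \<and> hn n < \<delta> / 2"
    then have h: "0 < hn n" "hn n < \<delta> / 2" by auto
    show "\<forall>\<omega>\<in>space M. (\<forall>u\<ge>0. \<bar>emp n i u \<omega> - SG i u\<bar> \<le> \<rho>) \<longrightarrow> (\<forall>u\<ge>0. \<bar>Ghat_sub k (hn n) n (ts \<omega>) (ds \<omega>) i u - SG i u\<bar> \<le> e)"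
    proof (intro ballI impI allI)
      fix \<omega> and u :: real assume GC: "\<forall>u\<ge>0. \<bar>emp n i u \<omega> - SG i u\<bar> \<le> \<rho>" and u: "u \<ge> 0"
      have GC': "\<bar>emp n i u \<omega> - SG i u\<bar> \<le> \<rho>" for u
        using GC emp_SG_neg(1)[of u n i \<omega>] emp_SG_neg(2)[of u i] \<rho>(1) by (cases "u \<ge> 0") auto
      have eq: "Ghat_sub k (hn n) n (ts \<omega>) (ds \<omega>) i u = avg n (\<lambda>z. cls i z * cwt (hn n) u (fst z)) \<omega>"
        unfolding Ghat_sub_eq[OF h(1)] avg_def cls_def Z_def by simp
      have lin: "avg n (\<lambda>z. cls i z * of_bool (fst z \<le> p) + q * (cls i z * of_bool (fst z \<le> 2 * hn n))) \<omega>
          = emp n i p \<omega> + q * emp n i (2 * hn n) \<omega>" for p q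
        unfolding emp_def avg_def by (simp add: sum.distrib sum_distrib_left[symmetric] add_divide_distrib)
      have up: "Ghat_sub k (hn n) n (ts \<omega>) (ds \<omega>) i u \<le> emp n i (u + hn n) \<omega> + (2 * Cb + 1) * emp n i (2 * hn n) \<omega>"
        unfolding eq lin[symmetric]
      proof (rule avg_mono)
        fix z :: "real \<times> real"
        have "cls i z * cwt (hn n) u (fst z) \<le> cls i z * (of_bool (fst z \<le> u + hn n) + (2 * Cb + 1) * of_bool (fst z \<le> 2 * hn n))"
          by (rule mult_left_mono[OF cwt_bounds(1)[OF h(1)] cls_range(1)])
        then show "cls i z * cwt (hn n) u (fst z) \<le> cls i z * of_bool (fst z \<le> u + hn n) + (2 * Cb + 1) * (cls i z * of_bool (fst z \<le> 2 * hn n))"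
          by (simp add: algebra_simps)
      qed
      have lo: "emp n i (u - hn n) \<omega> + (- (2 * Cb + 1)) * emp n i (2 * hn n) \<omega> \<le> Ghat_sub k (hn n) n (ts \<omega>) (ds \<omega>) i u"
        unfolding eq lin[symmetric]
      proof (rule avg_mono)
        fix z :: "real \<times> real"
        have "cls i z * (of_bool (fst z \<le> u - hn n) - (2 * Cb + 1) * of_bool (fst z \<le> 2 * hn n)) \<le> cls i z * cwt (hn n) u (fst z)"
          by (rule mult_left_mono[OF cwt_bounds(2)[OF h(1)] cls_range(1)])
        then show "cls i z * of_bool (fst z \<le> u - hn n) + (- (2 * Cb + 1)) * (cls i z * of_bool (fst z \<le> 2 * hn n)) \<le> cls i z * cwt (hn n) u (fst z)"
          by (simp add: algebra_simps)
      qed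
      have G1: "G (v + hn n) \<le> G v + \<rho>" for v
        using \<delta>(2)[of v] G_mono[of "v + hn n" "v + \<delta>"] h \<delta>(1) by linarith
      have S1: "SG i (u + hn n) \<le> SG i u + \<rho>" using SG_increment(2)[of u "u + hn n" i] G1[of u] h by simp
      have S2: "SG i u \<le> SG i (u - hn n) + \<rho>" using SG_increment(2)[of "u - hn n" u i] G1[of "u - hn n"] h by simp
      have S3: "SG i (2 * hn n) \<le> \<rho>"
      proof -
        have "SG i (2 * hn n) \<le> SG i (-1) + (G (2 * hn n) - G (-1))" by (rule SG_increment) (use h in simp)
        moreover have "G (2 * hn n) \<le> G (0 + \<delta>)" using h by (intro G_mono) simp
        ultimately show ?thesis using \<delta>(2)[of 0] G_nonpos[of 0] G_nonpos[of "-1"] emp_SG_neg(2)[of "-1" i] by simp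
      qed
      have E3: "emp n i (2 * hn n) \<omega> \<le> 2 * \<rho>" using S3 GC'[of "2 * hn n"] by linarith
      have C3: "(2 * Cb + 1) * emp n i (2 * hn n) \<omega> \<le> (2 * Cb + 1) * (2 * \<rho>)"
        using E3 Cb_pos by (intro mult_left_mono) auto
      have "(2 * Cb + 1) * (2 * \<rho>) + 2 * \<rho> = e" using \<rho>(2) by (simp add: algebra_simps)
      moreover have "(- (2 * Cb + 1)) * emp n i (2 * hn n) \<omega> = - ((2 * Cb + 1) * emp n i (2 * hn n) \<omega>)"
        by (rule minus_mult_left[symmetric])
      ultimately show "\<bar>Ghat_sub k (hn n) n (ts \<omega>) (ds \<omega>) i u - SG i u\<bar> \<le> e"
        using up lo C3 S1 S2 GC'[of "u + hn n"] GC'[of "u - hn n"] by linarith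
    qed
  qed
qed

lemma SG_sum_bounds: "0 \<le> SG 0 u + SG 1 u" "SG 0 u + SG 1 u \<le> 1"
proof -
  have i: "integrable M (\<lambda>\<omega>. cls i (Z 0 \<omega>) * of_bool (fst (Z 0 \<omega>) \<le> u))" for i
    by (rule integrable_bounded_Z[OF borel_cls_le cls_le_range(3)])
  have eq: "SG 0 u + SG 1 u = expectation (\<lambda>\<omega>. cls 0 (Z 0 \<omega>) * of_bool (fst (Z 0 \<omega>) \<le> u) + cls 1 (Z 0 \<omega>) * of_bool (fst (Z 0 \<omega>) \<le> u))"
    unfolding SG_def ex_def by (rule Bochner_Integration.integral_add[OF i i, symmetric])
  show "0 \<le> SG 0 u + SG 1 u" unfolding eq by (rule Bochner_Integration.integral_nonneg) (simp add: cls_def)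
  have "SG 0 u + SG 1 u \<le> expectation (\<lambda>_. 1)" unfolding eq
    by (rule integral_mono[OF Bochner_Integration.integrable_add[OF i i]]) (auto simp: cls_def)
  then show "SG 0 u + SG 1 u \<le> 1" by (simp add: prob_space)
qed

lemma f_naive_eq:
  assumes h: "h > 0" "h < t"
  shows "f_naive k h n tt dd t =
    (let p = ghat_sub k h n tt dd 0 t + ghat_sub k h n tt dd 1 t; q = ghat_sub k h n tt dd 1 t;
         p' = dghat h n tt dd 0 t + dghat h n tt dd 1 t; q' = dghat h n tt dd 1 t
     in (p * q' - p' * q) / p\<^sup>2)"
  unfolding f_naive_def ghat_def Let_def by (simp add: DERIV_imp_deriv[OF DERIV_ghat_sub[OF h]])

text \<open>Here \<open>p\<close> and \<open>q\<close> are the estimates of \<open>g\<close> and of the subdensity of the class \<open>1\<close>, with limits \<open>a\<close> and \<open>b\<close> at \<open>t\<close>. If they and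
  their derivatives are close to the limits, then the numerator \<open>p q' - p' q\<close> of the derivative of \<open>q / p\<close> is positive
  near \<open>t\<close>. If moreover the integrated estimates are uniformly close to their limits, then the curve inherits
  at least half of the margin \<open>\<gamma>\<close> that separates the limiting curve from its tangent, and
  \<open>hull_slope_near\<close> applies.\<close>

theorem f_MS_eq_f_naive_whp:
  "whp (\<lambda>n \<omega>. f_MS k (hn n) n (ts \<omega>) (ds \<omega>) t = f_naive k (hn n) n (ts \<omega>) (ds \<omega>) t)"
proof -
  define a b a' b' where "a = d 0 0 + d 1 0" and "b = d 1 0" and "a' = d 0 1 + d 1 1" and "b' = d 1 1"
  have a: "a > 0" and D0: "a * b' - a' * b > 0" using a_pos slope_pos by (auto simp: a_def b_def a'_def b'_def)
  \<comment> \<open>If all estimates are within \<open>e1\<close>, the numerator \<open>p q' - p' q\<close> changes by at most \<open>e1 * C\<close>.\<close>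
  define C where "C = 2 * (\<bar>b'\<bar> + 1) + a + 2 * (\<bar>b\<bar> + 1) + \<bar>a'\<bar>"
  have C: "C > 0" using a abs_ge_zero[of b'] abs_ge_zero[of b] abs_ge_zero[of a'] unfolding C_def
    by (intro add_pos_nonneg add_pos_pos) (simp_all add: add_nonneg_pos)
  define e1 where "e1 = min 1 (min (a / 4) ((a * b' - a' * b) / (2 * C)))"
  have e1: "e1 > 0" "e1 \<le> 1" "e1 \<le> a / 4" "e1 * C \<le> (a * b' - a' * b) / 2"
  proof -
    show "e1 > 0" using a D0 C by (simp add: e1_def)
    have "e1 \<le> (a * b' - a' * b) / (2 * C)" by (simp add: e1_def)
    then show "e1 * C \<le> (a * b' - a' * b) / 2" using C by (simp add: field_simps)
  qed (auto simp: e1_def)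
  obtain \<delta>1 where \<delta>1: "\<delta>1 > 0" "whp (\<lambda>n \<omega>. \<forall>i\<in>{0, 1}. \<forall>s. \<bar>s - t\<bar> \<le> \<delta>1 \<longrightarrow>
    \<bar>avg n (\<psi> i k 1 (hn n) s) \<omega> - d i 0\<bar> \<le> e1 \<and> \<bar>avg n (\<psi> i k' 2 (hn n) s) \<omega> - d i 1\<bar> \<le> e1)"
    using uniform_consistency[OF e1(1)] by blast
  define \<delta> where "\<delta> = min \<delta>1 (t / 2)"
  have \<delta>: "\<delta> > 0" "\<delta> \<le> \<delta>1" "\<delta> \<le> t / 2" using \<delta>1 t_pos by (auto simp: \<delta>_def)
  obtain \<gamma> where \<gamma>: "\<gamma> > 0" "\<And>u. u \<ge> 0 \<Longrightarrow> \<bar>u - t\<bar> \<ge> \<delta> \<Longrightarrow>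
      \<gamma> \<le> SG 1 u - SG 1 t - b / a * (SG 0 u + SG 1 u - (SG 0 t + SG 1 t))"
    using separation[OF \<delta>(1)] unfolding a_def b_def by blast
  \<comment> \<open>The errors of the integrated estimates (through \<open>e2\<close>) and of the slope at \<open>t\<close> (through \<open>e3\<close>)
    each cost a fraction of the margin \<open>\<gamma>\<close>: \<open>2 * e2\<close>, \<open>4 * e2\<close> and \<open>\<gamma> / 14\<close>, together at most \<open>\<gamma> / 2\<close>.\<close>
  define e2 where "e2 = \<gamma> / 14"
  define e3 where "e3 = \<gamma> * a / (28 * (1 + 2 * \<bar>b\<bar> / a))"
  have e2: "e2 > 0" "e2 \<le> \<gamma> / 14" using \<gamma>(1) a by (auto simp: e2_def)
  have den: "1 + 2 * \<bar>b\<bar> / a > 0" using a by (intro add_pos_nonneg) auto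
  have e3: "e3 > 0" using \<gamma>(1) a den by (simp add: e3_def)
  obtain \<delta>3 where \<delta>3: "\<delta>3 > 0" "whp (\<lambda>n \<omega>. \<forall>i\<in>{0, 1}. \<forall>s. \<bar>s - t\<bar> \<le> \<delta>3 \<longrightarrow>
    \<bar>avg n (\<psi> i k 1 (hn n) s) \<omega> - d i 0\<bar> \<le> e3 \<and> \<bar>avg n (\<psi> i k' 2 (hn n) s) \<omega> - d i 1\<bar> \<le> e3)"
    using uniform_consistency[OF e3] by blast
  have small: "\<forall>\<^sub>F n in sequentially. 0 < hn n \<and> hn n < t / 2" by (rule hn_small) (use t_pos in simp)
  note W = whp_conj[OF whp_conj[OF \<delta>1(2) \<delta>3(2)] whp_conj[OF Ghat_uniform[OF e2(1), of 0] Ghat_uniform[OF e2(1), of 1]]]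
  show ?thesis
  proof (rule whp_mono[OF W], rule eventually_mono[OF small], intro ballI impI)
    fix n \<omega>
    assume hh: "0 < hn n \<and> hn n < t / 2"
    assume H: "((\<forall>i\<in>{0, 1}. \<forall>s. \<bar>s - t\<bar> \<le> \<delta>1 \<longrightarrow>
        \<bar>avg n (\<psi> i k 1 (hn n) s) \<omega> - d i 0\<bar> \<le> e1 \<and> \<bar>avg n (\<psi> i k' 2 (hn n) s) \<omega> - d i 1\<bar> \<le> e1) \<and>
       (\<forall>i\<in>{0, 1}. \<forall>s. \<bar>s - t\<bar> \<le> \<delta>3 \<longrightarrow>
        \<bar>avg n (\<psi> i k 1 (hn n) s) \<omega> - d i 0\<bar> \<le> e3 \<and> \<bar>avg n (\<psi> i k' 2 (hn n) s) \<omega> - d i 1\<bar> \<le> e3)) \<and>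
       (\<forall>u\<ge>0. \<bar>Ghat_sub k (hn n) n (ts \<omega>) (ds \<omega>) 0 u - SG 0 u\<bar> \<le> e2) \<and>
       (\<forall>u\<ge>0. \<bar>Ghat_sub k (hn n) n (ts \<omega>) (ds \<omega>) 1 u - SG 1 u\<bar> \<le> e2)"
    define h where "h = hn n"
    have h: "0 < h" "h < t / 2" using hh by (auto simp: h_def)
    let ?g = "ghat_sub k h n (ts \<omega>) (ds \<omega>)" and ?dg = "dghat h n (ts \<omega>) (ds \<omega>)" and ?G = "Ghat_sub k h n (ts \<omega>) (ds \<omega>)"
    define p q p' q' where "p s = ?g 0 s + ?g 1 s" and "q s = ?g 1 s"
      and "p' s = ?dg 0 s + ?dg 1 s" and "q' s = ?dg 1 s" for s
    have in_h: "s > h" if "\<bar>s - t\<bar> \<le> \<delta>" for s using that \<delta>(3) h by linarith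
    have gb: "\<bar>?g i s - d i 0\<bar> \<le> e1" "\<bar>?dg i s - d i 1\<bar> \<le> e1" if "i \<in> {0, 1}" "\<bar>s - t\<bar> \<le> \<delta>" for i s
      using H that \<delta>(2) in_h[OF that(2)] h unfolding dghat_avg h_def
      by (auto simp: ghat_avg less_imp_le)
    have pb: "\<bar>p s - a\<bar> \<le> 2 * e1" "\<bar>q s - b\<bar> \<le> e1" "\<bar>p' s - a'\<bar> \<le> 2 * e1" "\<bar>q' s - b'\<bar> \<le> e1"
      if "\<bar>s - t\<bar> \<le> \<delta>" for s
      using gb[of 0 s] gb[of 1 s] that unfolding p_def q_def p'_def q'_def a_def b_def a'_def b'_def by auto
    have p_pos: "p s > 0" if "\<bar>s - t\<bar> \<le> \<delta>" for s using pb(1)[OF that] e1(1,3) a by linarith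
    have D_pos: "p s * q' s - p' s * q s > 0" if s: "\<bar>s - t\<bar> \<le> \<delta>" for s
    proof -
      have 1: "\<bar>(p s - a) * q' s\<bar> \<le> (2 * e1) * (\<bar>b'\<bar> + 1)"
        unfolding abs_mult using pb[OF s] e1 by (intro mult_mono) auto
      have 2: "\<bar>a * (q' s - b')\<bar> \<le> a * e1"
        unfolding abs_mult using pb[OF s] a by (intro mult_mono) auto
      have 3: "\<bar>(p' s - a') * q s\<bar> \<le> (2 * e1) * (\<bar>b\<bar> + 1)"
        unfolding abs_mult using pb[OF s] e1 by (intro mult_mono) auto
      have 4: "\<bar>a' * (q s - b)\<bar> \<le> \<bar>a'\<bar> * e1"
        unfolding abs_mult using pb[OF s] by (intro mult_mono) auto
      have "p s * q' s - p' s * q s - (a * b' - a' * b)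
          = (p s - a) * q' s + a * (q' s - b') - (p' s - a') * q s - a' * (q s - b)" by (simp add: algebra_simps)
      moreover have "(2 * e1) * (\<bar>b'\<bar> + 1) + a * e1 + (2 * e1) * (\<bar>b\<bar> + 1) + \<bar>a'\<bar> * e1 = e1 * C"
        unfolding C_def by (simp add: algebra_simps)
      moreover have "0 < X" if "X - Y = x1 + x2 - x3 - x4" "y1 + y2 + y3 + y4 = E"
        "\<bar>x1\<bar> \<le> y1" "\<bar>x2\<bar> \<le> y2" "\<bar>x3\<bar> \<le> y3" "\<bar>x4\<bar> \<le> y4" "E \<le> Y / 2" "0 < Y"
        for X Y x1 x2 x3 x4 y1 y2 y3 y4 E :: real using that by linarith
      ultimately show ?thesis using 1 2 3 4 e1(4) D0 by blast
    qed
    have dp: "DERIV p s :> p' s" and dq: "DERIV q s :> q' s" if "\<bar>s - t\<bar> \<le> \<delta>" for s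
      unfolding p_def[abs_def] q_def[abs_def] p'_def q'_def
      by (intro DERIV_add DERIV_ghat_sub h in_h that)+
    have dr: "DERIV (\<lambda>s. q s / p s) s :> (p s * q' s - p' s * q s) / (p s)\<^sup>2" if "\<bar>s - t\<bar> \<le> \<delta>" for s
      using DERIV_divide[OF dq[OF that] dp[OF that]] p_pos[OF that]
      by (simp add: power2_eq_square algebra_simps)
    let ?x = "Ghat k h n (ts \<omega>) (ds \<omega>)" and ?\<tau> = "tau k h n (ts \<omega>) (ds \<omega>)"
    have x_eq: "?x = (\<lambda>u. ?G 0 u + ?G 1 u)" unfolding Ghat_eq[OF h(1), abs_def] ..
    have Gb: "\<bar>?G 0 u - SG 0 u\<bar> \<le> e2" "\<bar>?G 1 u - SG 1 u\<bar> \<le> e2" if "u \<ge> 0" for u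
      using H that unfolding h_def by auto
    have qp: "0 \<le> q t" "q t \<le> p t"
      using ghat_sub_nonneg[OF h(1), of t n "ts \<omega>" "ds \<omega>"] h t_pos unfolding p_def q_def by auto
    define r where "r = q t / p t"
    have tt: "\<bar>t - t\<bar> \<le> \<delta>" using \<delta> by simp
    have r01: "0 \<le> r" "r \<le> 1" using qp p_pos[OF tt] by (auto simp: r_def)
    have rF: "\<bar>r - b / a\<bar> \<le> \<gamma> / 14"
    proof -
      have "\<bar>?g i t - d i 0\<bar> \<le> e3" if "i \<in> {0, 1}" for i
        using H that \<delta>3(1) h t_pos unfolding h_def by (auto simp: ghat_avg less_imp_le)
      from this[of 0] this[of 1] have 1: "\<bar>p t - a\<bar> \<le> 2 * e3" "\<bar>q t - b\<bar> \<le> e3"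
        unfolding p_def q_def a_def b_def by auto
      have pt: "p t \<ge> a / 2" using pb(1)[OF tt] e1(3) by linarith
      have "r - b / a = ((q t - b) - b / a * (p t - a)) / p t"
        using p_pos[OF tt] a by (simp add: r_def field_simps)
      then have "\<bar>r - b / a\<bar> = \<bar>(q t - b) - b / a * (p t - a)\<bar> / p t" using p_pos[OF tt] by simp
      also have "\<dots> \<le> (e3 * (1 + 2 * \<bar>b\<bar> / a)) / (a / 2)"
      proof (rule frac_le)
        have "\<bar>b / a * (p t - a)\<bar> \<le> \<bar>b\<bar> / a * (2 * e3)"
          unfolding abs_mult using 1 a by (intro mult_mono) auto
        then have "\<bar>(q t - b) - b / a * (p t - a)\<bar> \<le> e3 + \<bar>b\<bar> / a * (2 * e3)" using 1 by linarith
        then show "\<bar>(q t - b) - b / a * (p t - a)\<bar> \<le> e3 * (1 + 2 * \<bar>b\<bar> / a)" by (simp add: algebra_simps)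
      qed (use pt a e3 den in auto)
      also have "\<dots> = \<gamma> / 14"
      proof -
        have "e3 * (1 + 2 * \<bar>b\<bar> / a) = \<gamma> * a / 28" unfolding e3_def using den by (simp add: divide_simps)
        then show ?thesis using a by (simp only:) (simp add: field_simps)
      qed
      finally show ?thesis .
    qed
    have "\<forall>\<^sub>F s in nhds t. right_slope (lower_convex_hull ((\<lambda>s. (?x s, ?G 1 s)) ` {0..?\<tau>})) (?x s) = q s / p s"
    proof (rule hull_slope_near[where \<epsilon> = \<delta> and B = "1 + 2 * e2" and \<gamma> = "\<gamma> / 2"])
      show "\<delta> > 0" "\<delta> \<le> t" using \<delta> t_pos by auto
      show "t + \<delta> \<le> ?\<tau>" unfolding tau_def
      proof (rule cSup_upper)
        show "t + \<delta> \<in> {t. 0 \<le> t \<and> 0 < ?g 0 t + ?g 1 t}"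
          using p_pos[of "t + \<delta>"] \<delta>(1) t_pos unfolding p_def by simp
        show "bdd_above {t. 0 \<le> t \<and> 0 < ?g 0 t + ?g 1 t}"
        proof (rule bdd_aboveI)
          fix u assume "u \<in> {t. 0 \<le> t \<and> 0 < ?g 0 t + ?g 1 t}"
          then show "u \<le> obs_bound h n (ts \<omega>)"
            using ghat_sub_beyond[OF h(1), of n "ts \<omega>" u "ds \<omega>" 0] ghat_sub_beyond[OF h(1), of n "ts \<omega>" u "ds \<omega>" 1]
            by (cases "u \<le> obs_bound h n (ts \<omega>)") auto
        qed
      qed
      fix u assume u: "\<bar>u - t\<bar> < \<delta>"
      then have u': "\<bar>u - t\<bar> \<le> \<delta>" by simp
      show "DERIV ?x u :> p u" unfolding x_eq p_def by (intro DERIV_add DERIV_Ghat_sub h in_h u')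
      show "DERIV (?G 1) u :> q u" unfolding q_def by (intro DERIV_Ghat_sub h in_h u')
      show "p u > 0" by (rule p_pos[OF u'])
    next
      fix u v assume u: "\<bar>u - t\<bar> < \<delta>" and v: "\<bar>v - t\<bar> < \<delta>" and uv: "u \<le> v"
      show "q u / p u \<le> q v / p v"
      proof (rule DERIV_nonneg_imp_nondecreasing[OF uv])
        fix s assume "u \<le> s" "s \<le> v"
        then have s: "\<bar>s - t\<bar> \<le> \<delta>" using u v by linarith
        show "\<exists>y. DERIV (\<lambda>s. q s / p s) s :> y \<and> 0 \<le> y"
          using dr[OF s] D_pos[OF s] by (intro exI[of _ "(p s * q' s - p' s * q s) / (p s)\<^sup>2"]) (simp add: less_imp_le)
      qed
    next
      show "isCont (\<lambda>s. q s / p s) t" using dr[OF tt] DERIV_isCont by blast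
      show "\<gamma> / 2 > 0" using \<gamma> by simp
    next
      fix u assume "u \<in> {0..?\<tau>}"
      then have u: "u \<ge> 0" by simp
      show "\<bar>?x u\<bar> \<le> 1 + 2 * e2" unfolding x_eq using Gb[OF u] SG_sum_bounds[of u] by linarith
      assume ut: "\<delta> \<le> \<bar>u - t\<bar>"
      define S where "S v = SG 0 v + SG 1 v" for v
      have t0: "t \<ge> 0" using t_pos by simp
      have xs: "\<bar>(?x u - ?x t) - (S u - S t)\<bar> \<le> 4 * e2"
        unfolding x_eq S_def using Gb[OF u] Gb[OF t0] by linarith
      have ys: "\<bar>(?G 1 u - ?G 1 t) - (SG 1 u - SG 1 t)\<bar> \<le> 2 * e2" using Gb[OF u] Gb[OF t0] by linarith
      have 1: "\<bar>r * ((?x u - ?x t) - (S u - S t))\<bar> \<le> 1 * (4 * e2)"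
        unfolding abs_mult using r01 xs by (intro mult_mono) auto
      have 2: "\<bar>(r - b / a) * (S u - S t)\<bar> \<le> (\<gamma> / 14) * 1"
        unfolding abs_mult using rF SG_sum_bounds[of u] SG_sum_bounds[of t] \<gamma>(1) unfolding S_def
        by (intro mult_mono) auto
      have "?G 1 u - ?G 1 t - r * (?x u - ?x t)
          = (SG 1 u - SG 1 t - b / a * (S u - S t)) + ((?G 1 u - ?G 1 t) - (SG 1 u - SG 1 t))
            - r * ((?x u - ?x t) - (S u - S t)) - (r - b / a) * (S u - S t)" by (simp add: algebra_simps)
      moreover have "\<gamma> \<le> SG 1 u - SG 1 t - b / a * (S u - S t)" using \<gamma>(2)[OF u ut] unfolding S_def .
      ultimately show "\<gamma> / 2 \<le> ?G 1 u - ?G 1 t - q t / p t * (?x u - ?x t)"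
        unfolding r_def[symmetric] using 1 2 ys e2(2) \<gamma>(1) by linarith
    qed
    then have "\<forall>\<^sub>F s in nhds t. F_MS k h n (ts \<omega>) (ds \<omega>) s = q s / p s" unfolding F_MS_def .
    then have "f_MS k h n (ts \<omega>) (ds \<omega>) t = deriv (\<lambda>s. q s / p s) t"
      unfolding f_MS_def by (rule deriv_cong_ev) simp
    also have "\<dots> = (p t * q' t - p' t * q t) / (p t)\<^sup>2" by (rule DERIV_imp_deriv[OF dr[OF tt]])
    also have "\<dots> = f_naive k h n (ts \<omega>) (ds \<omega>) t"
      using h t_pos by (subst f_naive_eq) (auto simp: Let_def p_def q_def p'_def q'_def)
    finally show "f_MS k (hn n) n (ts \<omega>) (ds \<omega>) t = f_naive k (hn n) n (ts \<omega>) (ds \<omega>) t" unfolding h_def .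
  qed
qed

end

section \<open>Asymptotic normality\<close>

context iid_sample
begin

lemma ex_cmult: "ex (\<lambda>z. r * \<phi> z) = r * ex \<phi>"
  unfolding ex_def by simp

lemma avg_add: "avg n (\<lambda>z. \<phi> z + \<psi> z) \<omega> = avg n \<phi> \<omega> + avg n \<psi> \<omega>"
  unfolding avg_def by (simp add: sum.distrib add_divide_distrib)

lemma avg_cmult: "avg n (\<lambda>z. r * \<phi> z) \<omega> = r * avg n \<phi> \<omega>"
  unfolding avg_def by (simp add: sum_distrib_left[symmetric])

end

text \<open>With the abbreviation \<open>A = a + x0 + x1\<close>, the difference of the ratio and \<open>f\<close> is \<open>(Lin + Quad) / A\<^sup>2\<close>, where \<open>Quad\<close> is
  quadratic in the deviations. Replacing \<open>A\<^sup>2\<close> by \<open>a\<^sup>2\<close> causes another quadratic error. After multiplication by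
  \<open>N\<close>, quadratic terms are bounded by multiples of \<open>e\<close>.\<close>

lemma ratio_linearisation:
  fixes a b a' b' x0 x1 y0 y1 N e :: real
  defines "f \<equiv> (a * b' - a' * b) / a\<^sup>2"
  defines "Lin \<equiv> (a - b) * y1 - b * y0 + (b' - 2 * f * a - a') * x1 + (b' - 2 * f * a) * x0"
  defines "C \<equiv> \<bar>a - b\<bar> + \<bar>b\<bar> + \<bar>b' - 2 * f * a - a'\<bar> + \<bar>b' - 2 * f * a\<bar>"
  assumes a: "a > 0" and N: "N \<ge> 1"
    and small: "N * x0\<^sup>2 \<le> e" "N * x1\<^sup>2 \<le> e" "N * y0\<^sup>2 \<le> e" "N * y1\<^sup>2 \<le> e" and e: "16 * e \<le> (a / 2)\<^sup>2"
  shows "\<bar>N * (((a + (x0 + x1)) * (b' + y1) - (a' + (y0 + y1)) * (b + x1)) / (a + (x0 + x1))\<^sup>2 - f) - N / a\<^sup>2 * Lin\<bar>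
    \<le> (C * (5 / 2 * a) + a\<^sup>2 * (2 + \<bar>f\<bar>)) * (4 / a ^ 4) * (16 * e)"
proof -
  define S where "S = \<bar>x0\<bar> + \<bar>x1\<bar> + \<bar>y0\<bar> + \<bar>y1\<bar>"
  have S0: "S \<ge> 0" by (simp add: S_def)
  have x: "\<bar>x0\<bar> \<le> S" "\<bar>x1\<bar> \<le> S" "\<bar>y0\<bar> \<le> S" "\<bar>y1\<bar> \<le> S" "\<bar>x0 + x1\<bar> \<le> S" "\<bar>y0 + y1\<bar> \<le> S"
    unfolding S_def by linarith+
  have "S\<^sup>2 \<le> 4 * (x0\<^sup>2 + x1\<^sup>2 + y0\<^sup>2 + y1\<^sup>2)"
  proof -
    have "0 \<le> (\<bar>x0\<bar> - \<bar>x1\<bar>)\<^sup>2 + (\<bar>x0\<bar> - \<bar>y0\<bar>)\<^sup>2 + (\<bar>x0\<bar> - \<bar>y1\<bar>)\<^sup>2 + (\<bar>x1\<bar> - \<bar>y0\<bar>)\<^sup>2 + (\<bar>x1\<bar> - \<bar>y1\<bar>)\<^sup>2 + (\<bar>y0\<bar> - \<bar>y1\<bar>)\<^sup>2"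
      by (intro add_nonneg_nonneg) auto
    also have "\<dots> = 4 * (\<bar>x0\<bar>\<^sup>2 + \<bar>x1\<bar>\<^sup>2 + \<bar>y0\<bar>\<^sup>2 + \<bar>y1\<bar>\<^sup>2) - S\<^sup>2"
      unfolding S_def by (simp add: power2_eq_square algebra_simps del: power2_abs)
    finally show ?thesis by simp
  qed
  then have "N * S\<^sup>2 \<le> N * (4 * (x0\<^sup>2 + x1\<^sup>2 + y0\<^sup>2 + y1\<^sup>2))" using N by (intro mult_left_mono) auto
  also have "\<dots> = 4 * (N * x0\<^sup>2 + N * x1\<^sup>2 + N * y0\<^sup>2 + N * y1\<^sup>2)" by (simp add: algebra_simps)
  also have "\<dots> \<le> 16 * e" using small by simp
  finally have NS: "N * S\<^sup>2 \<le> 16 * e" .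
  have "S\<^sup>2 \<le> N * S\<^sup>2" using N by (simp add: mult_le_cancel_right1)
  then have "S\<^sup>2 \<le> (a / 2)\<^sup>2" using NS e by linarith
  then have Sa: "S \<le> a / 2" by (rule power2_le_imp_le) (use a in simp)
  define \<alpha> A where "\<alpha> = x0 + x1" and "A = a + \<alpha>"
  have \<alpha>S: "\<bar>\<alpha>\<bar> \<le> S" using x(5) by (simp add: \<alpha>_def)
  have A: "A \<ge> a / 2" "A \<le> 3 / 2 * a" using \<alpha>S Sa by (auto simp: A_def abs_le_iff)
  have A0: "A > 0" using A a by linarith
  define Quad where "Quad = \<alpha> * y1 - (y0 + y1) * x1 - f * \<alpha>\<^sup>2"
  have fa: "f * a\<^sup>2 = a * b' - a' * b" using a by (simp add: f_def)
  have num: "A * (b' + y1) - (a' + (y0 + y1)) * (b + x1) = f * A\<^sup>2 + (Lin + Quad)"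
  proof -
    have "A * (b' + y1) - (a' + (y0 + y1)) * (b + x1) - (Lin + Quad) - f * A\<^sup>2 = a * b' - a' * b - f * a\<^sup>2"
      unfolding A_def \<alpha>_def Lin_def Quad_def by (simp add: power2_eq_square algebra_simps)
    then show ?thesis unfolding fa by simp
  qed
  have "(A * (b' + y1) - (a' + (y0 + y1)) * (b + x1)) / A\<^sup>2 = f + (Lin + Quad) / A\<^sup>2"
    unfolding num using A0 by (simp add: add_divide_distrib)
  then have eq: "N * ((A * (b' + y1) - (a' + (y0 + y1)) * (b + x1)) / A\<^sup>2 - f) - N / a\<^sup>2 * Lin
     = N * ((Lin * (a\<^sup>2 - A\<^sup>2) + a\<^sup>2 * Quad) / (a\<^sup>2 * A\<^sup>2))"
    using A0 a by (simp add: field_simps)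
  have Lin: "\<bar>Lin\<bar> \<le> C * S"
  proof -
    have t: "\<bar>p * q\<bar> \<le> \<bar>p\<bar> * S" if "\<bar>q\<bar> \<le> S" for p q unfolding abs_mult using that by (intro mult_left_mono) auto
    have "\<bar>Lin\<bar> \<le> \<bar>(a - b) * y1\<bar> + \<bar>b * y0\<bar> + \<bar>(b' - 2 * f * a - a') * x1\<bar> + \<bar>(b' - 2 * f * a) * x0\<bar>"
      unfolding Lin_def by linarith
    also have "\<dots> \<le> \<bar>a - b\<bar> * S + \<bar>b\<bar> * S + \<bar>b' - 2 * f * a - a'\<bar> * S + \<bar>b' - 2 * f * a\<bar> * S"
      by (intro add_mono t x)
    finally show ?thesis unfolding C_def by (simp add: algebra_simps)
  qed
  have C0: "C \<ge> 0" unfolding C_def by simp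
  have "\<bar>a\<^sup>2 - A\<^sup>2\<bar> = \<bar>\<alpha>\<bar> * \<bar>a + A\<bar>"
    unfolding abs_mult[symmetric] A_def by (simp add: power2_eq_square algebra_simps abs_minus_commute)
  also have "\<dots> \<le> S * (5 / 2 * a)" using \<alpha>S A a by (intro mult_mono) auto
  finally have AA: "\<bar>a\<^sup>2 - A\<^sup>2\<bar> \<le> S * (5 / 2 * a)" .
  have Quad: "\<bar>Quad\<bar> \<le> (2 + \<bar>f\<bar>) * S\<^sup>2"
  proof -
    have "\<bar>\<alpha> * y1\<bar> \<le> S * S" "\<bar>(y0 + y1) * x1\<bar> \<le> S * S" unfolding abs_mult using \<alpha>S x S0 by (intro mult_mono; simp)+
    moreover have "\<bar>f * \<alpha>\<^sup>2\<bar> \<le> \<bar>f\<bar> * S\<^sup>2"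
      unfolding abs_mult using \<alpha>S S0 by (intro mult_left_mono) (auto simp: abs_le_square_iff[symmetric])
    ultimately have "\<bar>Quad\<bar> \<le> S * S + S * S + \<bar>f\<bar> * S\<^sup>2" unfolding Quad_def by linarith
    then show ?thesis by (simp add: power2_eq_square algebra_simps)
  qed
  have "\<bar>Lin * (a\<^sup>2 - A\<^sup>2) + a\<^sup>2 * Quad\<bar> \<le> (C * S) * (S * (5 / 2 * a)) + a\<^sup>2 * ((2 + \<bar>f\<bar>) * S\<^sup>2)"
  proof (rule order_trans[OF abs_triangle_ineq add_mono])
    show "\<bar>Lin * (a\<^sup>2 - A\<^sup>2)\<bar> \<le> (C * S) * (S * (5 / 2 * a))"
      unfolding abs_mult using Lin AA C0 S0 by (intro mult_mono) auto
    show "\<bar>a\<^sup>2 * Quad\<bar> \<le> a\<^sup>2 * ((2 + \<bar>f\<bar>) * S\<^sup>2)"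
      unfolding abs_mult using Quad by (intro mult_mono) auto
  qed
  also have "\<dots> = (C * (5 / 2 * a) + a\<^sup>2 * (2 + \<bar>f\<bar>)) * S\<^sup>2" by (simp add: power2_eq_square algebra_simps)
  finally have top: "\<bar>Lin * (a\<^sup>2 - A\<^sup>2) + a\<^sup>2 * Quad\<bar> \<le> (C * (5 / 2 * a) + a\<^sup>2 * (2 + \<bar>f\<bar>)) * S\<^sup>2" .
  have bot: "a ^ 4 / 4 \<le> a\<^sup>2 * A\<^sup>2"
  proof -
    have "(a / 2)\<^sup>2 \<le> A\<^sup>2" using A a by (intro power_mono) auto
    then have "a\<^sup>2 * (a / 2)\<^sup>2 \<le> a\<^sup>2 * A\<^sup>2" by (intro mult_left_mono) auto
    then show ?thesis by (simp add: power_divide power2_eq_square power4_eq_xxxx)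
  qed
  define P where "P = C * (5 / 2 * a) + a\<^sup>2 * (2 + \<bar>f\<bar>)"
  have P0: "P \<ge> 0" using C0 a by (simp add: P_def)
  have "\<bar>(Lin * (a\<^sup>2 - A\<^sup>2) + a\<^sup>2 * Quad) / (a\<^sup>2 * A\<^sup>2)\<bar> \<le> (P * S\<^sup>2) / (a ^ 4 / 4)"
    unfolding abs_divide using top bot a A0 P0 by (intro frac_le) (auto simp: P_def)
  then have "N * \<bar>(Lin * (a\<^sup>2 - A\<^sup>2) + a\<^sup>2 * Quad) / (a\<^sup>2 * A\<^sup>2)\<bar> \<le> N * ((P * S\<^sup>2) / (a ^ 4 / 4))"
    using N by (intro mult_left_mono) auto
  also have "\<dots> = P * (4 / a ^ 4) * (N * S\<^sup>2)" by simp
  also have "\<dots> \<le> P * (4 / a ^ 4) * (16 * e)" using NS P0 a by (intro mult_left_mono) auto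
  finally have fin: "N * \<bar>(Lin * (a\<^sup>2 - A\<^sup>2) + a\<^sup>2 * Quad) / (a\<^sup>2 * A\<^sup>2)\<bar> \<le> P * (4 / a ^ 4) * (16 * e)" .
  have "\<bar>N * ((A * (b' + y1) - (a' + (y0 + y1)) * (b + x1)) / A\<^sup>2 - f) - N / a\<^sup>2 * Lin\<bar>
    = N * \<bar>(Lin * (a\<^sup>2 - A\<^sup>2) + a\<^sup>2 * Quad) / (a\<^sup>2 * A\<^sup>2)\<bar>"
    unfolding eq abs_mult using N by simp
  with fin show ?thesis unfolding A_def \<alpha>_def P_def by simp
qed

context cs_point
begin

text \<open>The odd moments of \<open>k\<close> and the even moments of \<open>k'\<close> vanish, so the leading term of the bias comes from the quadratic
  Taylor coefficient for the estimate, and from the cubic one for its derivative.\<close>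

lemma bias_ghat:
  assumes i: "i = 0 \<or> i = 1"
  shows "(\<lambda>n. (ex (\<psi> i k 1 (hn n) t) - d i 0) / (hn n)\<^sup>2) \<longlonglongrightarrow> m2 k * d i 2"
    and "(\<lambda>n. (ex (\<psi> i k' 2 (hn n) t) - d i 1) / (hn n)\<^sup>2) \<longlonglongrightarrow> 3 * m2 k * d i 3"
proof -
  have main: "\<forall>\<^sub>F n in sequentially. \<bar>(ex (\<psi> i k 1 (hn n) t) - d i 0) / (hn n)\<^sup>2 - m2 k * d i 2\<bar> \<le> e \<and>
      \<bar>(ex (\<psi> i k' 2 (hn n) t) - d i 1) / (hn n)\<^sup>2 - 3 * m2 k * d i 3\<bar> \<le> e" if e: "e > 0" for e
  proof -
    have e': "e / (2 * Kb) > 0" using e Kb_pos by simp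
    obtain \<delta> where \<delta>: "\<delta> > 0" "\<And>x. \<bar>x\<bar> < \<delta> \<Longrightarrow> \<bar>sg i (t + x) - (\<Sum>j\<le>3. d i j * x ^ j)\<bar> \<le> e / (2 * Kb) * \<bar>x\<bar> ^ 3"
      using Peano[OF i e'] by blast
    have "\<forall>\<^sub>F n in sequentially. 0 < hn n \<and> hn n < min 1 \<delta>" by (rule hn_small) (use \<delta> in simp)
    then show ?thesis
    proof eventually_elim
      case (elim n)
      define h where "h = hn n"
      have h: "0 < h" "h < \<delta>" "h < 1" using elim by (auto simp: h_def)
      have E: "\<bar>(LINT u|lborel. w u * sg i (t - h * u)) - (\<Sum>j\<le>3. d i j * (- h) ^ j * (LINT u|lborel. u ^ j * w u))\<bar> \<le> e * h ^ 3"
        if "w \<in> borel_measurable borel" "\<And>u. \<bar>u\<bar> \<ge> 1 \<Longrightarrow> w u = 0" "\<And>u. \<bar>w u\<bar> \<le> Kb" for w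
        using smoothing_expansion(2)[OF that borel_sg \<delta>(2) h(1,2)] e' Kb_pos by simp
      have s3: "(\<Sum>j\<le>3. f j) = f 0 + f 1 + f 2 + f 3" for f :: "nat \<Rightarrow> real"
        by (simp add: numeral_3_eq_3 numeral_2_eq_2)
      have "\<bar>(LINT u|lborel. k u * sg i (t - h * u)) - (d i 0 + d i 2 * h\<^sup>2 * m2 k)\<bar> \<le> e * h ^ 3"
        using E[OF borel_k k_zero Kb(3)] unfolding s3 moments_k by simp
      then have "\<bar>ex (\<psi> i k 1 h t) - (d i 0 + d i 2 * h\<^sup>2 * m2 k)\<bar> / h\<^sup>2 \<le> e * h ^ 3 / h\<^sup>2"
        using ex_psi[OF i borel_k Kb(3) h(1), of 1 t] h by (intro divide_right_mono) auto
      also have "e * h ^ 3 / h\<^sup>2 = e * h" using h by (simp add: power2_eq_square power3_eq_cube)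
      also have "\<dots> \<le> e" using h e by (simp add: mult_left_le)
      also have "\<bar>ex (\<psi> i k 1 h t) - (d i 0 + d i 2 * h\<^sup>2 * m2 k)\<bar> / h\<^sup>2 = \<bar>(ex (\<psi> i k 1 h t) - d i 0) / h\<^sup>2 - m2 k * d i 2\<bar>"
      proof -
        have "(ex (\<psi> i k 1 h t) - d i 0) / h\<^sup>2 - m2 k * d i 2 = (ex (\<psi> i k 1 h t) - (d i 0 + d i 2 * h\<^sup>2 * m2 k)) / h\<^sup>2"
          using h by (simp add: field_simps)
        then show ?thesis using h by (simp add: abs_divide)
      qed
      finally have 1: "\<bar>(ex (\<psi> i k 1 h t) - d i 0) / h\<^sup>2 - m2 k * d i 2\<bar> \<le> e" .
      have I: "\<bar>(LINT u|lborel. k' u * sg i (t - h * u)) - (d i 1 * h + 3 * d i 3 * h ^ 3 * m2 k)\<bar> \<le> e * h ^ 3"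
        using E[OF borel_k' k'_zero Kb(4)] unfolding s3 moments_k' by (simp add: power3_eq_cube algebra_simps)
      have "(ex (\<psi> i k' 2 h t) - d i 1) / h\<^sup>2 - 3 * m2 k * d i 3
          = ((LINT u|lborel. k' u * sg i (t - h * u)) - (d i 1 * h + 3 * d i 3 * h ^ 3 * m2 k)) / h ^ 3"
        using ex_psi[OF i borel_k' Kb(4) h(1), of 2 t] h by (simp add: field_simps power2_eq_square power3_eq_cube)
      then have "\<bar>(ex (\<psi> i k' 2 h t) - d i 1) / h\<^sup>2 - 3 * m2 k * d i 3\<bar>
          = \<bar>(LINT u|lborel. k' u * sg i (t - h * u)) - (d i 1 * h + 3 * d i 3 * h ^ 3 * m2 k)\<bar> / h ^ 3"
        using h by (simp add: abs_divide)
      also have "\<dots> \<le> e * h ^ 3 / h ^ 3" using I h by (intro divide_right_mono) auto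
      also have "\<dots> = e" using h by simp
      finally show ?case using 1 unfolding h_def by blast
    qed
  qed
  have ev: "\<forall>\<^sub>F n in sequentially. dist ((ex (\<psi> i k 1 (hn n) t) - d i 0) / (hn n)\<^sup>2) (m2 k * d i 2) < e \<and>
      dist ((ex (\<psi> i k' 2 (hn n) t) - d i 1) / (hn n)\<^sup>2) (3 * m2 k * d i 3) < e" if "e > 0" for e
    using main[of "e / 2"] that by (auto simp: dist_real_def elim!: eventually_mono)
  show "(\<lambda>n. (ex (\<psi> i k 1 (hn n) t) - d i 0) / (hn n)\<^sup>2) \<longlonglongrightarrow> m2 k * d i 2"
    by (rule tendstoI, drule ev, erule eventually_mono, erule conjunct1)
  show "(\<lambda>n. (ex (\<psi> i k' 2 (hn n) t) - d i 1) / (hn n)\<^sup>2) \<longlonglongrightarrow> 3 * m2 k * d i 3"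
    by (rule tendstoI, drule ev, erule eventually_mono, erule conjunct2)
qed

text \<open>Applied to \<open>w\<close> equal to \<open>k'\<^sup>2\<close>, \<open>k' k\<close> and \<open>k\<^sup>2\<close>, this gives the second moments of the
  contributions of one observation.\<close>

lemma second_moment_limit:
  assumes i: "i = 0 \<or> i = 1" and w[measurable]: "w \<in> borel_measurable borel"
    and K: "\<And>u. \<bar>w u\<bar> \<le> K" and K0: "K > 0" and wz: "\<And>u. \<bar>u\<bar> \<ge> 1 \<Longrightarrow> w u = 0"
  shows "(\<lambda>n. ex (\<psi> i w 1 (hn n) t)) \<longlonglongrightarrow> d i 0 * (LINT u|lborel. w u)"
proof (rule tendstoI)
  fix e :: real assume e: "e > 0"
  have e': "e / (4 * K) > 0" using e K0 by simp
  obtain \<delta> where \<delta>: "\<delta> > 0" "\<And>x. \<bar>x\<bar> < \<delta> \<Longrightarrow> \<bar>sg i (t + x) - d i 0\<bar> \<le> e / (4 * K)"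
    using sg_cont[OF i e'] by blast
  have "\<forall>\<^sub>F n in sequentially. 0 < hn n \<and> hn n < \<delta>" by (rule hn_small) (use \<delta> in simp)
  then show "\<forall>\<^sub>F n in sequentially. dist (ex (\<psi> i w 1 (hn n) t)) (d i 0 * (LINT u|lborel. w u)) < e"
  proof eventually_elim
    case (elim n)
    have "\<bar>(LINT u|lborel. w u * sg i (t - hn n * u)) - (\<Sum>j\<le>0. d i 0 * (- hn n) ^ j * (LINT u|lborel. u ^ j * w u))\<bar>
        \<le> 2 * K * (e / (4 * K)) * hn n ^ 0"
      by (rule smoothing_expansion(2)[where \<delta> = \<delta>]) (use elim \<delta> e' wz K in auto)
    then show ?case using ex_psi[OF i w K, of "hn n" 1 t] elim K0 e by (simp add: dist_real_def)
  qed
qed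

text \<open>Bias and standard deviation are of order \<open>n\<^sup>-\<^sup>2\<^sup>/\<^sup>7\<close>, so the mean square is of order \<open>n\<^sup>-\<^sup>4\<^sup>/\<^sup>7\<close>, and
  Markov's inequality applies.\<close>

lemma sd_rate:
  assumes i: "i = 0 \<or> i = 1" and w: "w \<in> borel_measurable borel" and K: "\<And>u. \<bar>w u\<bar> \<le> K"
    and wz: "\<And>u. \<bar>u\<bar> \<ge> 1 \<Longrightarrow> w u = 0" and r: "r = 1 \<or> r = 2"
    and bias: "(\<lambda>n. (ex (\<psi> i w r (hn n) t) - m) / (hn n)\<^sup>2) \<longlonglongrightarrow> l" and e: "e > 0"
  shows "whp (\<lambda>n \<omega>. real n powr (2/7) * (avg n (\<psi> i w r (hn n) t) \<omega> - m)\<^sup>2 \<le> e)"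
proof -
  note [measurable] = w
  obtain B \<delta> where B: "\<delta> > 0" "B > 0" "\<And>v. \<bar>v - t\<bar> < \<delta> \<Longrightarrow> \<bar>sg i v\<bar> \<le> B"
    using sg_bounded[OF i] by blast
  define b where "b n = 2 * (2 * B * K\<^sup>2) * (real n powr (2/7) / ((hn n) ^ 3 * real n))
     + 2 * (real n powr (2/7) * (hn n) ^ 4) * ((ex (\<psi> i w r (hn n) t) - m) / (hn n)\<^sup>2)\<^sup>2" for n
  show ?thesis
  proof (rule whp_Markov[where b = b, OF _ _ e])
    have "\<forall>\<^sub>F n in sequentially. 0 < hn n \<and> hn n < min 1 (\<delta> / 2)" by (rule hn_small) (use B in simp)
    then show "\<forall>\<^sub>F n in sequentially. integrable M (\<lambda>\<omega>. real n powr (2/7) * (avg n (\<psi> i w r (hn n) t) \<omega> - m)\<^sup>2) \<and>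
        (\<forall>\<omega>. 0 \<le> real n powr (2/7) * (avg n (\<psi> i w r (hn n) t) \<omega> - m)\<^sup>2) \<and>
        expectation (\<lambda>\<omega>. real n powr (2/7) * (avg n (\<psi> i w r (hn n) t) \<omega> - m)\<^sup>2) \<le> b n"
      using eventually_gt_at_top[of 0]
    proof eventually_elim
      case (elim n)
      define \<phi> where "\<phi> = \<psi> i w r (hn n) t"
      have h: "0 < hn n" "hn n < \<delta> / 2" "hn n < 1" and n: "n > 0" using elim by auto
      have \<phi>[measurable]: "\<phi> \<in> borel_measurable (borel \<Otimes>\<^sub>M borel)" unfolding \<phi>_def by measurable
      have \<phi>K: "\<bar>\<phi> z\<bar> \<le> K / hn n ^ r" for z unfolding \<phi>_def by (rule psi_bound[OF K]) (use h in simp)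
      note D = avg_square_deviation(1)[OF \<phi> \<phi>K n] avg_square_deviation_le[OF \<phi> \<phi>K n]
      have pt: "(avg n \<phi> \<omega> - m)\<^sup>2 \<le> 2 * (avg n \<phi> \<omega> - ex \<phi>)\<^sup>2 + 2 * (ex \<phi> - m)\<^sup>2" for \<omega>
      proof -
        have "2 * (avg n \<phi> \<omega> - ex \<phi>)\<^sup>2 + 2 * (ex \<phi> - m)\<^sup>2 - (avg n \<phi> \<omega> - m)\<^sup>2 = (avg n \<phi> \<omega> - ex \<phi> - (ex \<phi> - m))\<^sup>2"
          by (simp add: power2_eq_square algebra_simps)
        then show ?thesis by (smt (verit) zero_le_power2)
      qed
      have iD: "integrable M (\<lambda>\<omega>. 2 * (avg n \<phi> \<omega> - ex \<phi>)\<^sup>2 + 2 * (ex \<phi> - m)\<^sup>2)"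
        by (intro Bochner_Integration.integrable_add integrable_mult_right D integrable_const)
      have i1: "integrable M (\<lambda>\<omega>. (avg n \<phi> \<omega> - m)\<^sup>2)"
        by (rule Bochner_Integration.integrable_bound[OF iD]) (use pt in \<open>auto intro!: AE_I2\<close>)
      have hr: "hn n / (hn n ^ r)\<^sup>2 \<le> 1 / hn n ^ 3"
        using r h by (auto simp: power2_eq_square power3_eq_cube field_simps mult_le_one)
      have "expectation (\<lambda>\<omega>. (avg n \<phi> \<omega> - m)\<^sup>2) \<le> expectation (\<lambda>\<omega>. 2 * (avg n \<phi> \<omega> - ex \<phi>)\<^sup>2 + 2 * (ex \<phi> - m)\<^sup>2)"
        by (rule integral_mono[OF i1 iD pt])
      also have "\<dots> = 2 * expectation (\<lambda>\<omega>. (avg n \<phi> \<omega> - ex \<phi>)\<^sup>2) + 2 * (ex \<phi> - m)\<^sup>2"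
        by (subst Bochner_Integration.integral_add[OF integrable_mult_right[OF D(1)] integrable_const]) (simp add: prob_space)
      also have "\<dots> \<le> 2 * (2 * B * K\<^sup>2 * (1 / hn n ^ 3) / n) + 2 * (ex \<phi> - m)\<^sup>2"
      proof -
        have "ex (\<lambda>z. (\<phi> z)\<^sup>2) \<le> 2 * B * K\<^sup>2 * (hn n / (hn n ^ r)\<^sup>2)"
          unfolding \<phi>_def by (rule ex_psi_square_le[OF i w K wz B(3) h(1,2)]) (use B in auto)
        also have "\<dots> \<le> 2 * B * K\<^sup>2 * (1 / hn n ^ 3)" using hr B(2) by (intro mult_left_mono) auto
        finally have "ex (\<lambda>z. (\<phi> z)\<^sup>2) / n \<le> 2 * B * K\<^sup>2 * (1 / hn n ^ 3) / n" by (rule divide_right_mono) simp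
        then show ?thesis using D(2) by linarith
      qed
      finally have "real n powr (2/7) * expectation (\<lambda>\<omega>. (avg n \<phi> \<omega> - m)\<^sup>2)
          \<le> real n powr (2/7) * (2 * (2 * B * K\<^sup>2 * (1 / hn n ^ 3) / n) + 2 * (ex \<phi> - m)\<^sup>2)"
        by (rule mult_left_mono) simp
      also have "\<dots> = b n"
      proof -
        have "(ex \<phi> - m)\<^sup>2 = hn n ^ 4 * ((ex \<phi> - m) / (hn n)\<^sup>2)\<^sup>2"
          using h by (simp add: power_divide flip: power_mult)
        then show ?thesis unfolding b_def \<phi>_def by (simp add: algebra_simps)
      qed
      finally show ?case using i1 unfolding \<phi>_def by simp
    qed
    have 1: "(\<lambda>n. real n powr (2/7) / ((c * real n powr (-1/7)) ^ 3 * real n)) \<longlonglongrightarrow> 0" using c_pos by real_asymp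
    have 2: "(\<lambda>n. real n powr (2/7) * (c * real n powr (-1/7)) ^ 4) \<longlonglongrightarrow> 0" using c_pos by real_asymp
    have "b \<longlonglongrightarrow> 2 * (2 * B * K\<^sup>2) * 0 + 2 * 0 * l\<^sup>2"
      unfolding b_def using 1 2 bias unfolding bandwidth_def by (intro tendsto_intros) auto
    then show "b \<longlonglongrightarrow> 0" by simp
  qed
qed

text \<open>Limits of the estimates of \<open>g\<close> and of the subdensity of the class \<open>1\<close>, and of their derivatives. Then \<open>fval\<close> stands
  for \<open>f\<^sub>0 t\<close>, and \<open>va - vb\<close>, \<open>- vb\<close>, \<open>e0 - va'\<close> and \<open>e0\<close> are the coefficients of the deviations in the linear
  part of \<open>ratio_linearisation\<close>.\<close>

definition "va = d 0 0 + d 1 0"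
definition "vb = d 1 0"
definition "va' = d 0 1 + d 1 1"
definition "vb' = d 1 1"
definition "fval = (va * vb' - va' * vb) / va\<^sup>2"
definition "e0 = vb' - 2 * fval * va"

definition "limit_mean = c\<^sup>2 / va\<^sup>2 * (3 * m2 k * ((va - vb) * d 1 3 - vb * d 0 3) + m2 k * ((e0 - va') * d 1 2 + e0 * d 0 2))"
definition "limit_var = ((va - vb)\<^sup>2 * d 1 0 + vb\<^sup>2 * d 0 0) * (LINT u|lborel. (k' u)\<^sup>2) / (va ^ 4 * c ^ 3)"

text \<open>The contribution of one observation to the linear part; \<open>centre\<close> below is the value of the linear part
  at the limits of the estimates.\<close>

definition \<eta> :: "nat \<Rightarrow> real \<times> real \<Rightarrow> real" where
  "\<eta> n z = ((va - vb) * \<psi> 1 k' 2 (hn n) t z + (e0 - va') * \<psi> 1 k 1 (hn n) t z)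
     + ((- vb) * \<psi> 0 k' 2 (hn n) t z + e0 * \<psi> 0 k 1 (hn n) t z)"

definition "centre = ((va - vb) * d 1 1 + (e0 - va') * d 1 0) + ((- vb) * d 0 1 + e0 * d 0 0)"

lemma va_pos: "va > 0" using a_pos by (simp add: va_def)

lemma hn_nonneg: "hn n \<ge> 0" using c_pos by (simp add: bandwidth_def)

lemma borel_eta [measurable]: "\<eta> n \<in> borel_measurable (borel \<Otimes>\<^sub>M borel)"
  unfolding \<eta>_def[abs_def] by measurable

lemma psi_k_bounds: "\<bar>\<psi> i k 1 (hn n) t z\<bar> \<le> Kb / hn n ^ 1" "\<bar>\<psi> i k' 2 (hn n) t z\<bar> \<le> Kb / hn n ^ 2"
  by (rule psi_bound[OF Kb(3) hn_nonneg], rule psi_bound[OF Kb(4) hn_nonneg])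

definition "\<kappa> n = (\<bar>va - vb\<bar> + \<bar>vb\<bar>) * (Kb / hn n ^ 2) + (\<bar>e0 - va'\<bar> + \<bar>e0\<bar>) * (Kb / hn n ^ 1)" for n

lemma eta_bound: "\<bar>\<eta> n z\<bar> \<le> \<kappa> n"
proof -
  have t: "\<bar>p * q\<bar> \<le> \<bar>p\<bar> * L" if "\<bar>q\<bar> \<le> L" for p q L :: real unfolding abs_mult using that by (intro mult_left_mono) auto
  have "\<bar>\<eta> n z\<bar> \<le> (\<bar>(va - vb) * \<psi> 1 k' 2 (hn n) t z\<bar> + \<bar>(e0 - va') * \<psi> 1 k 1 (hn n) t z\<bar>)
     + (\<bar>(- vb) * \<psi> 0 k' 2 (hn n) t z\<bar> + \<bar>e0 * \<psi> 0 k 1 (hn n) t z\<bar>)"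
    unfolding \<eta>_def by linarith
  also have "\<dots> \<le> (\<bar>va - vb\<bar> * (Kb / hn n ^ 2) + \<bar>e0 - va'\<bar> * (Kb / hn n ^ 1)) + (\<bar>- vb\<bar> * (Kb / hn n ^ 2) + \<bar>e0\<bar> * (Kb / hn n ^ 1))"
    by (intro add_mono t psi_k_bounds)
  also have "\<dots> = \<kappa> n" unfolding \<kappa>_def by (simp add: algebra_simps add_divide_distrib)
  finally show ?thesis .
qed

lemma avg_eta: "avg n (\<eta> n) \<omega> = ((va - vb) * avg n (\<psi> 1 k' 2 (hn n) t) \<omega> + (e0 - va') * avg n (\<psi> 1 k 1 (hn n) t) \<omega>)
     + ((- vb) * avg n (\<psi> 0 k' 2 (hn n) t) \<omega> + e0 * avg n (\<psi> 0 k 1 (hn n) t) \<omega>)"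
  unfolding \<eta>_def[abs_def] by (simp only: avg_add avg_cmult)

lemma ex_eta: "ex (\<eta> n) = ((va - vb) * ex (\<psi> 1 k' 2 (hn n) t) + (e0 - va') * ex (\<psi> 1 k 1 (hn n) t))
     + ((- vb) * ex (\<psi> 0 k' 2 (hn n) t) + e0 * ex (\<psi> 0 k 1 (hn n) t))"
proof -
  have i: "integrable M (\<lambda>\<omega>. \<psi> i k 1 (hn n) t (Z 0 \<omega>))" "integrable M (\<lambda>\<omega>. \<psi> i k' 2 (hn n) t (Z 0 \<omega>))" for i
    by (rule integrable_bounded_Z[OF _ psi_k_bounds(1)], measurable, rule integrable_bounded_Z[OF _ psi_k_bounds(2)], measurable)
  show ?thesis unfolding \<eta>_def ex_def by (simp add: i del: One_nat_def)
qed

lemma mean_limit: "(\<lambda>n. real n powr (2/7) / va\<^sup>2 * (ex (\<eta> n) - centre)) \<longlonglongrightarrow> limit_mean"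
proof -
  let ?b = "\<lambda>i n. (ex (\<psi> i k 1 (hn n) t) - d i 0) / (hn n)\<^sup>2" and ?b' = "\<lambda>i n. (ex (\<psi> i k' 2 (hn n) t) - d i 1) / (hn n)\<^sup>2"
  have "(\<lambda>n. c\<^sup>2 / va\<^sup>2 * (((va - vb) * ?b' 1 n + (e0 - va') * ?b 1 n) + ((- vb) * ?b' 0 n + e0 * ?b 0 n)))
     \<longlonglongrightarrow> c\<^sup>2 / va\<^sup>2 * (((va - vb) * (3 * m2 k * d 1 3) + (e0 - va') * (m2 k * d 1 2)) + ((- vb) * (3 * m2 k * d 0 3) + e0 * (m2 k * d 0 2)))"
    by (intro tendsto_intros bias_ghat) auto
  also have "c\<^sup>2 / va\<^sup>2 * (((va - vb) * (3 * m2 k * d 1 3) + (e0 - va') * (m2 k * d 1 2)) + ((- vb) * (3 * m2 k * d 0 3) + e0 * (m2 k * d 0 2))) = limit_mean"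
    unfolding limit_mean_def by (simp add: algebra_simps)
  finally show ?thesis
  proof (rule Lim_transform_eventually)
    show "\<forall>\<^sub>F n in sequentially. c\<^sup>2 / va\<^sup>2 * (((va - vb) * ?b' 1 n + (e0 - va') * ?b 1 n) + ((- vb) * ?b' 0 n + e0 * ?b 0 n))
       = real n powr (2/7) / va\<^sup>2 * (ex (\<eta> n) - centre)"
      using eventually_gt_at_top[of 0]
    proof eventually_elim
      case (elim n)
      have h: "hn n > 0" using elim by (rule hn_pos)
      have c2: "c\<^sup>2 = real n powr (2/7) * (hn n)\<^sup>2"
      proof -
        have "(real n powr (-1/7))\<^sup>2 = real n powr (-2/7)" using elim by (simp add: powr_power)
        then show ?thesis using elim by (simp add: bandwidth_def power_mult_distrib powr_add[symmetric])
      qed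
      have "ex (\<eta> n) - centre = ((va - vb) * (ex (\<psi> 1 k' 2 (hn n) t) - d 1 1) + (e0 - va') * (ex (\<psi> 1 k 1 (hn n) t) - d 1 0))
         + ((- vb) * (ex (\<psi> 0 k' 2 (hn n) t) - d 0 1) + e0 * (ex (\<psi> 0 k 1 (hn n) t) - d 0 0))"
        unfolding ex_eta centre_def by (simp add: algebra_simps)
      also have "\<dots> = (hn n)\<^sup>2 * (((va - vb) * ?b' 1 n + (e0 - va') * ?b 1 n) + ((- vb) * ?b' 0 n + e0 * ?b 0 n))"
      proof -
        have g: "A * x + B * y + (C * z + D * w) = H * (A * (x / H) + B * (y / H) + (C * (z / H) + D * (w / H)))"
          if "H \<noteq> 0" for A B C D H x y z w :: real using that by (simp add: field_simps)
        have "(hn n)\<^sup>2 \<noteq> 0" using h by simp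
        then show ?thesis by (rule g)
      qed
      finally show ?case unfolding c2 by simp
    qed
  qed
qed

text \<open>An observation belongs to one class only, so the square of \<open>\<eta> n\<close> has no mixed terms between classes. After scaling by
  \<open>h\<^sup>3\<close> only the squares of the terms with \<open>k'\<close> survive, and the squared mean is negligible.\<close>

lemma var_limit: "(\<lambda>n. (real n powr (2/7) / va\<^sup>2)\<^sup>2 * ex (\<lambda>z. (\<eta> n z - ex (\<eta> n))\<^sup>2) / n) \<longlonglongrightarrow> limit_var"
proof -
  define w1 w2 w3 where "w1 u = (k' u)\<^sup>2" and "w2 u = k' u * k u" and "w3 u = (k u)\<^sup>2" for u
  have [measurable]: "w1 \<in> borel_measurable borel" "w2 \<in> borel_measurable borel" "w3 \<in> borel_measurable borel"
    unfolding w1_def[abs_def] w2_def[abs_def] w3_def[abs_def] by measurable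
  have wb: "\<bar>w1 u\<bar> \<le> Kb * Kb" "\<bar>w2 u\<bar> \<le> Kb * Kb" "\<bar>w3 u\<bar> \<le> Kb * Kb" for u
    unfolding w1_def w2_def w3_def power2_eq_square abs_mult using Kb_pos by (intro mult_mono Kb; simp)+
  have wz: "\<bar>u\<bar> \<ge> 1 \<Longrightarrow> w1 u = 0" "\<bar>u\<bar> \<ge> 1 \<Longrightarrow> w2 u = 0" "\<bar>u\<bar> \<ge> 1 \<Longrightarrow> w3 u = 0" for u
    unfolding w1_def w2_def w3_def by (simp_all add: k_zero k'_zero)
  have K2: "Kb * Kb > 0" using Kb_pos by simp
  have lims: "(\<lambda>n. ex (\<psi> i w1 1 (hn n) t)) \<longlonglongrightarrow> d i 0 * (LINT u|lborel. w1 u)"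
    "(\<lambda>n. ex (\<psi> i w2 1 (hn n) t)) \<longlonglongrightarrow> d i 0 * (LINT u|lborel. w2 u)"
    "(\<lambda>n. ex (\<psi> i w3 1 (hn n) t)) \<longlonglongrightarrow> d i 0 * (LINT u|lborel. w3 u)" if i: "i = 0 \<or> i = 1" for i
    by (rule second_moment_limit[OF i _ wb(1) K2 wz(1)], measurable,
        rule second_moment_limit[OF i _ wb(2) K2 wz(2)], measurable,
        rule second_moment_limit[OF i _ wb(3) K2 wz(3)], measurable)
  define Q where "Q \<alpha> \<beta> i n = \<alpha>\<^sup>2 * ex (\<psi> i w1 1 (hn n) t) + hn n * (2 * \<alpha> * \<beta> * ex (\<psi> i w2 1 (hn n) t)) + (hn n)\<^sup>2 * (\<beta>\<^sup>2 * ex (\<psi> i w3 1 (hn n) t))"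
    for \<alpha> \<beta> i n
  have Qlim: "(\<lambda>n. Q \<alpha> \<beta> i n) \<longlonglongrightarrow> \<alpha>\<^sup>2 * (d i 0 * (LINT u|lborel. w1 u))" if i: "i = 0 \<or> i = 1" for \<alpha> \<beta> i
  proof -
    have "(\<lambda>n. Q \<alpha> \<beta> i n) \<longlonglongrightarrow> \<alpha>\<^sup>2 * (d i 0 * (LINT u|lborel. w1 u)) + 0 * (2 * \<alpha> * \<beta> * (d i 0 * (LINT u|lborel. w2 u)))
       + 0\<^sup>2 * (\<beta>\<^sup>2 * (d i 0 * (LINT u|lborel. w3 u)))"
      unfolding Q_def by (intro tendsto_intros lims[OF i] hn_tendsto)
    then show ?thesis by simp
  qed
  \<comment> \<open>Up to powers of \<open>h\<close>, products of \<open>\<psi> i k' 2\<close> and \<open>\<psi> i k 1\<close> are again functions \<open>\<psi> i w 1\<close>.\<close>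
  have sq: "(\<alpha> * \<psi> i k' 2 h t z + \<beta> * \<psi> i k 1 h t z)\<^sup>2 * h ^ 3
      = \<alpha>\<^sup>2 * \<psi> i w1 1 h t z + h * (2 * \<alpha> * \<beta> * \<psi> i w2 1 h t z) + h\<^sup>2 * (\<beta>\<^sup>2 * \<psi> i w3 1 h t z)" if "h > 0" for \<alpha> \<beta> i h z
    using that unfolding \<psi>_def w1_def w2_def w3_def cls_def
    by (cases "0 \<le> fst z \<and> status (snd z) (fst z) = i") (simp_all add: field_simps power2_eq_square power3_eq_cube)
  have cross: "\<eta> n z ^ 2 = ((va - vb) * \<psi> 1 k' 2 (hn n) t z + (e0 - va') * \<psi> 1 k 1 (hn n) t z)\<^sup>2
      + ((- vb) * \<psi> 0 k' 2 (hn n) t z + e0 * \<psi> 0 k 1 (hn n) t z)\<^sup>2" for n z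
    unfolding \<eta>_def \<psi>_def cls_def by (auto simp: status_def)
  have E2: "(hn n) ^ 3 * ex (\<lambda>z. (\<eta> n z)\<^sup>2) = Q (va - vb) (e0 - va') 1 n + Q (- vb) e0 0 n" if n: "n > 0" for n
  proof -
    have h: "hn n > 0" by (rule hn_pos[OF n])
    have pb: "\<bar>\<psi> i w1 1 (hn n) t z\<bar> \<le> Kb * Kb / hn n ^ 1" "\<bar>\<psi> i w2 1 (hn n) t z\<bar> \<le> Kb * Kb / hn n ^ 1"
      "\<bar>\<psi> i w3 1 (hn n) t z\<bar> \<le> Kb * Kb / hn n ^ 1" for i z
      by (rule psi_bound[OF wb(1) hn_nonneg], rule psi_bound[OF wb(2) hn_nonneg], rule psi_bound[OF wb(3) hn_nonneg])
    have i: "integrable M (\<lambda>\<omega>. \<psi> i w1 1 (hn n) t (Z 0 \<omega>))" "integrable M (\<lambda>\<omega>. \<psi> i w2 1 (hn n) t (Z 0 \<omega>))"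
      "integrable M (\<lambda>\<omega>. \<psi> i w3 1 (hn n) t (Z 0 \<omega>))" for i
      by (rule integrable_bounded_Z[OF _ pb(1)], measurable, rule integrable_bounded_Z[OF _ pb(2)], measurable,
          rule integrable_bounded_Z[OF _ pb(3)], measurable)
    have "(hn n) ^ 3 * ex (\<lambda>z. (\<eta> n z)\<^sup>2) = ex (\<lambda>z. (hn n) ^ 3 * (\<eta> n z)\<^sup>2)" by (rule ex_cmult[symmetric])
    also have "(\<lambda>z. (hn n) ^ 3 * (\<eta> n z)\<^sup>2) = (\<lambda>z. 
       ((va - vb)\<^sup>2 * \<psi> 1 w1 1 (hn n) t z + hn n * (2 * (va - vb) * (e0 - va') * \<psi> 1 w2 1 (hn n) t z) + (hn n)\<^sup>2 * ((e0 - va')\<^sup>2 * \<psi> 1 w3 1 (hn n) t z))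
       + ((- vb)\<^sup>2 * \<psi> 0 w1 1 (hn n) t z + hn n * (2 * (- vb) * e0 * \<psi> 0 w2 1 (hn n) t z) + (hn n)\<^sup>2 * (e0\<^sup>2 * \<psi> 0 w3 1 (hn n) t z)))"
      unfolding sq[OF h, symmetric] cross by (simp add: algebra_simps)
    also have "ex \<dots> = Q (va - vb) (e0 - va') 1 n + Q (- vb) e0 0 n"
      unfolding Q_def ex_def by (simp add: i del: One_nat_def)
    finally show ?thesis .
  qed
  have exl: "(\<lambda>n. ex (\<psi> i k 1 (hn n) t)) \<longlonglongrightarrow> d i 0" "(\<lambda>n. ex (\<psi> i k' 2 (hn n) t)) \<longlonglongrightarrow> d i 1" if i: "i = 0 \<or> i = 1" for i
  proof -
    have "X \<longlonglongrightarrow> p" if L: "(\<lambda>n. (X n - p) / (hn n)\<^sup>2) \<longlonglongrightarrow> q" for X :: "nat \<Rightarrow> real" and p q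
    proof -
      have "(\<lambda>n. (X n - p) / (hn n)\<^sup>2 * (hn n)\<^sup>2 + p) \<longlonglongrightarrow> q * 0\<^sup>2 + p" by (intro tendsto_intros L hn_tendsto)
      then have "(\<lambda>n. (X n - p) / (hn n)\<^sup>2 * (hn n)\<^sup>2 + p) \<longlonglongrightarrow> p" by simp
      then show ?thesis
      proof (rule Lim_transform_eventually, intro eventually_mono[OF eventually_gt_at_top[of 0]])
        fix n :: nat assume "0 < n"
        then show "(X n - p) / (hn n)\<^sup>2 * (hn n)\<^sup>2 + p = X n" using hn_pos[of n] by simp
      qed
    qed
    from this[OF bias_ghat(1)[OF i]] this[OF bias_ghat(2)[OF i]]
    show "(\<lambda>n. ex (\<psi> i k 1 (hn n) t)) \<longlonglongrightarrow> d i 0" "(\<lambda>n. ex (\<psi> i k' 2 (hn n) t)) \<longlonglongrightarrow> d i 1" .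
  qed
  have exe: "(\<lambda>n. ex (\<eta> n)) \<longlonglongrightarrow> centre" unfolding ex_eta centre_def by (intro tendsto_intros exl) auto
  have "(\<lambda>n. 1 / (va ^ 4 * c ^ 3) * ((Q (va - vb) (e0 - va') 1 n + Q (- vb) e0 0 n) - hn n ^ 3 * (ex (\<eta> n))\<^sup>2))
     \<longlonglongrightarrow> 1 / (va ^ 4 * c ^ 3) * (((va - vb)\<^sup>2 * (d 1 0 * (LINT u|lborel. w1 u)) + (- vb)\<^sup>2 * (d 0 0 * (LINT u|lborel. w1 u))) - 0 ^ 3 * centre\<^sup>2)"
    by (intro tendsto_intros Qlim exe hn_tendsto) auto
  also have "1 / (va ^ 4 * c ^ 3) * (((va - vb)\<^sup>2 * (d 1 0 * (LINT u|lborel. w1 u)) + (- vb)\<^sup>2 * (d 0 0 * (LINT u|lborel. w1 u))) - 0 ^ 3 * centre\<^sup>2) = limit_var"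
    unfolding limit_var_def w1_def by (simp add: algebra_simps add_divide_distrib)
  finally show ?thesis
  proof (rule Lim_transform_eventually)
    show "\<forall>\<^sub>F n in sequentially. 1 / (va ^ 4 * c ^ 3) * ((Q (va - vb) (e0 - va') 1 n + Q (- vb) e0 0 n) - hn n ^ 3 * (ex (\<eta> n))\<^sup>2)
       = (real n powr (2/7) / va\<^sup>2)\<^sup>2 * ex (\<lambda>z. (\<eta> n z - ex (\<eta> n))\<^sup>2) / n"
      using eventually_gt_at_top[of 0]
    proof eventually_elim
      case (elim n)
      have V: "ex (\<lambda>z. (\<eta> n z - ex (\<eta> n))\<^sup>2) = ex (\<lambda>z. (\<eta> n z)\<^sup>2) - (ex (\<eta> n))\<^sup>2"
        by (rule ex_centred_square[OF borel_eta eta_bound])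
      have n1: "hn n ^ 3 = c ^ 3 * real n powr (-3/7)"
        using elim by (simp add: bandwidth_def power_mult_distrib powr_power)
      have n2: "(real n powr (2/7))\<^sup>2 / n = real n powr (-3/7)"
      proof -
        have "(real n powr (2/7))\<^sup>2 / n = real n powr (4/7) / real n powr 1" using elim by (simp add: powr_power)
        also have "\<dots> = real n powr (4/7 - 1)" by (rule powr_diff[symmetric])
        finally show ?thesis by simp
      qed
      have "1 / (va ^ 4 * c ^ 3) * ((Q (va - vb) (e0 - va') 1 n + Q (- vb) e0 0 n) - hn n ^ 3 * (ex (\<eta> n))\<^sup>2)
         = 1 / (va ^ 4 * c ^ 3) * (hn n ^ 3 * ex (\<lambda>z. (\<eta> n z - ex (\<eta> n))\<^sup>2))"
        unfolding E2[OF elim, symmetric] V by (simp add: algebra_simps)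
      also have "\<dots> = (1 / va ^ 4) * (real n powr (-3/7) * ex (\<lambda>z. (\<eta> n z - ex (\<eta> n))\<^sup>2))"
        unfolding n1 using c_pos by simp
      also have "\<dots> = (real n powr (2/7) / va\<^sup>2)\<^sup>2 * ex (\<lambda>z. (\<eta> n z - ex (\<eta> n))\<^sup>2) / n"
        unfolding n2[symmetric] by (simp add: power_divide flip: power_mult)
      finally show ?case .
    qed
  qed
qed

text \<open>The linear part \<open>Y n\<close> is asymptotically normal, the naive estimator is close to it by
  \<open>ratio_linearisation\<close>, and the maximum smoothed likelihood estimator equals the naive one with probability
  tending to one.\<close>

theorem asymptotic_normality:
  assumes b_pos: "d 1 0 > 0" "d 0 0 > 0"
  shows "weak_conv_m (\<lambda>n. distr M borel (\<lambda>\<omega>. real n powr (2/7) * (f_naive k (hn n) n (ts \<omega>) (ds \<omega>) t - fval))) (normal_dist limit_mean limit_var)"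
    and "weak_conv_m (\<lambda>n. distr M borel (\<lambda>\<omega>. real n powr (2/7) * (f_MS k (hn n) n (ts \<omega>) (ds \<omega>) t - fval))) (normal_dist limit_mean limit_var)"
proof -
  have vpos: "limit_var > 0"
  proof -
    have "0 < (va - vb)\<^sup>2 * d 1 0 + vb\<^sup>2 * d 0 0" using b_pos by (intro add_pos_pos) (auto simp: va_def vb_def)
    then show ?thesis unfolding limit_var_def using integral_k'_square_pos va_pos c_pos by simp
  qed
  define s m where "s n = real n powr (2/7) / va\<^sup>2" and "m n = s n * (ex (\<eta> n) - centre)" for n
  define Y where "Y n \<omega> = m n + s n * (avg n (\<eta> n) \<omega> - ex (\<eta> n))" for n \<omega>
  have Ym[measurable]: "Y n \<in> borel_measurable M" for n unfolding Y_def[abs_def] by measurable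
  have Yeq: "Y n \<omega> = s n * (avg n (\<eta> n) \<omega> - centre)" for n \<omega> unfolding Y_def m_def by (simp add: algebra_simps)
  \<comment> \<open>The summands are of order \<open>n\<^sup>2\<^sup>/\<^sup>7 h\<^sup>-\<^sup>2 / n = n\<^sup>-\<^sup>3\<^sup>/\<^sup>7\<close>.\<close>
  have negl: "(\<lambda>n. s n * \<kappa> n / n) \<longlonglongrightarrow> 0"
  proof -
    have 1: "(\<lambda>n. real n powr (2/7) * (1 / (c * real n powr (-1/7)) ^ 2) / n) \<longlonglongrightarrow> 0"
      and 2: "(\<lambda>n. real n powr (2/7) * (1 / (c * real n powr (-1/7)) ^ 1) / n) \<longlonglongrightarrow> 0"
      using c_pos by real_asymp+
    have "(\<lambda>n. ((\<bar>va - vb\<bar> + \<bar>vb\<bar>) * Kb / va\<^sup>2) * (real n powr (2/7) * (1 / (c * real n powr (-1/7)) ^ 2) / n)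
        + ((\<bar>e0 - va'\<bar> + \<bar>e0\<bar>) * Kb / va\<^sup>2) * (real n powr (2/7) * (1 / (c * real n powr (-1/7)) ^ 1) / n))
      \<longlonglongrightarrow> ((\<bar>va - vb\<bar> + \<bar>vb\<bar>) * Kb / va\<^sup>2) * 0 + ((\<bar>e0 - va'\<bar> + \<bar>e0\<bar>) * Kb / va\<^sup>2) * 0"
      by (intro tendsto_intros 1 2)
    moreover have "((\<bar>va - vb\<bar> + \<bar>vb\<bar>) * Kb / va\<^sup>2) * (real n powr (2/7) * (1 / (c * real n powr (-1/7)) ^ 2) / n)
        + ((\<bar>e0 - va'\<bar> + \<bar>e0\<bar>) * Kb / va\<^sup>2) * (real n powr (2/7) * (1 / (c * real n powr (-1/7)) ^ 1) / n) = s n * \<kappa> n / n" for n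
      unfolding s_def \<kappa>_def bandwidth_def by (simp add: add_divide_distrib distrib_left ac_simps)
    ultimately show ?thesis by simp
  qed
  have mlim: "m \<longlonglongrightarrow> limit_mean" using mean_limit unfolding m_def s_def .
  have vlim: "(\<lambda>n. (s n)\<^sup>2 * ex (\<lambda>z. (\<eta> n z - ex (\<eta> n))\<^sup>2) / n) \<longlonglongrightarrow> limit_var" using var_limit unfolding s_def .
  have Yc: "(\<lambda>n. char (distr M borel (Y n)) \<theta>) \<longlonglongrightarrow> char (normal_dist limit_mean limit_var) \<theta>" for \<theta>
    unfolding Y_def by (rule triangular_array_CLT[OF borel_eta eta_bound negl vlim mlim vpos])
  have small: "\<forall>\<^sub>F n in sequentially. 0 < hn n \<and> hn n < t" by (rule hn_small[OF t_pos])
  let ?fn = "\<lambda>n \<omega>. f_naive k (hn n) n (ts \<omega>) (ds \<omega>) t" and ?fm = "\<lambda>n \<omega>. f_MS k (hn n) n (ts \<omega>) (ds \<omega>) t"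
  let ?x = "\<lambda>i n \<omega>. avg n (\<psi> i k 1 (hn n) t) \<omega>" and ?y = "\<lambda>i n \<omega>. avg n (\<psi> i k' 2 (hn n) t) \<omega>"
  have fn: "?fn n \<omega> = ((?x 0 n \<omega> + ?x 1 n \<omega>) * ?y 1 n \<omega> - (?y 0 n \<omega> + ?y 1 n \<omega>) * ?x 1 n \<omega>) / (?x 0 n \<omega> + ?x 1 n \<omega>)\<^sup>2"
    if "0 < hn n \<and> hn n < t" for n \<omega>
    using that by (subst f_naive_eq) (auto simp: Let_def ghat_avg dghat_avg)
  have close: "whp (\<lambda>n \<omega>. \<bar>real n powr (2/7) * (?fn n \<omega> - fval) - Y n \<omega>\<bar> \<le> e)" if e: "e > 0" for e
  proof -
    define P where "P = ((\<bar>va - vb\<bar> + \<bar>vb\<bar> + \<bar>e0 - va'\<bar> + \<bar>e0\<bar>) * (5 / 2 * va) + va\<^sup>2 * (2 + \<bar>fval\<bar>)) * (4 / va ^ 4) * 16"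
    have p1: "va\<^sup>2 * (2 + \<bar>fval\<bar>) > 0" using va_pos by (intro mult_pos_pos add_pos_nonneg) auto
    have P: "P > 0" unfolding P_def using va_pos by (intro p1 mult_pos_pos add_nonneg_pos) auto
    define \<epsilon> where "\<epsilon> = min ((va / 2)\<^sup>2 / 16) (e / P)"
    have \<epsilon>: "\<epsilon> > 0" "16 * \<epsilon> \<le> (va / 2)\<^sup>2" "P * \<epsilon> \<le> e"
    proof -
      show "\<epsilon> > 0" using va_pos e P by (simp add: \<epsilon>_def)
      have "\<epsilon> \<le> e / P" by (simp add: \<epsilon>_def)
      then show "P * \<epsilon> \<le> e" using P by (simp add: field_simps)
    qed (simp add: \<epsilon>_def)
    have x: "whp (\<lambda>n \<omega>. real n powr (2/7) * (?x i n \<omega> - d i 0)\<^sup>2 \<le> \<epsilon>)" if i: "i = 0 \<or> i = 1" for i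
      by (rule sd_rate[OF i borel_k Kb(3) k_zero _ bias_ghat(1)[OF i] \<epsilon>(1)]) auto
    have y: "whp (\<lambda>n \<omega>. real n powr (2/7) * (?y i n \<omega> - d i 1)\<^sup>2 \<le> \<epsilon>)" if i: "i = 0 \<or> i = 1" for i
      by (rule sd_rate[OF i borel_k' Kb(4) k'_zero _ bias_ghat(2)[OF i] \<epsilon>(1)]) auto
    have xy: "whp (\<lambda>n \<omega>. (real n powr (2/7) * (?x 0 n \<omega> - d 0 0)\<^sup>2 \<le> \<epsilon> \<and> real n powr (2/7) * (?x 1 n \<omega> - d 1 0)\<^sup>2 \<le> \<epsilon>) \<and>
        (real n powr (2/7) * (?y 0 n \<omega> - d 0 1)\<^sup>2 \<le> \<epsilon> \<and> real n powr (2/7) * (?y 1 n \<omega> - d 1 1)\<^sup>2 \<le> \<epsilon>))"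
      by (intro whp_conj x y) auto
    show ?thesis
    proof (rule whp_mono[OF xy], rule eventually_mono[OF eventually_conj[OF small eventually_ge_at_top[of 1]]], intro ballI impI)
      fix n \<omega> assume n: "(0 < hn n \<and> hn n < t) \<and> 1 \<le> n"
        and H: "(real n powr (2/7) * (?x 0 n \<omega> - d 0 0)\<^sup>2 \<le> \<epsilon> \<and> real n powr (2/7) * (?x 1 n \<omega> - d 1 0)\<^sup>2 \<le> \<epsilon>) \<and>
        (real n powr (2/7) * (?y 0 n \<omega> - d 0 1)\<^sup>2 \<le> \<epsilon> \<and> real n powr (2/7) * (?y 1 n \<omega> - d 1 1)\<^sup>2 \<le> \<epsilon>)"
      define x0 x1 y0 y1 where "x0 = ?x 0 n \<omega> - d 0 0" and "x1 = ?x 1 n \<omega> - d 1 0"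
        and "y0 = ?y 0 n \<omega> - d 0 1" and "y1 = ?y 1 n \<omega> - d 1 1"
      have N: "real n powr (2/7) \<ge> 1" using n by (intro ge_one_powr_ge_zero) auto
      have R: "\<bar>real n powr (2/7) * (((va + (x0 + x1)) * (vb' + y1) - (va' + (y0 + y1)) * (vb + x1)) / (va + (x0 + x1))\<^sup>2 - fval)
          - real n powr (2/7) / va\<^sup>2 * ((va - vb) * y1 - vb * y0 + (e0 - va') * x1 + e0 * x0)\<bar> \<le> P * \<epsilon>"
      proof -
        have H': "real n powr (2/7) * x0\<^sup>2 \<le> \<epsilon>" "real n powr (2/7) * x1\<^sup>2 \<le> \<epsilon>"
          "real n powr (2/7) * y0\<^sup>2 \<le> \<epsilon>" "real n powr (2/7) * y1\<^sup>2 \<le> \<epsilon>"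
          using H unfolding x0_def x1_def y0_def y1_def by auto
        show ?thesis
          using ratio_linearisation[OF va_pos N H' \<epsilon>(2), of vb' va' vb, folded fval_def, folded e0_def]
          unfolding P_def by (simp only: mult.assoc)
      qed
      have f: "?fn n \<omega> = ((va + (x0 + x1)) * (vb' + y1) - (va' + (y0 + y1)) * (vb + x1)) / (va + (x0 + x1))\<^sup>2"
        unfolding fn[OF conjunct1[OF n]] x0_def x1_def y0_def y1_def va_def vb_def va'_def vb'_def by (simp add: algebra_simps)
      have "avg n (\<eta> n) \<omega> - centre = (va - vb) * y1 - vb * y0 + (e0 - va') * x1 + e0 * x0"
        unfolding avg_eta centre_def x0_def x1_def y0_def y1_def by (simp add: algebra_simps)
      then have "Y n \<omega> = real n powr (2/7) / va\<^sup>2 * ((va - vb) * y1 - vb * y0 + (e0 - va') * x1 + e0 * x0)"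
        unfolding Yeq s_def by simp
      then show "\<bar>real n powr (2/7) * (?fn n \<omega> - fval) - Y n \<omega>\<bar> \<le> e" using R \<epsilon>(3) unfolding f by linarith
    qed
  qed
  show "weak_conv_m (\<lambda>n. distr M borel (\<lambda>\<omega>. real n powr (2/7) * (?fn n \<omega> - fval))) (normal_dist limit_mean limit_var)"
  proof (rule weak_conv_Slutsky[OF Ym _ real_distribution_normal_dist[OF vpos] Yc close])
    show "\<forall>\<^sub>F n in sequentially. (\<lambda>\<omega>. real n powr (2/7) * (?fn n \<omega> - fval)) \<in> borel_measurable M"
      by (rule eventually_mono[OF small]) (simp only: fn, measurable)
  qed
  show "weak_conv_m (\<lambda>n. distr M borel (\<lambda>\<omega>. real n powr (2/7) * (?fm n \<omega> - fval))) (normal_dist limit_mean limit_var)"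
  proof (rule weak_conv_Slutsky[OF Ym _ real_distribution_normal_dist[OF vpos] Yc])
    show "\<forall>\<^sub>F n in sequentially. (\<lambda>\<omega>. real n powr (2/7) * (?fm n \<omega> - fval)) \<in> borel_measurable M"
    proof (rule eventually_mono[OF small])
      fix n assume h: "0 < hn n \<and> hn n < t"
      have [measurable]: "(\<lambda>\<omega>. ?fm n \<omega>) \<in> borel_measurable M"
      proof (rule borel_measurable_f_MS)
        show "(\<lambda>\<omega>. status (X j \<omega>) (T j \<omega>)) \<in> M \<rightarrow>\<^sub>M count_space UNIV" for j
          unfolding status_def by measurable
      qed (use h in \<open>auto simp: status_def\<close>)
      show "(\<lambda>\<omega>. real n powr (2/7) * (?fm n \<omega> - fval)) \<in> borel_measurable M" by measurable
    qed
    fix e :: real assume e: "e > 0"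
    show "whp (\<lambda>n \<omega>. \<bar>real n powr (2/7) * (?fm n \<omega> - fval) - Y n \<omega>\<bar> \<le> e)"
      by (rule whp_mono[OF whp_conj[OF f_MS_eq_f_naive_whp close[OF e]]]) (rule always_eventually, simp)
  qed
qed

end

section \<open>Taylor expansions\<close>

lemma bound_from_derivative:
  fixes \<psi> \<psi>' :: "real \<Rightarrow> real"
  assumes d: "\<And>x. \<bar>x\<bar> < \<delta> \<Longrightarrow> DERIV \<psi> x :> \<psi>' x" and b: "\<And>x. \<bar>x\<bar> < \<delta> \<Longrightarrow> \<bar>\<psi>' x\<bar> \<le> e * \<bar>x\<bar> ^ m"
    and e: "e \<ge> 0" and 0: "\<psi> 0 = 0" and x: "\<bar>x\<bar> < \<delta>"
  shows "\<bar>\<psi> x\<bar> \<le> e * \<bar>x\<bar> ^ Suc m"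
proof -
  have "norm (\<psi> x - \<psi> 0) \<le> (e * \<bar>x\<bar> ^ m) * norm (x - 0)"
  proof (rule field_differentiable_bound[of "{- \<bar>x\<bar>..\<bar>x\<bar>}" \<psi> \<psi>'])
    fix y assume y: "y \<in> {- \<bar>x\<bar>..\<bar>x\<bar>}"
    then have y': "\<bar>y\<bar> \<le> \<bar>x\<bar>" "\<bar>y\<bar> < \<delta>" using x by auto
    show "(\<psi> has_field_derivative \<psi>' y) (at y within {- \<bar>x\<bar>..\<bar>x\<bar>})"
      by (rule has_field_derivative_at_within[OF d[OF y'(2)]])
    have "\<bar>\<psi>' y\<bar> \<le> e * \<bar>y\<bar> ^ m" by (rule b[OF y'(2)])
    also have "\<dots> \<le> e * \<bar>x\<bar> ^ m" using y'(1) e by (intro mult_left_mono power_mono) auto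
    finally show "norm (\<psi>' y) \<le> e * \<bar>x\<bar> ^ m" by simp
  qed auto
  then show ?thesis using 0 by (simp add: ac_simps)
qed

text \<open>The third derivative is needed at the single point \<open>t\<close>: the remainder of \<open>\<phi>2\<close> is \<open>o(x)\<close> by definition
  of the derivative, and two applications of the mean value theorem carry this over to \<open>\<phi>1\<close> and \<open>\<phi>\<close>.\<close>

lemma Peano_third_order:
  fixes \<phi> \<phi>1 \<phi>2 :: "real \<Rightarrow> real"
  assumes d1: "\<forall>\<^sub>F x in nhds t. DERIV \<phi> x :> \<phi>1 x" and d2: "\<forall>\<^sub>F x in nhds t. DERIV \<phi>1 x :> \<phi>2 x"
    and d3: "DERIV \<phi>2 t :> z" and e: "e > 0"
  shows "\<exists>\<delta>>0. \<forall>x. \<bar>x\<bar> < \<delta> \<longrightarrow> \<bar>\<phi> (t + x) - (\<phi> t + \<phi>1 t * x + \<phi>2 t / 2 * x\<^sup>2 + z / 6 * x ^ 3)\<bar> \<le> e * \<bar>x\<bar> ^ 3"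
proof -
  obtain \<delta>1 where \<delta>1: "\<delta>1 > 0" "\<And>x. dist x t < \<delta>1 \<Longrightarrow> DERIV \<phi> x :> \<phi>1 x \<and> DERIV \<phi>1 x :> \<phi>2 x"
    using eventually_conj[OF d1 d2] unfolding eventually_nhds_metric by blast
  have "((\<lambda>h. (\<phi>2 (t + h) - \<phi>2 t) / h) \<longlongrightarrow> z) (at 0)" using d3 unfolding DERIV_def .
  then have "\<forall>\<^sub>F h in at 0. dist ((\<phi>2 (t + h) - \<phi>2 t) / h) z < e" by (rule tendstoD[OF _ e])
  then obtain \<delta>2 where \<delta>2: "\<delta>2 > 0" "\<And>h. h \<noteq> 0 \<Longrightarrow> \<bar>h\<bar> < \<delta>2 \<Longrightarrow> \<bar>(\<phi>2 (t + h) - \<phi>2 t) / h - z\<bar> < e"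
    unfolding eventually_at by (auto simp: dist_real_def)
  define \<delta> where "\<delta> = min \<delta>1 \<delta>2"
  define R0 R1 R2 where "R0 x = \<phi> (t + x) - (\<phi> t + \<phi>1 t * x + \<phi>2 t / 2 * x\<^sup>2 + z / 6 * x ^ 3)"
    and "R1 x = \<phi>1 (t + x) - (\<phi>1 t + \<phi>2 t * x + z / 2 * x\<^sup>2)" and "R2 x = \<phi>2 (t + x) - (\<phi>2 t + z * x)" for x
  have sh: "DERIV (\<lambda>x. f (t + x)) x :> D" if "DERIV f (t + x) :> D" for f :: "real \<Rightarrow> real" and D x
    using DERIV_shift[of f D x t] that by (simp add: add.commute)
  have R2: "\<bar>R2 x\<bar> \<le> e * \<bar>x\<bar> ^ 1" if "\<bar>x\<bar> < \<delta>" for x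
  proof (cases "x = 0")
    case False
    have "\<bar>(\<phi>2 (t + x) - \<phi>2 t) / x - z\<bar> \<le> e" using \<delta>2(2)[OF False] that by (auto simp: \<delta>_def less_imp_le)
    moreover have "R2 x = ((\<phi>2 (t + x) - \<phi>2 t) / x - z) * x" using False by (simp add: R2_def field_simps)
    ultimately show ?thesis by (simp add: abs_mult mult_right_mono)
  qed (simp add: R2_def)
  have dR1: "DERIV R1 x :> R2 x" if "\<bar>x\<bar> < \<delta>" for x
  proof -
    have "DERIV \<phi>1 (t + x) :> \<phi>2 (t + x)" using \<delta>1(2)[of "t + x"] that by (simp add: \<delta>_def dist_real_def)
    from sh[OF this] show ?thesis unfolding R1_def[abs_def] R2_def
      by (auto intro!: derivative_eq_intros)
  qed
  have R1: "\<bar>R1 x\<bar> \<le> e * \<bar>x\<bar> ^ Suc 1" if "\<bar>x\<bar> < \<delta>" for x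
    by (rule bound_from_derivative[OF dR1 R2 _ _ that]) (use e in \<open>auto simp: R1_def\<close>)
  have dR0: "DERIV R0 x :> R1 x" if "\<bar>x\<bar> < \<delta>" for x
  proof -
    have "DERIV \<phi> (t + x) :> \<phi>1 (t + x)" using \<delta>1(2)[of "t + x"] that by (simp add: \<delta>_def dist_real_def)
    from sh[OF this] show ?thesis unfolding R0_def[abs_def] R1_def
      by (auto intro!: derivative_eq_intros simp: power2_eq_square)
  qed
  have "\<bar>R0 x\<bar> \<le> e * \<bar>x\<bar> ^ Suc (Suc 1)" if "\<bar>x\<bar> < \<delta>" for x
    by (rule bound_from_derivative[OF dR0 R1 _ _ that]) (use e in \<open>auto simp: R0_def\<close>)
  then show ?thesis using \<delta>1(1) \<delta>2(1) unfolding R0_def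
    by (intro exI[of _ \<delta>]) (auto simp: \<delta>_def numeral_3_eq_3)
qed

lemma strict_differentiability:
  fixes \<phi> \<phi>1 :: "real \<Rightarrow> real"
  assumes d1: "\<forall>\<^sub>F x in nhds t. DERIV \<phi> x :> \<phi>1 x" and c: "isCont \<phi>1 t" and e: "e > 0"
  shows "\<exists>\<delta>>0. \<forall>s x. \<bar>s - t\<bar> < \<delta> \<longrightarrow> \<bar>x\<bar> < \<delta> \<longrightarrow> \<bar>\<phi> (s + x) - \<phi> s - \<phi>1 t * x\<bar> \<le> e * \<bar>x\<bar>"
proof -
  obtain \<delta>1 where \<delta>1: "\<delta>1 > 0" "\<And>x. dist x t < \<delta>1 \<Longrightarrow> DERIV \<phi> x :> \<phi>1 x"
    using d1 unfolding eventually_nhds_metric by blast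
  obtain \<delta>2 where \<delta>2: "\<delta>2 > 0" "\<And>x. dist x t < \<delta>2 \<Longrightarrow> dist (\<phi>1 x) (\<phi>1 t) < e"
    using c e unfolding continuous_at_eps_delta by (metis dist_self)
  define \<delta> where "\<delta> = min \<delta>1 \<delta>2 / 2"
  have "\<bar>\<phi> (s + x) - \<phi> s - \<phi>1 t * x\<bar> \<le> e * \<bar>x\<bar>" if s: "\<bar>s - t\<bar> < \<delta>" and x: "\<bar>x\<bar> < \<delta>" for s x
  proof -
    define I where "I = {min s (s + x)..max s (s + x)}"
    have I: "dist y t < \<delta>1" "dist y t < \<delta>2" if "y \<in> I" for y
    proof -
      have "\<delta> \<le> \<delta>1 / 2" "\<delta> \<le> \<delta>2 / 2" by (simp_all add: \<delta>_def)
      moreover have "\<bar>y - s\<bar> \<le> \<bar>x\<bar>" using that by (auto simp: I_def)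
      ultimately show "dist y t < \<delta>1" "dist y t < \<delta>2" using s x unfolding dist_real_def by linarith+
    qed
    have "norm ((\<phi> (s + x) - \<phi>1 t * (s + x)) - (\<phi> s - \<phi>1 t * s)) \<le> e * norm ((s + x) - s)"
    proof (rule field_differentiable_bound[of I "\<lambda>y. \<phi> y - \<phi>1 t * y" "\<lambda>y. \<phi>1 y - \<phi>1 t"])
      fix y assume y: "y \<in> I"
      have "DERIV (\<lambda>y. \<phi> y - \<phi>1 t * y) y :> \<phi>1 y - \<phi>1 t"
        using \<delta>1(2)[OF I(1)[OF y]] by (auto intro!: derivative_eq_intros)
      then show "((\<lambda>y. \<phi> y - \<phi>1 t * y) has_field_derivative \<phi>1 y - \<phi>1 t) (at y within I)"
        by (rule has_field_derivative_at_within)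
      show "norm (\<phi>1 y - \<phi>1 t) \<le> e" using \<delta>2(2)[OF I(2)[OF y]] by (simp add: dist_real_def)
    qed (auto simp: I_def)
    then show ?thesis by (simp add: algebra_simps)
  qed
  then show ?thesis using \<delta>1(1) \<delta>2(1) by (intro exI[of _ \<delta>]) (auto simp: \<delta>_def)
qed

lemma third_deriv_DERIV:
  assumes "third_deriv_continuous_at f t" "j < 3"
  shows "\<forall>\<^sub>F x in nhds t. DERIV ((deriv ^^ j) f) x :> (deriv ^^ Suc j) f x"
proof -
  have "\<forall>\<^sub>F x in nhds t. \<forall>j<3. (deriv ^^ j) f differentiable (at x)"
    using assms(1) unfolding third_deriv_continuous_at_def by blast
  then show ?thesis
    by (rule eventually_mono) (use assms(2) in \<open>simp add: DERIV_deriv_iff_real_differentiable\<close>)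
qed

text \<open>The density is only related to \<open>F\<close> through integrals; continuity near \<open>t\<close> makes it the pointwise derivative.\<close>

lemma distribution_function_DERIV:
  assumes dens: "density_of f F" and ev: "\<forall>\<^sub>F x in nhds t. isCont f x"
  shows "\<forall>\<^sub>F x in nhds t. DERIV F x :> f x"
proof -
  have int: "set_integrable lborel {..x} f" and F: "F x = (LINT u:{..x}|lborel. f u)" for x
    using dens unfolding density_of_def by auto
  obtain d where d: "d > 0" "\<And>x. dist x t < d \<Longrightarrow> isCont f x"
    using ev unfolding eventually_nhds_metric by blast
  define a b where "a = t - d / 2" and "b = t + d / 2"
  have cont: "continuous_on {a..b} f"
    using d by (intro continuous_at_imp_continuous_on) (auto simp: a_def b_def dist_real_def)
  have Feq: "F z = F a + integral {a..z} f" if "z \<in> {a..b}" for z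
  proof -
    have i: "set_integrable lborel {a<..z} f" "set_integrable lborel {a..z} f"
      by (rule set_integrable_subset[OF int[of z]]; auto)+
    have "{..z} = {..a} \<union> {a<..z}" using that by auto
    then have "F z = (LINT u:{..a} \<union> {a<..z}|lborel. f u)" unfolding F by simp
    also have "\<dots> = F a + (LINT u:{a<..z}|lborel. f u)"
      unfolding F by (rule set_integral_Un) (use i int in auto)
    also have "(LINT u:{a<..z}|lborel. f u) = (LINT u:{a..z}|lborel. f u)"
      unfolding set_lebesgue_integral_def
    proof (rule integral_cong_AE)
      show "AE u in lborel. indicator {a<..z} u *\<^sub>R f u = indicator {a..z} u *\<^sub>R f u"
        by (rule AE_I'[of "{a}"]) (auto simp: indicator_def)
    qed (use i in \<open>auto simp: set_integrable_def\<close>)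
    also have "\<dots> = integral {a..z} f" by (rule set_borel_integral_eq_integral(2)[OF i(2)])
    finally show ?thesis .
  qed
  have "DERIV F x :> f x" if x: "x \<in> {a<..<b}" for x
  proof -
    have "((\<lambda>x. integral {a..x} f) has_real_derivative f x) (at x within {a..b})"
      by (rule integral_has_real_derivative[OF cont]) (use x in auto)
    moreover have "at x within {a..b} = at x" by (rule at_within_Icc_at) (use x in auto)
    ultimately have "((\<lambda>x. integral {a..x} f) has_real_derivative f x) (at x)" by (simp only:)
    from DERIV_add[OF DERIV_const[of "F a"] this]
    have "((\<lambda>x. F a + integral {a..x} f) has_real_derivative f x) (at x)" by (simp only: add_0_left)
    then show ?thesis
    proof (rule has_field_derivative_transform_within_open)
      show "x \<in> {a<..<b}" by (rule x)
      show "F a + integral {a..z} f = F z" if "z \<in> {a<..<b}" for z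
        by (rule Feq[symmetric]) (use that in simp)
    qed simp
  qed
  then show ?thesis
    unfolding eventually_nhds using d(1) by (intro exI[of _ "{a<..<b}"]) (auto simp: a_def b_def)
qed

text \<open>Outside of its support a distribution function is locally constant.\<close>

lemma cdf_support_DERIV_zero:
  assumes "x \<notin> cdf_support F" and mono: "\<And>u v. u \<le> v \<Longrightarrow> F u \<le> F v" and d: "DERIV F x :> D"
  shows "D = 0"
proof -
  obtain e where e: "e > 0" "F (x + e) \<le> F (x - e)"
    using assms(1) unfolding cdf_support_def by (auto simp: not_less)
  have const: "F u = F x" if "u \<in> {x - e<..<x + e}" for u
  proof -
    have "F (x - e) \<le> F u" "F u \<le> F (x + e)" "F (x - e) \<le> F x" "F x \<le> F (x + e)"
      using that e(1) by (intro mono; simp)+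
    with e(2) show ?thesis by linarith
  qed
  have "DERIV (\<lambda>_. F x) x :> D"
  proof (rule has_field_derivative_transform_within_open[OF d])
    show "x \<in> {x - e<..<x + e}" using e(1) by simp
  qed (simp, rule const)
  from DERIV_unique[OF this DERIV_const] show ?thesis .
qed

section \<open>The optimal bandwidth constant\<close>

text \<open>At \<open>x\<close> the derivative vanishes, that is \<open>V = 4 A x\<^sup>7 / 3\<close>. With \<open>c = x s\<close>, the difference between the
  value at \<open>c\<close> and the value at \<open>x\<close> is a positive multiple of \<open>3 s\<^sup>7 - 7 s\<^sup>3 + 4\<close>, which has a double zero at \<open>s = 1\<close>
  and a cofactor with positive coefficients.\<close>

lemma aMSE_unique_minimiser:
  fixes A V :: real
  assumes A: "A > 0" and V: "V > 0"
  defines "x \<equiv> (3 * V) powr (1/7) * (4 * A) powr (-1/7)"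
  shows "is_arg_min (\<lambda>c. A * c ^ 4 + V / c ^ 3) (\<lambda>c. c > 0) c \<longleftrightarrow> c = x"
proof -
  have x0: "x > 0" using A V by (simp add: x_def)
  have x7: "x ^ 7 = 3 * V / (4 * A)"
  proof -
    have pw: "(y powr a) ^ 7 = y powr (a * 7)" if "y > 0" for y a :: real
    proof -
      have "0 \<le> y powr a" by simp
      from powr_numeral[OF this, of "num.Bit1 (num.Bit1 num.One)"]
      show ?thesis unfolding powr_powr by (rule sym)
    qed
    have "x ^ 7 = ((3 * V) powr (1/7)) ^ 7 * ((4 * A) powr (-1/7)) ^ 7" unfolding x_def by (rule power_mult_distrib)
    also have "((3 * V) powr (1/7)) ^ 7 = (3 * V) powr 1" using pw[of "3 * V" "1/7"] V by simp
    also have "((4 * A) powr (-1/7)) ^ 7 = (4 * A) powr (-1)" using pw[of "4 * A" "-1/7"] A by simp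
    also have "(3 * V) powr 1 * (4 * A) powr (-1) = 3 * V / (4 * A)"
      using A V by (simp add: powr_minus_divide)
    finally show ?thesis .
  qed
  have Veq: "V = 4 * A * x ^ 7 / 3" using x7 A by (simp add: field_simps)
  have less: "A * x ^ 4 + V / x ^ 3 < A * c ^ 4 + V / c ^ 3" if c: "c > 0" "c \<noteq> x" for c
  proof -
    define s where "s = c / x"
    have s: "s > 0" "s \<noteq> 1" and cs: "c = x * s" using c x0 by (auto simp: s_def)
    have "0 < (s - 1)\<^sup>2 * (3 * s ^ 5 + 6 * s ^ 4 + 9 * s ^ 3 + 12 * s\<^sup>2 + 8 * s + 4)"
      using s by (intro mult_pos_pos) (auto intro!: add_pos_pos)
    also have "\<dots> = 3 * s ^ 7 - 7 * s ^ 3 + 4" by (simp add: power2_eq_square algebra_simps power_numeral_reduce)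
    finally have "7 * s ^ 3 < 3 * s ^ 7 + 4" by simp
    then have "7 * s ^ 3 / (3 * s ^ 3) < (3 * s ^ 7 + 4) / (3 * s ^ 3)" using s by (intro divide_strict_right_mono) auto
    then have "7 / 3 < s ^ 4 + 4 / (3 * s ^ 3)" using s by (simp add: field_simps power_numeral_reduce)
    then have "A * x ^ 4 * (7 / 3) < A * x ^ 4 * (s ^ 4 + 4 / (3 * s ^ 3))" using A x0 by (intro mult_strict_left_mono) auto
    moreover have "A * x ^ 4 + V / x ^ 3 = A * x ^ 4 * (7 / 3)"
      unfolding Veq using x0 by (simp add: field_simps power_numeral_reduce)
    moreover have "A * c ^ 4 + V / c ^ 3 = A * x ^ 4 * (s ^ 4 + 4 / (3 * s ^ 3))"
      unfolding Veq cs using x0 s by (simp add: field_simps power_numeral_reduce)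
    ultimately show ?thesis by (simp only:)
  qed
  show ?thesis
  proof
    assume *: "is_arg_min (\<lambda>c. A * c ^ 4 + V / c ^ 3) (\<lambda>c. c > 0) c"
    show "c = x"
    proof (rule ccontr)
      assume "c \<noteq> x"
      with * have "A * x ^ 4 + V / x ^ 3 < A * c ^ 4 + V / c ^ 3" by (intro less) (auto simp: is_arg_min_def)
      with * x0 show False unfolding is_arg_min_def by blast
    qed
  next
    assume c: "c = x"
    have "\<not> (A * y ^ 4 + V / y ^ 3 < A * x ^ 4 + V / x ^ 3)" if "y > 0" for y
      using less[of y] that by (cases "y = x") auto
    then show "is_arg_min (\<lambda>c. A * c ^ 4 + V / c ^ 3) (\<lambda>c. c > 0) c"
      unfolding is_arg_min_def c using x0 by blast
  qed
qed

section \<open>Limit law and optimal bandwidth in the current status model\<close>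

theorem theorem3p6:
  fixes M :: "'a measure" and X T :: "nat \<Rightarrow> 'a \<Rightarrow> real"
    and F\<^sub>0 G f\<^sub>0 g k :: "real \<Rightarrow> real" and M\<^sub>0 t :: real
  assumes model: "current_status_model M X T F\<^sub>0 G g"
    and kernel: "smooth_kernel k"
    and F_supp: "cdf_support F\<^sub>0 = {0..M\<^sub>0}"
    and F_incr: "strict_mono_on {0..M\<^sub>0} F\<^sub>0"
    and F_dens: "density_of f\<^sub>0 F\<^sub>0"
    and F_pos: "away_from_zero_on {0..M\<^sub>0} f\<^sub>0"
    and G_supp: "cdf_support G = {0..}"
    and G_incr: "strict_mono_on {0..M\<^sub>0} G"
    and G_pos: "away_from_zero_on {0..M\<^sub>0} g"
    and G_deriv: "\<exists>B. \<forall>x\<in>{0..M\<^sub>0}. \<exists>d. (g has_real_derivative d) (at x within {0..}) \<and> \<bar>d\<bar> \<le> B"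
    and t_pos: "t > 0"
    and f0_smooth: "third_deriv_continuous_at f\<^sub>0 t"
    and g_smooth: "third_deriv_continuous_at g t"
    and q_nonzero: "q_MS f\<^sub>0 g t \<noteq> 0"
  shows "(\<forall>c>0.
            weak_conv_m
              (\<lambda>n. distr M borel
                 (\<lambda>\<omega>. real n powr (2/7) *
                   (f_MS k (bandwidth c n) n (\<lambda>j. T j \<omega>) (\<lambda>j. status (X j \<omega>) (T j \<omega>)) t - f\<^sub>0 t)))
              (normal_dist (mu_MS k f\<^sub>0 g t c) (sigma2_MS k F\<^sub>0 g t c)) \<and>
            weak_conv_m
              (\<lambda>n. distr M borel
                 (\<lambda>\<omega>. real n powr (2/7) *
                   (f_naive k (bandwidth c n) n (\<lambda>j. T j \<omega>) (\<lambda>j. status (X j \<omega>) (T j \<omega>)) t - f\<^sub>0 t)))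
              (normal_dist (mu_MS k f\<^sub>0 g t c) (sigma2_MS k F\<^sub>0 g t c)))
         \<and> (\<forall>c. is_arg_min (aMSE_MS k F\<^sub>0 f\<^sub>0 g t) (\<lambda>c. c > 0) c \<longleftrightarrow> c = c_opt_MS k F\<^sub>0 f\<^sub>0 g t)"
proof -
  have "prob_space M" using model unfolding current_status_model_def by blast
  then interpret prob_space M .
  interpret S: current_status M X T F\<^sub>0 G g by unfold_locales (rule model)
  interpret K: kernel_fun k by unfold_locales (rule kernel)
  obtain \<delta>f where \<delta>f: "\<delta>f > 0" "\<And>x. x \<in> {0..M\<^sub>0} \<Longrightarrow> \<delta>f \<le> f\<^sub>0 x"
    using F_pos unfolding away_from_zero_on_def by blast
  obtain \<delta>g where \<delta>g: "\<delta>g > 0" "\<And>x. x \<in> {0..M\<^sub>0} \<Longrightarrow> \<delta>g \<le> g x"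
    using G_pos unfolding away_from_zero_on_def by blast
  define f1 f2 g1 g2 g3 where "f1 = deriv f\<^sub>0" and "f2 = (deriv ^^ 2) f\<^sub>0"
    and "g1 = deriv g" and "g2 = (deriv ^^ 2) g" and "g3 = (deriv ^^ 3) g"
  have df0: "\<forall>\<^sub>F x in nhds t. DERIV f\<^sub>0 x :> f1 x" and df1: "\<forall>\<^sub>F x in nhds t. DERIV f1 x :> f2 x"
    using third_deriv_DERIV[OF f0_smooth, of 0] third_deriv_DERIV[OF f0_smooth, of 1]
    unfolding f1_def f2_def by (simp_all add: numeral_2_eq_2)
  have dg0: "\<forall>\<^sub>F x in nhds t. DERIV g x :> g1 x" and dg1: "\<forall>\<^sub>F x in nhds t. DERIV g1 x :> g2 x"
    and dg2: "\<forall>\<^sub>F x in nhds t. DERIV g2 x :> g3 x"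
    using third_deriv_DERIV[OF g_smooth, of 0] third_deriv_DERIV[OF g_smooth, of 1] third_deriv_DERIV[OF g_smooth, of 2]
    unfolding g1_def g2_def g3_def by (simp_all add: numeral_2_eq_2 numeral_3_eq_3)
  have "\<forall>\<^sub>F x in nhds t. isCont f\<^sub>0 x" using df0 by (rule eventually_mono) (rule DERIV_isCont)
  then have dF: "\<forall>\<^sub>F x in nhds t. DERIV F\<^sub>0 x :> f\<^sub>0 x" by (rule distribution_function_DERIV[OF F_dens])
  have f0_cont: "isCont f\<^sub>0 t" using eventually_nhds_x_imp_x[OF df0] by (rule DERIV_isCont)
  have out: "\<forall>\<^sub>F x in nhds t. x \<notin> {0..M\<^sub>0} \<longrightarrow> f\<^sub>0 x = 0"
    using dF by (rule eventually_mono) (use cdf_support_DERIV_zero[of _ F\<^sub>0] S.F0_mono in \<open>auto simp: F_supp\<close>)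
  \<comment> \<open>Beyond \<open>M\<^sub>0\<close> the density \<open>f\<^sub>0\<close> vanishes near \<open>t\<close>, and then \<open>q t = 0\<close>. At \<open>M\<^sub>0\<close> it would vanish to the right of \<open>t\<close>,
    so by continuity also at \<open>t\<close>, where it is bounded away from zero.\<close>
  have tM: "t < M\<^sub>0"
  proof (rule ccontr)
    assume "\<not> t < M\<^sub>0"
    then consider "t = M\<^sub>0" | "M\<^sub>0 < t" by linarith
    then show False
    proof cases
      case 1
      have "\<forall>\<^sub>F x in at_right t. x \<notin> {0..M\<^sub>0} \<longrightarrow> f\<^sub>0 x = 0"
        using out unfolding eventually_at_filter by (rule eventually_mono) auto
      moreover have "\<forall>\<^sub>F x in at_right t. t < x" by (rule eventually_at_right_less)
      ultimately have "\<forall>\<^sub>F x in at_right t. f\<^sub>0 x = 0" by eventually_elim (use 1 in auto)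
      then have "(f\<^sub>0 \<longlongrightarrow> 0) (at_right t)" by (rule tendsto_eventually)
      moreover have "(f\<^sub>0 \<longlongrightarrow> f\<^sub>0 t) (at_right t)" using f0_cont unfolding isCont_def by (rule tendsto_within_subset) auto
      ultimately have "f\<^sub>0 t = 0" using tendsto_unique trivial_limit_at_right_real by blast
      then show False using \<delta>f(2)[of t] \<delta>f(1) 1 t_pos by auto
    next
      case 2
      have "\<forall>\<^sub>F x in nhds t. x \<in> {M\<^sub>0<..}" by (rule eventually_nhds_in_open) (use 2 in auto)
      with out have z: "\<forall>\<^sub>F x in nhds t. f\<^sub>0 x = 0" by eventually_elim auto
      then have "\<forall>\<^sub>F x in nhds t. \<forall>\<^sub>F y in nhds x. f\<^sub>0 y = 0" by (simp only: eventually_eventually)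
      then have z1: "\<forall>\<^sub>F x in nhds t. deriv f\<^sub>0 x = 0"
      proof (rule eventually_mono)
        fix x assume "\<forall>\<^sub>F y in nhds x. f\<^sub>0 y = 0"
        then have "deriv f\<^sub>0 x = deriv (\<lambda>_. 0) x" by (rule deriv_cong_ev) simp
        then show "deriv f\<^sub>0 x = 0" by simp
      qed
      have "deriv (deriv f\<^sub>0) t = deriv (\<lambda>_. 0) t" by (rule deriv_cong_ev[OF z1]) simp
      then have "q_MS f\<^sub>0 g t = 0"
        using eventually_nhds_x_imp_x[OF z] eventually_nhds_x_imp_x[OF z1] unfolding q_MS_def numeral_2_eq_2 by simp
      then show False using q_nonzero by simp
    qed
  qed
  have tI: "t \<in> {0..M\<^sub>0}" using t_pos tM by auto
  have gt: "g t > 0" and ft: "f\<^sub>0 t > 0" using \<delta>g \<delta>f tI by force+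
  have sm: "F\<^sub>0 u < F\<^sub>0 v" if "0 \<le> u" "u < v" "v \<le> M\<^sub>0" for u v
    using strict_mono_onD[OF F_incr, of u v] that by auto
  have Ft: "0 < F\<^sub>0 t" "F\<^sub>0 t < 1"
    using sm[of 0 t] sm[of t M\<^sub>0] S.F0_bounds[of 0] S.F0_bounds[of M\<^sub>0] t_pos tM by auto
  \<comment> \<open>By the Leibniz rule. The third derivative \<open>b3\<close> involves \<open>f\<^sub>0\<close> only up to its second derivative,
    because \<open>F\<^sub>0\<close> is one order smoother than \<open>f\<^sub>0\<close>.\<close>
  define b b1 b2 b3 where "b x = F\<^sub>0 x * g x" and "b1 x = f\<^sub>0 x * g x + F\<^sub>0 x * g1 x"
    and "b2 x = f1 x * g x + 2 * (f\<^sub>0 x * g1 x) + F\<^sub>0 x * g2 x"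
    and "b3 x = f2 x * g x + 3 * (f1 x * g1 x) + 3 * (f\<^sub>0 x * g2 x) + F\<^sub>0 x * g3 x" for x
  have all: "\<forall>\<^sub>F x in nhds t. DERIV F\<^sub>0 x :> f\<^sub>0 x \<and> DERIV f\<^sub>0 x :> f1 x \<and> DERIV f1 x :> f2 x \<and>
      DERIV g x :> g1 x \<and> DERIV g1 x :> g2 x \<and> DERIV g2 x :> g3 x"
    by (intro eventually_conj dF df0 df1 dg0 dg1 dg2)
  have db: "DERIV b x :> b1 x" "DERIV b1 x :> b2 x" "DERIV b2 x :> b3 x"
    if "DERIV F\<^sub>0 x :> f\<^sub>0 x \<and> DERIV f\<^sub>0 x :> f1 x \<and> DERIV f1 x :> f2 x \<and>
      DERIV g x :> g1 x \<and> DERIV g1 x :> g2 x \<and> DERIV g2 x :> g3 x" for x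
    unfolding b_def[abs_def] b1_def[abs_def] b2_def[abs_def] b3_def using that
    by (auto intro!: derivative_eq_intros simp: algebra_simps)
  define D :: "nat \<Rightarrow> nat \<Rightarrow> real" where
    "D i j = (if i = 1 then [b t, b1 t, b2 t / 2, b3 t / 6] ! j
              else [g t - b t, g1 t - b1 t, (g2 t - b2 t) / 2, (g3 t - b3 t) / 6] ! j)" for i j
  have sum3: "(\<Sum>j\<le>3. D i j * x ^ j) = D i 0 + D i 1 * x + D i 2 * x\<^sup>2 + D i 3 * x ^ 3" for i x
    by (simp add: numeral_3_eq_3 numeral_2_eq_2)
  have D1: "D 1 0 = b t" "D 1 1 = b1 t" "D 1 2 = b2 t / 2" "D 1 3 = b3 t / 6"
    and D0: "D 0 0 = g t - b t" "D 0 1 = g1 t - b1 t" "D 0 2 = (g2 t - b2 t) / 2" "D 0 3 = (g3 t - b3 t) / 6"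
    by (simp_all add: D_def numeral_2_eq_2 numeral_3_eq_3)
  have sg1: "S.sg 1 = b" and sg0: "S.sg 0 = (\<lambda>x. g x - b x)"
    by (auto simp: S.sg_def b_def fun_eq_iff algebra_simps)
  have at_t: "DERIV F\<^sub>0 t :> f\<^sub>0 t \<and> DERIV f\<^sub>0 t :> f1 t \<and> DERIV f1 t :> f2 t \<and>
      DERIV g t :> g1 t \<and> DERIV g1 t :> g2 t \<and> DERIV g2 t :> g3 t"
    by (rule eventually_nhds_x_imp_x[OF all])
  have ev1: "\<forall>\<^sub>F x in nhds t. DERIV b x :> b1 x" "\<forall>\<^sub>F x in nhds t. DERIV b1 x :> b2 x"
    by (rule eventually_mono[OF all], erule db)+
  have ev0: "\<forall>\<^sub>F x in nhds t. DERIV (\<lambda>x. g x - b x) x :> g1 x - b1 x"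
    "\<forall>\<^sub>F x in nhds t. DERIV (\<lambda>x. g1 x - b1 x) x :> g2 x - b2 x"
    by (rule eventually_mono[OF eventually_conj[OF dg0 ev1(1)]], erule conjE, erule (1) DERIV_diff,
        rule eventually_mono[OF eventually_conj[OF dg1 ev1(2)]], erule conjE, erule (1) DERIV_diff)
  have at0: "DERIV (\<lambda>x. g2 x - b2 x) t :> g3 t - b3 t" using at_t db(3)[OF at_t] by (intro DERIV_diff) auto
  have P: "\<exists>\<delta>>0. \<forall>x. \<bar>x\<bar> < \<delta> \<longrightarrow> \<bar>S.sg i (t + x) - (\<Sum>j\<le>3. D i j * x ^ j)\<bar> \<le> e * \<bar>x\<bar> ^ 3" if i: "i = 0 \<or> i = 1" and e: "e > 0" for i e
    using i Peano_third_order[OF ev1 db(3)[OF at_t] e] Peano_third_order[OF ev0 at0 e]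
    unfolding sum3 by (auto simp: sg1 sg0 D0 D1 simp del: One_nat_def)
  have Sd: "\<exists>\<delta>>0. \<forall>s x. \<bar>s - t\<bar> < \<delta> \<longrightarrow> \<bar>x\<bar> < \<delta> \<longrightarrow> \<bar>S.sg i (s + x) - S.sg i s - D i 1 * x\<bar> \<le> e * \<bar>x\<bar>" if i: "i = 0 \<or> i = 1" and e: "e > 0" for i e
    using i strict_differentiability[OF ev1(1) DERIV_isCont[OF eventually_nhds_x_imp_x[OF ev1(2)]] e]
      strict_differentiability[OF ev0(1) DERIV_isCont[OF eventually_nhds_x_imp_x[OF ev0(2)]] e]
    by (auto simp: sg1 sg0 D0 D1 simp del: One_nat_def)
  have a: "D 0 0 + D 1 0 = g t" unfolding D0 D1 by simp
  have slope: "(D 0 0 + D 1 0) * D 1 1 - (D 0 1 + D 1 1) * D 1 0 = f\<^sub>0 t * (g t)\<^sup>2"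
    unfolding D0 D1 b_def b1_def by (simp add: power2_eq_square algebra_simps)
  have ratio: "D 1 0 / (D 0 0 + D 1 0) = F\<^sub>0 t" unfolding a unfolding D1 b_def using gt by simp
  \<comment> \<open>The distance to the tangent is the integral of \<open>(F\<^sub>0 v - F\<^sub>0 t) g v\<close> from \<open>t\<close> to \<open>u\<close>, whose integrand \<open>\<Phi> u\<close>
    (with signs) is nonnegative. It is bounded below by the contribution of a fixed interval on the relevant side of \<open>t\<close>:
    \<open>[p1, q1]\<close> on the right and \<open>(p2, q2]\<close> on the left.\<close>
  have sep: "\<exists>\<gamma>>0. \<forall>u\<ge>0. \<bar>u - t\<bar> \<ge> e \<longrightarrow>
      \<gamma> \<le> S.SG 1 u - S.SG 1 t - D 1 0 / (D 0 0 + D 1 0) * (S.SG 0 u + S.SG 1 u - (S.SG 0 t + S.SG 1 t))" if e: "e > 0" for e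
  proof -
    define \<Phi> where "\<Phi> u v = (F\<^sub>0 v - F\<^sub>0 t) * g v * (of_bool (v \<le> u) - of_bool (v \<le> t))" for u v
    have isg: "integrable lborel (\<lambda>v. S.sg i v * of_bool (v \<le> u))" for i u
      by (rule S.integrable_sg_mult[where K = 1]) auto
    have \<Phi>_decomp: "\<Phi> u v = S.sg 1 v * of_bool (v \<le> u) - S.sg 1 v * of_bool (v \<le> t)
        - F\<^sub>0 t * (S.sg 0 v * of_bool (v \<le> u) + S.sg 1 v * of_bool (v \<le> u) - (S.sg 0 v * of_bool (v \<le> t) + S.sg 1 v * of_bool (v \<le> t)))" for u v
      unfolding \<Phi>_def sg1 sg0 b_def by (auto simp: algebra_simps)
    have i\<Phi>: "integrable lborel (\<Phi> u)" for u
      unfolding \<Phi>_decomp[abs_def]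
      by (intro Bochner_Integration.integrable_diff Bochner_Integration.integrable_add integrable_mult_right isg)
    have val: "S.SG 1 u - S.SG 1 t - F\<^sub>0 t * (S.SG 0 u + S.SG 1 u - (S.SG 0 t + S.SG 1 t)) = (LINT v|lborel. \<Phi> u v)" for u
      unfolding \<Phi>_decomp using S.SG_eq[of 0] S.SG_eq[of 1] by (simp add: isg del: One_nat_def)
    have nn: "0 \<le> \<Phi> u v" for u v
      using S.F0_mono[of v t] S.F0_mono[of t v] by (auto simp: \<Phi>_def mult_nonpos_nonneg)
    have lower: "cc * (q - p) \<le> (LINT v|lborel. \<Phi> u v)"
      if "p \<le> q" "\<And>v. p \<le> v \<Longrightarrow> v \<le> q \<Longrightarrow> cc \<le> \<Phi> u v" for cc p q u
    proof -
      have "cc * (q - p) = (LINT v|lborel. cc * indicator {p..q} v)" using that(1) by simp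
      also have "\<dots> \<le> (LINT v|lborel. \<Phi> u v)"
      proof (rule Bochner_Integration.integral_mono)
        show "integrable lborel (\<lambda>v. cc * indicator {p..q} v)" by (rule integrable_mult_right) simp
        show "cc * indicator {p..q} v \<le> \<Phi> u v" for v
          using that(2)[of v] nn[of u v] by (auto simp: indicator_def)
      qed (rule i\<Phi>)
      finally show ?thesis .
    qed
    define q1 p1 where "q1 = min (t + e) M\<^sub>0" and "p1 = (t + q1) / 2"
    have q1: "t < p1" "p1 < q1" "q1 \<le> M\<^sub>0" "q1 \<le> t + e" using e tM by (auto simp: p1_def q1_def)
    define p2 q2 where "p2 = max 0 (t - e)" and "q2 = (t + p2) / 2"
    have q2: "0 \<le> p2" "p2 < q2" "q2 < t" "t - e \<le> p2" using e t_pos by (auto simp: p2_def q2_def)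
    define c1 c2 where "c1 = (F\<^sub>0 p1 - F\<^sub>0 t) * \<delta>g" and "c2 = (F\<^sub>0 t - F\<^sub>0 q2) * \<delta>g"
    have c: "c1 > 0" "c2 > 0" unfolding c1_def c2_def
      using sm[of t p1] sm[of q2 t] q1 q2 t_pos tM \<delta>g(1) by (intro mult_pos_pos; simp)+
    have g1: "c1 * (q1 - p1) \<le> (LINT v|lborel. \<Phi> u v)" if u: "u \<ge> t + e" for u
    proof (rule lower)
      fix v assume v: "p1 \<le> v" "v \<le> q1"
      have "c1 \<le> (F\<^sub>0 v - F\<^sub>0 t) * g v" unfolding c1_def
        using S.F0_mono[OF v(1)] S.F0_mono[of t v] \<delta>g(2)[of v] \<delta>g(1) v q1 t_pos by (intro mult_mono) auto
      also have "\<dots> = \<Phi> u v" unfolding \<Phi>_def using u v q1 by auto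
      finally show "c1 \<le> \<Phi> u v" .
    qed (use q1 in simp)
    have g2: "c2 * (q2 - p2) \<le> (LINT v|lborel. \<Phi> u v)" if u: "u \<ge> 0" "u \<le> t - e" for u
    proof -
      have ue: "u \<le> p2" using u by (simp add: p2_def)
      have "c2 * (q2 - p2) \<le> (LINT v|lborel. c2 * indicator {p2<..q2} v)" using q2 by simp
      also have "\<dots> \<le> (LINT v|lborel. \<Phi> u v)"
      proof (rule Bochner_Integration.integral_mono)
        show "integrable lborel (\<lambda>v. c2 * indicator {p2<..q2} v)"
          by (intro integrable_mult_right integrable_real_indicator) (use q2 in simp_all)
        fix v
        show "c2 * indicator {p2<..q2} v \<le> \<Phi> u v"
        proof (cases "v \<in> {p2<..q2}")
          case True
          have "c2 \<le> (F\<^sub>0 t - F\<^sub>0 v) * g v" unfolding c2_def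
            using S.F0_mono[of v q2] S.F0_mono[of v t] \<delta>g(2)[of v] \<delta>g(1) True q2 tM by (intro mult_mono) auto
          also have "\<dots> = \<Phi> u v" unfolding \<Phi>_def using ue True q2 by (auto simp: algebra_simps)
          finally show ?thesis using True by simp
        qed (simp add: nn)
      qed (rule i\<Phi>)
      finally show ?thesis .
    qed
    define \<gamma> where "\<gamma> = min (c1 * (q1 - p1)) (c2 * (q2 - p2))"
    have "\<gamma> > 0" using c q1 q2 by (simp add: \<gamma>_def)
    moreover have "\<gamma> \<le> (LINT v|lborel. \<Phi> u v)" if "u \<ge> 0" "\<bar>u - t\<bar> \<ge> e" for u
    proof (cases "u \<ge> t + e")
      case True
      from g1[OF this] show ?thesis by (simp add: \<gamma>_def)
    next
      case False
      then have "u \<le> t - e" using that by (auto simp: abs_if split: if_splits)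
      from g2[OF that(1) this] show ?thesis by (simp add: \<gamma>_def)
    qed
    ultimately show ?thesis unfolding ratio val by blast
  qed
  have main: "weak_conv_m (\<lambda>n. distr M borel (\<lambda>\<omega>. real n powr (2/7) *
          (f_MS k (bandwidth c n) n (\<lambda>j. T j \<omega>) (\<lambda>j. status (X j \<omega>) (T j \<omega>)) t - f\<^sub>0 t)))
        (normal_dist (mu_MS k f\<^sub>0 g t c) (sigma2_MS k F\<^sub>0 g t c)) \<and>
      weak_conv_m (\<lambda>n. distr M borel (\<lambda>\<omega>. real n powr (2/7) *
          (f_naive k (bandwidth c n) n (\<lambda>j. T j \<omega>) (\<lambda>j. status (X j \<omega>) (T j \<omega>)) t - f\<^sub>0 t)))
        (normal_dist (mu_MS k f\<^sub>0 g t c) (sigma2_MS k F\<^sub>0 g t c))" if c: "c > 0" for c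
  proof -
    interpret C: cs_point M X T F\<^sub>0 G g k t c D
    proof (unfold_locales)
      show "0 < D 0 0 + D 1 0" unfolding a by (rule gt)
      show "(D 0 0 + D 1 0) * D 1 1 - (D 0 1 + D 1 1) * D 1 0 > 0" unfolding slope using ft gt by simp
    qed (rule t_pos c Sd P sep; assumption)+
    have va: "C.va = g t" "C.vb = F\<^sub>0 t * g t" "C.va' = g1 t" "C.vb' = b1 t"
      unfolding C.va_def C.vb_def C.va'_def C.vb'_def D0 D1 b_def by simp_all
    have fv: "C.fval = f\<^sub>0 t"
      unfolding C.fval_def va b1_def using gt by (simp add: field_simps power2_eq_square)
    have e0: "C.e0 = b1 t - 2 * f\<^sub>0 t * g t" unfolding C.e0_def fv va ..
    have mean: "C.limit_mean = mu_MS k f\<^sub>0 g t c"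
    proof -
      have eq: "3 * m2 k * ((g t - F\<^sub>0 t * g t) * (b3 t / 6) - F\<^sub>0 t * g t * ((g3 t - b3 t) / 6))
          + m2 k * ((b1 t - 2 * f\<^sub>0 t * g t - g1 t) * (b2 t / 2) + (b1 t - 2 * f\<^sub>0 t * g t) * ((g2 t - b2 t) / 2))
        = m2 k / 2 * (f2 t * (g t)\<^sup>2 + 2 * (f1 t * g1 t * g t) + 2 * (f\<^sub>0 t * g2 t * g t) - 2 * (f\<^sub>0 t * (g1 t)\<^sup>2))"
        unfolding b1_def b2_def b3_def by (simp add: field_simps power2_eq_square)
      have "C.limit_mean = c\<^sup>2 / (g t)\<^sup>2 * (m2 k / 2 * (f2 t * (g t)\<^sup>2 + 2 * (f1 t * g1 t * g t) + 2 * (f\<^sub>0 t * g2 t * g t) - 2 * (f\<^sub>0 t * (g1 t)\<^sup>2)))"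
        unfolding C.limit_mean_def va e0 D0 D1 eq ..
      also have "\<dots> = mu_MS k f\<^sub>0 g t c"
        unfolding mu_MS_def q_MS_def f1_def[symmetric] f2_def[symmetric] g1_def[symmetric] g2_def[symmetric]
        using gt by (simp add: field_simps power2_eq_square)
      finally show ?thesis .
    qed
    have var: "C.limit_var = sigma2_MS k F\<^sub>0 g t c"
      unfolding C.limit_var_def sigma2_MS_def va D0 D1 b_def using gt c
      by (simp add: field_simps power2_eq_square power4_eq_xxxx power3_eq_cube)
    have "D 1 0 > 0" "D 0 0 > 0"
    proof -
      show "D 1 0 > 0" unfolding D1 b_def using Ft gt by simp
      have "g t - F\<^sub>0 t * g t = (1 - F\<^sub>0 t) * g t" by (simp add: algebra_simps)
      then show "D 0 0 > 0" unfolding D0 b_def using Ft gt by simp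
    qed
    from C.asymptotic_normality[OF this] show ?thesis unfolding fv mean var by blast
  qed
  have argmin: "is_arg_min (aMSE_MS k F\<^sub>0 f\<^sub>0 g t) (\<lambda>c. c > 0) c \<longleftrightarrow> c = c_opt_MS k F\<^sub>0 f\<^sub>0 g t" for c
  proof -
    define A V where "A = (m2 k)\<^sup>2 * (q_MS f\<^sub>0 g t)\<^sup>2 / 4" and "V = F\<^sub>0 t * (1 - F\<^sub>0 t) / g t * (LINT u|lborel. (deriv k u)\<^sup>2)"
    have A: "A > 0" unfolding A_def using K.m2_pos q_nonzero by simp
    have V: "V > 0" unfolding V_def using K.integral_k'_square_pos Ft gt by simp
    have eq: "aMSE_MS k F\<^sub>0 f\<^sub>0 g t = (\<lambda>c. A * c ^ 4 + V / c ^ 3)"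
      unfolding aMSE_MS_def mu_MS_def sigma2_MS_def A_def V_def fun_eq_iff
      by (simp add: power_mult_distrib power2_eq_square power4_eq_xxxx algebra_simps)
    have "c_opt_MS k F\<^sub>0 f\<^sub>0 g t = (3 * V) powr (1/7) * (4 * A) powr (-1/7)"
      unfolding c_opt_MS_def A_def V_def by (simp add: mult.assoc)
    then show ?thesis unfolding eq using aMSE_unique_minimiser[OF A V, of c] by simp
  qed
  show ?thesis using main argmin by blast
qed

end
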